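(* The map $\sigma\colon\mathcal{T}\mathrm{Gr}(2,n)\to\mathrm{Gr}(2,n)^{\mathrm{an}}$ is continuous.
   Context: $K$ is a field complete with respect to a non-Archimedean absolute value $|\cdot|$ (possibly trivial). Pairs $kl\in\binom{[n]}2$ are unordered. $\mathrm{Gr}(2,n)\subset\mathbb{P}_K^{\binom n2-1}$ is embedded by Plücker coordinates $p_{kl}$ ($p_{lk}=-p_{kl}$). For an affine $K$-scheme $\operatorname{Spec}B$ of finite type, $(\operatorname{Spec} B)^{\mathrm{an}}$ is the space of multiplicative seminorms on $B$ extending $|\cdot|$, with the topology of pointwise convergence; general analytifications are obtained by gluing. $\overline{\mathbb R}=\mathbb R\cup\{-\infty\}$ (the intervals $[-\infty,a)$ being basic neighborhoods of $-\infty$), $\log0=-\infty$, $\exp(-\infty)=0$, $0\cdot(-\infty)=0$. $\mathbb{TP}^{N}=(\overline{\mathbb R}^{N+1}\smallsetminus\{(-\infty,\dots,-\infty)\})/\mathbb R\cdot(1,\dots,1)$ with the quotient topology. $\mathrm{trop}\colon\mathrm{Gr}(2,n)^{\mathrm{an}}\to\mathbb{TP}^{\binom n2-1}$ sends $\gamma$ over $\{p_{ij}\ne0\}$ to the class of $x$ with $x_{kl}-x_{ij}=\log\gamma(p_{kl}/p_{ij})$; $\mathcal{T}\mathrm{Gr}(2,n)$ is its image with the subspace topology. Cells: $U_{ij}=\{p_{ij}\ne0\}\subset\mathrm{Gr}(2,n)$ has coordinate ring the polynomial ring $R(ij)=K[u_{kl}:kl\in I(ij)]$, $u_{kl}=p_{kl}/p_{ij}$,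 $I(ij)=\{il,jl:l\ne i,j\}$; for $k,l\notin\{i,j\}$, $u_{kl}=u_{ik}u_{jl}-u_{il}u_{jk}\in R(ij)$. $\mathcal{T}U_{ij}=\{x\in\mathcal{T}\mathrm{Gr}(2,n):x_{ij}\ne-\infty\}$. For $x\in\mathcal{T}\mathrm{Gr}(2,n)$, $J(x)=\{kl:x_{kl}=-\infty\}$. Trees: a tree $T$ on $n$ leaves is a finite connected acyclic graph without degree-two vertices whose leaves are labeled bijectively by $[n]$; inner edges are those not ending in a leaf. $\mathscr{C}_T\subset\mathbb R^{\binom n2}/\mathbb R\cdot(1,\dots,1)\subset\mathbb{TP}^{\binom n2-1}$ is the set of classes of vectors $x$ for which there is $\omega\colon E(T)\to\mathbb R$, nonnegative on inner edges, with $x_{kl}$ the sum of $\omega(e)$ over the edges $e$ of the path from $k$ to $l$; $\overline{\mathscr C_T}$ is its closure in $\mathbb{TP}^{\binom n2-1}$. Given $i\ne j$, let $v_1,\dots,v_m$ be the internal vertices of the path from $i$ to $j$ in $T$, and let $T_a$ be the set of leaves $l\neq i,j$ whose path to the $i$–$j$ path first meets it at $v_a$. A quartet $\{a,b,c,d\}$ of $T$ is the subtree spanned by four leaves (degree-two vertices suppressed); a cherry is a pair of leaves adjacent to the same vertex. A partial order $\preceq$ on $[n]\smallsetminus\{i,j\}$ has the cherry property on $T$ with respect to $i,j$ if: leaves in different $T_a,T_b$ are incomparable; $\preceq$ is total on each $T_a$; and whenever $k\prec l\prec v$, either $\{k,l\}$ or $\{l,v\}$ is a cherry of the quartet $\{i,k,l,v\}$.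 Such orders always exist. For $J\subset\binom{[n]}2$ put $J(ij)=J\cap I(ij)$. A set $I\subset\binom{[n]}2$ of size $2(n-2)$ with $ij\notin I$ is compatible with $\preceq$ and $J(ij)$ if for each $a$ and each $k\in T_a$ exactly one of the following holds: (i) $ik,jk\in I$, and for all $l\prec k$ we have $il\in J(ij)$ or $jl\in J(ij)$; (ii) $ik\notin I$, $jl\in I$ for all $l\in T_a$, there is $t\prec k$ in $T_a$ with $it,jt\notin J(ij)$, and for the maximal such $t$, $kt\in I$; (iii) the same as (ii) with the roles of $i$ and $j$ exchanged. Definition of $\sigma$: given $x\in\mathcal{T}\mathrm{Gr}(2,n)$, choose $ij\notin J:=J(x)$, a tree $T$ with $x\in\overline{\mathscr C_T}$, an order $\preceq$ with the cherry property on $T$ with respect to $i,j$, and $I$ compatible with $\preceq$ and $J(ij)$ (all these choices exist). Let $H=I\cap I(ij)$. The elements $u_{kl}$, $kl\in I$, are algebraically independent over $K$ in the fraction field of $R(ij)$, and inside it $R(ij)\subset K[u_{kl}:kl\in I][u_{kl}^{-1}:kl\in H\smallsetminus J]$. Then $\sigma(x)\in U_{ij}^{\mathrm{an}}\subset\mathrm{Gr}(2,n)^{\mathrm{an}}$ is the restriction to $R(ij)$ of the multiplicative seminorm $\sum_\alpha c_\alpha u^\alpha\mapsto\max_\alpha\{|c_\alpha|\exp(\sum_{kl\in I}\alpha_{kl}(x_{kl}-x_{ij}))\}$. This point $\sigma(x)$ is independent of all the choices made. *)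

theory Defs
  imports
    "HOL-Analysis.Analysis"
    "HOL-Library.Poly_Mapping"
    "HOL-Library.Nat_Bijection"
    "HOL-Computational_Algebra.Fraction_Field"
begin

section \<open>Complete non-Archimedean fields\<close>

text \<open>The trivial absolute value is allowed.\<close>

locale complete_nonarch_field =
  fixes v :: "'k::field \<Rightarrow> real"
  assumes nonneg: "0 \<le> v a"
    and eq_0_iff: "v a = 0 \<longleftrightarrow> a = 0"
    and mult: "v (a * b) = v a * v b"
    and ultrametric: "v (a + b) \<le> max (v a) (v b)"
    and complete: "(\<forall>e>0. \<exists>M::nat. \<forall>p\<ge>M. \<forall>q\<ge>M. v (X p - X q) < e)
                     \<Longrightarrow> \<exists>L. \<forall>e>0. \<exists>M. \<forall>p\<ge>M. v (X p - L) < e"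


section \<open>Quotient topologies\<close>

definition quotient_topology :: "'a topology \<Rightarrow> ('a \<Rightarrow> 'b) \<Rightarrow> 'b topology" where
  "quotient_topology X q =
     topology (\<lambda>U. U \<subseteq> q ` topspace X \<and> openin X {x \<in> topspace X. q x \<in> U})"

lemma openin_quotient_topology:
  "openin (quotient_topology X q) U \<longleftrightarrow>
     U \<subseteq> q ` topspace X \<and> openin X {x \<in> topspace X. q x \<in> U}"
proof -
  let ?L = "\<lambda>U. U \<subseteq> q ` topspace X \<and> openin X {x \<in> topspace X. q x \<in> U}"
  have "istopology ?L"
    unfolding istopology_def
  proof (rule conjI; intro allI impI)
    fix S T assume "?L S" "?L T"
    moreover have "{x \<in> topspace X. q x \<in> S \<inter> T}
        = {x \<in> topspace X. q x \<in> S} \<inter> {x \<in> topspace X. q x \<in> T}" by auto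
    ultimately show "?L (S \<inter> T)" by (auto simp only: openin_Int)
  next
    fix \<K> assume "\<forall>K\<in>\<K>. ?L K"
    moreover have "{x \<in> topspace X. q x \<in> \<Union>\<K>} = (\<Union>K\<in>\<K>. {x \<in> topspace X. q x \<in> K})" by auto
    moreover have "openin X (\<Union>K\<in>\<K>. {x \<in> topspace X. q x \<in> K})"
      using calculation(1) by (intro openin_Union) auto
    ultimately show "?L (\<Union>\<K>)" by (metis (no_types, lifting) Sup_least)
  qed
  then show ?thesis
    unfolding quotient_topology_def by (simp add: topology_inverse')
qed

lemma topspace_quotient_topology [simp]:
  "topspace (quotient_topology X q) = q ` topspace X"
proof
  show "topspace (quotient_topology X q) \<subseteq> q ` topspace X"
    using openin_quotient_topology[of X q "topspace (quotient_topology X q)"] by simp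
  have "{x \<in> topspace X. q x \<in> q ` topspace X} = topspace X" by auto
  then have "openin (quotient_topology X q) (q ` topspace X)"
    by (simp add: openin_quotient_topology)
  then show "q ` topspace X \<subseteq> topspace (quotient_topology X q)"
    by (rule openin_subset)
qed

lemma quotient_map_quotient_topology: "quotient_map X (quotient_topology X q) q"
  by (auto simp: quotient_map_def openin_quotient_topology)


section \<open>Tropical projective space\<close>

definition pairs :: "nat \<Rightarrow> nat set set" where
  "pairs n = {{k, l} | k l. k \<in> {1..n} \<and> l \<in> {1..n} \<and> k \<noteq> l}"

definition charts :: "nat \<Rightarrow> (nat \<times> nat) set" where
  "charts n = {(i, j). 1 \<le> i \<and> i < j \<and> j \<le> n}"

definition elog :: "real \<Rightarrow> ereal" where
  "elog r = (if r = 0 then -\<infinity> else ereal (ln r))"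

text \<open>Only used at arguments different from \<open>\<infinity>\<close>.\<close>

definition eexp :: "ereal \<Rightarrow> real" where
  "eexp x = (if x = -\<infinity> then 0 else exp (real_of_ereal x))"

text \<open>The space of real numbers extended by \<open>-\<infinity>\<close>.\<close>

definition rbar :: "ereal topology" where
  "rbar = subtopology euclidean {x. x \<noteq> \<infinity>}"

definition tclass :: "nat \<Rightarrow> (nat set \<Rightarrow> ereal) \<Rightarrow> (nat set \<Rightarrow> ereal) set" where
  "tclass n x = {(\<lambda>e\<in>pairs n. x e + ereal c) | c::real. True}"

definition TP :: "nat \<Rightarrow> (nat set \<Rightarrow> ereal) set topology" where
  "TP n = quotient_topology
     (subtopology (product_topology (\<lambda>_. rbar) (pairs n)) {x. \<exists>e\<in>pairs n. x e \<noteq> -\<infinity>})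
     (tclass n)"


section \<open>The charts of the Grassmannian\<close>

text \<open>
  Polynomials in variables \<open>X\<^sub>e\<close> indexed by unordered pairs \<open>e\<close>. The variables are numbered
  by natural numbers because the integral domain instance for polynomials
  needs linearly ordered indices.
\<close>

type_synonym 'k mpoly = "(nat \<Rightarrow>\<^sub>0 nat) \<Rightarrow>\<^sub>0 'k"

definition pvar :: "nat set \<Rightarrow> nat" where
  "pvar e = prod_encode (Min e, Max e)"

definition Var :: "nat set \<Rightarrow> 'k::field mpoly" where
  "Var e = Poly_Mapping.single (Poly_Mapping.single (pvar e) 1) 1"

definition Const :: "'k::field \<Rightarrow> 'k mpoly" where
  "Const a = Poly_Mapping.single 0 a"

definition to_frac :: "'k::field mpoly \<Rightarrow> 'k mpoly fract" where
  "to_frac f = Fraction_Field.Fract f 1"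

definition Iset :: "nat \<Rightarrow> nat \<Rightarrow> nat \<Rightarrow> nat set set" where
  "Iset n i j = {{i, l} | l. l \<in> {1..n} - {i, j}} \<union> {{j, l} | l. l \<in> {1..n} - {i, j}}"

text \<open>The polynomial ring \<open>R(ij)\<close> in the variables indexed by \<open>I(ij)\<close>.\<close>

definition chart_ring :: "nat \<Rightarrow> nat \<Rightarrow> nat \<Rightarrow> 'k::field mpoly set" where
  "chart_ring n i j = {f. \<forall>\<alpha>\<in>Poly_Mapping.keys f. Poly_Mapping.keys \<alpha> \<subseteq> pvar ` Iset n i j}"

text \<open>
  For a pair \<open>e = {k, l}\<close> with \<open>k < l\<close>, the element \<open>ucoord i j e\<close> is the function
  \<open>p\<^sub>k\<^sub>l / p\<^sub>i\<^sub>j\<close> on the chart of \<open>i < j\<close>; it is the variable of \<open>e\<close> if \<open>e \<in> I(ij)\<close>. The auxiliary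
  \<open>signed_var a b\<close> is the signed version with \<open>p\<^sub>b\<^sub>a = - p\<^sub>a\<^sub>b\<close>.
\<close>

definition signed_var :: "nat \<Rightarrow> nat \<Rightarrow> 'k::field mpoly" where
  "signed_var a b = (if a < b then Var {a, b} else - Var {a, b})"

definition ucoord :: "nat \<Rightarrow> nat \<Rightarrow> nat set \<Rightarrow> 'k::field mpoly" where
  "ucoord i j e =
     (if e = {i, j} then 1
      else if i \<in> e \<or> j \<in> e then Var e
      else signed_var i (Min e) * signed_var j (Max e)
           - signed_var i (Max e) * signed_var j (Min e))"

text \<open>
  The comorphism on the overlap of two charts: it substitutes
  \<open>p\<^sub>e / p\<^sub>k\<^sub>l = (p\<^sub>e / p\<^sub>i\<^sub>j) / (p\<^sub>k\<^sub>l / p\<^sub>i\<^sub>j)\<close> for the variables \<open>e \<in> I(kl)\<close> of \<open>f \<in> R(kl)\<close>.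
\<close>

definition transition ::
    "nat \<Rightarrow> nat \<Rightarrow> nat \<Rightarrow> nat \<Rightarrow> nat \<Rightarrow> 'k::field mpoly \<Rightarrow> 'k mpoly fract" where
  "transition n i j k l f =
     (\<Sum>\<alpha>\<in>Poly_Mapping.keys f. to_frac (Const (Poly_Mapping.lookup f \<alpha>)) *
        (\<Prod>e\<in>Iset n k l.
           (to_frac (ucoord i j e) / to_frac (ucoord i j {k, l})) ^ Poly_Mapping.lookup \<alpha> (pvar e)))"


section \<open>Analytification\<close>

definition mult_seminorms :: "('k::field \<Rightarrow> real) \<Rightarrow> 'k mpoly set \<Rightarrow> ('k mpoly \<Rightarrow> real) set" where
  "mult_seminorms v B = {\<gamma> \<in> extensional B.
     (\<forall>f\<in>B. 0 \<le> \<gamma> f) \<and>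
     (\<forall>f\<in>B. \<forall>g\<in>B. \<gamma> (f + g) \<le> \<gamma> f + \<gamma> g) \<and>
     (\<forall>f\<in>B. \<forall>g\<in>B. \<gamma> (f * g) = \<gamma> f * \<gamma> g) \<and>
     (\<forall>a. \<gamma> (Const a) = v a)}"

definition U_an :: "nat \<Rightarrow> ('k::field \<Rightarrow> real) \<Rightarrow> nat \<times> nat \<Rightarrow> ('k mpoly \<Rightarrow> real) topology" where
  "U_an n v = (\<lambda>(i, j). subtopology (product_topology (\<lambda>_. euclideanreal) (chart_ring n i j))
     (mult_seminorms v (chart_ring n i j)))"

type_synonym 'k chart_point = "(nat \<times> nat) \<times> ('k mpoly \<Rightarrow> real)"

definition U_sum :: "nat \<Rightarrow> ('k::field \<Rightarrow> real) \<Rightarrow> 'k chart_point topology" where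
  "U_sum n v = sum_topology (U_an n v) (charts n)"

text \<open>
  The intersection of two charts is the spectrum of \<open>R(ij)[u\<^sub>k\<^sub>l\<^sup>-\<^sup>1]\<close>. Points of two
  charts are identified if \<open>\<gamma>\<close> is nonzero on \<open>u\<^sub>k\<^sub>l\<close> and its extension to this
  localization pulls back to \<open>\<delta>\<close>.
\<close>

definition glued :: "nat \<Rightarrow> 'k::field chart_point \<Rightarrow> 'k chart_point \<Rightarrow> bool" where
  "glued n = (\<lambda>((i, j), \<gamma>) ((k, l), \<delta>).
     \<gamma> (ucoord i j {k, l}) \<noteq> 0 \<and>
     (\<forall>f\<in>chart_ring n k l. \<forall>g\<in>chart_ring n i j. \<forall>m.
        transition n i j k l f = to_frac g / to_frac (ucoord i j {k, l}) ^ m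
        \<longrightarrow> \<delta> f = \<gamma> g / \<gamma> (ucoord i j {k, l}) ^ m))"

definition glue :: "nat \<Rightarrow> ('k::field \<Rightarrow> real) \<Rightarrow> 'k chart_point \<Rightarrow> 'k chart_point set" where
  "glue n v p = {q \<in> topspace (U_sum n v). glued n p q}"

definition Gr_an :: "nat \<Rightarrow> ('k::field \<Rightarrow> real) \<Rightarrow> 'k chart_point set topology" where
  "Gr_an n v = quotient_topology (U_sum n v) (glue n v)"


section \<open>Tropicalization\<close>

text \<open>The representative with \<open>x\<^sub>i\<^sub>j = 0\<close> is used; the class does not depend on the chart.\<close>

definition trop :: "nat \<Rightarrow> 'k::field chart_point set \<Rightarrow> (nat set \<Rightarrow> ereal) set" where
  "trop n z = (THE t. \<exists>i j \<gamma>. ((i, j), \<gamma>) \<in> z \<and> t = tclass n (\<lambda>e. elog (\<gamma> (ucoord i j e))))"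

definition TGr :: "nat \<Rightarrow> ('k::field \<Rightarrow> real) \<Rightarrow> (nat set \<Rightarrow> ereal) set topology" where
  "TGr n v = subtopology (TP n) (trop n ` topspace (Gr_an n v))"

definition Jset :: "nat \<Rightarrow> (nat set \<Rightarrow> ereal) \<Rightarrow> nat set set" where
  "Jset n x = {e \<in> pairs n. x e = -\<infinity>}"


section \<open>Trees\<close>

record ugraph =
  gverts :: "nat set"
  gedges :: "nat set set"

definition simple_graph :: "ugraph \<Rightarrow> bool" where
  "simple_graph G \<longleftrightarrow> finite (gverts G) \<and>
     gedges G \<subseteq> {{a, b} | a b. a \<in> gverts G \<and> b \<in> gverts G \<and> a \<noteq> b}"

definition deg :: "ugraph \<Rightarrow> nat \<Rightarrow> nat" where
  "deg G a = card {e \<in> gedges G. a \<in> e}"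

definition leaves :: "ugraph \<Rightarrow> nat set" where
  "leaves G = {a \<in> gverts G. deg G a = 1}"

definition is_path :: "ugraph \<Rightarrow> nat \<Rightarrow> nat \<Rightarrow> nat list \<Rightarrow> bool" where
  "is_path G a b p \<longleftrightarrow> p \<noteq> [] \<and> hd p = a \<and> last p = b \<and> distinct p \<and> set p \<subseteq> gverts G \<and>
     successively (\<lambda>c d. {c, d} \<in> gedges G) p"

definition connected_graph :: "ugraph \<Rightarrow> bool" where
  "connected_graph G \<longleftrightarrow> (\<forall>a\<in>gverts G. \<forall>b\<in>gverts G. \<exists>p. is_path G a b p)"

definition acyclic_graph :: "ugraph \<Rightarrow> bool" where
  "acyclic_graph G \<longleftrightarrow> \<not> (\<exists>p. 3 \<le> length p \<and> distinct p \<and>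
     successively (\<lambda>c d. {c, d} \<in> gedges G) p \<and> {last p, hd p} \<in> gedges G)"

text \<open>
  Leaves are identified with their labels, so that the labeling is the identity; up to
  isomorphism of labeled trees this is no restriction.
\<close>

definition tree_on :: "nat \<Rightarrow> ugraph \<Rightarrow> bool" where
  "tree_on n T \<longleftrightarrow> simple_graph T \<and> connected_graph T \<and> acyclic_graph T \<and>
     (\<forall>a\<in>gverts T. deg T a \<noteq> 2) \<and> leaves T = {1..n}"

definition tpath :: "ugraph \<Rightarrow> nat \<Rightarrow> nat \<Rightarrow> nat list" where
  "tpath T a b = (THE p. is_path T a b p)"

definition path_edges :: "nat list \<Rightarrow> nat set set" where
  "path_edges p = {{p ! m, p ! Suc m} | m. Suc m < length p}"

definition inner_edges :: "ugraph \<Rightarrow> nat set set" where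
  "inner_edges T = {e \<in> gedges T. e \<inter> leaves T = {}}"

definition tree_cone :: "nat \<Rightarrow> ugraph \<Rightarrow> (nat set \<Rightarrow> ereal) set set" where
  "tree_cone n T = {tclass n (\<lambda>e. ereal (x e)) | x.
     \<exists>\<omega>::nat set \<Rightarrow> real. (\<forall>e\<in>inner_edges T. 0 \<le> \<omega> e) \<and>
       (\<forall>k\<in>{1..n}. \<forall>l\<in>{1..n}. k \<noteq> l \<longrightarrow> x {k, l} = (\<Sum>e\<in>path_edges (tpath T k l). \<omega> e))}"

text \<open>
  The set \<open>T\<^sub>a\<close>, indexed by the internal vertex \<open>w = v\<^sub>a\<close> of the path from \<open>i\<close> to \<open>j\<close>.
\<close>

definition path_vertices :: "ugraph \<Rightarrow> nat \<Rightarrow> nat \<Rightarrow> nat set" where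
  "path_vertices T i j = set (tpath T i j) - {i, j}"

definition branch :: "nat \<Rightarrow> ugraph \<Rightarrow> nat \<Rightarrow> nat \<Rightarrow> nat \<Rightarrow> nat set" where
  "branch n T i j w = {l \<in> {1..n} - {i, j}. set (tpath T l w) \<inter> set (tpath T i j) = {w}}"

definition spanned :: "ugraph \<Rightarrow> nat set \<Rightarrow> ugraph" where
  "spanned T A = \<lparr> gverts = (\<Union>a\<in>A. \<Union>b\<in>A. set (tpath T a b)),
                   gedges = (\<Union>a\<in>A. \<Union>b\<in>A. path_edges (tpath T a b)) \<rparr>"

definition suppress :: "ugraph \<Rightarrow> ugraph" where
  "suppress G = \<lparr> gverts = {a \<in> gverts G. deg G a \<noteq> 2},
                  gedges = {{a, b} | a b. a \<noteq> b \<and> deg G a \<noteq> 2 \<and> deg G b \<noteq> 2 \<and>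
                     (\<exists>p. is_path G a b p \<and> (\<forall>c\<in>set p - {a, b}. deg G c = 2))} \<rparr>"

definition quartet :: "ugraph \<Rightarrow> nat set \<Rightarrow> ugraph" where
  "quartet T A = suppress (spanned T A)"

definition cherry :: "ugraph \<Rightarrow> nat \<Rightarrow> nat \<Rightarrow> bool" where
  "cherry G a b \<longleftrightarrow> a \<noteq> b \<and> a \<in> leaves G \<and> b \<in> leaves G \<and>
     (\<exists>w. {a, w} \<in> gedges G \<and> {b, w} \<in> gedges G)"

text \<open>Membership \<open>(k, l) \<in> r\<close> stands for \<open>k \<preceq> l\<close>.\<close>

definition cherry_property :: "nat \<Rightarrow> ugraph \<Rightarrow> nat \<Rightarrow> nat \<Rightarrow> nat rel \<Rightarrow> bool" where
  "cherry_property n T i j r \<longleftrightarrow>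
     partial_order_on ({1..n} - {i, j}) r \<and>
     (\<forall>a\<in>path_vertices T i j. \<forall>b\<in>path_vertices T i j. a \<noteq> b \<longrightarrow>
        (\<forall>k\<in>branch n T i j a. \<forall>l\<in>branch n T i j b. (k, l) \<notin> r)) \<and>
     (\<forall>a\<in>path_vertices T i j. total_on (branch n T i j a) r) \<and>
     (\<forall>k l m. (k, l) \<in> r \<and> k \<noteq> l \<and> (l, m) \<in> r \<and> l \<noteq> m \<longrightarrow>
        cherry (quartet T {i, k, l, m}) k l \<or> cherry (quartet T {i, k, l, m}) l m)"


section \<open>Compatible index sets\<close>

text \<open>
  Conditions (i) and (ii) for \<open>k\<close> in a set \<open>A = T\<^sub>a\<close>; condition (iii) is (ii) with \<open>i\<close> and \<open>j\<close>
  exchanged. Here \<open>Ji\<close> is \<open>J(ij)\<close>.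
\<close>

definition compat_i ::
    "nat rel \<Rightarrow> nat set set \<Rightarrow> nat set set \<Rightarrow> nat \<Rightarrow> nat \<Rightarrow> nat \<Rightarrow> bool" where
  "compat_i r Ji I i j k \<longleftrightarrow> {i, k} \<in> I \<and> {j, k} \<in> I \<and>
     (\<forall>l. (l, k) \<in> r \<and> l \<noteq> k \<longrightarrow> {i, l} \<in> Ji \<or> {j, l} \<in> Ji)"

definition compat_ii ::
    "nat rel \<Rightarrow> nat set set \<Rightarrow> nat set set \<Rightarrow> nat set \<Rightarrow> nat \<Rightarrow> nat \<Rightarrow> nat \<Rightarrow> bool" where
  "compat_ii r Ji I A i j k \<longleftrightarrow> {i, k} \<notin> I \<and> (\<forall>l\<in>A. {j, l} \<in> I) \<and>
     (\<exists>t\<in>A. (t, k) \<in> r \<and> t \<noteq> k \<and> {i, t} \<notin> Ji \<and> {j, t} \<notin> Ji \<and>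
        (\<forall>s\<in>A. (s, k) \<in> r \<and> s \<noteq> k \<and> {i, s} \<notin> Ji \<and> {j, s} \<notin> Ji \<longrightarrow> (s, t) \<in> r) \<and>
        {k, t} \<in> I)"

definition compatible ::
    "nat \<Rightarrow> ugraph \<Rightarrow> nat \<Rightarrow> nat \<Rightarrow> nat rel \<Rightarrow> nat set set \<Rightarrow> nat set set \<Rightarrow> bool" where
  "compatible n T i j r Ji I \<longleftrightarrow> I \<subseteq> pairs n \<and> card I = 2 * (n - 2) \<and> {i, j} \<notin> I \<and>
     (\<forall>a\<in>path_vertices T i j. \<forall>k\<in>branch n T i j a.
        let A = branch n T i j a;
            P1 = compat_i r Ji I i j k;
            P2 = compat_ii r Ji I A i j k;
            P3 = compat_ii r Ji I A j i k
        in (P1 \<and> \<not> P2 \<and> \<not> P3) \<or> (\<not> P1 \<and> P2 \<and> \<not> P3) \<or> (\<not> P1 \<and> \<not> P2 \<and> P3))"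


section \<open>The section of the tropicalization map\<close>

text \<open>
  An expansion of \<open>f \<in> R(ij)\<close> in \<open>K[u\<^sub>e : e \<in> I][u\<^sub>e\<^sup>-\<^sup>1 : e \<in> H - J]\<close>, inside the fraction field.
  Coefficients are indexed by exponent vectors with integer entries, where negative
  exponents are only allowed for \<open>e \<in> H - J\<close>.
\<close>

definition expansion ::
    "nat \<Rightarrow> nat \<Rightarrow> nat \<Rightarrow> nat set set \<Rightarrow> nat set set \<Rightarrow> 'k::field mpoly \<Rightarrow>
      ((nat set \<Rightarrow>\<^sub>0 int) \<Rightarrow>\<^sub>0 'k) \<Rightarrow> bool" where
  "expansion n i j I J f c \<longleftrightarrow>
     (\<forall>\<alpha>\<in>Poly_Mapping.keys c. Poly_Mapping.keys \<alpha> \<subseteq> I \<and>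
       (\<forall>e\<in>I. Poly_Mapping.lookup \<alpha> e < 0 \<longrightarrow> e \<in> I \<inter> Iset n i j - J)) \<and>
     to_frac f = (\<Sum>\<alpha>\<in>Poly_Mapping.keys c.
       to_frac (Const (Poly_Mapping.lookup c \<alpha>)) *
       (\<Prod>e\<in>I. to_frac (ucoord i j e) powi Poly_Mapping.lookup \<alpha> e))"

definition expansion_norm ::
    "('k::field \<Rightarrow> real) \<Rightarrow> nat \<Rightarrow> nat \<Rightarrow> nat set set \<Rightarrow> (nat set \<Rightarrow> ereal) \<Rightarrow>
      ((nat set \<Rightarrow>\<^sub>0 int) \<Rightarrow>\<^sub>0 'k) \<Rightarrow> real" where
  "expansion_norm v i j I x c =
     Max (insert 0 ((\<lambda>\<alpha>. v (Poly_Mapping.lookup c \<alpha>) *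
        eexp (\<Sum>e\<in>I. ereal (real_of_int (Poly_Mapping.lookup \<alpha> e)) * (x e - x {i, j})))
        ` Poly_Mapping.keys c))"

definition sigma_seminorm ::
    "nat \<Rightarrow> ('k::field \<Rightarrow> real) \<Rightarrow> nat \<Rightarrow> nat \<Rightarrow> nat set set \<Rightarrow> (nat set \<Rightarrow> ereal) \<Rightarrow>
      'k mpoly \<Rightarrow> real" where
  "sigma_seminorm n v i j I x =
     (\<lambda>f\<in>chart_ring n i j. THE s. \<exists>c. expansion n i j I (Jset n x) f c \<and>
        s = expansion_norm v i j I x c)"

text \<open>Admissible choices in the construction at the class \<open>t\<close>; \<open>x\<close> is a representative of \<open>t\<close>.\<close>

definition sigma_choice ::
    "nat \<Rightarrow> (nat set \<Rightarrow> ereal) set \<Rightarrow> (nat set \<Rightarrow> ereal) \<Rightarrow> nat \<Rightarrow> nat \<Rightarrow> ugraph \<Rightarrow> nat rel \<Rightarrow>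
      nat set set \<Rightarrow> bool" where
  "sigma_choice n t x i j T r I \<longleftrightarrow>
     x \<in> t \<and> (i, j) \<in> charts n \<and> {i, j} \<notin> Jset n x \<and>
     tree_on n T \<and> t \<in> TP n closure_of tree_cone n T \<and>
     cherry_property n T i j r \<and>
     compatible n T i j r (Jset n x \<inter> Iset n i j) I"

definition sigma_map ::
    "nat \<Rightarrow> ('k::field \<Rightarrow> real) \<Rightarrow> (nat set \<Rightarrow> ereal) set \<Rightarrow> 'k chart_point set" where
  "sigma_map n v t = (THE z. \<exists>x i j T r I. sigma_choice n t x i j T r I \<and>
     z = glue n v ((i, j), sigma_seminorm n v i j I x))"

end

(*
Over a tropical Pluecker vector w on the chart U_ij there is a largest multiplicative seminorm with
the values w(e) on the coordinates u_e. It is the Gauss norm in any adapted system D of 2(n-2)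
coordinates: the labels k are introduced one after the other through u_ak and u_tk, where a, t are
old labels, u_at is invertible, and the two terms of the Pluecker relation for u_lk do not cancel
tropically. Compatible index sets for an order with the cherry property are adapted, which
identifies sigma with the fibrewise maximum and makes it independent of the choices and of the
chart. Continuity follows because, for w' near w, one can choose systems adapted to w and to w'
that agree up to coordinates of weight zero at w, so the maximum is squeezed between two Gauss
norms that depend continuously on w'. That every point lies in the closure of some tree cone follows
by perturbing the zero weights in the Gauss norm, which yields positive tropical Pluecker vectors
and hence tree metrics by the four-point condition.
*)
theory Submission
  imports Defs
begin

text \<open>The obstacle is that every ingredient of \<open>sigma_map\<close> jumps: the tree, the
  order, the index set and the set of vanishing coordinates all vary discontinuously, and a system
  adapted at a limit point need not be adapted nearby. Maximality in the fibre of
  \<open>trop\<close> is a property of the seminorm alone, so two sets of choices never have to be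
  compared directly. Weights are kept in multiplicative form, with 0 in place of minus infinity; a
  Gauss norm then depends continuously on its weights even where some of them vanish, as long as
  only coordinates of nonzero weight are inverted. The two systems differ only in labels whose
  coordinates with both i and j vanish at the limit. From above nothing is lost, because the Gauss
  norm of the limit system, taken at the nearby weights, still bounds the whole nearby fibre. From
  below, the terms that vanish in the limit are split off and estimated by the triangle inequality.
  Trees enter through the splits induced by their edges, which turn membership in the closure of a
  tree cone into inequalities between products of two weights.\<close>

abbreviation "lookup \<equiv> Poly_Mapping.lookup"
abbreviation "keys \<equiv> Poly_Mapping.keys"
abbreviation "single \<equiv> Poly_Mapping.single"

section \<open>Ring homomorphisms and sums over finite support\<close>

definition rhom :: "('a::comm_ring_1 \<Rightarrow> 'b::comm_ring_1) \<Rightarrow> bool" where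
  "rhom h \<longleftrightarrow> (\<forall>x y. h (x + y) = h x + h y) \<and> (\<forall>x y. h (x * y) = h x * h y) \<and> h 1 = 1"

lemma rhom_simps:
  assumes "rhom h"
  shows "h (x + y) = h x + h y" "h (x * y) = h x * h y" "h 1 = 1" "h 0 = 0"
    "h (- x) = - h x" "h (x - y) = h x - h y" "h (x ^ m) = h x ^ m"
proof -
  have add: "h (x + y) = h x + h y" for x y using assms by (simp add: rhom_def)
  have mult: "h (x * y) = h x * h y" for x y using assms by (simp add: rhom_def)
  have one: "h 1 = 1" using assms by (simp add: rhom_def)
  have zero: "h 0 = 0" using add[of 0 0] by simp
  have neg: "h (- x) = - h x" for x using add[of x "- x"] zero by (simp add: eq_neg_iff_add_eq_0 add.commute)
  show "h (x + y) = h x + h y" "h (x * y) = h x * h y" "h 1 = 1" "h 0 = 0" "h (- x) = - h x"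
    by fact+
  show "h (x - y) = h x - h y" using add[of x "- y"] neg by simp
  show "h (x ^ m) = h x ^ m" by (induction m) (simp_all add: one mult)
qed

lemma rhom_sum: "rhom h \<Longrightarrow> h (sum f A) = (\<Sum>a\<in>A. h (f a))"
  by (induction A rule: infinite_finite_induct) (simp_all add: rhom_simps)

lemma rhom_prod: "rhom h \<Longrightarrow> h (prod f A) = (\<Prod>a\<in>A. h (f a))"
  by (induction A rule: infinite_finite_induct) (simp_all add: rhom_simps)

lemma rhom_comp: "rhom g \<Longrightarrow> rhom h \<Longrightarrow> rhom (\<lambda>x. g (h x))"
  by (simp add: rhom_def)

lemma rhom_id: "rhom (\<lambda>x. x)"
  by (simp add: rhom_def)

lemma sum_keys_superset:
  assumes "finite A" "keys P \<subseteq> A" "\<And>\<alpha>. g 0 \<alpha> = 0"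
  shows "(\<Sum>\<alpha>\<in>keys P. g (lookup P \<alpha>) \<alpha>) = (\<Sum>\<alpha>\<in>A. g (lookup P \<alpha>) \<alpha>)"
  using assms by (intro sum.mono_neutral_left) (auto simp: in_keys_iff)

lemma sum_single: "(\<Sum>\<alpha>\<in>keys P. single \<alpha> (lookup P \<alpha>)) = P"
  by (intro poly_mapping_eqI)
    (auto simp: lookup_sum lookup_single when_def in_keys_iff)

section \<open>Evaluation homomorphisms\<close>

text \<open>The exponents range over an arbitrary type, so that one notion covers polynomials on a
  chart, homogeneous polynomials and Laurent polynomials with integer exponents.\<close>

definition geval :: "('k::comm_ring_1 \<Rightarrow> 'a::comm_ring_1) \<Rightarrow> ('m \<Rightarrow> 'a) \<Rightarrow> ('m \<Rightarrow>\<^sub>0 'k) \<Rightarrow> 'a" where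
  "geval \<phi> \<theta> P = (\<Sum>\<alpha>\<in>keys P. \<phi> (lookup P \<alpha>) * \<theta> \<alpha>)"

lemma geval_single:
  assumes "rhom \<phi>"
  shows "geval \<phi> \<theta> (single \<alpha> a) = \<phi> a * \<theta> \<alpha>"
  using assms by (auto simp: geval_def rhom_simps)

lemma geval_add:
  assumes "rhom \<phi>"
  shows "geval \<phi> \<theta> (P + Q) = geval \<phi> \<theta> P + geval \<phi> \<theta> Q"
proof -
  let ?A = "keys P \<union> keys Q"
  have "geval \<phi> \<theta> R = (\<Sum>\<alpha>\<in>?A. \<phi> (lookup R \<alpha>) * \<theta> \<alpha>)" if "keys R \<subseteq> ?A" for R
    unfolding geval_def using that
    by (intro sum_keys_superset[where g = "\<lambda>c \<alpha>. \<phi> c * \<theta> \<alpha>"]) (auto simp: rhom_simps[OF assms])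
  from this[of P] this[of Q] this[of "P + Q"] show ?thesis
    by (simp add: keys_add lookup_add rhom_simps[OF assms] ring_distribs sum.distrib)
qed

lemma geval_sum:
  assumes "rhom \<phi>"
  shows "geval \<phi> \<theta> (sum F A) = (\<Sum>a\<in>A. geval \<phi> \<theta> (F a))"
proof -
  have "geval \<phi> \<theta> 0 = 0" by (simp add: geval_def)
  then show ?thesis
    by (induction A rule: infinite_finite_induct) (simp_all add: geval_add[OF assms])
qed

lemma rhom_geval:
  fixes \<theta> :: "'m::comm_monoid_add \<Rightarrow> 'a::comm_ring_1"
  assumes "rhom \<phi>" and "\<theta> 0 = 1" and "\<And>\<alpha> \<beta>. \<theta> (\<alpha> + \<beta>) = \<theta> \<alpha> * \<theta> \<beta>"
  shows "rhom (geval \<phi> \<theta>)"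
  unfolding rhom_def
proof (intro conjI allI)
  fix P Q
  show "geval \<phi> \<theta> (P + Q) = geval \<phi> \<theta> P + geval \<phi> \<theta> Q" by (rule geval_add[OF assms(1)])
  have "P * Q = (\<Sum>\<alpha>\<in>keys P. single \<alpha> (lookup P \<alpha>)) * (\<Sum>\<beta>\<in>keys Q. single \<beta> (lookup Q \<beta>))"
    by (simp add: sum_single)
  also have "\<dots> = (\<Sum>\<alpha>\<in>keys P. \<Sum>\<beta>\<in>keys Q. single (\<alpha> + \<beta>) (lookup P \<alpha> * lookup Q \<beta>))"
    by (simp add: sum_product mult_single)
  also have "geval \<phi> \<theta> \<dots> = (\<Sum>\<alpha>\<in>keys P. \<Sum>\<beta>\<in>keys Q. (\<phi> (lookup P \<alpha>) * \<theta> \<alpha>) * (\<phi> (lookup Q \<beta>) * \<theta> \<beta>))"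
    by (simp add: geval_sum[OF assms(1)] geval_single[OF assms(1)] rhom_simps[OF assms(1)] assms(3) algebra_simps)
  also have "\<dots> = geval \<phi> \<theta> P * geval \<phi> \<theta> Q"
    by (simp add: geval_def sum_product)
  finally show "geval \<phi> \<theta> (P * Q) = geval \<phi> \<theta> P * geval \<phi> \<theta> Q" .
next
  show "geval \<phi> \<theta> 1 = 1"
    using geval_single[OF assms(1), of \<theta> 0 1] assms by (simp add: rhom_simps)
qed

section \<open>Polynomials on the charts\<close>

lemma finite_pairs [simp]: "finite (pairs n)"
proof -
  have "pairs n \<subseteq> Pow {1..n}" by (auto simp: pairs_def)
  then show ?thesis by (rule finite_subset) simp
qed

lemma pairsE:
  assumes "e \<in> pairs n"
  obtains a b where "e = {a, b}" "a \<in> {1..n}" "b \<in> {1..n}" "a < b"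
  using assms unfolding pairs_def
  by (smt (verit, best) insert_commute mem_Collect_eq nat_neq_iff)

lemma pairs_iff: "{a, b} \<in> pairs n \<longleftrightarrow> a \<in> {1..n} \<and> b \<in> {1..n} \<and> a \<noteq> b"
  by (auto simp: pairs_def doubleton_eq_iff)

lemma chartsD: "(i, j) \<in> charts n \<Longrightarrow> i \<in> {1..n} \<and> j \<in> {1..n} \<and> i < j \<and> i \<noteq> j"
  by (auto simp: charts_def)

lemma Iset_subset: "(i, j) \<in> charts n \<Longrightarrow> Iset n i j \<subseteq> pairs n"
  by (auto simp: Iset_def charts_def pairs_iff)

lemma finite_Iset: "(i, j) \<in> charts n \<Longrightarrow> finite (Iset n i j)"
  by (rule finite_subset[OF Iset_subset finite_pairs])

lemma inj_on_pvar: "inj_on pvar (pairs n)"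
proof (rule inj_onI)
  fix e f assume "e \<in> pairs n" "f \<in> pairs n" "pvar e = pvar f"
  then show "e = f"
    by (elim pairsE) (auto simp: pvar_def)
qed

lemma Iset_iff:
  assumes "(i, j) \<in> charts n"
  shows "e \<in> Iset n i j \<longleftrightarrow> e \<in> pairs n \<and> e \<noteq> {i, j} \<and> (i \<in> e \<or> j \<in> e)"
proof
  assume "e \<in> Iset n i j" then show "e \<in> pairs n \<and> e \<noteq> {i, j} \<and> (i \<in> e \<or> j \<in> e)"
    using assms by (auto simp: Iset_def charts_def pairs_iff doubleton_eq_iff)
next
  assume *: "e \<in> pairs n \<and> e \<noteq> {i, j} \<and> (i \<in> e \<or> j \<in> e)"
  then obtain a b where "e = {a, b}" "a \<in> {1..n}" "b \<in> {1..n}" "a < b" by (meson pairsE)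
  then show "e \<in> Iset n i j" using * by (auto simp: Iset_def doubleton_eq_iff)
qed

lemma rhom_Const: "rhom Const"
  by (simp add: rhom_def Const_def single_add mult_single)

lemma rhom_to_frac: "rhom to_frac"
  by (simp add: rhom_def to_frac_def One_fract_def)

lemma to_frac_eq_iff: "to_frac f = to_frac g \<longleftrightarrow> f = g"
  by (simp add: to_frac_def eq_fract)

lemma to_frac_eq_0_iff: "to_frac f = 0 \<longleftrightarrow> f = 0"
  by (metis to_frac_eq_iff rhom_to_frac rhom_simps(4))

text \<open>The value of a chart monomial at the point \<open>Y\<close>. Variables outside
  \<open>I(ij)\<close> are ignored; elements of the chart ring do not contain them.\<close>

definition Vmono :: "nat \<Rightarrow> nat \<Rightarrow> nat \<Rightarrow> (nat set \<Rightarrow> 'a::comm_ring_1) \<Rightarrow> (nat \<Rightarrow>\<^sub>0 nat) \<Rightarrow> 'a" where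
  "Vmono n i j Y \<alpha> = (\<Prod>e\<in>Iset n i j. Y e ^ lookup \<alpha> (pvar e))"

lemma Vmono_0 [simp]: "Vmono n i j Y 0 = 1"
  by (simp add: Vmono_def)

lemma Vmono_add: "Vmono n i j Y (\<alpha> + \<beta>) = Vmono n i j Y \<alpha> * Vmono n i j Y \<beta>"
  by (simp add: Vmono_def lookup_add power_add prod.distrib)

lemma rhom_chart_eval: "rhom \<phi> \<Longrightarrow> rhom (geval \<phi> (Vmono n i j Y))"
  by (rule rhom_geval) (simp_all add: Vmono_add)

lemma geval_Const: "rhom \<phi> \<Longrightarrow> geval \<phi> (Vmono n i j Y) (Const a) = \<phi> a"
  by (simp add: Const_def geval_single)

lemma geval_Var:
  assumes "rhom \<phi>" "(i, j) \<in> charts n" "e \<in> Iset n i j"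
  shows "geval \<phi> (Vmono n i j Y) (Var e) = Y e"
proof -
  have "Vmono n i j Y (single (pvar e) 1) = (\<Prod>f\<in>Iset n i j. if f = e then Y e else 1)"
    unfolding Vmono_def
    using assms inj_on_pvar[of n] Iset_subset[OF assms(2)]
    by (intro prod.cong) (auto simp: lookup_single when_def inj_on_def)
  also have "\<dots> = Y e" using assms finite_Iset[OF assms(2)] by simp
  finally show ?thesis by (simp add: Var_def geval_single[OF assms(1)] rhom_simps[OF assms(1)])
qed

lemma Var_power: "Var e ^ m = single (single (pvar e) m) 1"
  by (induction m) (simp_all add: Var_def mult_single flip: single_add)

text \<open>This is what makes a ring homomorphism on the chart ring determined by its values on
  constants and variables.\<close>

lemma chart_expand:
  fixes f :: "'k::field mpoly"
  assumes "(i, j) \<in> charts n" "f \<in> chart_ring n i j"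
  shows "geval Const (Vmono n i j Var) f = f"
proof -
  have prods: "(\<Prod>e\<in>A. single (g e) (1::'k::field)) = single (\<Sum>e\<in>A. g e) 1" if "finite A"
    for A and g :: "nat set \<Rightarrow> nat \<Rightarrow>\<^sub>0 nat" using that
    by (induction A rule: finite_induct) (simp_all add: mult_single)
  have "Const (lookup f \<alpha>) * Vmono n i j Var \<alpha> = single \<alpha> (lookup f \<alpha>)" if "\<alpha> \<in> keys f" for \<alpha>
  proof -
    have sub: "keys \<alpha> \<subseteq> pvar ` Iset n i j" using assms that by (auto simp: chart_ring_def)
    have inj: "inj_on pvar (Iset n i j)" using inj_on_pvar Iset_subset[OF assms(1)] by (rule inj_on_subset)
    have "(\<Sum>e\<in>Iset n i j. single (pvar e) (lookup \<alpha> (pvar e))) = (\<Sum>x\<in>pvar ` Iset n i j. single x (lookup \<alpha> x))"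
      using inj by (simp add: sum.reindex)
    also have "\<dots> = (\<Sum>x\<in>keys \<alpha>. single x (lookup \<alpha> x))"
      using sub finite_Iset[OF assms(1)] by (intro sum.mono_neutral_right) (auto simp: in_keys_iff)
    also have "\<dots> = \<alpha>" by (rule sum_single)
    finally have *: "(\<Sum>e\<in>Iset n i j. single (pvar e) (lookup \<alpha> (pvar e))) = \<alpha>" .
    have "Vmono n i j Var \<alpha> = (single \<alpha> 1 :: 'k mpoly)"
      using finite_Iset[OF assms(1)] by (simp add: Vmono_def Var_power prods *)
    then show ?thesis by (simp add: Const_def mult_single)
  qed
  then have "geval Const (Vmono n i j Var) f = (\<Sum>\<alpha>\<in>keys f. single \<alpha> (lookup f \<alpha>))"
    by (simp add: geval_def)
  then show ?thesis by (simp add: sum_single)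
qed

lemma chart_ring_add: "f \<in> chart_ring n i j \<Longrightarrow> g \<in> chart_ring n i j \<Longrightarrow> f + g \<in> chart_ring n i j"
  using keys_add[of f g] by (auto simp: chart_ring_def)

lemma chart_ring_uminus: "f \<in> chart_ring n i j \<Longrightarrow> - f \<in> chart_ring n i j"
  by (auto simp: chart_ring_def in_keys_iff lookup_uminus)

lemma chart_ring_diff: "f \<in> chart_ring n i j \<Longrightarrow> g \<in> chart_ring n i j \<Longrightarrow> f - g \<in> chart_ring n i j"
  using chart_ring_add[of f n i j "- g"] by (simp add: chart_ring_uminus)

lemma chart_ring_mult:
  assumes "f \<in> chart_ring n i j" "g \<in> chart_ring n i j" shows "f * g \<in> chart_ring n i j"
  unfolding chart_ring_def
proof safe
  fix \<alpha> x assume "\<alpha> \<in> keys (f * g)" "x \<in> keys \<alpha>"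
  then obtain a b where "\<alpha> = a + b" "a \<in> keys f" "b \<in> keys g" using keys_mult[of f g] by blast
  then show "x \<in> pvar ` Iset n i j"
    using assms keys_add[of a b] \<open>x \<in> keys \<alpha>\<close> by (fastforce simp: chart_ring_def)
qed

lemma chart_ring_Const [simp]: "Const a \<in> chart_ring n i j"
  by (auto simp: chart_ring_def Const_def split: if_splits)

lemma Const_0: "Const 0 = 0" and Const_1: "Const 1 = 1"
  using rhom_simps(3,4)[OF rhom_Const] by simp_all

lemma chart_ring_0 [simp]: "0 \<in> chart_ring n i j" and chart_ring_1 [simp]: "1 \<in> chart_ring n i j"
  using chart_ring_Const[of 0 n i j] chart_ring_Const[of 1 n i j] by (simp_all only: Const_0 Const_1)

lemma chart_ring_Var: "e \<in> Iset n i j \<Longrightarrow> Var e \<in> chart_ring n i j"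
  by (auto simp: chart_ring_def Var_def split: if_splits)

lemma chart_ring_power: "f \<in> chart_ring n i j \<Longrightarrow> f ^ m \<in> chart_ring n i j"
  by (induction m) (auto intro: chart_ring_mult)

lemma chart_ring_sum: "(\<And>a. a \<in> A \<Longrightarrow> F a \<in> chart_ring n i j) \<Longrightarrow> sum F A \<in> chart_ring n i j"
  by (induction A rule: infinite_finite_induct) (auto intro: chart_ring_add)

lemma chart_ring_prod: "(\<And>a. a \<in> A \<Longrightarrow> F a \<in> chart_ring n i j) \<Longrightarrow> prod F A \<in> chart_ring n i j"
  by (induction A rule: infinite_finite_induct) (auto intro: chart_ring_mult)

lemma rhom_eq_on_chart:
  assumes "(i, j) \<in> charts n" "rhom h" "rhom h'"
    and "\<And>a. h (Const a) = h' (Const a)" and "\<And>e. e \<in> Iset n i j \<Longrightarrow> h (Var e) = h' (Var e)"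
    and "f \<in> chart_ring n i j"
  shows "h f = h' f"
proof -
  have "g f = (\<Sum>\<alpha>\<in>keys f. g (Const (lookup f \<alpha>)) * (\<Prod>e\<in>Iset n i j. g (Var e) ^ lookup \<alpha> (pvar e)))"
    if "rhom g" for g :: "'a mpoly \<Rightarrow> 'b"
    by (subst chart_expand[OF assms(1,6), symmetric])
      (simp add: geval_def Vmono_def rhom_sum[OF that] rhom_prod[OF that] rhom_simps[OF that])
  from this[OF assms(2)] this[OF assms(3)] show ?thesis using assms by simp
qed

section \<open>Signed Pluecker coordinates\<close>

text \<open>Restores the antisymmetry that is lost on unordered pairs; the Pluecker relations then
  hold for all labels, in any order and with repetitions.\<close>

definition sp :: "nat \<Rightarrow> nat \<Rightarrow> nat \<Rightarrow> nat \<Rightarrow> 'k::field mpoly" where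
  "sp i j a b = (if a = b then 0 else if a < b then ucoord i j {a, b} else - ucoord i j {a, b})"

lemma sp_same [simp]: "sp i j a a = 0"
  by (simp add: sp_def)

lemma sp_swap: "sp i j b a = - sp i j a b"
  by (auto simp: sp_def insert_commute)

lemma Min_Max_pair: "a < b \<Longrightarrow> Min {a, b} = a" "a < b \<Longrightarrow> Max {a, b} = (b::nat)"
  by auto

lemma ucoord_ij [simp]: "ucoord i j {i, j} = 1"
  by (simp add: ucoord_def)

lemma sp_ij: "i < j \<Longrightarrow> sp i j i j = 1"
  by (simp add: sp_def)

lemma sp_ji: "i < j \<Longrightarrow> sp i j j i = -1"
  by (subst sp_swap) (simp add: sp_ij)

text \<open>On the chart the 2 x n matrix can be normalized so that its columns i and j form the
  identity matrix. Its column a is then (-p_ja, p_ia), and the right side is the minor of the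
  columns a and b.\<close>

lemma sp_expand:
  assumes "i < j"
  shows "sp i j a b = sp i j i a * sp i j j b - sp i j i b * sp i j j a"
proof -
  have main: "sp i j a b = sp i j i a * sp i j j b - sp i j i b * sp i j j a" if "a < b" for a b
  proof -
    consider "a = i" | "b = i" | "a = j" | "b = j" | "a \<notin> {i, j}" "b \<notin> {i, j}" by auto
    then show ?thesis
    proof cases
      case 5
      then have "{a, b} \<noteq> {i, j}" by auto
      moreover have sv: "sp i j c d = signed_var c d" if "c \<in> {i, j}" "d \<in> {a, b}" for c d :: nat
        using that 5 assms by (auto simp: sp_def signed_var_def ucoord_def)
      ultimately show ?thesis using 5 \<open>a < b\<close> assms
        by (simp add: sv Min_Max_pair) (simp add: sp_def ucoord_def Min_Max_pair)
    next
      case 1 then show ?thesis using assms by (simp add: sp_ji)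
    next
      case 2 then show ?thesis using assms sp_swap[of i j a i] by (simp add: sp_ji)
    next
      case 3 then show ?thesis using assms by (simp add: sp_ij)
    next
      case 4 then show ?thesis using assms sp_swap[of i j a j] by (simp add: sp_ij)
    qed
  qed
  consider "a = b" | "a < b" | "b < a" by linarith
  then show ?thesis
  proof cases
    case 3
    have "sp i j a b = - sp i j b a" by (rule sp_swap)
    also have "\<dots> = - (sp i j i b * sp i j j a - sp i j i a * sp i j j b)" by (subst main[OF 3]) simp
    finally show ?thesis by simp
  qed (use main in auto)
qed

lemma sp_plucker:
  assumes "i < j"
  shows "(sp i j a b :: 'a::field mpoly) * sp i j c d = sp i j a c * sp i j b d - sp i j a d * sp i j b c"
proof -
  define A B where "A = (sp i j i :: nat \<Rightarrow> 'a mpoly)" and "B = (sp i j j :: nat \<Rightarrow> 'a mpoly)"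
  have e: "sp i j x y = A x * B y - A y * B x" for x y
    unfolding A_def B_def by (rule sp_expand[OF assms])
  show ?thesis
    unfolding e[of a b] e[of c d] e[of a c] e[of b d] e[of a d] e[of b c] by (simp add: algebra_simps)
qed

lemma ucoord_Iset: "(i, j) \<in> charts n \<Longrightarrow> e \<in> Iset n i j \<Longrightarrow> ucoord i j e = Var e"
  by (auto simp: Iset_iff ucoord_def)

lemma ucoord_sp: "a < b \<Longrightarrow> ucoord i j {a, b} = sp i j a b"
  by (simp add: sp_def)

lemma sp_chart_ring:
  assumes "(i, j) \<in> charts n" "a \<in> {1..n}" "b \<in> {1..n}"
  shows "(sp i j a b :: 'k::field mpoly) \<in> chart_ring n i j"
proof -
  have *: "(sp i j c d :: 'k mpoly) \<in> chart_ring n i j" if "c \<in> {i, j}" "d \<in> {1..n}" for c d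
  proof (cases "c = d")
    case False
    have "(ucoord i j {c, d} :: 'k mpoly) \<in> chart_ring n i j"
    proof (cases "{c, d} = {i, j}")
      case False
      then have "{c, d} \<in> Iset n i j"
        using that \<open>c \<noteq> d\<close> assms chartsD[OF assms(1)] by (auto simp: Iset_iff pairs_iff)
      then show ?thesis by (simp add: ucoord_Iset[OF assms(1)] chart_ring_Var)
    qed (simp only: ucoord_ij chart_ring_1)
    then show ?thesis using False by (auto simp: sp_def chart_ring_uminus)
  qed simp
  have "i < j" using assms by (auto simp: charts_def)
  have "(sp i j i a * sp i j j b - sp i j i b * sp i j j a :: 'k mpoly) \<in> chart_ring n i j"
    using assms by (intro chart_ring_diff chart_ring_mult *) auto
  then show ?thesis by (simp only: sp_expand[OF \<open>i < j\<close>, of a b])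
qed

lemma ucoord_chart_ring:
  assumes "(i, j) \<in> charts n" "e \<in> pairs n"
  shows "(ucoord i j e :: 'k::field mpoly) \<in> chart_ring n i j"
proof -
  obtain a b where "e = {a, b}" "a \<in> {1..n}" "b \<in> {1..n}" "a < b" using assms(2) by (rule pairsE)
  then show ?thesis using sp_chart_ring[OF assms(1), of a b, where 'k = 'k] by (simp add: ucoord_sp)
qed

lemma Var_neq_0: "(Var e :: 'a::field mpoly) \<noteq> 0"
proof
  assume "(Var e :: 'a mpoly) = 0"
  then have "lookup (Var e :: 'a mpoly) (single (pvar e) 1) = 0" by simp
  then show False by (simp add: Var_def)
qed

section \<open>The Gauss norm on Laurent polynomials\<close>

type_synonym 'k laurent = "(nat set \<Rightarrow>\<^sub>0 int) \<Rightarrow>\<^sub>0 'k"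

definition mono_wt :: "nat set set \<Rightarrow> (nat set \<Rightarrow> real) \<Rightarrow> (nat set \<Rightarrow>\<^sub>0 int) \<Rightarrow> real" where
  "mono_wt A w \<alpha> = (\<Prod>e\<in>A. w e powi lookup \<alpha> e)"

text \<open>A negative power of a vanishing weight evaluates to 0, which would destroy the
  multiplicativity of \<open>mono_wt\<close>.\<close>

definition okexp :: "nat set set \<Rightarrow> (nat set \<Rightarrow> real) \<Rightarrow> (nat set \<Rightarrow>\<^sub>0 int) \<Rightarrow> bool" where
  "okexp A w \<alpha> \<longleftrightarrow> (\<forall>e\<in>A. lookup \<alpha> e < 0 \<longrightarrow> w e \<noteq> 0)"

text \<open>The weighted Gauss norm; the inserted 0 is the norm of the zero polynomial, whose set of
  keys is empty.\<close>

definition gauss :: "('k::field \<Rightarrow> real) \<Rightarrow> nat set set \<Rightarrow> (nat set \<Rightarrow> real) \<Rightarrow> 'k laurent \<Rightarrow> real" where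
  "gauss v A w P = Max (insert 0 ((\<lambda>\<alpha>. v (lookup P \<alpha>) * mono_wt A w \<alpha>) ` keys P))"

lemma mono_wt_nonneg: "(\<And>e. e \<in> A \<Longrightarrow> 0 \<le> w e) \<Longrightarrow> 0 \<le> mono_wt A w \<alpha>"
  unfolding mono_wt_def by (intro prod_nonneg) (auto intro: zero_le_power_int)

lemma mono_wt_0 [simp]: "mono_wt A w 0 = 1"
  by (simp add: mono_wt_def)

lemma power_int_add_ok:
  fixes x :: real
  assumes "m < 0 \<Longrightarrow> x \<noteq> 0" "k < 0 \<Longrightarrow> x \<noteq> 0"
  shows "x powi (m + k) = x powi m * x powi k"
proof (cases "x = 0")
  case True
  then have "m \<ge> 0" "k \<ge> 0" using assms by linarith+
  then have "m + k = 0 \<longleftrightarrow> m = 0 \<and> k = 0" by linarith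
  then show ?thesis using True by (simp add: power_int_0_left_if)
qed (simp add: power_int_add)

lemma mono_wt_add:
  assumes "okexp A w \<alpha>" "okexp A w \<beta>"
  shows "mono_wt A w (\<alpha> + \<beta>) = mono_wt A w \<alpha> * mono_wt A w \<beta>"
  using assms unfolding mono_wt_def prod.distrib[symmetric]
  by (intro prod.cong) (auto simp: lookup_add okexp_def power_int_add_ok)

lemma tendsto_Max_insert0:
  fixes f :: "'i \<Rightarrow> 'a \<Rightarrow> real"
  assumes "finite K" "\<And>k. k \<in> K \<Longrightarrow> (f k \<longlongrightarrow> l k) F"
  shows "((\<lambda>x. Max (insert 0 ((\<lambda>k. f k x) ` K))) \<longlongrightarrow> Max (insert 0 (l ` K))) F"
  using assms
proof (induction K rule: finite_induct)
  case (insert k K)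
  have ins: "Max (insert 0 (g ` insert k K)) = max (g k) (Max (insert 0 (g ` K)))" for g :: "'i \<Rightarrow> real"
    using insert.hyps by (simp add: insert_commute[of 0])
  show ?case unfolding ins using insert by (intro tendsto_max) auto
qed simp

text \<open>Nonnegative powers are continuous everywhere, negative ones away from 0;
  \<open>okexp\<close> is required at the limit only.\<close>

lemma tendsto_mono_wt:
  assumes "\<And>e. e \<in> A \<Longrightarrow> ((\<lambda>x. w x e) \<longlongrightarrow> w0 e) F" "okexp A w0 \<alpha>"
  shows "((\<lambda>x. mono_wt A (w x) \<alpha>) \<longlongrightarrow> mono_wt A w0 \<alpha>) F"
  unfolding mono_wt_def
proof (rule tendsto_prod)
  fix e assume e: "e \<in> A"
  show "((\<lambda>x. w x e powi lookup \<alpha> e) \<longlongrightarrow> w0 e powi lookup \<alpha> e) F"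
  proof (cases "lookup \<alpha> e < 0")
    case True
    then show ?thesis using assms e by (intro tendsto_power_int) (auto simp: okexp_def)
  next
    case False
    then have "lookup \<alpha> e = int (nat (lookup \<alpha> e))" by simp
    then obtain m where "lookup \<alpha> e = int m" by blast
    then show ?thesis using assms(1)[OF e] by (simp add: tendsto_power)
  qed
qed

lemma tendsto_gauss:
  assumes "\<And>e. e \<in> A \<Longrightarrow> ((\<lambda>x. w x e) \<longlongrightarrow> w0 e) F" "\<And>\<alpha>. \<alpha> \<in> keys P \<Longrightarrow> okexp A w0 \<alpha>"
  shows "((\<lambda>x. gauss v A (w x) P) \<longlongrightarrow> gauss v A w0 P) F"
  unfolding gauss_def using assms
  by (intro tendsto_Max_insert0 tendsto_mult tendsto_const tendsto_mono_wt) auto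

lemma lookup_mult_sum:
  "lookup (P * Q) \<gamma> = (\<Sum>(\<alpha>, \<beta>)\<in>keys P \<times> keys Q. if \<alpha> + \<beta> = \<gamma> then lookup P \<alpha> * lookup Q \<beta> else 0)"
proof -
  have "P * Q = (\<Sum>\<alpha>\<in>keys P. single \<alpha> (lookup P \<alpha>)) * (\<Sum>\<beta>\<in>keys Q. single \<beta> (lookup Q \<beta>))"
    by (simp add: sum_single)
  also have "\<dots> = (\<Sum>(\<alpha>, \<beta>)\<in>keys P \<times> keys Q. single (\<alpha> + \<beta>) (lookup P \<alpha> * lookup Q \<beta>))"
    by (simp add: sum_product mult_single sum.cartesian_product)
  finally show ?thesis
    by (simp add: lookup_sum lookup_single when_def case_prod_unfold)
qed

context complete_nonarch_field
begin

lemma v_0 [simp]: "v 0 = 0" by (simp add: eq_0_iff)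

lemma v_1 [simp]: "v 1 = 1"
proof -
  have "v 1 * v 1 = v 1" using mult[of 1 1] by simp
  then show ?thesis using eq_0_iff[of 1] by simp
qed

lemma v_uminus [simp]: "v (- a) = v a"
proof -
  have "v (-1) * v (-1) = 1" using mult[of "-1" "-1"] by simp
  then have "v (-1) = 1" using nonneg[of "-1"] by (metis abs_of_nonneg abs_1 mult_cancel_left2 square_eq_1_iff v_1 zero_neq_one linorder_not_le minus_less_iff neg_less_0_iff_less zero_less_one)
  then show ?thesis using mult[of "-1" a] by simp
qed

lemma v_sum_le: "(\<And>x. x \<in> A \<Longrightarrow> v (f x) \<le> B) \<Longrightarrow> 0 \<le> B \<Longrightarrow> v (sum f A) \<le> B"
proof (induction A rule: infinite_finite_induct)
  case (insert x A)
  have "v (f x + sum f A) \<le> max (v (f x)) (v (sum f A))" by (rule ultrametric)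
  moreover have "v (f x) \<le> B" "v (sum f A) \<le> B" using insert by simp_all
  ultimately show ?case using insert.hyps by simp
qed simp_all

lemma v_sum_less: "(\<And>x. x \<in> A \<Longrightarrow> v (f x) < B) \<Longrightarrow> 0 < B \<Longrightarrow> v (sum f A) < B"
proof (induction A rule: infinite_finite_induct)
  case (insert x A)
  have "v (f x + sum f A) \<le> max (v (f x)) (v (sum f A))" by (rule ultrametric)
  moreover have "v (f x) < B" "v (sum f A) < B" using insert by simp_all
  ultimately show ?case using insert.hyps by simp
qed simp_all

lemma gauss_le_iff:
  "gauss v A w P \<le> B \<longleftrightarrow> 0 \<le> B \<and> (\<forall>\<alpha>\<in>keys P. v (lookup P \<alpha>) * mono_wt A w \<alpha> \<le> B)"
  by (simp add: gauss_def)

lemma gauss_nonneg: "0 \<le> gauss v A w P"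
  by (simp add: gauss_def)

lemma gauss_ge: "v (lookup P \<alpha>) * mono_wt A w \<alpha> \<le> gauss v A w P"
proof (cases "\<alpha> \<in> keys P")
  case True
  then show ?thesis using gauss_le_iff[of A w P "gauss v A w P"] by simp
next
  case False
  then show ?thesis by (simp add: in_keys_iff gauss_nonneg)
qed

lemma gauss_attained:
  assumes "gauss v A w P \<noteq> 0"
  obtains \<alpha> where "\<alpha> \<in> keys P" "gauss v A w P = v (lookup P \<alpha>) * mono_wt A w \<alpha>"
proof -
  have "gauss v A w P \<in> insert 0 ((\<lambda>\<alpha>. v (lookup P \<alpha>) * mono_wt A w \<alpha>) ` keys P)"
    unfolding gauss_def by (intro Max_in) auto
  then show ?thesis using assms that by auto
qed

lemma gauss_single [simp]:
  assumes "\<And>e. e \<in> A \<Longrightarrow> 0 \<le> w e"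
  shows "gauss v A w (single \<alpha> a) = v a * mono_wt A w \<alpha>"
  using mono_wt_nonneg[of A w \<alpha>] assms nonneg[of a] by (auto simp: gauss_def)

lemma gauss_add:
  assumes "\<And>e. e \<in> A \<Longrightarrow> 0 \<le> w e"
  shows "gauss v A w (P + Q) \<le> max (gauss v A w P) (gauss v A w Q)"
  unfolding gauss_le_iff
proof (intro conjI ballI)
  fix \<alpha>
  have "v (lookup (P + Q) \<alpha>) * mono_wt A w \<alpha> \<le> max (v (lookup P \<alpha>)) (v (lookup Q \<alpha>)) * mono_wt A w \<alpha>"
    using ultrametric mono_wt_nonneg[of A w] assms by (intro mult_right_mono) (auto simp: lookup_add)
  also have "\<dots> \<le> max (gauss v A w P) (gauss v A w Q)"
    using gauss_ge[of P \<alpha> A w] gauss_ge[of Q \<alpha> A w] by (auto simp: max_def)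
  finally show "v (lookup (P + Q) \<alpha>) * mono_wt A w \<alpha> \<le> max (gauss v A w P) (gauss v A w Q)" .
qed (use gauss_nonneg in \<open>simp add: le_max_iff_disj\<close>)

lemma gauss_uminus [simp]: "gauss v A w (- P) = gauss v A w P"
  by (simp add: gauss_def)

text \<open>Without a common exponent no coefficient can cancel. This is where the maximum in the
  definition of \<open>adapted\<close> comes from.\<close>

lemma gauss_add_disjoint:
  assumes "keys P \<inter> keys Q = {}"
  shows "gauss v A w (P + Q) = max (gauss v A w P) (gauss v A w Q)"
proof (rule antisym)
  have P: "lookup (P + Q) \<alpha> = lookup P \<alpha>" if "\<alpha> \<in> keys P" for \<alpha>
    using assms that by (auto simp: lookup_add in_keys_iff)
  have Q: "lookup (P + Q) \<alpha> = lookup Q \<alpha>" if "\<alpha> \<in> keys Q" for \<alpha>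
    using assms that by (auto simp: lookup_add in_keys_iff)
  show "gauss v A w (P + Q) \<le> max (gauss v A w P) (gauss v A w Q)"
    unfolding gauss_le_iff
  proof (intro conjI ballI)
    fix \<alpha> assume "\<alpha> \<in> keys (P + Q)"
    then have "\<alpha> \<in> keys P \<or> \<alpha> \<in> keys Q" using keys_add[of P Q] by auto
    then show "v (lookup (P + Q) \<alpha>) * mono_wt A w \<alpha> \<le> max (gauss v A w P) (gauss v A w Q)"
      using gauss_ge[of P \<alpha> A w] gauss_ge[of Q \<alpha> A w] P Q by auto
  qed (use gauss_nonneg in \<open>simp add: le_max_iff_disj\<close>)
  show "max (gauss v A w P) (gauss v A w Q) \<le> gauss v A w (P + Q)"
    unfolding max.bounded_iff
  proof (intro conjI)
    show "gauss v A w P \<le> gauss v A w (P + Q)" "gauss v A w Q \<le> gauss v A w (P + Q)"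
      unfolding gauss_le_iff using gauss_ge[of "P + Q" _ A w] gauss_nonneg P Q by (metis, metis)
  qed
qed

lemma gauss_mult_le:
  assumes "\<And>e. e \<in> A \<Longrightarrow> 0 \<le> w e"
    and "\<And>\<alpha>. \<alpha> \<in> keys P \<Longrightarrow> okexp A w \<alpha>" "\<And>\<alpha>. \<alpha> \<in> keys Q \<Longrightarrow> okexp A w \<alpha>"
  shows "gauss v A w (P * Q) \<le> gauss v A w P * gauss v A w Q"
  unfolding gauss_le_iff
proof (intro conjI ballI)
  fix \<gamma> assume "\<gamma> \<in> keys (P * Q)"
  let ?B = "gauss v A w P * gauss v A w Q"
  have wt: "0 \<le> mono_wt A w \<gamma>" by (rule mono_wt_nonneg) (rule assms)
  have *: "v (lookup P \<alpha> * lookup Q \<beta>) * mono_wt A w \<gamma> \<le> ?B"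
    if "\<alpha> + \<beta> = \<gamma>" "\<alpha> \<in> keys P" "\<beta> \<in> keys Q" for \<alpha> \<beta>
  proof -
    have "v (lookup P \<alpha> * lookup Q \<beta>) * mono_wt A w \<gamma>
      = (v (lookup P \<alpha>) * mono_wt A w \<alpha>) * (v (lookup Q \<beta>) * mono_wt A w \<beta>)"
      using that assms(2,3) by (simp add: mult mono_wt_add flip: that(1))
    also have "\<dots> \<le> ?B"
      using assms(1) mono_wt_nonneg[of A w]
      by (intro mult_mono gauss_ge gauss_nonneg mult_nonneg_nonneg nonneg) auto
    finally show ?thesis .
  qed
  show "v (lookup (P * Q) \<gamma>) * mono_wt A w \<gamma> \<le> ?B"
  \<comment> \<open>The ultrametric bound on the coefficient is obtained after dividing by the
    weight; a monomial of weight 0 contributes nothing.\<close>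
  proof (cases "mono_wt A w \<gamma> = 0")
    case False
    then have pos: "mono_wt A w \<gamma> > 0" using wt by simp
    have "v (lookup (P * Q) \<gamma>) \<le> ?B / mono_wt A w \<gamma>"
      unfolding lookup_mult_sum
      using * pos gauss_nonneg by (intro v_sum_le) (auto simp: pos_le_divide_eq)
    then show ?thesis using pos by (simp add: pos_le_divide_eq)
  qed (use gauss_nonneg in simp)
qed (use gauss_nonneg in simp)

text \<open>
  The product of the first dominant terms, in a translation invariant order of the exponents,
  cannot be cancelled in the product.
\<close>

lemma gauss_mult:
  assumes w: "\<And>e. e \<in> A \<Longrightarrow> 0 \<le> w e" and fin: "\<And>e. e \<in> A \<Longrightarrow> finite e"
    and P: "\<And>\<alpha>. \<alpha> \<in> keys P \<Longrightarrow> okexp A w \<alpha> \<and> keys \<alpha> \<subseteq> A"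
    and Q: "\<And>\<alpha>. \<alpha> \<in> keys Q \<Longrightarrow> okexp A w \<alpha> \<and> keys \<alpha> \<subseteq> A"
  shows "gauss v A w (P * Q) = gauss v A w P * gauss v A w Q"
proof (rule antisym)
  show "gauss v A w (P * Q) \<le> gauss v A w P * gauss v A w Q"
    using assms by (intro gauss_mult_le) auto
  let ?G = "gauss v A w" and ?m = "mono_wt A w"
  \<comment> \<open>Exponents indexed by natural numbers are linearly ordered compatibly with
    addition, those indexed by sets are not. Pulling back along \<open>set_decode\<close> transfers
    the order, and it loses nothing on exponents supported in \<open>A\<close> because the members
    of \<open>A\<close> are finite.\<close>
  define f where "f = (Poly_Mapping.map_key set_decode :: (nat set \<Rightarrow>\<^sub>0 int) \<Rightarrow> (nat \<Rightarrow>\<^sub>0 int))"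
  have inj: "inj set_decode" by (rule inj_on_inverseI[of _ set_encode]) simp
  have f_add: "f (\<alpha> + \<beta>) = f \<alpha> + f \<beta>" for \<alpha> \<beta>
    unfolding f_def by (rule map_key_plus[OF inj])
  have f_inj: "\<alpha> = \<beta>" if "f \<alpha> = f \<beta>" "keys \<alpha> \<subseteq> A" "keys \<beta> \<subseteq> A" for \<alpha> \<beta>
  proof (rule poly_mapping_eqI)
    fix e show "lookup \<alpha> e = lookup \<beta> e"
    proof (cases "e \<in> A")
      case True
      then have "e = set_decode (set_encode e)" using fin by simp
      moreover have "lookup (f \<alpha>) (set_encode e) = lookup (f \<beta>) (set_encode e)" using that by simp
      ultimately show ?thesis
        by (simp add: f_def map_key.rep_eq[OF inj])
    next
      case False
      then show ?thesis using that by (metis in_keys_iff subsetD)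
    qed
  qed
  show "?G P * ?G Q \<le> ?G (P * Q)"
  proof (cases "?G P = 0 \<or> ?G Q = 0")
    case True then show ?thesis using gauss_nonneg by auto
  next
    case False
    define lead where "lead R = {\<alpha> \<in> keys R. ?G R = v (lookup R \<alpha>) * ?m \<alpha>}" for R
    have first: "\<exists>\<alpha>\<in>lead R. \<forall>\<beta>\<in>lead R. f \<alpha> \<le> f \<beta>" if "?G R \<noteq> 0" for R
    proof -
      have "finite (lead R)" by (simp add: lead_def)
      moreover have "lead R \<noteq> {}" using gauss_attained[OF that] by (force simp: lead_def)
      ultimately show ?thesis
        by (metis (no_types, lifting) arg_min_if_finite(1) arg_min_if_finite(2) not_le)
    qed
    obtain \<alpha> where \<alpha>: "\<alpha> \<in> lead P" "\<And>\<beta>. \<beta> \<in> lead P \<Longrightarrow> f \<alpha> \<le> f \<beta>" using first False by blast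
    obtain \<beta> where \<beta>: "\<beta> \<in> lead Q" "\<And>\<alpha>. \<alpha> \<in> lead Q \<Longrightarrow> f \<beta> \<le> f \<alpha>" using first False by blast
    have \<alpha>P: "\<alpha> \<in> keys P" and \<beta>Q: "\<beta> \<in> keys Q" using \<alpha> \<beta> by (auto simp: lead_def)
    let ?\<gamma> = "\<alpha> + \<beta>" and ?B = "?G P * ?G Q"
    have Bpos: "?B > 0" using False gauss_nonneg by (metis mult_pos_pos order_le_less)
    have split: "v (lookup P a * lookup Q b) * ?m ?\<gamma> = (v (lookup P a) * ?m a) * (v (lookup Q b) * ?m b)"
      if "a \<in> keys P" "b \<in> keys Q" "a + b = ?\<gamma>" for a b
    proof -
      have "?m ?\<gamma> = ?m a * ?m b"
        unfolding that(3)[symmetric] using P Q that by (intro mono_wt_add) auto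
      then show ?thesis by (simp add: mult)
    qed
    have top: "v (lookup P \<alpha> * lookup Q \<beta>) * ?m ?\<gamma> = ?B"
      using split[OF \<alpha>P \<beta>Q] \<alpha> \<beta> by (simp add: lead_def)
    have mpos: "?m ?\<gamma> > 0"
      using top Bpos mono_wt_nonneg[of A w ?\<gamma>] w by (metis less_eq_real_def mult_zero_right not_less_iff_gr_or_eq)
    have rest: "v (lookup P a * lookup Q b) < ?B / ?m ?\<gamma>"
      if ab: "a \<in> keys P" "b \<in> keys Q" "a + b = ?\<gamma>" "(a, b) \<noteq> (\<alpha>, \<beta>)" for a b
    proof -
      have le: "v (lookup P a) * ?m a \<le> ?G P" "v (lookup Q b) * ?m b \<le> ?G Q" by (rule gauss_ge)+
      have nn: "0 \<le> v (lookup P a) * ?m a" "0 \<le> v (lookup Q b) * ?m b"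
        using mono_wt_nonneg[of A w] w nonneg by (simp_all add: mult_nonneg_nonneg)
      \<comment> \<open>Two dominant terms that are first in this order have the smallest possible
        sum, and no other pair of dominant terms attains it.\<close>
      have "\<not> (a \<in> lead P \<and> b \<in> lead Q)"
      proof
        assume *: "a \<in> lead P \<and> b \<in> lead Q"
        then have "f \<alpha> \<le> f a" "f \<beta> \<le> f b" using \<alpha> \<beta> by auto
        moreover have "f a + f b = f \<alpha> + f \<beta>" using ab(3) f_add by metis
        ultimately have "f \<alpha> = f a" "f \<beta> = f b"
          by (metis add_le_cancel_left add_le_cancel_right add_mono antisym)+
        then show False using f_inj[of \<alpha> a] f_inj[of \<beta> b] P Q ab \<alpha>P \<beta>Q by auto
      qed
      then have "v (lookup P a) * ?m a < ?G P \<or> v (lookup Q b) * ?m b < ?G Q"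
        using le ab by (auto simp: lead_def)
      then have "(v (lookup P a) * ?m a) * (v (lookup Q b) * ?m b) < ?B"
      proof
        assume "v (lookup P a) * ?m a < ?G P"
        moreover have "?G Q > 0" using False gauss_nonneg[of A w Q] by simp
        ultimately show ?thesis using le nn by (smt (verit) mult_less_cancel_right mult_left_mono)
      next
        assume "v (lookup Q b) * ?m b < ?G Q"
        moreover have "?G P > 0" using False gauss_nonneg[of A w P] by simp
        ultimately show ?thesis using le nn by (smt (verit) mult_less_cancel_left mult_right_mono)
      qed
      then show ?thesis using split[OF ab(1-3)] mpos by (simp add: pos_less_divide_eq)
    qed
    let ?K = "keys P \<times> keys Q"
    let ?t = "\<lambda>(a, b). if a + b = ?\<gamma> then lookup P a * lookup Q b else 0"
    have fK: "finite ?K" by simp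
    have mem: "(\<alpha>, \<beta>) \<in> ?K" using \<alpha>P \<beta>Q by simp
    define r where "r = sum ?t (?K - {(\<alpha>, \<beta>)})"
    have "lookup (P * Q) ?\<gamma> = sum ?t ?K" by (rule lookup_mult_sum)
    also have "\<dots> = lookup P \<alpha> * lookup Q \<beta> + r"
      unfolding r_def sum.remove[OF fK mem] by simp
    finally have eq: "lookup (P * Q) ?\<gamma> + - r = lookup P \<alpha> * lookup Q \<beta>" by simp
    have "v r < ?B / ?m ?\<gamma>"
      unfolding r_def
    proof (rule v_sum_less)
      fix x assume x: "x \<in> ?K - {(\<alpha>, \<beta>)}"
      obtain a b where "x = (a, b)" by (cases x)
      then show "v (?t x) < ?B / ?m ?\<gamma>" using rest[of a b] x Bpos mpos by auto
    qed (use Bpos mpos in simp)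
    moreover have "v (lookup P \<alpha> * lookup Q \<beta>) = ?B / ?m ?\<gamma>" using top mpos by (simp add: field_simps)
    moreover have "v (lookup P \<alpha> * lookup Q \<beta>) \<le> max (v (lookup (P * Q) ?\<gamma>)) (v r)"
      using ultrametric[of "lookup (P * Q) ?\<gamma>" "- r"] by (simp only: eq v_uminus)
    ultimately have "?B / ?m ?\<gamma> \<le> v (lookup (P * Q) ?\<gamma>)" by linarith
    then have "?B \<le> v (lookup (P * Q) ?\<gamma>) * ?m ?\<gamma>" using mpos by (simp add: pos_divide_le_eq)
    also have "\<dots> \<le> ?G (P * Q)" by (rule gauss_ge)
    finally show ?thesis .
  qed
qed

end

section \<open>Admissible Laurent polynomials\<close>

text \<open>The elements of the ring K[D] with the variables of \<open>N\<close> inverted.\<close>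

definition adm :: "nat set set \<Rightarrow> nat set set \<Rightarrow> 'k::zero laurent \<Rightarrow> bool" where
  "adm D N P \<longleftrightarrow> (\<forall>\<alpha>\<in>keys P. keys \<alpha> \<subseteq> D \<and> (\<forall>e\<in>D. lookup \<alpha> e < 0 \<longrightarrow> e \<in> N))"

lemma adm_single:
  "adm D N (single \<alpha> a) \<longleftrightarrow> a = 0 \<or> (keys \<alpha> \<subseteq> D \<and> (\<forall>e\<in>D. lookup \<alpha> e < 0 \<longrightarrow> e \<in> N))"
  by (auto simp: adm_def)

lemma adm_add: "adm D N P \<Longrightarrow> adm D N Q \<Longrightarrow> adm D N (P + Q)"
  using keys_add[of P Q] by (auto simp: adm_def)

lemma adm_uminus: "adm D N (- P) \<longleftrightarrow> adm D N (P :: 'k::ab_group_add laurent)"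
  by (simp add: adm_def)

lemma adm_diff: "adm D N P \<Longrightarrow> adm D N Q \<Longrightarrow> adm D N (P - Q :: 'k::ab_group_add laurent)"
  using adm_add[of D N P "- Q"] by (simp add: adm_uminus)

lemma adm_mult:
  assumes "adm D N P" "adm D N Q" shows "adm D N (P * Q :: 'k::field laurent)"
  unfolding adm_def
proof
  fix \<alpha> assume "\<alpha> \<in> keys (P * Q)"
  then obtain a b where ab: "\<alpha> = a + b" "a \<in> keys P" "b \<in> keys Q" using keys_mult[of P Q] by blast
  have "e \<in> N" if "e \<in> D" "lookup \<alpha> e < 0" for e
    using that ab assms by (cases "lookup a e < 0") (auto simp: adm_def lookup_add)
  moreover have "keys a \<subseteq> D" "keys b \<subseteq> D" using ab assms by (auto simp: adm_def)
  then have "keys \<alpha> \<subseteq> D" using ab(1) keys_add[of a b] by blast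
  ultimately show "keys \<alpha> \<subseteq> D \<and> (\<forall>e\<in>D. lookup \<alpha> e < 0 \<longrightarrow> e \<in> N)" by blast
qed

lemma adm_0: "adm D N 0" and adm_1: "adm D N (1 :: 'k::field laurent)"
  by (auto simp: adm_def)

lemma adm_power: "adm D N P \<Longrightarrow> adm D N (P ^ m :: 'k::field laurent)"
  by (induction m) (auto intro: adm_mult adm_1)

lemma adm_sum: "(\<And>a. a \<in> A \<Longrightarrow> adm D N (F a)) \<Longrightarrow> adm D N (sum F A :: 'k::field laurent)"
  by (induction A rule: infinite_finite_induct) (auto intro: adm_add adm_0)

lemma adm_prod: "(\<And>a. a \<in> A \<Longrightarrow> adm D N (F a)) \<Longrightarrow> adm D N (prod F A :: 'k::field laurent)"
  by (induction A rule: infinite_finite_induct) (auto intro: adm_mult adm_1)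

lemma adm_mono:
  assumes "adm D N P" "D \<subseteq> D'" "N \<subseteq> N'" shows "adm D' N' P"
  unfolding adm_def
proof (intro ballI conjI impI)
  fix \<alpha> assume a: "\<alpha> \<in> keys P"
  then show "keys \<alpha> \<subseteq> D'" using assms by (auto simp: adm_def)
  fix e assume "e \<in> D'" "lookup \<alpha> e < 0"
  moreover from this have "e \<in> D" using a assms by (auto simp: adm_def in_keys_iff subset_iff)
  ultimately show "e \<in> N'" using a assms by (auto simp: adm_def)
qed

lemma adm_okexp:
  assumes "adm D N P" "D \<subseteq> A" "\<And>e. e \<in> N \<Longrightarrow> w e \<noteq> 0" "\<alpha> \<in> keys P"
  shows "okexp A w \<alpha> \<and> keys \<alpha> \<subseteq> A"
  using assms unfolding adm_def okexp_def
  by (metis in_keys_iff order_less_irrefl subset_iff)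

definition rmono :: "'a set \<Rightarrow> ('a \<Rightarrow> 'b::field) \<Rightarrow> ('a \<Rightarrow>\<^sub>0 int) \<Rightarrow> 'b" where
  "rmono A u \<alpha> = (\<Prod>e\<in>A. u e powi lookup \<alpha> e)"

lemma rmono_0 [simp]: "rmono A u 0 = 1"
  by (simp add: rmono_def)

lemma rmono_add:
  assumes "\<And>e. e \<in> A \<Longrightarrow> u e \<noteq> 0"
  shows "rmono A u (\<alpha> + \<beta>) = rmono A u \<alpha> * rmono A u \<beta>"
  unfolding rmono_def prod.distrib[symmetric]
  using assms by (intro prod.cong) (auto simp: lookup_add power_int_add)

lemma rmono_single:
  assumes "finite A" "e \<in> A"
  shows "rmono A u (single e k) = u e powi k"
proof -
  have "rmono A u (single e k) = (\<Prod>f\<in>A. if f = e then u e powi k else 1)"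
    unfolding rmono_def by (intro prod.cong) (auto simp: lookup_single when_def)
  then show ?thesis using assms by simp
qed

lemma mono_wt_rmono: "mono_wt = rmono"
  by (simp add: fun_eq_iff mono_wt_def rmono_def)

section \<open>Adapted coordinates\<close>

text \<open>The value 0 on the diagonal matches p_aa = 0, so that tropical Pluecker relations make
  sense for coinciding labels too.\<close>

definition wd :: "(nat set \<Rightarrow> real) \<Rightarrow> nat \<Rightarrow> nat \<Rightarrow> real" where
  "wd w a b = (if a = b then 0 else w {a, b})"

lemma wd_same [simp]: "wd w a a = 0"
  by (simp add: wd_def)

lemma wd_swap: "wd w a b = wd w b a"
  by (simp add: wd_def insert_commute)

text \<open>Formal Laurent polynomials may use all pairs as variables, which keeps this map the same
  for all systems \<open>D\<close>. It is the map from formal expressions to the fraction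
  field.\<close>

definition ev :: "nat \<Rightarrow> nat \<Rightarrow> nat \<Rightarrow> 'k::field laurent \<Rightarrow> 'k mpoly fract" where
  "ev n i j = geval (\<lambda>a. to_frac (Const a)) (rmono (pairs n) (\<lambda>e. to_frac (ucoord i j e)))"

definition X :: "nat set \<Rightarrow> 'k::field laurent" where
  "X e = single (single e 1) 1"

definition sX :: "nat \<Rightarrow> nat \<Rightarrow> 'k::field laurent" where
  "sX a b = (if a < b then X {a, b} else - X {a, b})"

text \<open>If \<open>D\<close> is a compatible index set, these are the pairs of H that lie outside
  J.\<close>

definition invertibles :: "nat \<Rightarrow> nat \<Rightarrow> nat \<Rightarrow> (nat set \<Rightarrow> real) \<Rightarrow> nat set set \<Rightarrow> nat set set" where
  "invertibles n i j w D = {e \<in> D \<inter> Iset n i j. w e \<noteq> 0}"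

text \<open>
  \<open>D\<close> collects the coordinates \<open>u\<^sub>a\<^sub>k\<close>, \<open>u\<^sub>t\<^sub>k\<close> by which the labels \<open>k\<close> are introduced one
  after the other, relative to a pair \<open>a, t\<close> of old labels with invertible \<open>u\<^sub>a\<^sub>t\<close>. The condition on
  the weights says that the two terms of
  \<open>u\<^sub>a\<^sub>t u\<^sub>l\<^sub>k = u\<^sub>a\<^sub>k u\<^sub>l\<^sub>t - u\<^sub>t\<^sub>k u\<^sub>l\<^sub>a\<close> do not cancel.
\<close>

inductive adapted :: "nat \<Rightarrow> nat \<Rightarrow> nat \<Rightarrow> (nat set \<Rightarrow> real) \<Rightarrow> nat set \<Rightarrow> nat set set \<Rightarrow> bool"
  for n i j w where
  base: "adapted n i j w {i, j} {}"
| step: "adapted n i j w S D \<Longrightarrow> k \<in> {1..n} \<Longrightarrow> k \<notin> S \<Longrightarrow> a \<in> S \<Longrightarrow> t \<in> S \<Longrightarrow>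
    {a, t} = {i, j} \<or> {a, t} \<in> D \<inter> Iset n i j \<Longrightarrow> wd w a t \<noteq> 0 \<Longrightarrow>
    (\<And>l. l \<in> S \<Longrightarrow> wd w l k * wd w a t = max (wd w a k * wd w l t) (wd w t k * wd w l a)) \<Longrightarrow>
    adapted n i j w (insert k S) (insert {a, k} (insert {t, k} D))"

text \<open>Recognizes the terms that contain a newly introduced variable, so that the two halves of
  a new minor can be seen to have disjoint supports.\<close>

lemma keys_X_mult:
  assumes "adm D N P" "e \<notin> D" "\<alpha> \<in> keys (X e * P)"
  shows "lookup \<alpha> e = 1"
proof -
  have "\<alpha> \<in> {a + b |a b. a \<in> keys (X e :: 'a laurent) \<and> b \<in> keys P}" using keys_mult assms(3) by blast
  then obtain b where "\<alpha> = single e 1 + b" "b \<in> keys P" by (auto simp: X_def)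
  then show ?thesis using assms by (auto simp: lookup_add adm_def in_keys_iff subset_iff)
qed

lemma adm_X: "adm D N (X e) \<longleftrightarrow> e \<in> D"
  by (auto simp: X_def adm_single lookup_single when_def)

lemma X_single_inverse: "X e * single (single e (- 1)) 1 = 1"
  by (simp add: X_def mult_single flip: single_add)

locale chart = complete_nonarch_field v for v :: "'k::field \<Rightarrow> real" +
  fixes n i j :: nat
  assumes chart: "(i, j) \<in> charts n"
begin

abbreviation "R \<equiv> chart_ring n i j :: 'k mpoly set"
abbreviation "u \<equiv> ucoord i j :: nat set \<Rightarrow> 'k mpoly"
abbreviation "p \<equiv> sp i j :: nat \<Rightarrow> nat \<Rightarrow> 'k mpoly"
abbreviation "G \<equiv> gauss v (pairs n)"
abbreviation "EV \<equiv> ev n i j :: 'k laurent \<Rightarrow> 'k mpoly fract"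

lemma ij: "i \<in> {1..n}" "j \<in> {1..n}" "i < j" "i \<noteq> j"
  using chartsD[OF chart] by auto

lemma finite_pair: "e \<in> pairs n \<Longrightarrow> finite e"
  by (auto elim: pairsE)

text \<open>Needed because \<open>EV\<close> inverts all coordinates. For a pair {a, b} away from i
  and j, the quadratic expression is nonzero at the point where u_ia = u_jb = 1 and all other
  variables are 0.\<close>

lemma u_neq_0:
  assumes "e \<in> pairs n" shows "u e \<noteq> 0"
proof -
  obtain a b where ab: "e = {a, b}" "a \<in> {1..n}" "b \<in> {1..n}" "a < b" using assms by (rule pairsE)
  show ?thesis
  proof (cases "e = {i, j} \<or> e \<in> Iset n i j")
    case True
    then show ?thesis using ucoord_Iset[OF chart, of e, where 'a = 'k] by (auto simp: Var_neq_0)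
  next
    case False
    then have nin: "i \<notin> e" "j \<notin> e" using assms by (auto simp: Iset_iff[OF chart])
    define Y where "Y f = (if f = {i, a} \<or> f = {j, b} then 1 else 0 :: 'k)" for f
    define h where "h = geval (\<lambda>a::'k. a) (Vmono n i j Y)"
    have h: "rhom h" unfolding h_def by (rule rhom_chart_eval) (rule rhom_id)
    have I: "{c, d} \<in> Iset n i j" if "c \<in> {i, j}" "d \<in> {a, b}" for c d
      using that nin ab ij by (auto simp: Iset_iff[OF chart] pairs_iff doubleton_eq_iff)
    have hV: "h (Var f) = Y f" if "f \<in> Iset n i j" for f
      unfolding h_def by (rule geval_Var[OF rhom_id chart that])
    have hp: "h (p c d) = (if c < d then Y {c, d} else - Y {c, d})" if "c \<in> {i, j}" "d \<in> {a, b}" for c d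
    proof -
      have "c \<noteq> d" using that nin ab by auto
      then show ?thesis
        using I[OF that] hV[OF I[OF that]] ucoord_Iset[OF chart I[OF that], where 'a = 'k] rhom_simps(5)[OF h]
        by (auto simp: sp_def)
    qed
    have "h (u e) = h (p i a) * h (p j b) - h (p i b) * h (p j a)"
      using ab sp_expand[OF ij(3), of a b, where 'a = 'k] by (simp add: ucoord_sp rhom_simps[OF h])
    also have "h (p i b) * h (p j a) = 0"
      using hp nin ab ij by (auto simp: Y_def doubleton_eq_iff)
    also have "h (p i a) * h (p j b) - 0 \<noteq> 0"
      using hp nin ab ij by (auto simp: Y_def)
    finally show ?thesis using rhom_simps(4)[OF h] by auto
  qed
qed

lemma tu_neq_0: "e \<in> pairs n \<Longrightarrow> to_frac (u e) \<noteq> 0"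
  by (simp add: to_frac_eq_0_iff u_neq_0)

lemma rhom_tC: "rhom (\<lambda>a::'k. to_frac (Const a))"
  using rhom_comp[OF rhom_to_frac rhom_Const] .

lemma rhom_EV: "rhom EV"
  unfolding ev_def by (rule rhom_geval[OF rhom_tC]) (simp_all add: rmono_add tu_neq_0)

lemma EV_single: "EV (single \<alpha> a) = to_frac (Const a) * rmono (pairs n) (\<lambda>e. to_frac (u e)) \<alpha>"
  unfolding ev_def by (rule geval_single[OF rhom_tC])

lemma EV_X:
  assumes "e \<in> pairs n" shows "EV (X e) = to_frac (u e)"
  using assms by (simp add: X_def EV_single rmono_single Const_1 rhom_simps[OF rhom_to_frac])

lemma EV_sX:
  assumes "a \<in> {1..n}" "b \<in> {1..n}" "a \<noteq> b" shows "EV (sX a b) = to_frac (p a b)"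
  using assms EV_X[of "{a, b}"]
  by (auto simp: sX_def sp_def pairs_iff rhom_simps[OF rhom_EV] rhom_simps[OF rhom_to_frac])

lemma G_X:
  assumes "\<And>e. e \<in> pairs n \<Longrightarrow> 0 \<le> w e" "e \<in> pairs n"
  shows "G w (X e) = w e"
  using assms by (simp add: X_def gauss_single mono_wt_rmono rmono_single)

lemma G_sX:
  assumes "\<And>e. e \<in> pairs n \<Longrightarrow> 0 \<le> w e" "{a, b} \<in> pairs n"
  shows "G w (sX a b) = w {a, b}"
  using G_X[OF assms] by (simp add: sX_def)

lemma G_mult:
  assumes "\<And>e. e \<in> pairs n \<Longrightarrow> 0 \<le> w e" "D \<subseteq> pairs n" "\<And>e. e \<in> N \<Longrightarrow> w e \<noteq> 0"
    and "adm D N P" "adm D N Q"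
  shows "G w (P * Q) = G w P * G w Q"
  using assms by (intro gauss_mult adm_okexp[where w = w]) (auto simp: finite_pair)

text \<open>Each new label contributes exactly two new coordinates. The resulting cardinality later
  identifies a system contained in a compatible index set with the whole set.\<close>

lemma adapted_basic:
  assumes "adapted n i j w S D"
  shows "finite S \<and> S \<subseteq> {1..n} \<and> {i, j} \<subseteq> S \<and> D \<subseteq> pairs n \<and> \<Union>D \<subseteq> S \<and> finite D \<and>
    card D = 2 * (card S - 2) \<and> 2 \<le> card S \<and> {i, j} \<notin> D"
  using assms
proof (induction rule: adapted.induct)
  case base
  then show ?case using ij by auto
next
  case (step S D k a t)
  have IH: "finite S" "S \<subseteq> {1..n}" "{i, j} \<subseteq> S" "D \<subseteq> pairs n" "\<Union>D \<subseteq> S" "finite D"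
    "card D = 2 * (card S - 2)" "2 \<le> card S" "{i, j} \<notin> D"
    using step.IH by auto
  note h = step.hyps(2-5) and nz = step.hyps(7)
  have "a \<noteq> t" using nz by (auto simp: wd_def)
  have new: "{a, k} \<notin> D" "{t, k} \<notin> D" using h IH(5) by auto
  have ne: "{a, k} \<noteq> {t, k}" using \<open>a \<noteq> t\<close> by (auto simp: doubleton_eq_iff)
  have pr: "{a, k} \<in> pairs n" "{t, k} \<in> pairs n" using h IH(2) by (auto simp: pairs_iff)
  have nij: "{a, k} \<noteq> {i, j}" "{t, k} \<noteq> {i, j}" using h IH(3) by (auto simp: doubleton_eq_iff)
  have "card (insert {a, k} (insert {t, k} D)) = 2 * (card (insert k S) - 2)"
    using new ne IH(1,6,7,8) h(2) by simp
  moreover have "2 \<le> card (insert k S)" using IH(1,8) h(2) by simp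
  moreover have "\<Union>(insert {a, k} (insert {t, k} D)) \<subseteq> insert k S" using IH(5) h by blast
  ultimately show ?case using IH(1-4,6,9) pr nij h(1) by simp
qed

text \<open>A lift of the normalized 2 x n matrix to Laurent polynomials: the column of a is (P a, Q
  a). Minors indexed by \<open>D\<close> are required to be variables, and all minors to have the
  prescribed Gauss norm.\<close>

definition frame :: "(nat set \<Rightarrow> real) \<Rightarrow> nat set \<Rightarrow> nat set set \<Rightarrow> (nat \<Rightarrow> 'k laurent) \<Rightarrow> (nat \<Rightarrow> 'k laurent) \<Rightarrow> bool"
  where "frame w S D P Q \<longleftrightarrow>
    P i = 1 \<and> Q i = 0 \<and> P j = 0 \<and> Q j = 1 \<and>
    (\<forall>a\<in>S. adm D (invertibles n i j w D) (P a) \<and> adm D (invertibles n i j w D) (Q a)) \<and>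
    (\<forall>a b. a < b \<longrightarrow> {a, b} \<in> D \<longrightarrow> P a * Q b - P b * Q a = X {a, b}) \<and>
    (\<forall>a\<in>S. \<forall>b\<in>S. G w (P a * Q b - P b * Q a) = wd w a b) \<and>
    (\<forall>a\<in>S. EV (P a) = - to_frac (p j a) \<and> EV (Q a) = to_frac (p i a))"

lemma G_0 [simp]: "G w 0 = 0"
  by (simp add: gauss_def)

lemma G_1: "(\<And>e. e \<in> pairs n \<Longrightarrow> 0 \<le> w e) \<Longrightarrow> G w 1 = 1"
  using gauss_single[of "pairs n" w 0 1] by (simp only: single_one mono_wt_0) simp

text \<open>A new column is determined by its minors with two old columns a and t, provided the
  minor of a and t is a unit. Its minor with a further column l is a combination of two terms, only
  one of which contains the new variable of {a, k}; hence its norm is the maximum of theirs, as the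
  weight condition demands.\<close>

lemma frame_exists:
  assumes "adapted n i j w S D" and w: "\<And>e. e \<in> pairs n \<Longrightarrow> 0 \<le> w e" "w {i, j} = 1"
  shows "\<exists>P Q. frame w S D P Q"
  using assms(1)
proof (induction rule: adapted.induct)
  case base
  define P where "P a = (if a = i then 1 else 0 :: 'k laurent)" for a
  define Q where "Q a = (if a = j then 1 else 0 :: 'k laurent)" for a
  have "frame w {i, j} {} P Q"
    using ij w G_1[of w] by (auto simp: frame_def P_def Q_def adm_0 adm_1 wd_def insert_commute rhom_simps[OF rhom_EV]
        rhom_simps[OF rhom_to_frac] sp_ij sp_ji)
  then show ?case by blast
next
  case (step S D k a t)
  note basic = adapted_basic[OF step.hyps(1)]
  obtain P Q where PQ: "frame w S D P Q" using step.IH by blast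
  let ?N = "invertibles n i j w D"
  let ?D = "insert {a, k} (insert {t, k} D)"
  let ?N' = "invertibles n i j w ?D"
  let ?y = "\<lambda>c d. P c * Q d - P d * Q c"
  have mem: "a \<in> {1..n}" "t \<in> {1..n}" "k \<in> {1..n}" and neq: "a \<noteq> k" "t \<noteq> k" "a \<noteq> t"
    using step.hyps basic by auto
  have pr: "{a, k} \<in> pairs n" "{t, k} \<in> pairs n" "{a, t} \<in> pairs n" using mem neq by (auto simp: pairs_iff)
  have new: "{a, k} \<notin> D" "{t, k} \<notin> D" using basic step.hyps by auto
  have sub: "?D \<subseteq> pairs n" using basic pr by auto
  have N': "e \<in> ?N' \<Longrightarrow> w e \<noteq> 0" for e by (simp add: invertibles_def)
  have admP: "adm ?D ?N' (P c)" "adm ?D ?N' (Q c)" if "c \<in> S" for c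
    using PQ that by (auto simp: frame_def invertibles_def intro: adm_mono[of D ?N])
  have admy: "adm D ?N (?y c d)" if "c \<in> S" "d \<in> S" for c d
    using PQ that by (auto simp: frame_def intro!: adm_diff adm_mult)
  \<comment> \<open>The minor of a and t is 1 or -1 for the initial pair, and otherwise up to sign a
    variable that may be inverted.\<close>
  have "\<exists>U. ?y a t * U = 1 \<and> adm D ?N U"
  proof (cases "{a, t} = {i, j}")
    case True
    then have "a = i \<and> t = j \<or> a = j \<and> t = i" by (auto simp: doubleton_eq_iff)
    then have "?y a t * ?y a t = 1" using PQ by (auto simp: frame_def)
    then show ?thesis using admy step.hyps by blast
  next
    case False
    then have at: "{a, t} \<in> D \<inter> Iset n i j" using step.hyps by auto
    then have inv: "{a, t} \<in> ?N" using step.hyps neq by (auto simp: invertibles_def wd_def)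
    define V where "V = (single (single {a, t} (- 1)) 1 :: 'k laurent)"
    have V: "X {a, t} * V = 1" unfolding V_def by (rule X_single_inverse)
    have admV: "adm D ?N V" using at inv by (auto simp: V_def adm_single lookup_single when_def split: if_splits)
    consider "a < t" | "t < a" using neq by linarith
    then show ?thesis
    proof cases
      case 1
      then have "?y a t = X {a, t}" using PQ at by (auto simp: frame_def)
      then show ?thesis using V admV by auto
    next
      case 2
      then have "?y t a = X {a, t}" using PQ at by (auto simp: frame_def insert_commute)
      then have "?y a t * (- V) = 1" using V by (metis minus_diff_eq minus_mult_minus)
      then show ?thesis using admV by (metis adm_uminus)
    qed
  qed
  then obtain U where U: "?y a t * U = 1" "adm D ?N U" by blast
  then have admU: "adm ?D ?N' U" by (auto simp: invertibles_def intro: adm_mono[of D ?N])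
  define A B where "A = (sX a k :: 'k laurent)" and "B = (sX t k :: 'k laurent)"
  have admAB: "adm ?D ?N' A" "adm ?D ?N' B"
    by (auto simp: A_def B_def sX_def adm_X adm_uminus)
  \<comment> \<open>Cramer's rule for the column whose minors with a and t are \<open>A\<close> and
    \<open>B\<close>.\<close>
  define P' where "P' = P(k := U * (A * P t - B * P a))"
  define Q' where "Q' = Q(k := U * (A * Q t - B * Q a))"
  let ?y' = "\<lambda>c d. P' c * Q' d - P' d * Q' c"
  have old: "P' c = P c" "Q' c = Q c" if "c \<in> S" for c using that step.hyps by (auto simp: P'_def Q'_def)
  have y_old: "?y' c d = ?y c d" if "c \<in> S" "d \<in> S" for c d using old that by simp
  have y_new: "?y' l k = U * (A * ?y l t - B * ?y l a)" if "l \<in> S" for l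
    using old[OF that] by (simp add: P'_def Q'_def algebra_simps)
  have y_ak: "?y' a k = A" and y_tk: "?y' t k = B"
  proof -
    have "?y' a k = (?y a t * U) * A" using y_new[of a] step.hyps by (simp add: algebra_simps)
    then show "?y' a k = A" using U by simp
    have "?y' t k = (?y a t * U) * B" using y_new[of t] step.hyps by (simp add: algebra_simps)
    then show "?y' t k = B" using U by simp
  qed
  have "frame w (insert k S) ?D P' Q'"
    unfolding frame_def
  proof (intro conjI ballI allI impI)
    have "i \<in> S" "j \<in> S" using basic by auto
    then show "P' i = 1" "Q' i = 0" "P' j = 0" "Q' j = 1" using old PQ by (auto simp: frame_def)
  next
    fix c assume "c \<in> insert k S"
    then consider "c = k" | "c \<in> S" by auto
    then show "adm ?D ?N' (P' c)" "adm ?D ?N' (Q' c)"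
    proof (atomize (full), cases)
      case 1
      then show "adm ?D ?N' (P' c) \<and> adm ?D ?N' (Q' c)"
        using admP step.hyps admAB admU by (auto simp: P'_def Q'_def intro!: adm_mult adm_diff)
    qed (use admP old in auto)
  next
    fix c d :: nat assume cd: "c < d" "{c, d} \<in> ?D"
    show "?y' c d = X {c, d}"
    proof (cases "{c, d} \<in> D")
      case True
      then have "c \<in> S" "d \<in> S" using basic by auto
      then show ?thesis using y_old PQ cd True by (auto simp: frame_def)
    next
      case False
      have flip: "?y' k c = - ?y' c k" for c by simp
      from False cd have "{c, d} = {a, k} \<or> {c, d} = {t, k}" by auto
      then consider "c = a" "d = k" | "c = k" "d = a" | "c = t" "d = k" | "c = k" "d = t"
        by (auto simp: doubleton_eq_iff)
      then show ?thesis
      proof cases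
        case 1 then show ?thesis using y_ak cd(1) by (simp add: A_def sX_def)
      next
        case 2 then show ?thesis using y_ak flip[of a] cd(1) by (simp add: A_def sX_def insert_commute)
      next
        case 3 then show ?thesis using y_tk cd(1) by (simp add: B_def sX_def)
      next
        case 4 then show ?thesis using y_tk flip[of t] cd(1) by (simp add: B_def sX_def insert_commute)
      qed
    qed
  next
    have Gm: "G w (F * H) = G w F * G w H" if "adm ?D ?N' F" "adm ?D ?N' H" for F H
      using w(1) sub N' that by (rule G_mult)
    have ext: "adm ?D ?N' F" if "adm D ?N F" for F
      using that by (auto simp: invertibles_def intro: adm_mono[of D ?N])
    have wat: "G w U * wd w a t = 1"
    proof -
      have "G w (?y a t * U) = G w (?y a t) * G w U" using admy U step.hyps by (intro Gm ext) auto
      moreover have "G w (?y a t) = wd w a t" using PQ step.hyps by (auto simp: frame_def)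
      ultimately show ?thesis using U G_1[of w, OF w(1)] by (simp add: mult.commute)
    qed
    have Gnew: "G w (?y' l k) = wd w l k" if l: "l \<in> S" for l
    proof -
      have k1: "lookup \<alpha> {a, k} = 1" if "\<alpha> \<in> keys (A * ?y l t)" for \<alpha>
      proof -
        have "keys (A * ?y l t) = keys (X {a, k} * ?y l t)"
          unfolding A_def sX_def by (cases "a < k") (simp_all add: mult_minus_left)
        then show ?thesis using keys_X_mult[OF admy[OF l step.hyps(5)] new(1)] that by blast
      qed
      have k2: "lookup \<alpha> {a, k} \<noteq> 1" if \<alpha>: "\<alpha> \<in> keys (B * ?y l a)" for \<alpha>
      proof -
        have "adm (insert {t, k} D) ?N' B" by (auto simp: B_def sX_def adm_X adm_uminus)
        moreover have "adm (insert {t, k} D) ?N' (?y l a)"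
          using adm_mono[OF admy[OF l step.hyps(4)], of "insert {t, k} D" ?N'] by (auto simp: invertibles_def)
        ultimately have "adm (insert {t, k} D) ?N' (B * ?y l a)" by (rule adm_mult)
        then have "keys \<alpha> \<subseteq> insert {t, k} D" using \<alpha> by (auto simp: adm_def)
        moreover have "{a, k} \<notin> insert {t, k} D" using new neq by (auto simp: doubleton_eq_iff)
        ultimately have "{a, k} \<notin> keys \<alpha>" by blast
        then show ?thesis by (simp add: in_keys_iff)
      qed
      \<comment> \<open>One product contains the new variable of {a, k} with exponent 1, the other
        one does not contain it.\<close>
      have "keys (A * ?y l t) \<inter> keys (- (B * ?y l a)) = {}"
        using k1 k2 by (auto simp: keys_minus)
      then have "G w (A * ?y l t + - (B * ?y l a)) = max (G w (A * ?y l t)) (G w (- (B * ?y l a)))"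
        by (rule gauss_add_disjoint)
      also have "G w (- (B * ?y l a)) = G w (B * ?y l a)" by (rule gauss_uminus)
      also have "G w (A * ?y l t) = w {a, k} * wd w l t"
        using Gm[OF admAB(1) ext[OF admy[OF l step.hyps(5)]]] G_sX[OF w(1) pr(1)] PQ l step.hyps
        by (simp add: A_def frame_def)
      also have "G w (B * ?y l a) = w {t, k} * wd w l a"
        using Gm[OF admAB(2) ext[OF admy[OF l step.hyps(4)]]] G_sX[OF w(1) pr(2)] PQ l step.hyps
        by (simp add: B_def frame_def)
      finally have "G w (A * ?y l t - B * ?y l a) = wd w l k * wd w a t"
        using step.hyps(8)[OF l] neq by (simp add: wd_def)
      moreover have "G w (?y' l k) = G w U * G w (A * ?y l t - B * ?y l a)"
        unfolding y_new[OF l]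
        by (rule Gm[OF admU adm_diff[OF adm_mult[OF admAB(1) ext[OF admy[OF l step.hyps(5)]]]
              adm_mult[OF admAB(2) ext[OF admy[OF l step.hyps(4)]]]]])
      ultimately show ?thesis using wat by (simp add: algebra_simps)
    qed
    fix c d assume "c \<in> insert k S" "d \<in> insert k S"
    then consider "c \<in> S" "d \<in> S" | "c \<in> S" "d = k" | "c = k" "d \<in> S" | "c = k" "d = k" by auto
    then show "G w (?y' c d) = wd w c d"
    proof cases
      case 1 then show ?thesis using y_old PQ by (auto simp: frame_def)
    next
      case 2 then show ?thesis using Gnew by simp
    next
      case 3
      have "?y' c d = - ?y' d k" using 3 by simp
      then show ?thesis using Gnew[OF 3(2)] 3 by (simp only: gauss_uminus wd_swap)
    next
      case 4 then show ?thesis by simp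
    qed
  next
    note evs = rhom_simps[OF rhom_EV] and tfs = rhom_simps[OF rhom_to_frac]
    have EVAB: "EV A = to_frac (p a k)" "EV B = to_frac (p t k)"
      using EV_sX mem neq by (auto simp: A_def B_def)
    have EVPQ: "EV (P c) = - to_frac (p j c)" "EV (Q c) = to_frac (p i c)" if "c \<in> S" for c
      using PQ that by (auto simp: frame_def)
    have at: "a \<in> S" "t \<in> S" using step.hyps by auto
    have "EV (?y a t) = to_frac (p a t)"
      by (subst sp_expand[OF ij(3), of a t]) (simp add: evs tfs EVPQ at algebra_simps)
    moreover have "EV (?y a t) * EV U = 1"
      using arg_cong[OF U(1), of EV] by (simp only: evs(2)[of _ U] evs(3))
    ultimately have patU: "to_frac (p a t) * EV U = 1" by simp
    then have "to_frac (p a t) \<noteq> 0" by auto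
    then have EVU: "x = y" if "to_frac (p a t) * x = to_frac (p a t) * y" for x y
      using that by simp
    \<comment> \<open>After multiplication by p_at the recursion for the new column becomes a
      Pluecker relation.\<close>
    have "to_frac (p a t) * EV (P' k) = (to_frac (p a t) * EV U) * (EV A * EV (P t) - EV B * EV (P a))"
      by (simp add: P'_def evs algebra_simps)
    also have "\<dots> = to_frac (p a k) * - to_frac (p j t) - to_frac (p t k) * - to_frac (p j a)"
      using patU by (simp add: EVAB EVPQ at)
    also have "\<dots> = to_frac (- (p a t * p j k))"
      unfolding sp_plucker[OF ij(3), of a t j k] sp_swap[of i j a j] sp_swap[of i j t j]
      by (simp add: tfs algebra_simps)
    also have "\<dots> = to_frac (p a t) * - to_frac (p j k)" by (simp add: tfs)
    finally have 1: "EV (P' k) = - to_frac (p j k)" by (rule EVU)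
    have "to_frac (p a t) * EV (Q' k) = (to_frac (p a t) * EV U) * (EV A * EV (Q t) - EV B * EV (Q a))"
      by (simp add: Q'_def evs algebra_simps)
    also have "\<dots> = to_frac (p a k) * to_frac (p i t) - to_frac (p t k) * to_frac (p i a)"
      using patU by (simp add: EVAB EVPQ at)
    also have "\<dots> = to_frac (p a t * p i k)"
      unfolding sp_plucker[OF ij(3), of a t i k] sp_swap[of i j a i] sp_swap[of i j t i]
      by (simp add: tfs algebra_simps)
    also have "\<dots> = to_frac (p a t) * to_frac (p i k)" by (simp add: tfs)
    finally have 2: "EV (Q' k) = to_frac (p i k)" by (rule EVU)
    fix c assume "c \<in> insert k S"
    then show "EV (P' c) = - to_frac (p j c)" "EV (Q' c) = to_frac (p i c)"
      using 1 2 old EVPQ by auto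
  qed
  then show ?case by blast
qed

end

section \<open>Presentation of the coordinate ring by Laurent polynomials\<close>

context chart
begin

text \<open>On the chart ring \<open>\<Psi>\<close> is a section of \<open>EV\<close>: it writes a
  function as a Laurent polynomial in the coordinates of \<open>D\<close>. It also records that the
  Gauss norm lies over the weight vector \<open>w\<close>.\<close>

definition presents :: "nat set set \<Rightarrow> (nat set \<Rightarrow> real) \<Rightarrow> ('k mpoly \<Rightarrow> 'k laurent) \<Rightarrow> bool" where
  "presents D w \<Psi> \<longleftrightarrow> D \<subseteq> pairs n \<and> rhom \<Psi> \<and> (\<forall>a. \<Psi> (Const a) = single 0 a) \<and>
     (\<forall>f\<in>R. adm D (invertibles n i j w D) (\<Psi> f) \<and> EV (\<Psi> f) = to_frac f) \<and>
     (\<forall>e\<in>D. \<Psi> (u e) = X e) \<and> (\<forall>e\<in>pairs n. G w (\<Psi> (u e)) = w e)"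

text \<open>The chart ring is free on its variables, so the minors of a frame may be substituted for
  them; \<open>sp_expand\<close> then gives the images of all other coordinates.\<close>

lemma presentation_exists:
  assumes "adapted n i j w {1..n} D" and w: "\<And>e. e \<in> pairs n \<Longrightarrow> 0 \<le> w e" "w {i, j} = 1"
  shows "\<exists>\<Psi>. presents D w \<Psi>"
proof -
  obtain P Q where PQ: "frame w {1..n} D P Q" using frame_exists[OF assms] by blast
  note basic = adapted_basic[OF assms(1)]
  let ?N = "invertibles n i j w D"
  let ?y = "\<lambda>c d. P c * Q d - P d * Q c"
  define Y where "Y e = ?y (Min e) (Max e)" for e
  define \<Psi> where "\<Psi> = geval (\<lambda>a::'k. single 0 a) (Vmono n i j Y)"
  have rC: "rhom (\<lambda>a::'k. single 0 a :: 'k laurent)"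
    by (simp add: rhom_def single_add mult_single)
  have \<Psi>: "rhom \<Psi>" unfolding \<Psi>_def by (rule rhom_chart_eval[OF rC])
  have \<Psi>C: "\<Psi> (Const a) = single 0 a" for a unfolding \<Psi>_def by (rule geval_Const[OF rC])
  have \<Psi>V: "\<Psi> (Var e) = Y e" if "e \<in> Iset n i j" for e
    unfolding \<Psi>_def by (rule geval_Var[OF rC chart that])
  have yij: "?y i j = 1" using PQ by (simp add: frame_def)
  have \<Psi>p0: "\<Psi> (p c d) = ?y c d" if "c \<in> {i, j}" "d \<in> {1..n}" for c d
  proof (cases "c = d")
    case False
    define a b where "a = min c d" and "b = max c d"
    have ab: "a < b" "{a, b} = {c, d}" using False by (auto simp: a_def b_def min_def max_def)
    have pab: "{c, d} \<in> pairs n" using that ij False by (auto simp: pairs_iff)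
    have main: "\<Psi> (u {a, b}) = ?y a b"
    proof (cases "{a, b} = {i, j}")
      case True
      then have "a = i" "b = j" using ab ij by (auto simp: doubleton_eq_iff)
      then show ?thesis using yij rhom_simps(3)[OF \<Psi>] by simp
    next
      case False
      then have "{a, b} \<in> Iset n i j" using pab ab that by (auto simp: Iset_iff[OF chart])
      then show ?thesis using ucoord_Iset[OF chart, where 'a = 'k] \<Psi>V ab(1) by (simp add: Y_def Min_Max_pair)
    qed
    show ?thesis
    proof (cases "c < d")
      case True then show ?thesis using main by (simp add: sp_def a_def b_def min_def max_def)
    next
      case False
      then have cd: "a = d" "b = c" using \<open>c \<noteq> d\<close> by (auto simp: a_def b_def min_def max_def)
      have pu: "p c d = - u {a, b}" using False \<open>c \<noteq> d\<close> ab by (simp add: sp_def)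
      have "\<Psi> (p c d) = - ?y a b" by (simp only: pu main rhom_simps(5)[OF \<Psi>])
      then show ?thesis unfolding cd by simp
    qed
  qed (simp add: rhom_simps[OF \<Psi>])
  have \<Psi>p: "\<Psi> (p a b) = ?y a b" if "a \<in> {1..n}" "b \<in> {1..n}" for a b
  proof -
    have "\<Psi> (p a b) = \<Psi> (p i a) * \<Psi> (p j b) - \<Psi> (p i b) * \<Psi> (p j a)"
      by (subst sp_expand[OF ij(3)]) (simp add: rhom_simps[OF \<Psi>])
    then show ?thesis using PQ that by (simp add: \<Psi>p0 frame_def algebra_simps)
  qed
  have admY: "adm D ?N (Y e)" if "e \<in> Iset n i j" for e
  proof -
    have "e \<in> pairs n" using that Iset_subset[OF chart] by auto
    then obtain a b where "e = {a, b}" "a \<in> {1..n}" "b \<in> {1..n}" "a < b" by (rule pairsE)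
    then show ?thesis using PQ by (auto simp: Y_def Min_Max_pair frame_def intro!: adm_diff adm_mult)
  qed
  have adm: "adm D ?N (\<Psi> f)" for f
    unfolding \<Psi>_def geval_def Vmono_def
    by (intro adm_sum adm_mult adm_prod adm_power admY) (auto simp: adm_single)
  have ev: "EV (\<Psi> f) = to_frac f" if "f \<in> R" for f
  proof (rule rhom_eq_on_chart[OF chart rhom_comp[OF rhom_EV \<Psi>] rhom_to_frac _ _ that])
    show "EV (\<Psi> (Const a)) = to_frac (Const a)" for a by (simp add: \<Psi>C EV_single)
    fix e assume e: "e \<in> Iset n i j"
    then have "e \<in> pairs n" using Iset_subset[OF chart] by auto
    then obtain a b where ab: "e = {a, b}" "a \<in> {1..n}" "b \<in> {1..n}" "a < b" by (rule pairsE)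
    have "EV (?y a b) = to_frac (p a b)"
      using PQ ab by (subst sp_expand[OF ij(3), of a b])
        (simp add: frame_def rhom_simps[OF rhom_EV] rhom_simps[OF rhom_to_frac] algebra_simps)
    then show "EV (\<Psi> (Var e)) = to_frac (Var e)"
      using ab e ucoord_Iset[OF chart e, where 'a = 'k] ucoord_sp[OF ab(4), of i j, where 'a = 'k]
      by (simp add: \<Psi>V Y_def Min_Max_pair)
  qed
  have "\<Psi> (u e) = X e" if "e \<in> D" for e
  proof -
    have "e \<in> pairs n" using that basic by auto
    then obtain a b where "e = {a, b}" "a \<in> {1..n}" "b \<in> {1..n}" "a < b" by (rule pairsE)
    then show ?thesis using \<Psi>p PQ that by (simp add: ucoord_sp frame_def)
  qed
  moreover have "G w (\<Psi> (u e)) = w e" if e: "e \<in> pairs n" for e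
  proof -
    obtain a b where "e = {a, b}" "a \<in> {1..n}" "b \<in> {1..n}" "a < b" using e by (rule pairsE)
    then show ?thesis using \<Psi>p PQ by (simp add: ucoord_sp frame_def wd_def)
  qed
  ultimately have "presents D w \<Psi>"
    using basic \<Psi> \<Psi>C adm ev by (simp add: presents_def)
  then show ?thesis by blast
qed

section \<open>Clearing denominators and uniqueness of expansions\<close>

definition umono :: "(nat set \<Rightarrow> nat) \<Rightarrow> 'k mpoly" where
  "umono M = (\<Prod>e\<in>pairs n. u e ^ M e)"

lemma umono_R: "umono M \<in> R"
  unfolding umono_def by (intro chart_ring_prod chart_ring_power ucoord_chart_ring[OF chart])

text \<open>Turns an identity in the fraction field, where seminorms are not defined, into one in
  the chart ring. The multiplier involves only invertible coordinates, so it can be cancelled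
  again.\<close>

lemma clear_denominators:
  assumes "adm D N c" "D \<subseteq> pairs n" "N \<subseteq> D" "EV c = to_frac f"
  obtains M :: "nat set \<Rightarrow> nat" where "\<And>e. e \<notin> N \<Longrightarrow> M e = 0"
    "\<And>\<alpha> e. \<alpha> \<in> keys c \<Longrightarrow> 0 \<le> lookup \<alpha> e + int (M e)"
    "umono M * f = (\<Sum>\<alpha>\<in>keys c. Const (lookup c \<alpha>) * umono (\<lambda>e. nat (lookup \<alpha> e + int (M e))))"
proof -
  \<comment> \<open>The sum of the negative parts of all exponents is a crude common bound for each
    of them.\<close>
  define M where "M e = (if e \<in> N then \<Sum>\<alpha>\<in>keys c. nat (- lookup \<alpha> e) else 0)" for e
  have M0: "M e = 0" if "e \<notin> N" for e using that by (simp add: M_def)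
  have nn: "0 \<le> lookup \<alpha> e + int (M e)" if \<alpha>: "\<alpha> \<in> keys c" for \<alpha> e
  proof (cases "lookup \<alpha> e < 0")
    case True
    then have "e \<in> keys \<alpha>" by (simp add: in_keys_iff)
    then have "e \<in> N" using assms(1) \<alpha> True unfolding adm_def by blast
    moreover have "nat (- lookup \<alpha> e) \<le> (\<Sum>\<alpha>\<in>keys c. nat (- lookup \<alpha> e))"
      using \<alpha> by (intro member_le_sum) auto
    ultimately have "nat (- lookup \<alpha> e) \<le> M e" by (simp only: M_def if_True)
    then show ?thesis by linarith
  qed simp
  note tfs = rhom_simps[OF rhom_to_frac] rhom_sum[OF rhom_to_frac] rhom_prod[OF rhom_to_frac]
  have tm: "to_frac (umono M) * rmono (pairs n) (\<lambda>e. to_frac (u e)) \<alpha>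
      = to_frac (umono (\<lambda>e. nat (lookup \<alpha> e + int (M e))))" if "\<alpha> \<in> keys c" for \<alpha>
    unfolding umono_def rmono_def tfs prod.distrib[symmetric]
  proof (rule prod.cong)
    fix e assume e: "e \<in> pairs n"
    have "to_frac (u e) ^ M e * to_frac (u e) powi lookup \<alpha> e = to_frac (u e) powi (int (M e) + lookup \<alpha> e)"
      using tu_neq_0[OF e] by (simp add: power_int_add)
    also have "int (M e) + lookup \<alpha> e = int (nat (lookup \<alpha> e + int (M e)))" using nn[OF that, of e] by simp
    also have "to_frac (u e) powi \<dots> = to_frac (u e) ^ nat (lookup \<alpha> e + int (M e))" by (rule power_int_of_nat)
    finally show "to_frac (u e) ^ M e * to_frac (u e) powi lookup \<alpha> e = to_frac (u e) ^ nat (lookup \<alpha> e + int (M e))" .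
  qed simp
  have "to_frac (umono M * f) = to_frac (umono M) * EV c" by (simp add: tfs assms)
  also have "\<dots> = (\<Sum>\<alpha>\<in>keys c. to_frac (Const (lookup c \<alpha>)) * (to_frac (umono M) * rmono (pairs n) (\<lambda>e. to_frac (u e)) \<alpha>))"
    by (simp add: ev_def geval_def sum_distrib_left mult.left_commute)
  also have "\<dots> = to_frac (\<Sum>\<alpha>\<in>keys c. Const (lookup c \<alpha>) * umono (\<lambda>e. nat (lookup \<alpha> e + int (M e))))"
    unfolding tfs by (intro sum.cong) (simp_all add: tm tfs)
  finally have "umono M * f = (\<Sum>\<alpha>\<in>keys c. Const (lookup c \<alpha>) * umono (\<lambda>e. nat (lookup \<alpha> e + int (M e))))"
    by (simp only: to_frac_eq_iff)
  then show ?thesis using that M0 nn by blast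
qed

lemma presents_umono:
  assumes \<Psi>: "presents D w \<Psi>" and M: "\<And>e. e \<notin> D \<Longrightarrow> M e = 0" and \<mu>: "\<And>e. lookup \<mu> e = int (M e)"
  shows "\<Psi> (umono M) = single \<mu> 1"
proof -
  have hom: "rhom \<Psi>" using \<Psi> by (simp add: presents_def)
  have Xp: "X e ^ m = (single (single e (int m)) 1 :: 'k laurent)" for e m
    by (induction m) (simp_all add: X_def mult_single add.commute flip: single_add)
  have prods: "(\<Prod>e\<in>A. single (g e) (1::'k)) = single (\<Sum>e\<in>A. g e) 1" if "finite A"
    for A and g :: "nat set \<Rightarrow> nat set \<Rightarrow>\<^sub>0 int" using that
    by (induction A rule: finite_induct) (simp_all add: mult_single)
  have "\<Psi> (u e) ^ M e = single (single e (int (M e))) 1" if "e \<in> pairs n" for e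
  proof (cases "e \<in> D")
    case True then show ?thesis using \<Psi> Xp by (simp add: presents_def)
  next
    case False then show ?thesis by (simp add: M)
  qed
  then have "\<Psi> (umono M) = single (\<Sum>e\<in>pairs n. single e (int (M e))) 1"
    by (simp add: umono_def rhom_prod[OF hom] rhom_simps[OF hom] prods)
  also have "(\<Sum>e\<in>pairs n. single e (int (M e))) = \<mu>"
  proof (rule poly_mapping_eqI)
    fix f
    have "M f = 0" if "f \<notin> pairs n" using that M \<Psi> by (auto simp: presents_def)
    then show "lookup (\<Sum>e\<in>pairs n. single e (int (M e))) f = lookup \<mu> f"
      by (auto simp: lookup_sum lookup_single when_def \<mu>)
  qed
  finally show ?thesis .
qed

lemma nat_fun_exponent:
  assumes "D \<subseteq> pairs n" "\<And>e. e \<notin> D \<Longrightarrow> M e = (0::nat)"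
  obtains \<mu> :: "nat set \<Rightarrow>\<^sub>0 int" where "\<And>e. lookup \<mu> e = int (M e)"
proof
  have "finite {e. int (M e) \<noteq> 0}"
    by (rule finite_subset[OF _ finite_pairs[of n]]) (use assms in force)
  then show "lookup (Poly_Mapping.Abs_poly_mapping (\<lambda>e. int (M e))) e = int (M e)" for e by simp
qed

text \<open>This plays the role of the algebraic independence of the coordinates in
  \<open>D\<close>: apply \<open>\<Psi>\<close> to the cleared identity, where every monomial in
  \<open>D\<close> returns to itself, and cancel a monomial.\<close>

lemma presents_unique:
  assumes \<Psi>: "presents D w \<Psi>" and f: "f \<in> R"
    and c: "adm D (invertibles n i j w D) c" "EV c = to_frac f"
  shows "c = \<Psi> f"
proof -
  have D: "D \<subseteq> pairs n" and hom: "rhom \<Psi>" and \<Psi>C: "\<And>a. \<Psi> (Const a) = single 0 a"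
    using \<Psi> by (auto simp: presents_def)
  obtain M where M: "\<And>e. e \<notin> invertibles n i j w D \<Longrightarrow> M e = 0"
    "\<And>\<alpha> e. \<alpha> \<in> keys c \<Longrightarrow> 0 \<le> lookup \<alpha> e + int (M e)"
    "umono M * f = (\<Sum>\<alpha>\<in>keys c. Const (lookup c \<alpha>) * umono (\<lambda>e. nat (lookup \<alpha> e + int (M e))))"
    by (rule clear_denominators[OF c(1) D _ c(2)]) (auto simp: invertibles_def)
  have MD: "M e = 0" if "e \<notin> D" for e using M(1) that by (auto simp: invertibles_def)
  obtain \<mu> where \<mu>: "\<And>e. lookup \<mu> e = int (M e)" using nat_fun_exponent[of D M] D MD by blast
  have "single \<mu> 1 * \<Psi> f = \<Psi> (umono M * f)"
    by (simp add: rhom_simps[OF hom] presents_umono[OF \<Psi> MD \<mu>])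
  also have "\<dots> = (\<Sum>\<alpha>\<in>keys c. single 0 (lookup c \<alpha>) * \<Psi> (umono (\<lambda>e. nat (lookup \<alpha> e + int (M e)))))"
    by (simp add: M(3) rhom_sum[OF hom] rhom_simps[OF hom] \<Psi>C)
  also have "\<dots> = (\<Sum>\<alpha>\<in>keys c. single \<mu> 1 * single \<alpha> (lookup c \<alpha>))"
  proof (rule sum.cong)
    fix \<alpha> assume \<alpha>: "\<alpha> \<in> keys c"
    have "\<Psi> (umono (\<lambda>e. nat (lookup \<alpha> e + int (M e)))) = single (\<mu> + \<alpha>) 1"
    proof (rule presents_umono[OF \<Psi>])
      fix e
      show "lookup (\<mu> + \<alpha>) e = int (nat (lookup \<alpha> e + int (M e)))"
        using M(2)[OF \<alpha>, of e] by (simp add: lookup_add \<mu>)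
      assume "e \<notin> D"
      moreover from this have "lookup \<alpha> e = 0" using c(1) \<alpha> by (auto simp: adm_def in_keys_iff subset_iff)
      ultimately show "nat (lookup \<alpha> e + int (M e)) = 0" by (simp add: MD)
    qed
    then show "single 0 (lookup c \<alpha>) * \<Psi> (umono (\<lambda>e. nat (lookup \<alpha> e + int (M e))))
      = single \<mu> 1 * single \<alpha> (lookup c \<alpha>)" by (simp add: mult_single)
  qed simp
  also have "\<dots> = single \<mu> 1 * c" by (simp add: sum_single flip: sum_distrib_left)
  finally have "single (- \<mu>) 1 * (single \<mu> 1 * \<Psi> f) = single (- \<mu>) 1 * (single \<mu> 1 * c)" by simp
  then show ?thesis by (simp add: mult_single flip: mult.assoc)
qed

section \<open>Multiplicative seminorms\<close>

text \<open>The points of the chart that tropicalize to \<open>w\<close>.\<close>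

definition fiber :: "(nat set \<Rightarrow> real) \<Rightarrow> ('k mpoly \<Rightarrow> real) set" where
  "fiber w = {\<delta> \<in> mult_seminorms v R. \<forall>e\<in>pairs n. \<delta> (u e) = w e}"

lemma v_of_nat: "v (of_nat m) \<le> 1"
proof (induction m)
  case (Suc m)
  then show ?case using ultrametric[of 1 "of_nat m"] by simp
qed simp

context
  fixes \<delta> assumes \<delta>: "\<delta> \<in> mult_seminorms v R"
begin

lemma ms_nonneg: "f \<in> R \<Longrightarrow> 0 \<le> \<delta> f"
  and ms_mult: "f \<in> R \<Longrightarrow> g \<in> R \<Longrightarrow> \<delta> (f * g) = \<delta> f * \<delta> g"
  and ms_triangle: "f \<in> R \<Longrightarrow> g \<in> R \<Longrightarrow> \<delta> (f + g) \<le> \<delta> f + \<delta> g"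
  and ms_Const: "\<delta> (Const a) = v a"
  using \<delta> by (auto simp: mult_seminorms_def)

lemma ms_0: "\<delta> 0 = 0" and ms_1: "\<delta> 1 = 1"
  using ms_Const[of 0] ms_Const[of 1] by (simp_all add: Const_0 Const_1)

lemma ms_power: "f \<in> R \<Longrightarrow> \<delta> (f ^ m) = \<delta> f ^ m"
  by (induction m) (simp_all add: ms_1 ms_mult chart_ring_power)

lemma ms_prod: "(\<And>a. a \<in> A \<Longrightarrow> F a \<in> R) \<Longrightarrow> \<delta> (prod F A) = (\<Prod>a\<in>A. \<delta> (F a))"
  by (induction A rule: infinite_finite_induct) (simp_all add: ms_1 ms_mult chart_ring_prod)

lemma ms_sum_triangle: "(\<And>a. a \<in> A \<Longrightarrow> F a \<in> R) \<Longrightarrow> \<delta> (sum F A) \<le> (\<Sum>a\<in>A. \<delta> (F a))"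
proof (induction A rule: infinite_finite_induct)
  case (insert x A)
  then have "\<delta> (F x + sum F A) \<le> \<delta> (F x) + \<delta> (sum F A)" by (intro ms_triangle chart_ring_sum) auto
  also have "\<delta> (sum F A) \<le> (\<Sum>a\<in>A. \<delta> (F a))" using insert by auto
  finally show ?case using insert.hyps by simp
qed (simp_all add: ms_0)

lemma Const_of_nat: "Const (of_nat m) = (of_nat m :: 'k mpoly)"
  by (simp add: Const_def)

text \<open>A multiplicative seminorm is only assumed to satisfy the triangle inequality. Binomial
  coefficients have absolute value at most 1, so the m-th power of the left side is at most m + 1
  times that of the right side, and a geometric sequence outgrows a linear one.\<close>

lemma ms_ultra:
  assumes "f \<in> R" "g \<in> R" shows "\<delta> (f + g) \<le> max (\<delta> f) (\<delta> g)"
proof (rule ccontr)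
  define B where "B = max (\<delta> f) (\<delta> g)"
  assume "\<not> \<delta> (f + g) \<le> max (\<delta> f) (\<delta> g)"
  then have less: "B < \<delta> (f + g)" unfolding B_def by (simp only: not_le)
  have B: "0 \<le> B" "\<delta> f \<le> B" "\<delta> g \<le> B" using ms_nonneg assms by (auto simp: B_def le_max_iff_disj)
  have R: "(of_nat m :: 'k mpoly) \<in> R" for m
    using chart_ring_Const[of "of_nat m :: 'k"] by (simp only: Const_of_nat)
  have bound: "\<delta> (f + g) ^ m \<le> real (m + 1) * B ^ m" for m
  proof -
    have "\<delta> (f + g) ^ m = \<delta> (\<Sum>k\<le>m. of_nat (m choose k) * f ^ k * g ^ (m - k))"
      using assms by (simp add: ms_power[symmetric] chart_ring_add binomial_ring)
    also have "\<dots> \<le> (\<Sum>k\<le>m. \<delta> (of_nat (m choose k) * f ^ k * g ^ (m - k)))"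
      using assms R by (intro ms_sum_triangle chart_ring_mult chart_ring_power) auto
    also have "\<dots> \<le> (\<Sum>k\<le>m. B ^ m)"
    proof (rule sum_mono)
      fix k assume k: "k \<in> {..m}"
      have "\<delta> (of_nat (m choose k) * f ^ k * g ^ (m - k)) = v (of_nat (m choose k)) * (\<delta> f ^ k * \<delta> g ^ (m - k))"
        using assms R ms_Const[of "of_nat (m choose k)"] by (simp add: ms_mult ms_power chart_ring_mult chart_ring_power Const_of_nat)
      also have "\<dots> \<le> 1 * (B ^ k * B ^ (m - k))"
        using B v_of_nat ms_nonneg assms by (intro mult_mono power_mono mult_nonneg_nonneg) auto
      also have "\<dots> = B ^ m" using k by (simp flip: power_add)
      finally show "\<delta> (of_nat (m choose k) * f ^ k * g ^ (m - k)) \<le> B ^ m" .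
    qed
    finally show ?thesis by simp
  qed
  have "B \<noteq> 0" using bound[of 1] less by auto
  then have Bpos: "B > 0" using B by simp
  define r where "r = \<delta> (f + g) / B"
  have r: "1 < r" using less Bpos by (simp add: r_def)
  have rb: "r ^ m \<le> real (m + 1)" for m
    using bound[of m] Bpos by (simp add: r_def power_divide pos_divide_le_eq)
  have "(\<lambda>m. real m / r ^ m) \<longlonglongrightarrow> 0" using r by (intro lim_n_over_pown) simp
  then have "eventually (\<lambda>m. real m / r ^ m < 1 / 2) sequentially"
    by (rule order_tendstoD) simp
  then obtain m where m: "m \<ge> 1" "real m / r ^ m < 1 / 2"
    unfolding eventually_sequentially by (metis max.cobounded1 max.cobounded2)
  have "2 * real m < r ^ m" using m r by (simp add: field_simps)
  also have "\<dots> \<le> real m + 1" using rb[of m] by simp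
  finally show False using m by simp
qed

lemma ms_uminus: "f \<in> R \<Longrightarrow> \<delta> (- f) = \<delta> f"
proof -
  assume f: "f \<in> R"
  have "- f = Const (-1) * f" by (simp add: rhom_simps[OF rhom_Const] Const_1)
  then have "\<delta> (- f) = \<delta> (Const (-1)) * \<delta> f" using f by (metis ms_mult chart_ring_Const)
  then show ?thesis using ms_Const[of "-1"] by simp
qed

lemma ms_sum_le:
  "(\<And>a. a \<in> A \<Longrightarrow> F a \<in> R \<and> \<delta> (F a) \<le> B) \<Longrightarrow> 0 \<le> B \<Longrightarrow> \<delta> (sum F A) \<le> B"
proof (induction A rule: infinite_finite_induct)
  case (insert x A)
  have "\<delta> (F x + sum F A) \<le> max (\<delta> (F x)) (\<delta> (sum F A))"
    using insert by (intro ms_ultra chart_ring_sum) auto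
  moreover have "\<delta> (F x) \<le> B" "\<delta> (sum F A) \<le> B" using insert by auto
  ultimately show ?case using insert.hyps by simp
qed (simp_all add: ms_0)

lemma ms_umono: "\<delta> (umono M) = (\<Prod>e\<in>pairs n. \<delta> (u e) ^ M e)"
  unfolding umono_def
  by (simp add: ms_prod ms_power chart_ring_power ucoord_chart_ring[OF chart])

end

definition wmono :: "(nat set \<Rightarrow> real) \<Rightarrow> (nat set \<Rightarrow> nat) \<Rightarrow> real" where
  "wmono w M = (\<Prod>e\<in>pairs n. w e ^ M e)"

lemma fiber_umono: "\<delta> \<in> fiber w \<Longrightarrow> \<delta> (umono M) = wmono w M"
  by (simp add: fiber_def ms_umono wmono_def)

lemma wmono_nonneg: "(\<And>e. e \<in> pairs n \<Longrightarrow> 0 \<le> w e) \<Longrightarrow> 0 \<le> wmono w M"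
  by (simp add: wmono_def prod_nonneg)

lemma wmono_shift:
  assumes "okexp (pairs n) w \<alpha>" "\<And>e. 0 \<le> lookup \<alpha> e + int (M e)"
  shows "wmono w (\<lambda>e. nat (lookup \<alpha> e + int (M e))) = wmono w M * mono_wt (pairs n) w \<alpha>"
  unfolding wmono_def mono_wt_def prod.distrib[symmetric]
proof (rule prod.cong)
  fix e assume e: "e \<in> pairs n"
  have "w e ^ nat (lookup \<alpha> e + int (M e)) = w e powi (int (nat (lookup \<alpha> e + int (M e))))"
    by (rule power_int_of_nat[symmetric])
  also have "int (nat (lookup \<alpha> e + int (M e))) = int (M e) + lookup \<alpha> e" using assms(2)[of e] by simp
  also have "w e powi \<dots> = w e powi int (M e) * w e powi lookup \<alpha> e"
    using assms(1) e by (intro power_int_add_ok) (auto simp: okexp_def)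
  finally show "w e ^ nat (lookup \<alpha> e + int (M e)) = w e ^ M e * w e powi lookup \<alpha> e" by simp
qed simp

lemma fiber_nonneg: "\<delta> \<in> fiber w \<Longrightarrow> e \<in> pairs n \<Longrightarrow> 0 \<le> w e"
  using ucoord_chart_ring[OF chart, of e, where 'k = 'k] by (auto simp: fiber_def mult_seminorms_def)

text \<open>Multiplying by a unit monomial turns a Laurent expansion into a polynomial one.\<close>

lemma fiber_le_gauss:
  assumes \<Psi>: "presents D w \<Psi>" and \<delta>: "\<delta> \<in> fiber w'"
    and nz: "\<And>e. e \<in> invertibles n i j w D \<Longrightarrow> w' e \<noteq> 0" and f: "f \<in> R"
  shows "\<delta> f \<le> G w' (\<Psi> f)"
proof -
  have D: "D \<subseteq> pairs n" and c: "adm D (invertibles n i j w D) (\<Psi> f)" "EV (\<Psi> f) = to_frac f"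
    using \<Psi> f by (auto simp: presents_def)
  have ms: "\<delta> \<in> mult_seminorms v R" using \<delta> by (simp add: fiber_def)
  have w0: "\<And>e. e \<in> pairs n \<Longrightarrow> 0 \<le> w' e" using fiber_nonneg[OF \<delta>] .
  obtain M where M: "\<And>e. e \<notin> invertibles n i j w D \<Longrightarrow> M e = 0"
    "\<And>\<alpha> e. \<alpha> \<in> keys (\<Psi> f) \<Longrightarrow> 0 \<le> lookup \<alpha> e + int (M e)"
    "umono M * f = (\<Sum>\<alpha>\<in>keys (\<Psi> f). Const (lookup (\<Psi> f) \<alpha>) * umono (\<lambda>e. nat (lookup \<alpha> e + int (M e))))"
    by (rule clear_denominators[OF c(1) D _ c(2)]) (auto simp: invertibles_def)
  have pos: "wmono w' M > 0"
    unfolding wmono_def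
  proof (rule prod_pos)
    fix e assume "e \<in> pairs n"
    then show "0 < w' e ^ M e" using w0[of e] nz[of e] M(1)[of e] by (cases "e \<in> invertibles n i j w D") auto
  qed
  have "wmono w' M * \<delta> f = \<delta> (umono M * f)"
    using ms_mult[OF ms umono_R f] fiber_umono[OF \<delta>] by simp
  also have "\<dots> \<le> wmono w' M * G w' (\<Psi> f)"
    unfolding M(3)
  proof (rule ms_sum_le[OF ms], intro conjI)
    fix \<alpha> assume \<alpha>: "\<alpha> \<in> keys (\<Psi> f)"
    show "Const (lookup (\<Psi> f) \<alpha>) * umono (\<lambda>e. nat (lookup \<alpha> e + int (M e))) \<in> R"
      by (intro chart_ring_mult chart_ring_Const umono_R)
    have "okexp (pairs n) w' \<alpha>" using adm_okexp[OF c(1) D nz \<alpha>] by simp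
    then have "\<delta> (Const (lookup (\<Psi> f) \<alpha>) * umono (\<lambda>e. nat (lookup \<alpha> e + int (M e))))
      = wmono w' M * (v (lookup (\<Psi> f) \<alpha>) * mono_wt (pairs n) w' \<alpha>)"
      using ms_mult[OF ms chart_ring_Const umono_R] ms_Const[OF ms] fiber_umono[OF \<delta>] wmono_shift M(2)[OF \<alpha>]
      by simp
    also have "\<dots> \<le> wmono w' M * G w' (\<Psi> f)"
      using pos gauss_ge by (intro mult_left_mono) auto
    finally show "\<delta> (Const (lookup (\<Psi> f) \<alpha>) * umono (\<lambda>e. nat (lookup \<alpha> e + int (M e)))) \<le> wmono w' M * G w' (\<Psi> f)" .
  qed (use pos gauss_nonneg in simp)
  finally show ?thesis using pos by simp
qed

text \<open>The weights \<open>w'\<close> may differ from those of the presentation. This freedom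
  provides points with nonvanishing coordinates when zero weights are perturbed.\<close>

lemma gauss_mult_seminorm:
  assumes \<Psi>: "presents D w \<Psi>" and w': "\<And>e. e \<in> pairs n \<Longrightarrow> 0 \<le> w' e"
    and nz: "\<And>e. e \<in> invertibles n i j w D \<Longrightarrow> w' e \<noteq> 0"
  shows "(\<lambda>f\<in>R. G w' (\<Psi> f)) \<in> mult_seminorms v R"
proof -
  have D: "D \<subseteq> pairs n" and hom: "rhom \<Psi>" and C: "\<And>a. \<Psi> (Const a) = single 0 a"
    and adm: "\<And>f. f \<in> R \<Longrightarrow> adm D (invertibles n i j w D) (\<Psi> f)"
    using \<Psi> by (auto simp: presents_def)
  have "G w' (\<Psi> (f + g)) \<le> G w' (\<Psi> f) + G w' (\<Psi> g)" for f g
    using gauss_add[of "pairs n" w' "\<Psi> f" "\<Psi> g"] w' gauss_nonneg[of "pairs n" w' "\<Psi> f"]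
      gauss_nonneg[of "pairs n" w' "\<Psi> g"] by (simp add: rhom_simps[OF hom])
  moreover have "G w' (\<Psi> (f * g)) = G w' (\<Psi> f) * G w' (\<Psi> g)" if "f \<in> R" "g \<in> R" for f g
    using G_mult[OF w' D nz adm[OF that(1)] adm[OF that(2)]] by (simp add: rhom_simps[OF hom])
  moreover have "G w' (\<Psi> (Const a)) = v a" for a
    using gauss_single[of "pairs n" w' 0 a, OF w'] by (simp add: C)
  ultimately show ?thesis
    by (auto simp: mult_seminorms_def gauss_nonneg chart_ring_add chart_ring_mult)
qed

definition is_max :: "(nat set \<Rightarrow> real) \<Rightarrow> ('k mpoly \<Rightarrow> real) \<Rightarrow> bool" where
  "is_max w \<gamma> \<longleftrightarrow> \<gamma> \<in> fiber w \<and> (\<forall>\<delta>\<in>fiber w. \<forall>f\<in>R. \<delta> f \<le> \<gamma> f)"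

lemma is_max_unique:
  assumes "is_max w \<gamma>" "is_max w \<gamma>'" shows "\<gamma> = \<gamma>'"
proof (rule extensionalityI[of _ R])
  show "\<gamma> \<in> extensional R" "\<gamma>' \<in> extensional R"
    using assms by (auto simp: is_max_def fiber_def mult_seminorms_def)
  show "\<gamma> f = \<gamma>' f" if "f \<in> R" for f
    using assms that by (auto simp: is_max_def intro: antisym)
qed

text \<open>The Gauss norm lies in the fibre because the presentation has the right norms on
  coordinates, and it dominates the fibre by clearing denominators.\<close>

lemma presents_is_max:
  assumes "presents D w \<Psi>" "\<And>e. e \<in> pairs n \<Longrightarrow> 0 \<le> w e"
  shows "is_max w (\<lambda>f\<in>R. G w (\<Psi> f))"
proof -
  have nz: "\<And>e. e \<in> invertibles n i j w D \<Longrightarrow> w e \<noteq> 0" by (simp add: invertibles_def)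
  have "(\<lambda>f\<in>R. G w (\<Psi> f)) \<in> fiber w"
    using gauss_mult_seminorm[OF assms nz] assms(1) ucoord_chart_ring[OF chart, where 'k = 'k]
    by (simp add: fiber_def presents_def)
  then show ?thesis using fiber_le_gauss[OF assms(1), where w' = w] nz by (simp add: is_max_def)
qed

end

section \<open>Tropical Pluecker vectors\<close>

context chart
begin

text \<open>The three-term tropical Pluecker relations for exponentials of tropical coordinates.
  Since all labels are quantified, permuting them shows that the largest of the three products is
  attained twice.\<close>

definition tplu :: "(nat set \<Rightarrow> real) \<Rightarrow> bool" where
  "tplu w \<longleftrightarrow> w {i, j} = 1 \<and> (\<forall>e\<in>pairs n. 0 \<le> w e) \<and>
     (\<forall>a\<in>{1..n}. \<forall>b\<in>{1..n}. \<forall>c\<in>{1..n}. \<forall>d\<in>{1..n}.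
        wd w a b * wd w c d \<le> max (wd w a c * wd w b d) (wd w a d * wd w b c))"

lemma fiber_p:
  assumes "\<delta> \<in> fiber w" "a \<in> {1..n}" "b \<in> {1..n}"
  shows "\<delta> (p a b) = wd w a b"
proof -
  have ms: "\<delta> \<in> mult_seminorms v R" using assms by (simp add: fiber_def)
  consider "a = b" | "a \<noteq> b" "a < b" | "a \<noteq> b" "b < a" by linarith
  then show ?thesis
  proof cases
    case 1 then show ?thesis by (simp add: ms_0[OF ms])
  next
    case 2
    then have "{a, b} \<in> pairs n" using assms by (simp add: pairs_iff)
    then show ?thesis using 2 assms by (simp add: sp_def wd_def fiber_def)
  next
    case 3
    then have ab: "{a, b} \<in> pairs n" using assms by (simp add: pairs_iff)
    then have "\<delta> (- u {a, b}) = \<delta> (u {a, b})" by (intro ms_uminus[OF ms] ucoord_chart_ring[OF chart])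
    then show ?thesis using 3 ab assms by (simp add: sp_def wd_def fiber_def)
  qed
qed

text \<open>The ultrametric inequality applied to the Pluecker relations.\<close>

lemma fiber_tplu:
  assumes "\<delta> \<in> fiber w" shows "tplu w"
proof -
  have ms: "\<delta> \<in> mult_seminorms v R" using assms by (simp add: fiber_def)
  have "w {i, j} = 1"
    using assms ij ms_1[OF ms] unfolding fiber_def by (metis (mono_tags, lifting) mem_Collect_eq pairs_iff ucoord_ij)
  moreover have "wd w a b * wd w c d \<le> max (wd w a c * wd w b d) (wd w a d * wd w b c)"
    if abcd: "a \<in> {1..n}" "b \<in> {1..n}" "c \<in> {1..n}" "d \<in> {1..n}" for a b c d
  proof -
    note pR = sp_chart_ring[OF chart, where 'k = 'k]
    have "wd w a b * wd w c d = \<delta> (p a b * p c d)"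
      using abcd by (simp add: ms_mult[OF ms] pR fiber_p[OF assms])
    also have "p a b * p c d = p a c * p b d + - (p a d * p b c)"
      using sp_plucker[OF ij(3), of a b c d] by simp
    also have "\<delta> \<dots> \<le> max (\<delta> (p a c * p b d)) (\<delta> (- (p a d * p b c)))"
      using abcd by (intro ms_ultra[OF ms] chart_ring_uminus chart_ring_mult pR) auto
    also have "\<dots> = max (wd w a c * wd w b d) (wd w a d * wd w b c)"
      using abcd by (simp add: ms_uminus[OF ms] chart_ring_mult ms_mult[OF ms] pR fiber_p[OF assms])
    finally show ?thesis .
  qed
  ultimately show ?thesis using fiber_nonneg[OF assms] by (simp add: tplu_def)
qed

context
  fixes w assumes w: "tplu w"
begin

lemma wd_nonneg: "a \<in> {1..n} \<Longrightarrow> b \<in> {1..n} \<Longrightarrow> 0 \<le> wd w a b"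
  using w by (auto simp: tplu_def wd_def pairs_iff)

lemma wd_ij: "wd w i j = 1" "wd w j i = 1"
  using w ij by (auto simp: tplu_def wd_def insert_commute)

lemma plu:
  "a \<in> {1..n} \<Longrightarrow> b \<in> {1..n} \<Longrightarrow> c \<in> {1..n} \<Longrightarrow> d \<in> {1..n} \<Longrightarrow>
    wd w a b * wd w c d \<le> max (wd w a c * wd w b d) (wd w a d * wd w b c)"
  using w by (simp add: tplu_def)

text \<open>The maximum of the three terms is attained twice, so a term that dominates one of the
  others equals the maximum of these two.\<close>

lemma plu_eq:
  assumes "a \<in> {1..n}" "b \<in> {1..n}" "c \<in> {1..n}" "d \<in> {1..n}"
    and "wd w a d * wd w b c \<le> wd w a b * wd w c d"
  shows "wd w a b * wd w c d = max (wd w a c * wd w b d) (wd w a d * wd w b c)"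
proof -
  have "wd w a c * wd w b d \<le> max (wd w a b * wd w c d) (wd w a d * wd w b c)"
    using plu[of a c b d] assms by (simp add: wd_swap[of w c b])
  then show ?thesis using plu[of a b c d] assms by simp
qed

text \<open>Take t maximizing the quotient of \<open>wd w b t\<close> by \<open>wd w t l\<close>,
  that is, the old label closest to l. If some admissible t has \<open>wd w t l = 0\<close>, it
  already makes the left side vanish.\<close>

lemma best_base:
  assumes "finite S" "S \<subseteq> {1..n}" "s0 \<in> S" "wd w b s0 \<noteq> 0" "b \<in> {1..n}" "l \<in> {1..n}"
  shows "\<exists>t\<in>S. wd w b t \<noteq> 0 \<and> (\<forall>s\<in>S. wd w b s * wd w t l \<le> wd w b t * wd w s l)"
proof -
  have nn: "0 \<le> wd w c d" if "c \<in> insert b (insert l S)" "d \<in> insert b (insert l S)" for c d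
    using that assms by (intro wd_nonneg) auto
  let ?T = "{t \<in> S. wd w b t \<noteq> 0}"
  show ?thesis
  proof (cases "\<exists>t\<in>?T. wd w t l = 0")
    case True
    then show ?thesis using nn by (auto intro!: mult_nonneg_nonneg)
  next
    case False
    have "finite ?T" "?T \<noteq> {}" using assms by auto
    then have "Max ((\<lambda>t. wd w b t / wd w t l) ` ?T) \<in> (\<lambda>t. wd w b t / wd w t l) ` ?T" by (intro Max_in) auto
    then obtain t where t': "t \<in> ?T" "Max ((\<lambda>t. wd w b t / wd w t l) ` ?T) = wd w b t / wd w t l" by blast
    have t: "t \<in> ?T" "\<And>s. s \<in> ?T \<Longrightarrow> wd w b s / wd w s l \<le> wd w b t / wd w t l"
      using t' \<open>finite ?T\<close> by (auto simp flip: t'(2))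
    have pos: "wd w s l > 0" if "s \<in> ?T" for s using False that nn[of s l] by force
    have "wd w b s * wd w t l \<le> wd w b t * wd w s l" if "s \<in> S" for s
    proof (cases "wd w b s = 0")
      case True
      then show ?thesis using nn that t by simp
    next
      case False
      then have "wd w b s / wd w s l \<le> wd w b t / wd w t l" using t(2) that by simp
      then show ?thesis using pos[OF t(1)] pos[of s] False that by (simp add: field_simps)
    qed
    then show ?thesis using t by auto
  qed
qed

text \<open>Translates maximality of t relative to the anchor b into the weight condition of
  \<open>adapted\<close>.\<close>

lemma best_condition:
  assumes "S \<subseteq> {1..n}" "b \<in> {1..n}" "t \<in> S" "l \<in> {1..n}"
    and "\<And>s. s \<in> S \<Longrightarrow> wd w b s * wd w t l \<le> wd w b t * wd w s l" "s \<in> S"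
  shows "wd w s l * wd w b t = max (wd w b l * wd w s t) (wd w t l * wd w s b)"
proof -
  have mem: "s \<in> {1..n}" "t \<in> {1..n}" using assms by auto
  have "wd w s b * wd w l t \<le> wd w s l * wd w t b"
    using assms(5)[OF assms(6)]
    by (simp add: wd_swap[of w s b] wd_swap[of w l t] wd_swap[of w t b] mult.commute)
  from plu_eq[OF mem(1) assms(4) mem(2) assms(2) this] show ?thesis
    by (simp add: wd_swap[of w t b] wd_swap[of w l b] wd_swap[of w l t] mult.commute)
qed

text \<open>One of the three terms of the relation vanishes, so the other two agree. Such a label
  can always be attached to the initial pair.\<close>

lemma zero_condition:
  assumes "s \<in> {1..n}" "l \<in> {1..n}" "wd w i l = 0 \<or> wd w j l = 0"
  shows "wd w s l * wd w i j = max (wd w i l * wd w s j) (wd w j l * wd w s i)"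
proof -
  have nn: "0 \<le> wd w i l" "0 \<le> wd w j l" "0 \<le> wd w s i" "0 \<le> wd w s j" "0 \<le> wd w s l"
    using assms ij by (auto intro: wd_nonneg)
  have 1: "wd w s l * wd w i j \<le> max (wd w i l * wd w s j) (wd w j l * wd w s i)"
    using plu[of s l i j] assms ij by (simp add: wd_swap[of w l] mult.commute max.commute)
  have 2: "wd w i l * wd w s j \<le> max (wd w s l * wd w i j) (wd w j l * wd w s i)"
    using plu[of s j i l] assms ij by (simp add: wd_swap[of w j i] wd_swap[of w j l] mult.commute max.commute)
  have 3: "wd w j l * wd w s i \<le> max (wd w s l * wd w i j) (wd w i l * wd w s j)"
    using plu[of s i j l] assms ij by (metis max.commute mult.commute wd_swap)
  have nn': "0 \<le> wd w s l * wd w i j" "0 \<le> wd w i l * wd w s j" "0 \<le> wd w j l * wd w s i"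
    using nn wd_ij by auto
  have "wd w i l * wd w s j = 0 \<or> wd w j l * wd w s i = 0" using assms(3) by auto
  then show ?thesis using 1 2 3 nn' by linarith
qed

text \<open>
  If the best old label \<open>t\<close> relative to the anchor \<open>j\<close> can only be used with the anchor \<open>i\<close>,
  then \<open>t\<close> is also best relative to \<open>i\<close>, unless \<open>i\<close> is best relative to \<open>j\<close>.
\<close>

lemma change_anchor:
  assumes S: "S \<subseteq> {1..n}" "i \<in> S" "t \<in> S" "l \<in> {1..n}"
    and nz: "wd w i l \<noteq> 0" "wd w j t \<noteq> 0"
    and best: "\<And>s. s \<in> S \<Longrightarrow> wd w j s * wd w t l \<le> wd w j t * wd w s l"
  shows "(\<forall>s\<in>S. wd w j s * wd w i l \<le> wd w j i * wd w s l) \<or>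
    (wd w i t \<noteq> 0 \<and> (\<forall>s\<in>S. wd w i s * wd w t l \<le> wd w i t * wd w s l))"
proof -
  have nn: "0 \<le> wd w c d" if "c \<in> insert j (insert l S)" "d \<in> insert j (insert l S)" for c d
    using that assms ij by (intro wd_nonneg) auto
  have t: "t \<in> {1..n}" using S by auto
  have il: "wd w i l > 0" and jt: "wd w j t > 0" using nz nn S by (simp_all add: less_le)
  have XY: "wd w t l \<le> wd w j t * wd w i l" using best[OF S(2)] wd_ij by simp
  show ?thesis
  proof (cases "wd w t l = wd w j t * wd w i l")
    case True
    have "wd w j s * wd w i l \<le> wd w j i * wd w s l" if "s \<in> S" for s
    proof -
      have "wd w j t * (wd w j s * wd w i l) \<le> wd w j t * wd w s l"
        using best[OF that] True by (simp add: algebra_simps)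
      then show ?thesis using jt wd_ij by simp
    qed
    then show ?thesis by blast
  next
    case False
    then have XY': "wd w t l < wd w j t * wd w i l" using XY by simp
    \<comment> \<open>In the relation for i, j, t, l the term \<open>wd w t l\<close> is strictly
      below another one, so the remaining two terms agree.\<close>
    have "wd w j t * wd w i l \<le> max (wd w i t * wd w j l) (wd w t l)"
      using plu[of j t i l] ij t S wd_ij by (simp add: wd_swap[of w t i] mult.commute max.commute)
    moreover have "wd w i t * wd w j l \<le> max (wd w j t * wd w i l) (wd w t l)"
      using plu[of i t j l] ij t S wd_ij by (simp add: wd_swap[of w t j] mult.commute max.commute)
    ultimately have Z: "wd w j t * wd w i l = wd w i t * wd w j l" using XY' by linarith
    have "wd w i t * wd w j l > 0" using Z il jt by (metis mult_pos_pos)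
    then have pos: "wd w i t > 0" "wd w j l > 0" using nn[of i t] nn[of j l] S by (auto simp: zero_less_mult_iff)
    have "wd w i s * wd w t l \<le> wd w i t * wd w s l" if s: "s \<in> S" for s
    \<comment> \<open>In the first case the bound relative to j is rescaled by means of
      \<open>Z\<close>; otherwise the relation for i, s, j, l bounds
      \<open>wd w i s * wd w j l\<close> by \<open>wd w s l\<close>.\<close>
    proof (cases "wd w i s * wd w j l \<le> wd w j s * wd w i l")
      case True
      have "wd w j t * wd w i s * wd w i l = wd w i t * (wd w i s * wd w j l)" using Z by (simp add: algebra_simps)
      also have "\<dots> \<le> wd w i t * (wd w j s * wd w i l)" using True pos by simp
      finally have "wd w j t * wd w i s \<le> wd w i t * wd w j s" using il by (simp add: algebra_simps)
      then have "wd w j t * wd w i s * wd w t l \<le> wd w i t * wd w j s * wd w t l"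
        using nn[of t l] S by (intro mult_right_mono) auto
      also have "\<dots> \<le> wd w i t * (wd w j t * wd w s l)"
        using best[OF s] pos by (simp add: algebra_simps)
      finally show ?thesis using jt by (simp add: algebra_simps)
    next
      case False
      have "wd w i s * wd w j l \<le> max (wd w s l) (wd w j s * wd w i l)"
        using plu[of i s j l] ij S s wd_ij by (auto simp: wd_swap[of w s j] mult.commute max.commute)
      then have *: "wd w i s * wd w j l \<le> wd w s l" using False by linarith
      have "wd w i s * wd w t l \<le> wd w i s * (wd w j t * wd w i l)"
        using XY nn[of i s] S s by (intro mult_left_mono) auto
      also have "\<dots> = wd w i t * (wd w i s * wd w j l)" using Z by (simp add: algebra_simps)
      also have "\<dots> \<le> wd w i t * wd w s l" using * pos by simp
      finally show ?thesis .
    qed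
    then show ?thesis using pos by auto
  qed
qed

text \<open>Extends an adapted system by an arbitrary label without reference to a tree. The
  invariant that every old label is joined to i or j in \<open>D\<close> makes a coordinate
  available as divisor; \<open>change_anchor\<close> handles the case that it is the one with the
  wrong anchor.\<close>

lemma adapted_add_any:
  assumes ad: "adapted n i j w S D" and inv: "\<forall>t\<in>S - {i, j}. {i, t} \<in> D \<or> {j, t} \<in> D"
    and l: "l \<in> {1..n}" "l \<notin> S"
  shows "\<exists>D'. adapted n i j w (insert l S) D' \<and> D \<subseteq> D' \<and>
    (\<forall>t\<in>insert l S - {i, j}. {i, t} \<in> D' \<or> {j, t} \<in> D')"
proof -
  have basic: "finite S" "S \<subseteq> {1..n}" "i \<in> S" "j \<in> S" "D \<subseteq> pairs n" "{i, j} \<notin> D"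
    using adapted_basic[OF ad] by auto
  have base: ?thesis if c: "a \<in> {i, j}" "t \<in> S" "{a, t} = {i, j} \<or> {a, t} \<in> D" "wd w a t \<noteq> 0"
    "\<And>s. s \<in> S \<Longrightarrow> wd w s l * wd w a t = max (wd w a l * wd w s t) (wd w t l * wd w s a)" for a t
  proof -
    have "{a, t} = {i, j} \<or> {a, t} \<in> D \<inter> Iset n i j"
      using c basic by (auto simp: Iset_iff[OF chart])
    then have "adapted n i j w (insert l S) (insert {a, l} (insert {t, l} D))"
      using c basic l by (intro adapted.step[OF ad]) auto
    then show ?thesis using c(1) inv by blast
  qed
  show ?thesis
  proof (cases "wd w i l = 0 \<or> wd w j l = 0")
    case True
    show ?thesis
      by (rule base[of i j]) (use zero_condition[OF _ l(1) True] basic wd_ij in auto)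
  next
    case False
    obtain t where t: "t \<in> S" "wd w j t \<noteq> 0" "\<And>s. s \<in> S \<Longrightarrow> wd w j s * wd w t l \<le> wd w j t * wd w s l"
      using best_base[OF basic(1-3), of j l] wd_ij ij l by auto
    then have "t \<noteq> j" by auto
    show ?thesis
    proof (cases "t = i \<or> {j, t} \<in> D")
      case True
      show ?thesis
        by (rule base[of j t, OF _ t(1) _ t(2) best_condition[OF basic(2) ij(2) t(1) l(1) t(3)]]) (use True in auto)
    next
      case nD: False
      then have it: "{i, t} \<in> D" using inv t \<open>t \<noteq> j\<close> by blast
      have "(\<forall>s\<in>S. wd w j s * wd w i l \<le> wd w j i * wd w s l) \<or>
        (wd w i t \<noteq> 0 \<and> (\<forall>s\<in>S. wd w i s * wd w t l \<le> wd w i t * wd w s l))"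
        using t basic l False by (intro change_anchor) auto
      then show ?thesis
      proof
        assume *: "\<forall>s\<in>S. wd w j s * wd w i l \<le> wd w j i * wd w s l"
        show ?thesis
          by (rule base[of j i, OF _ basic(3) _ _ best_condition[OF basic(2) ij(2) basic(3) l(1)]]) (use * wd_ij in auto)
      next
        assume *: "wd w i t \<noteq> 0 \<and> (\<forall>s\<in>S. wd w i s * wd w t l \<le> wd w i t * wd w s l)"
        show ?thesis
          by (rule base[of i t, OF _ t(1) _ _ best_condition[OF basic(2) ij(1) t(1) l(1)]]) (use * it in auto)
      qed
    qed
  qed
qed

end

section \<open>Systems adapted simultaneously to nearby weight vectors\<close>

definition near :: "(nat set \<Rightarrow> real) \<Rightarrow> (nat set \<Rightarrow> real) \<Rightarrow> bool" where
  "near w w' \<longleftrightarrow> (\<forall>e\<in>pairs n. w e \<noteq> 0 \<longrightarrow> w' e \<noteq> 0) \<and>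
    (\<forall>a\<in>{1..n}. \<forall>b\<in>{1..n}. \<forall>c\<in>{1..n}. \<forall>d\<in>{1..n}. \<forall>a'\<in>{1..n}. \<forall>b'\<in>{1..n}. \<forall>c'\<in>{1..n}. \<forall>d'\<in>{1..n}.
      wd w a b * wd w c d < wd w a' b' * wd w c' d' \<longrightarrow> wd w' a b * wd w' c d < wd w' a' b' * wd w' c' d')"

lemma near_refl: "near w w"
  by (simp add: near_def)

text \<open>Nonvanishing and strict inequalities are open conditions; contrapositively, weak
  inequalities at \<open>w'\<close> pass to \<open>w\<close>.\<close>

lemma near_le:
  assumes "near w w'" "wd w' a' b' * wd w' c' d' \<le> wd w' a b * wd w' c d"
    "a \<in> {1..n}" "b \<in> {1..n}" "c \<in> {1..n}" "d \<in> {1..n}" "a' \<in> {1..n}" "b' \<in> {1..n}" "c' \<in> {1..n}" "d' \<in> {1..n}"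
  shows "wd w a' b' * wd w c' d' \<le> wd w a b * wd w c d"
proof (rule ccontr)
  assume "\<not> wd w a' b' * wd w c' d' \<le> wd w a b * wd w c d"
  then have "wd w a b * wd w c d < wd w a' b' * wd w c' d'" by simp
  then have "wd w' a b * wd w' c d < wd w' a' b' * wd w' c' d'"
    using assms unfolding near_def by blast
  then show False using assms(2) by simp
qed

lemma eventually_near:
  assumes "\<And>e. e \<in> pairs n \<Longrightarrow> ((\<lambda>x. W x e) \<longlongrightarrow> w e) F"
  shows "eventually (\<lambda>x. near w (W x)) F"
proof -
  have wd: "((\<lambda>x. wd (W x) a b) \<longlongrightarrow> wd w a b) F" if "a \<in> {1..n}" "b \<in> {1..n}" for a b
    using assms that by (auto simp: wd_def pairs_iff)
  have 1: "eventually (\<lambda>x. w e \<noteq> 0 \<longrightarrow> W x e \<noteq> 0) F" if "e \<in> pairs n" for e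
    using tendsto_imp_eventually_ne[OF assms[OF that], of 0] by (cases "w e = 0") auto
  have 2: "eventually (\<lambda>x. wd w a b * wd w c d < wd w a' b' * wd w c' d' \<longrightarrow>
      wd (W x) a b * wd (W x) c d < wd (W x) a' b' * wd (W x) c' d') F"
    if "a \<in> {1..n}" "b \<in> {1..n}" "c \<in> {1..n}" "d \<in> {1..n}" "a' \<in> {1..n}" "b' \<in> {1..n}" "c' \<in> {1..n}" "d' \<in> {1..n}"
    for a b c d a' b' c' d'
  proof (cases "wd w a b * wd w c d < wd w a' b' * wd w c' d'")
    case True
    then obtain m where m: "wd w a b * wd w c d < m" "m < wd w a' b' * wd w c' d'" using dense by blast
    have "eventually (\<lambda>x. wd (W x) a b * wd (W x) c d < m) F"
      using that m by (intro order_tendstoD(2)[OF tendsto_mult[OF wd wd]]) auto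
    moreover have "eventually (\<lambda>x. m < wd (W x) a' b' * wd (W x) c' d') F"
      using that m by (intro order_tendstoD(1)[OF tendsto_mult[OF wd wd]]) auto
    ultimately show ?thesis by eventually_elim auto
  qed simp
  show ?thesis
    unfolding near_def
    by (intro eventually_conj eventually_ball_finite ballI 1 2) auto
qed

text \<open>The anchor of l is dictated by \<open>w\<close>: j if w_jl is nonzero, otherwise i. The
  best old label is chosen for \<open>w'\<close> and remains best for \<open>w\<close> by
  \<open>near_le\<close>; the point is that the chosen divisor does not vanish at \<open>w\<close>.
  The last clause records which coordinate is available as divisor later.\<close>

lemma adapted_near_nonloops:
  assumes w: "tplu w" and w': "tplu w'" and near: "near w w'"
    and K: "finite K" "K \<subseteq> {1..n} - {i, j}" "\<And>l. l \<in> K \<Longrightarrow> wd w i l \<noteq> 0 \<or> wd w j l \<noteq> 0"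
  shows "\<exists>D. adapted n i j w ({i, j} \<union> K) D \<and> adapted n i j w' ({i, j} \<union> K) D \<and>
    (\<forall>t\<in>K. (wd w j t = 0 \<longrightarrow> {i, t} \<in> D) \<and> (wd w j t \<noteq> 0 \<longrightarrow> {j, t} \<in> D))"
  using K
proof (induction K rule: finite_induct)
  case empty
  then show ?case using adapted.base[of n i j w] adapted.base[of n i j w'] by auto
next
  case (insert l K)
  let ?S = "{i, j} \<union> K"
  have nl: "\<And>t. t \<in> insert l K \<Longrightarrow> wd w i t \<noteq> 0 \<or> wd w j t \<noteq> 0" by (rule insert.prems(2))
  obtain D where D: "adapted n i j w ?S D" "adapted n i j w' ?S D"
    "\<And>t. t \<in> K \<Longrightarrow> wd w j t = 0 \<Longrightarrow> {i, t} \<in> D" "\<And>t. t \<in> K \<Longrightarrow> wd w j t \<noteq> 0 \<Longrightarrow> {j, t} \<in> D"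
    using insert.IH insert.prems by auto
  have S: "finite ?S" "?S \<subseteq> {1..n}" using adapted_basic[OF D(1)] by auto
  have l: "l \<in> {1..n}" "l \<notin> ?S" using insert by auto
  have basic: "D \<subseteq> pairs n" "{i, j} \<notin> D" using adapted_basic[OF D(1)] by auto
  have step: ?case if b: "b \<in> {i, j}" "(wd w j l = 0 \<and> b = i) \<or> (wd w j l \<noteq> 0 \<and> b = j)"
    "t \<in> ?S" "{b, t} = {i, j} \<or> {b, t} \<in> D" "wd w b t \<noteq> 0" "wd w' b t \<noteq> 0"
    "\<And>s. s \<in> ?S \<Longrightarrow> wd w b s * wd w t l \<le> wd w b t * wd w s l"
    "\<And>s. s \<in> ?S \<Longrightarrow> wd w' b s * wd w' t l \<le> wd w' b t * wd w' s l" for b t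
  proof -
    let ?D = "insert {b, l} (insert {t, l} D)"
    have bt: "{b, t} = {i, j} \<or> {b, t} \<in> D \<inter> Iset n i j"
      using b basic by (auto simp: Iset_iff[OF chart])
    have bS: "b \<in> ?S" and bn: "b \<in> {1..n}" using b(1) ij by auto
    have "adapted n i j w (insert l ?S) ?D"
      by (rule adapted.step[OF D(1) l bS b(3) bt b(5) best_condition[OF w S(2) bn b(3) l(1) b(7)]])
    moreover have "adapted n i j w' (insert l ?S) ?D"
      by (rule adapted.step[OF D(2) l bS b(3) bt b(6) best_condition[OF w' S(2) bn b(3) l(1) b(8)]])
    moreover have "(wd w j t = 0 \<longrightarrow> {i, t} \<in> ?D) \<and> (wd w j t \<noteq> 0 \<longrightarrow> {j, t} \<in> ?D)" if "t \<in> insert l K" for t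
      using that D(3,4) b(2) by auto
    ultimately show ?thesis by (intro exI[of _ ?D]) (simp add: insert_commute)
  qed
  have le: "wd w b s * wd w t l \<le> wd w b t * wd w s l"
    if "wd w' b s * wd w' t l \<le> wd w' b t * wd w' s l" "b \<in> {i, j}" "s \<in> ?S" "t \<in> ?S" for b s t
    using that S l ij by (intro near_le[OF near that(1)]) auto
  have nn: "\<And>a b. a \<in> {1..n} \<Longrightarrow> b \<in> {1..n} \<Longrightarrow> 0 \<le> wd w a b" by (rule wd_nonneg[OF w])
  show ?case
  proof (cases "wd w j l = 0")
    case False
    have "i \<in> ?S" "wd w' j i \<noteq> 0" using wd_ij[OF w'] by simp_all
    from best_base[OF w' S this ij(2) l(1)]
    obtain t where t: "t \<in> ?S" "wd w' j t \<noteq> 0" "\<And>s. s \<in> ?S \<Longrightarrow> wd w' j s * wd w' t l \<le> wd w' j t * wd w' s l"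
      by blast
    have tn: "t \<in> {1..n}" using t S by auto
    have "t \<noteq> j" using t by auto
    have le': "wd w j s * wd w t l \<le> wd w j t * wd w s l" if "s \<in> ?S" for s
      using le t that by auto
    \<comment> \<open>If w_jt vanished, maximality of t compared with s = i would force w_tl = 0,
      and the relation for i, t, j, l would fail.\<close>
    have nz: "wd w j t \<noteq> 0"
    proof
      assume 0: "wd w j t = 0"
      then have "t \<noteq> i" using wd_ij[OF w] by auto
      then have "wd w i t \<noteq> 0" using nl[of t] t \<open>t \<noteq> j\<close> 0 by auto
      then have "wd w i t * wd w j l > 0" using False nn[of i t] nn[of j l] tn l ij by (simp add: less_le)
      moreover have "wd w t l \<le> 0" using le'[of i] 0 wd_ij[OF w] by simp
      moreover have "wd w i t * wd w j l \<le> max (wd w i j * wd w t l) (wd w i l * wd w t j)"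
        using plu[OF w, of i t j l] ij tn l by simp
      ultimately show False using 0 wd_ij[OF w] by (simp add: wd_swap[of w t j])
    qed
    have "{j, t} = {i, j} \<or> {j, t} \<in> D"
      using t \<open>t \<noteq> j\<close> D(4)[of t] nz by auto
    then show ?thesis using step[of j t] t nz le' False by auto
  next
    case True
    then have il: "wd w i l \<noteq> 0" using nl[of l] by simp
    have "j \<in> ?S" "wd w' i j \<noteq> 0" using wd_ij[OF w'] by simp_all
    from best_base[OF w' S this ij(1) l(1)]
    obtain t where t: "t \<in> ?S" "wd w' i t \<noteq> 0" "\<And>s. s \<in> ?S \<Longrightarrow> wd w' i s * wd w' t l \<le> wd w' i t * wd w' s l"
      by blast
    have tn: "t \<in> {1..n}" using t S by auto
    have "t \<noteq> i" using t by auto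
    have le': "wd w i s * wd w t l \<le> wd w i t * wd w s l" if "s \<in> ?S" for s
      using le t that by auto
    \<comment> \<open>Maximality of t compared with s = j, where the right side vanishes.\<close>
    have tl: "wd w t l = 0" using le'[of j] True wd_ij[OF w] nn[of t l] tn l by simp
    have jt: "wd w j t = 0"
    proof (rule ccontr)
      assume "wd w j t \<noteq> 0"
      then have "wd w j t * wd w i l > 0" using il nn[of j t] nn[of i l] tn l ij by (simp add: less_le)
      moreover have "wd w j t * wd w i l \<le> max (wd w j i * wd w t l) (wd w j l * wd w t i)"
        using plu[OF w, of j t i l] ij tn l by simp
      ultimately show False using tl True by simp
    qed
    have it: "wd w i t \<noteq> 0" using jt nl[of t] t \<open>t \<noteq> i\<close> wd_ij[OF w] by (cases "t = j") auto
    have "{i, t} = {i, j} \<or> {i, t} \<in> D"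
      using t \<open>t \<noteq> i\<close> D(3)[of t] jt by auto
    then show ?thesis using step[of i t] t it le' True by auto
  qed
qed

text \<open>All labels but those with both coordinates vanishing at \<open>w\<close> are introduced
  by a common system. The remaining ones are attached to i, j for \<open>w\<close> and freely for
  \<open>w'\<close>; the two coordinates added for \<open>w\<close> have weight zero there.\<close>

lemma adapted_near:
  assumes w: "tplu w" and w': "tplu w'" and near: "near w w'"
  shows "\<exists>D D'. adapted n i j w {1..n} D \<and> adapted n i j w' {1..n} D' \<and> {e \<in> D. w e \<noteq> 0} \<subseteq> D'"
proof -
  define N where "N = {l \<in> {1..n} - {i, j}. wd w i l \<noteq> 0 \<or> wd w j l \<noteq> 0}"
  define L where "L = {l \<in> {1..n} - {i, j}. wd w i l = 0 \<and> wd w j l = 0}"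
  have N: "finite N" "N \<subseteq> {1..n} - {i, j}" "\<And>l. l \<in> N \<Longrightarrow> wd w i l \<noteq> 0 \<or> wd w j l \<noteq> 0"
    by (auto simp: N_def)
  obtain D0 where D0: "adapted n i j w ({i, j} \<union> N) D0" "adapted n i j w' ({i, j} \<union> N) D0"
    "\<forall>t\<in>N. (wd w j t = 0 \<longrightarrow> {i, t} \<in> D0) \<and> (wd w j t \<noteq> 0 \<longrightarrow> {j, t} \<in> D0)"
    using adapted_near_nonloops[OF assms N] by blast
  have "\<exists>D D'. adapted n i j w ({i, j} \<union> N \<union> K) D \<and> adapted n i j w' ({i, j} \<union> N \<union> K) D' \<and>
     {e \<in> D. w e \<noteq> 0} \<subseteq> D' \<and> (\<forall>t\<in>({i, j} \<union> N \<union> K) - {i, j}. {i, t} \<in> D' \<or> {j, t} \<in> D')"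
    if "finite K" "K \<subseteq> L" for K using that
  proof (induction K rule: finite_induct)
    case empty
    have inv: "\<forall>t\<in>({i, j} \<union> N) - {i, j}. {i, t} \<in> D0 \<or> {j, t} \<in> D0" using D0(3) by blast
    have "{e \<in> D0. w e \<noteq> 0} \<subseteq> D0" by auto
    show ?case unfolding Un_empty_right
      by (rule exI[of _ D0], rule exI[of _ D0]) (intro conjI D0(1,2) inv \<open>{e \<in> D0. w e \<noteq> 0} \<subseteq> D0\<close>)
  next
    case (insert l K)
    let ?S = "{i, j} \<union> N \<union> K"
    have "K \<subseteq> L" using insert.prems by simp
    from insert.IH[OF this] obtain D D' where D: "adapted n i j w ?S D" "adapted n i j w' ?S D'"
      "{e \<in> D. w e \<noteq> 0} \<subseteq> D'" "\<forall>t\<in>?S - {i, j}. {i, t} \<in> D' \<or> {j, t} \<in> D'"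
      by (elim exE conjE)
    have l: "l \<in> {1..n}" "l \<notin> ?S" "wd w i l = 0" "wd w j l = 0" using insert by (auto simp: L_def N_def)
    have S: "?S \<subseteq> {1..n}" using adapted_basic[OF D(1)] by auto
    have a: "adapted n i j w (insert l ?S) (insert {i, l} (insert {j, l} D))"
    proof (rule adapted.step[OF D(1) l(1,2)])
      show "wd w s l * wd w i j = max (wd w i l * wd w s j) (wd w j l * wd w s i)" if "s \<in> ?S" for s
        using zero_condition[OF w] that S l by blast
    qed (use wd_ij[OF w] in auto)
    obtain D'' where D'': "adapted n i j w' (insert l ?S) D''" "D' \<subseteq> D''"
      "\<forall>t\<in>insert l ?S - {i, j}. {i, t} \<in> D'' \<or> {j, t} \<in> D''"
      using adapted_add_any[OF w' D(2) D(4) l(1,2)] by (elim exE conjE)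
    have "w {i, l} = 0" "w {j, l} = 0" using l by (auto simp: wd_def)
    then have sub: "{e \<in> insert {i, l} (insert {j, l} D). w e \<noteq> 0} \<subseteq> D''" using D(3) D''(2) by auto
    have eq: "{i, j} \<union> N \<union> insert l K = insert l ?S" by auto
    show ?case unfolding eq 
      by (rule exI[of _ "insert {i, l} (insert {j, l} D)"], rule exI[of _ D''], intro conjI; fact)
  qed
  from this[of L] obtain D D' where "adapted n i j w ({i, j} \<union> N \<union> L) D" "adapted n i j w' ({i, j} \<union> N \<union> L) D'"
    "{e \<in> D. w e \<noteq> 0} \<subseteq> D'" by (auto simp: L_def)
  moreover have "{i, j} \<union> N \<union> L = {1..n}" using ij by (auto simp: N_def L_def)
  ultimately show ?thesis by auto
qed

section \<open>The maximal seminorm over a tropical Pluecker vector\<close>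

definition smax :: "(nat set \<Rightarrow> real) \<Rightarrow> 'k mpoly \<Rightarrow> real" where
  "smax w = (THE \<gamma>. is_max w \<gamma>)"

lemma smax_eq: "is_max w \<gamma> \<Longrightarrow> smax w = \<gamma>"
  unfolding smax_def by (rule the_equality) (auto intro: is_max_unique)

lemma tplu_nonneg: "tplu w \<Longrightarrow> e \<in> pairs n \<Longrightarrow> 0 \<le> w e" and tplu_ij: "tplu w \<Longrightarrow> w {i, j} = 1"
  by (simp_all add: tplu_def)

lemma adapted_smax:
  assumes "tplu w" "adapted n i j w {1..n} D"
  obtains \<Psi> where "presents D w \<Psi>" "is_max w (smax w)" "smax w = (\<lambda>f\<in>R. G w (\<Psi> f))"
proof -
  obtain \<Psi> where \<Psi>: "presents D w \<Psi>"
    using presentation_exists[OF assms(2)] tplu_nonneg[OF assms(1)] tplu_ij[OF assms(1)] by blast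
  then have "is_max w (\<lambda>f\<in>R. G w (\<Psi> f))" using tplu_nonneg[OF assms(1)] by (rule presents_is_max)
  then show ?thesis using that \<Psi> smax_eq by metis
qed

lemma smax_is_max:
  assumes "tplu w" shows "is_max w (smax w)"
proof -
  \<comment> \<open>Comparing \<open>w\<close> with itself yields in particular the existence of an
    adapted system.\<close>
  obtain D where "adapted n i j w {1..n} D" using adapted_near[OF assms assms near_refl] by blast
  then show ?thesis using adapted_smax[OF assms] by blast
qed

text \<open>The polynomial that represents the monomial with exponent \<open>M\<close> times
  \<open>P\<close>, provided all shifted exponents are nonnegative. It is also applied to parts of
  an expansion, which need not come from elements of the chart ring.\<close>

definition shifted :: "(nat set \<Rightarrow> nat) \<Rightarrow> 'k laurent \<Rightarrow> 'k mpoly" where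
  "shifted M P = (\<Sum>\<alpha>\<in>keys P. Const (lookup P \<alpha>) * umono (\<lambda>e. nat (lookup \<alpha> e + int (M e))))"

lemma shifted_R: "shifted M P \<in> R"
  unfolding shifted_def by (intro chart_ring_sum chart_ring_mult chart_ring_Const umono_R)

lemma shifted_add:
  assumes "keys P \<inter> keys Q = {}" shows "shifted M (P + Q) = shifted M P + shifted M Q"
proof -
  have "keys (P + Q) = keys P \<union> keys Q"
    using assms keys_add[of P Q] by (auto simp: lookup_add in_keys_iff disjoint_iff) (metis add.left_neutral add.right_neutral)+
  moreover have "lookup (P + Q) \<alpha> = lookup P \<alpha>" if "\<alpha> \<in> keys P" for \<alpha>
    using assms that by (auto simp: lookup_add in_keys_iff)
  moreover have "lookup (P + Q) \<alpha> = lookup Q \<alpha>" if "\<alpha> \<in> keys Q" for \<alpha>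
    using assms that by (auto simp: lookup_add in_keys_iff)
  ultimately show ?thesis using assms by (simp add: shifted_def sum.union_disjoint)
qed

lemma fiber_shifted_le:
  assumes \<delta>: "\<delta> \<in> fiber w" and ok: "\<And>\<alpha>. \<alpha> \<in> keys P \<Longrightarrow> okexp (pairs n) w \<alpha>"
    and nn: "\<And>\<alpha> e. \<alpha> \<in> keys P \<Longrightarrow> 0 \<le> lookup \<alpha> e + int (M e)"
  shows "\<delta> (shifted M P) \<le> wmono w M * G w P"
proof -
  have ms: "\<delta> \<in> mult_seminorms v R" using \<delta> by (simp add: fiber_def)
  have w0: "0 \<le> wmono w M" using fiber_nonneg[OF \<delta>] by (rule wmono_nonneg)
  show ?thesis
  unfolding shifted_def
proof (rule ms_sum_le[OF ms], intro conjI)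
  fix \<alpha> assume \<alpha>: "\<alpha> \<in> keys P"
  show "Const (lookup P \<alpha>) * umono (\<lambda>e. nat (lookup \<alpha> e + int (M e))) \<in> R"
    by (intro chart_ring_mult chart_ring_Const umono_R)
  have "\<delta> (Const (lookup P \<alpha>) * umono (\<lambda>e. nat (lookup \<alpha> e + int (M e))))
    = wmono w M * (v (lookup P \<alpha>) * mono_wt (pairs n) w \<alpha>)"
    using ms_mult[OF ms chart_ring_Const umono_R] ms_Const[OF ms] fiber_umono[OF \<delta>]
      wmono_shift[of w, OF ok[OF \<alpha>] nn[OF \<alpha>]] by simp
  also have "\<dots> \<le> wmono w M * G w P"
    using w0 gauss_ge by (intro mult_left_mono) auto
  finally show "\<delta> (Const (lookup P \<alpha>) * umono (\<lambda>e. nat (lookup \<alpha> e + int (M e)))) \<le> wmono w M * G w P" .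
next
  show "0 \<le> wmono w M * G w P"
    using w0 gauss_nonneg by (intro mult_nonneg_nonneg) auto
qed
qed

text \<open>In an admissible expansion each of the remaining terms carries a positive power of a
  weight that vanishes at \<open>w\<close>.\<close>

definition nzpart :: "(nat set \<Rightarrow> real) \<Rightarrow> 'k laurent \<Rightarrow> 'k laurent" where
  "nzpart w P = (\<Sum>\<alpha>\<in>{\<alpha> \<in> keys P. \<forall>e\<in>keys \<alpha>. w e \<noteq> 0}. single \<alpha> (lookup P \<alpha>))"

lemma lookup_nzpart: "lookup (nzpart w P) \<alpha> = (if \<forall>e\<in>keys \<alpha>. w e \<noteq> 0 then lookup P \<alpha> else 0)"
  by (auto simp: nzpart_def lookup_sum lookup_single when_def in_keys_iff)

lemma keys_nzpart: "keys (nzpart w P) = {\<alpha> \<in> keys P. \<forall>e\<in>keys \<alpha>. w e \<noteq> 0}"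
  by (auto simp: in_keys_iff[of _ "nzpart w P"] in_keys_iff[of _ P] lookup_nzpart split: if_splits)

lemma keys_zpart: "keys (P - nzpart w P) = {\<alpha> \<in> keys P. \<exists>e\<in>keys \<alpha>. w e = 0}"
  by (auto simp: in_keys_iff[of _ "P - nzpart w P"] in_keys_iff[of _ P] lookup_nzpart lookup_minus split: if_splits)

lemma gauss_zpart:
  assumes "\<And>\<alpha>. \<alpha> \<in> keys P \<Longrightarrow> keys \<alpha> \<subseteq> pairs n"
  shows "G w (P - nzpart w P) = 0"
proof -
  have "mono_wt (pairs n) w \<alpha> = 0" if \<alpha>: "\<alpha> \<in> keys (P - nzpart w P)" for \<alpha>
  proof -
    obtain e where "\<alpha> \<in> keys P" "e \<in> keys \<alpha>" "w e = 0" using \<alpha> by (auto simp: keys_zpart)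
    then have "e \<in> pairs n" using assms by blast
    moreover have "w e powi lookup \<alpha> e = 0"
      using \<open>e \<in> keys \<alpha>\<close> \<open>w e = 0\<close> by (simp add: power_int_0_left_if in_keys_iff)
    ultimately show ?thesis by (auto simp: mono_wt_def)
  qed
  then have "G w (P - nzpart w P) \<le> 0" unfolding gauss_le_iff by simp
  then show ?thesis using gauss_nonneg[of "pairs n" w "P - nzpart w P"] by simp
qed

text \<open>
  The terms of the expansion at \<open>w\<close> with a factor of weight zero are negligible near \<open>w\<close>, and
  the others are monomials in coordinates that are also adapted to \<open>w'\<close>.
\<close>

lemma smax_bounds:
  assumes w: "tplu w" and w': "tplu w'" and near: "near w w'"
    and D: "adapted n i j w {1..n} D" "adapted n i j w' {1..n} D'" "{e \<in> D. w e \<noteq> 0} \<subseteq> D'"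
    and \<Psi>: "presents D w \<Psi>" and f: "f \<in> R"
  shows "smax w' f \<le> G w' (\<Psi> f)"
    and "G w' (nzpart w (\<Psi> f)) - G w' (\<Psi> f - nzpart w (\<Psi> f)) \<le> smax w' f"
proof -
  let ?\<gamma> = "smax w'" and ?P = "\<Psi> f" and ?Pa = "nzpart w (\<Psi> f)" and ?Pb = "\<Psi> f - nzpart w (\<Psi> f)"
  let ?N = "invertibles n i j w D"
  have \<gamma>: "?\<gamma> \<in> fiber w'" using smax_is_max[OF w'] by (simp add: is_max_def)
  then have ms: "?\<gamma> \<in> mult_seminorms v R" by (simp add: fiber_def)
  have Dp: "D \<subseteq> pairs n" and c: "adm D ?N ?P" "EV ?P = to_frac f"
    using \<Psi> f by (auto simp: presents_def)
  have N: "?N \<subseteq> D" by (auto simp: invertibles_def)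
  have nz: "w' e \<noteq> 0" if "e \<in> ?N" for e
    using that near Dp unfolding near_def invertibles_def by auto
  show "smax w' f \<le> G w' ?P" by (rule fiber_le_gauss[OF \<Psi> \<gamma> nz f])
  have w'0: "\<And>e. e \<in> pairs n \<Longrightarrow> 0 \<le> w' e" using tplu_nonneg[OF w'] .
  obtain M where M: "\<And>e. e \<notin> ?N \<Longrightarrow> M e = 0"
    "\<And>\<alpha> e. \<alpha> \<in> keys ?P \<Longrightarrow> 0 \<le> lookup \<alpha> e + int (M e)"
    "umono M * f = shifted M ?P"
    unfolding shifted_def using clear_denominators[OF c(1) Dp N c(2)] by blast
  have pos: "wmono w' M > 0"
    unfolding wmono_def
  proof (rule prod_pos)
    fix e assume "e \<in> pairs n"
    then show "0 < w' e ^ M e" using w'0[of e] nz[of e] M(1)[of e] by (cases "e \<in> ?N") auto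
  qed
  have disj: "keys ?Pa \<inter> keys ?Pb = {}" by (auto simp: keys_nzpart keys_zpart)
  have split: "shifted M ?P = shifted M ?Pa + shifted M ?Pb"
    using shifted_add[OF disj, of M] by simp
  have ok: "okexp (pairs n) w' \<alpha> \<and> keys \<alpha> \<subseteq> pairs n" if "\<alpha> \<in> keys ?P" for \<alpha>
    by (rule adm_okexp[OF c(1) Dp nz that])
  have P1: "?\<gamma> (shifted M ?Pb) \<le> wmono w' M * G w' ?Pb"
    by (rule fiber_shifted_le[OF \<gamma>]) (use ok M(2) in \<open>auto simp: keys_zpart\<close>)
  obtain \<Psi>' where \<Psi>': "presents D' w' \<Psi>'" "?\<gamma> = (\<lambda>f\<in>R. G w' (\<Psi>' f))"
    by (rule adapted_smax[OF w' D(2)])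
  have hom: "rhom \<Psi>'" and C: "\<And>a. \<Psi>' (Const a) = single 0 a" using \<Psi>'(1) by (auto simp: presents_def)
  have MD: "M e = 0" if "e \<notin> D" for e using M(1) that N by auto
  obtain \<mu> where \<mu>: "\<And>e. lookup \<mu> e = int (M e)" using nat_fun_exponent[of D M] Dp MD by blast
  \<comment> \<open>All monomials of this part use only coordinates shared by both systems, so the
    presentation at \<open>w'\<close> maps them to the same monomials and the maximal seminorm of
    this part is known exactly.\<close>
  have "\<Psi>' (shifted M ?Pa) = (\<Sum>\<alpha>\<in>keys ?Pa. single \<mu> 1 * single \<alpha> (lookup ?Pa \<alpha>))"
    unfolding shifted_def rhom_sum[OF hom]
  proof (rule sum.cong)
    fix \<alpha> assume \<alpha>: "\<alpha> \<in> keys ?Pa"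
    then have \<alpha>P: "\<alpha> \<in> keys ?P" and \<alpha>nz: "\<And>e. e \<in> keys \<alpha> \<Longrightarrow> w e \<noteq> 0" by (auto simp: keys_nzpart)
    have "\<Psi>' (umono (\<lambda>e. nat (lookup \<alpha> e + int (M e)))) = single (\<mu> + \<alpha>) 1"
    proof (rule presents_umono[OF \<Psi>'(1)])
      fix e
      show "lookup (\<mu> + \<alpha>) e = int (nat (lookup \<alpha> e + int (M e)))"
        using M(2)[OF \<alpha>P, of e] by (simp add: lookup_add \<mu>)
      assume e: "e \<notin> D'"
      have "keys \<alpha> \<subseteq> D" using c(1) \<alpha>P by (simp add: adm_def)
      then have "keys \<alpha> \<subseteq> D'" using \<alpha>nz D(3) by blast
      then have "lookup \<alpha> e = 0" using e by (auto simp: in_keys_iff)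
      moreover have "M e = 0" using e M(1)[of e] D(3) by (auto simp: invertibles_def)
      ultimately show "nat (lookup \<alpha> e + int (M e)) = 0" by simp
    qed
    then show "\<Psi>' (Const (lookup ?Pa \<alpha>) * umono (\<lambda>e. nat (lookup \<alpha> e + int (M e))))
      = single \<mu> 1 * single \<alpha> (lookup ?Pa \<alpha>)" by (simp add: mult_single rhom_simps[OF hom] C)
  qed simp
  also have "\<dots> = single \<mu> 1 * ?Pa" by (simp add: sum_single flip: sum_distrib_left)
  finally have "?\<gamma> (shifted M ?Pa) = G w' (single \<mu> 1 * ?Pa)" by (simp add: \<Psi>'(2) shifted_R)
  also have "\<dots> = G w' (single \<mu> 1) * G w' ?Pa"
  proof (rule gauss_mult[OF w'0 finite_pair])
    fix \<alpha>
    show "okexp (pairs n) w' \<alpha> \<and> keys \<alpha> \<subseteq> pairs n" if "\<alpha> \<in> keys ?Pa"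
      using that by (intro ok) (auto simp: keys_nzpart)
    show "okexp (pairs n) w' \<alpha> \<and> keys \<alpha> \<subseteq> pairs n" if "\<alpha> \<in> keys (single \<mu> (1::'k))"
    proof -
      have "M e = 0" if "e \<notin> pairs n" for e using that MD Dp by blast
      then show ?thesis using that by (auto simp: okexp_def \<mu> in_keys_iff) (metis less_irrefl)
    qed
  qed
  also have "G w' (single \<mu> 1) = wmono w' M"
    using gauss_single[of "pairs n" w' \<mu> 1, OF w'0] by (simp add: mono_wt_def wmono_def \<mu>)
  finally have P0: "?\<gamma> (shifted M ?Pa) = wmono w' M * G w' ?Pa" .
  have "?\<gamma> (shifted M ?P) = wmono w' M * ?\<gamma> f"
    using ms_mult[OF ms umono_R[of M] f] fiber_umono[OF \<gamma>, of M] M(3) by simp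
  \<comment> \<open>The reverse triangle inequality separates the two parts.\<close>
  moreover have "?\<gamma> (shifted M ?Pa) \<le> ?\<gamma> (shifted M ?P) + ?\<gamma> (shifted M ?Pb)"
  proof -
    have "shifted M ?Pa = shifted M ?P + - shifted M ?Pb" using split by simp
    then show ?thesis
      using ms_triangle[OF ms shifted_R[of M ?P] chart_ring_uminus[OF shifted_R[of M ?Pb]]]
        ms_uminus[OF ms shifted_R[of M ?Pb]] by simp
  qed
  ultimately have "wmono w' M * G w' ?Pa \<le> wmono w' M * (?\<gamma> f + G w' ?Pb)"
    using P0 P1 by (simp add: algebra_simps)
  then show "G w' ?Pa - G w' ?Pb \<le> smax w' f" using pos by simp
qed

text \<open>The system \<open>D\<close> for which the bounds hold depends on x, but only finitely
  many systems exist, so finitely many conditions on a neighbourhood suffice.\<close>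

lemma tendsto_smax:
  assumes lim: "\<And>e. e \<in> pairs n \<Longrightarrow> ((\<lambda>x. W x e) \<longlongrightarrow> w e) F" and w: "tplu w"
    and ev: "eventually (\<lambda>x. tplu (W x)) F" and f: "f \<in> R"
  shows "((\<lambda>x. smax (W x) f) \<longlongrightarrow> smax w f) F"
proof (rule tendstoI)
  fix \<epsilon> :: real assume \<epsilon>: "\<epsilon> > 0"
  define \<D> where "\<D> = {D. D \<subseteq> pairs n \<and> adapted n i j w {1..n} D}"
  have fin: "finite \<D>" unfolding \<D>_def by (rule finite_subset[of _ "Pow (pairs n)"]) auto
  have "\<exists>\<Psi>. presents D w \<Psi> \<and> smax w = (\<lambda>f\<in>R. G w (\<Psi> f))" if D: "D \<in> \<D>" for D
  proof -
    have "adapted n i j w {1..n} D" using D by (simp add: \<D>_def)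
    from adapted_smax[OF w this] show ?thesis by blast
  qed
  then obtain \<Psi> where \<Psi>: "\<And>D. D \<in> \<D> \<Longrightarrow> presents D w (\<Psi> D) \<and> smax w = (\<lambda>f\<in>R. G w (\<Psi> D f))" by metis
  have bounds: "eventually (\<lambda>x. G (W x) (\<Psi> D f) < smax w f + \<epsilon> \<and>
      smax w f - \<epsilon> < G (W x) (nzpart w (\<Psi> D f)) - G (W x) (\<Psi> D f - nzpart w (\<Psi> D f))) F" if D: "D \<in> \<D>" for D
  proof -
    let ?P = "\<Psi> D f" and ?Pa = "nzpart w (\<Psi> D f)" and ?Pb = "\<Psi> D f - nzpart w (\<Psi> D f)"
    have c: "adm D (invertibles n i j w D) ?P" "D \<subseteq> pairs n" using \<Psi>[OF D] f by (auto simp: presents_def)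
    have ok: "okexp (pairs n) w \<alpha> \<and> keys \<alpha> \<subseteq> pairs n" if "\<alpha> \<in> keys ?P" for \<alpha>
      by (rule adm_okexp[OF c _ that]) (simp add: invertibles_def)
    have l: "((\<lambda>x. G (W x) Q) \<longlongrightarrow> G w Q) F" if "keys Q \<subseteq> keys ?P" for Q
      by (rule tendsto_gauss) (use lim ok that in auto)
    have z: "G w ?Pb = 0" by (rule gauss_zpart) (use ok in blast)
    have s: "smax w f = G w ?P" using \<Psi>[OF D] f by (metis (no_types, lifting) restrict_apply)
    have "G w (?Pa + ?Pb) = max (G w ?Pa) (G w ?Pb)"
      by (rule gauss_add_disjoint) (auto simp: keys_nzpart keys_zpart)
    \<comment> \<open>At \<open>w\<close> itself the discarded part has norm 0, so the upper and the
      lower bound have the same limit.\<close>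
    then have s0: "smax w f = G w ?Pa - G w ?Pb" using s z gauss_nonneg[of "pairs n" w ?Pa] by simp
    have "((\<lambda>x. G (W x) ?P) \<longlongrightarrow> smax w f) F" unfolding s by (rule l) simp
    then have 1: "eventually (\<lambda>x. G (W x) ?P < smax w f + \<epsilon>) F" by (rule order_tendstoD) (use \<epsilon> in simp)
    have "((\<lambda>x. G (W x) ?Pa - G (W x) ?Pb) \<longlongrightarrow> smax w f) F"
      unfolding s0 by (intro tendsto_diff l) (auto simp: keys_nzpart keys_zpart)
    then have 2: "eventually (\<lambda>x. smax w f - \<epsilon> < G (W x) ?Pa - G (W x) ?Pb) F"
      by (rule order_tendstoD) (use \<epsilon> in simp)
    from 1 2 show ?thesis by eventually_elim simp
  qed
  have near: "eventually (\<lambda>x. near w (W x)) F" using lim by (rule eventually_near)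
  have "eventually (\<lambda>x. \<forall>D\<in>\<D>. G (W x) (\<Psi> D f) < smax w f + \<epsilon> \<and>
      smax w f - \<epsilon> < G (W x) (nzpart w (\<Psi> D f)) - G (W x) (\<Psi> D f - nzpart w (\<Psi> D f))) F"
    using fin bounds by (intro eventually_ball_finite ballI)
  then show "eventually (\<lambda>x. dist (smax (W x) f) (smax w f) < \<epsilon>) F"
    using ev near
  proof eventually_elim
    case (elim x)
    obtain D D' where D: "adapted n i j w {1..n} D" "adapted n i j (W x) {1..n} D'" "{e \<in> D. w e \<noteq> 0} \<subseteq> D'"
      using adapted_near[OF w elim(2,3)] by blast
    have "D \<in> \<D>" using D(1) adapted_basic[OF D(1)] by (simp add: \<D>_def)
    then have "smax (W x) f \<le> G (W x) (\<Psi> D f)"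
      "G (W x) (nzpart w (\<Psi> D f)) - G (W x) (\<Psi> D f - nzpart w (\<Psi> D f)) \<le> smax (W x) f"
      using smax_bounds[OF w elim(2,3) D _ f] \<Psi> by blast+
    then show ?case using elim(1) \<open>D \<in> \<D>\<close> by (fastforce simp: dist_real_def abs_less_iff)
  qed
qed

end

section \<open>Separation in trees\<close>

definition adj :: "nat set set \<Rightarrow> (nat \<times> nat) set" where
  "adj E = {(x, y). {x, y} \<in> E}"

lemma adj_sym: "(x, y) \<in> (adj E)\<^sup>* \<Longrightarrow> (y, x) \<in> (adj E)\<^sup>*"
proof (induction rule: rtrancl_induct)
  case (step y z)
  then have "(z, y) \<in> adj E" by (simp add: adj_def insert_commute)
  then show ?case using step.IH by (rule converse_rtrancl_into_rtrancl)
qed simp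

lemma successively_prefix: "successively P (xs @ z # ys) \<Longrightarrow> successively P (xs @ [z])"
  by (auto simp: successively_append_iff)

lemma rtrancl_imp_simple_path:
  assumes "(a, b) \<in> (adj E)\<^sup>*"
  shows "\<exists>p. p \<noteq> [] \<and> hd p = a \<and> last p = b \<and> distinct p \<and> successively (\<lambda>c d. {c, d} \<in> E) p"
  using assms
proof (induction rule: rtrancl_induct)
  case base
  show ?case by (rule exI[of _ "[a]"]) simp
next
  case (step y z)
  then obtain p where p: "p \<noteq> []" "hd p = a" "last p = y" "distinct p" "successively (\<lambda>c d. {c, d} \<in> E) p" by blast
  show ?case
  proof (cases "z \<in> set p")
    case True
    then obtain xs ys where "p = xs @ z # ys" by (auto dest: split_list)
    then show ?thesis using p successively_prefix[of _ xs z ys]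
      by (intro exI[of _ "xs @ [z]"]) (cases xs; auto)
  next
    case False
    then show ?thesis using p step.hyps(2)
      by (intro exI[of _ "p @ [z]"]) (auto simp: successively_append_iff adj_def)
  qed
qed

lemma nth_rtrancl:
  assumes "k \<le> m" "\<And>q. k \<le> q \<Longrightarrow> q < m \<Longrightarrow> {p ! q, p ! Suc q} \<in> E"
  shows "(p ! k, p ! m) \<in> (adj E)\<^sup>*"
  using assms
proof (induction m)
  case (Suc m)
  show ?case
  proof (cases "k = Suc m")
    case False
    then have "(p ! k, p ! m) \<in> (adj E)\<^sup>*" using Suc by auto
    moreover have "(p ! m, p ! Suc m) \<in> adj E" using Suc False by (simp add: adj_def)
    ultimately show ?thesis by (rule rtrancl_into_rtrancl)
  qed simp
qed simp

lemma is_path_nth: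
  assumes "is_path T a b p"
  shows "p \<noteq> []" "p ! 0 = a" "p ! (length p - 1) = b" "distinct p" "set p \<subseteq> gverts T"
    "\<And>m. Suc m < length p \<Longrightarrow> {p ! m, p ! Suc m} \<in> gedges T"
  using assms by (auto simp: is_path_def hd_conv_nth last_conv_nth successively_conv_nth)

lemma is_path_rev: "is_path T a b p \<Longrightarrow> is_path T b a (rev p)"
  by (auto simp: is_path_def hd_rev last_rev successively_rev insert_commute)

lemma is_path_take:
  assumes "is_path T a b p" "m < length p" shows "is_path T a (p ! m) (take (Suc m) p)"
proof -
  have "set (take (Suc m) p) \<subseteq> gverts T"
    by (rule order_trans[OF set_take_subset is_path_nth(5)[OF assms(1)]])
  moreover have "successively (\<lambda>c d. {c, d} \<in> gedges T) (take (Suc m) p)"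
    using is_path_nth(6)[OF assms(1)] assms(2) by (auto simp: successively_conv_nth)
  moreover have "take (Suc m) p \<noteq> []" using is_path_nth(1)[OF assms(1)] by simp
  moreover from this have "hd (take (Suc m) p) = a" using is_path_nth(2)[OF assms(1)] by (simp add: hd_conv_nth)
  moreover have "last (take (Suc m) p) = p ! m" by (simp add: take_Suc_conv_app_nth[OF assms(2)])
  moreover have "distinct (take (Suc m) p)" using is_path_nth(4)[OF assms(1)] by (rule distinct_take)
  ultimately show ?thesis by (simp add: is_path_def)
qed

lemma path_edges_subset: "f \<in> path_edges p \<Longrightarrow> f \<subseteq> set p"
  by (auto simp: path_edges_def)

lemma distinct_consecutive:
  assumes "distinct p" "Suc m < length p" "Suc q < length p" "{p ! m, p ! Suc m} = {p ! q, p ! Suc q}"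
  shows "m = q"
  using assms by (auto simp: doubleton_eq_iff nth_eq_iff_index_eq)

locale utree =
  fixes T :: ugraph
  assumes simple: "simple_graph T" and conn: "connected_graph T" and acyc: "acyclic_graph T"
begin

abbreviation "V \<equiv> gverts T"
abbreviation "E \<equiv> gedges T"

text \<open>Paths, branches and quartets are all described below by the splits that edges induce on
  vertices.\<close>

definition sep :: "nat set \<Rightarrow> nat \<Rightarrow> nat \<Rightarrow> bool" where
  "sep e a b \<longleftrightarrow> (a, b) \<notin> (adj (E - {e}))\<^sup>*"

lemma edgeE:
  assumes "e \<in> E" obtains a b where "e = {a, b}" "a \<in> V" "b \<in> V" "a \<noteq> b"
  using assms simple unfolding simple_graph_def by blast

lemma finite_E: "finite E"
proof -
  have V: "finite V" using simple by (simp add: simple_graph_def)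
  have "E \<subseteq> Pow V" using simple unfolding simple_graph_def by blast
  then show "finite E" using V by (meson finite_Pow_iff finite_subset)
qed

lemma edge_not_subset_singleton: "e \<in> E \<Longrightarrow> \<not> e \<subseteq> {x}"
  by (elim edgeE) auto

lemma sep_sym: "sep e a b \<longleftrightarrow> sep e b a"
  unfolding sep_def using adj_sym by blast

lemma sep_same [simp]: "\<not> sep e a a"
  by (simp add: sep_def)

text \<open>A simple path between the ends of an edge that avoids the edge would close up to a
  cycle.\<close>

lemma bridge:
  assumes "{c, d} \<in> E" shows "sep {c, d} c d"
proof (rule ccontr)
  assume "\<not> sep {c, d} c d"
  then have "(c, d) \<in> (adj (E - {{c, d}}))\<^sup>*" by (simp add: sep_def)
  then obtain p where p: "p \<noteq> []" "hd p = c" "last p = d" "distinct p"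
    "successively (\<lambda>x y. {x, y} \<in> E - {{c, d}}) p"
    using rtrancl_imp_simple_path by blast
  have "c \<noteq> d" using assms by (elim edgeE) auto
  have "length p \<ge> 3"
  proof (rule ccontr)
    assume "\<not> 3 \<le> length p"
    moreover have "length p > 0" using p(1) by simp
    ultimately consider "length p = 1" | "length p = 2" by linarith
    then show False
    proof cases
      case 1 then show ?thesis using p \<open>c \<noteq> d\<close> by (auto simp: length_Suc_conv)
    next
      case 2
      then obtain x y where "p = [x, y]" by (auto simp: length_Suc_conv numeral_2_eq_2)
      then show ?thesis using p by auto
    qed
  qed
  moreover have "successively (\<lambda>x y. {x, y} \<in> E) p" using p(5) by (rule successively_mono) auto
  moreover have "{last p, hd p} \<in> E" using assms p(2,3) by (simp add: insert_commute)
  ultimately show False using acyc p(4) unfolding acyclic_graph_def by blast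
qed

text \<open>Walk from one end along a path: each step stays on its side unless it is the edge
  itself, and then it arrives at an end.\<close>

lemma sep_two_sides:
  assumes "e = {c, d}" "a \<in> V" "c \<in> V"
  shows "\<not> sep e c a \<or> \<not> sep e d a"
proof -
  obtain p where p: "is_path T c a p" using conn assms by (auto simp: connected_graph_def)
  have "(c, p ! m) \<in> (adj (E - {e}))\<^sup>* \<or> (d, p ! m) \<in> (adj (E - {e}))\<^sup>*" if "m < length p" for m
    using that
  proof (induction m)
    case 0 then show ?case using is_path_nth(2)[OF p] by simp
  next
    case (Suc m)
    then have IH: "(c, p ! m) \<in> (adj (E - {e}))\<^sup>* \<or> (d, p ! m) \<in> (adj (E - {e}))\<^sup>*" by simp
    show ?case
    proof (cases "{p ! m, p ! Suc m} = e")
      case True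
      then have "p ! Suc m = c \<or> p ! Suc m = d" using assms(1) by (auto simp: doubleton_eq_iff)
      then show ?thesis by auto
    next
      case False
      then have "(p ! m, p ! Suc m) \<in> adj (E - {e})"
        using is_path_nth(6)[OF p Suc.prems] by (simp add: adj_def)
      then show ?thesis using IH by (meson rtrancl_into_rtrancl)
    qed
  qed
  from this[of "length p - 1"] show ?thesis
    using is_path_nth(1,3)[OF p] by (auto simp: sep_def)
qed

lemma not_sep_trans: "\<not> sep e a b \<Longrightarrow> \<not> sep e b c \<Longrightarrow> \<not> sep e a c"
  unfolding sep_def by (meson not_not rtrancl_trans)

text \<open>Removing an edge leaves exactly two sides, so separation is additive modulo 2.\<close>

lemma sep_xor:
  assumes "e \<in> E" "a \<in> V" "b \<in> V" "c \<in> V"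
  shows "sep e a c \<longleftrightarrow> sep e a b \<noteq> sep e b c"
proof -
  obtain x y where e: "e = {x, y}" "x \<in> V" "y \<in> V" using assms(1) by (rule edgeE)
  have "\<not> sep e x z \<or> \<not> sep e y z" if "z \<in> V" for z using sep_two_sides[OF e(1) that e(2)] .
  then show ?thesis using assms not_sep_trans sep_sym by metis
qed

text \<open>An edge of the path is a bridge whose ends are tied to a and b by the rest of the path;
  an edge off the path leaves the path intact.\<close>

lemma path_edges_eq:
  assumes p: "is_path T a b p" shows "path_edges p = {e \<in> E. sep e a b}"
proof (rule set_eqI)
  note pn = is_path_nth[OF p]
  fix e
  show "e \<in> path_edges p \<longleftrightarrow> e \<in> {e \<in> E. sep e a b}"
  proof (cases "e \<in> path_edges p")
    case True
    then obtain m where m: "Suc m < length p" "e = {p ! m, p ! Suc m}" by (auto simp: path_edges_def)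
    have eE: "e \<in> E" using pn(6) m by simp
    have av: "{p ! q, p ! Suc q} \<in> E - {e}" if "Suc q < length p" "q \<noteq> m" for q
      using pn(6)[OF that(1)] distinct_consecutive[OF pn(4) that(1) m(1)] that(2) m(2) by auto
    have "(p ! 0, p ! m) \<in> (adj (E - {e}))\<^sup>*" by (rule nth_rtrancl) (use m av in auto)
    moreover have "(p ! Suc m, p ! (length p - 1)) \<in> (adj (E - {e}))\<^sup>*"
      by (rule nth_rtrancl) (use m av in auto)
    ultimately have "\<not> sep e a (p ! m)" "\<not> sep e (p ! Suc m) b" using pn by (auto simp: sep_def)
    moreover have "sep e (p ! m) (p ! Suc m)" using bridge eE m(2) by simp
    ultimately have "sep e a b" using not_sep_trans sep_sym by metis
    then show ?thesis using True eE by simp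
  next
    case False
    have "(p ! 0, p ! (length p - 1)) \<in> (adj (E - {e}))\<^sup>*"
    proof (rule nth_rtrancl)
      fix q assume "q < length p - 1"
      then have q: "Suc q < length p" by simp
      then have "{p ! q, p ! Suc q} \<in> path_edges p" by (auto simp: path_edges_def)
      then show "{p ! q, p ! Suc q} \<in> E - {e}" using False pn(6)[OF q] by auto
    qed simp
    then show ?thesis using False pn by (simp add: sep_def)
  qed
qed

text \<open>Both paths have the same edges by \<open>path_edges_eq\<close>, and the first edge is
  the only one of a path that contains its starting vertex.\<close>

lemma path_unique: "is_path T a b p \<Longrightarrow> is_path T a b q \<Longrightarrow> p = q"
proof (induction p arbitrary: a q)
  case (Cons x p)
  have x: "x = a" using Cons.prems by (simp add: is_path_def)
  obtain q' where q': "q = a # q'" using Cons.prems(2) by (cases q) (auto simp: is_path_def)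
  show ?case
  proof (cases p)
    case Nil
    then have "b = a" using Cons.prems x by (auto simp: is_path_def)
    then show ?thesis using Cons.prems(2) Nil x q' by (cases "q' = []") (auto simp: is_path_def)
  next
    case (Cons c p')
    have "last p \<in> set p" using Cons by (intro last_in_set) simp
    moreover have "b = last p" "a \<notin> set p" using Cons.prems(1) x Cons by (auto simp: is_path_def)
    ultimately have "a \<noteq> b" by auto
    then obtain d q'' where q'': "q' = d # q''" using Cons.prems(2) q' by (cases q') (auto simp: is_path_def)
    have "{a, c} \<in> path_edges (x # p)" using Cons x by (force simp: path_edges_def)
    then have "{a, c} \<in> path_edges q" using path_edges_eq[OF Cons.prems(1)] path_edges_eq[OF Cons.prems(2)] by simp
    then obtain m where m: "Suc m < length q" "{a, c} = {q ! m, q ! Suc m}" by (auto simp: path_edges_def)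
    have dq: "distinct q" "q ! 0 = a" using is_path_nth[OF Cons.prems(2)] by auto
    have "m = 0"
    proof (rule ccontr)
      assume "m \<noteq> 0"
      moreover have "a \<in> {q ! m, q ! Suc m}" using m(2) by auto
      moreover from \<open>m \<noteq> 0\<close> have "q ! m \<noteq> q ! 0" "q ! Suc m \<noteq> q ! 0"
        using m(1) is_path_nth(1)[OF Cons.prems(2)] nth_eq_iff_index_eq[OF dq(1), of m 0] nth_eq_iff_index_eq[OF dq(1), of "Suc m" 0] by auto
      ultimately show False using dq(2) by auto
    qed
    then have "c = d" using m(2) q' q'' \<open>a \<noteq> b\<close> by (auto simp: doubleton_eq_iff)
    have "is_path T c b p" using Cons.prems(1) Cons by (auto simp: is_path_def)
    moreover have "is_path T c b q'" using Cons.prems(2) q' q'' \<open>c = d\<close> by (auto simp: is_path_def)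
    ultimately show ?thesis using Cons.IH x q' by blast
  qed
qed (simp add: is_path_def)

lemma tpath_eq: "is_path T a b p \<Longrightarrow> tpath T a b = p"
  unfolding tpath_def by (rule the_equality) (auto intro: path_unique)

lemma tpath: "a \<in> V \<Longrightarrow> b \<in> V \<Longrightarrow> is_path T a b (tpath T a b)"
  using conn tpath_eq unfolding connected_graph_def by metis

lemma tpath_edges: "a \<in> V \<Longrightarrow> b \<in> V \<Longrightarrow> path_edges (tpath T a b) = {e \<in> E. sep e a b}"
  by (rule path_edges_eq[OF tpath])

lemma tpath_subset: "a \<in> V \<Longrightarrow> b \<in> V \<Longrightarrow> set (tpath T a b) \<subseteq> V"
  using is_path_nth(5)[OF tpath] .

lemma sep_edge_in_path: "e \<in> E \<Longrightarrow> sep e a b \<Longrightarrow> a \<in> V \<Longrightarrow> b \<in> V \<Longrightarrow> e \<subseteq> set (tpath T a b)"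
  using path_edges_subset[of e "tpath T a b"] tpath_edges by auto

lemma ends_in_path: "a \<in> V \<Longrightarrow> b \<in> V \<Longrightarrow> a \<in> set (tpath T a b) \<and> b \<in> set (tpath T a b)"
  using tpath[of a b] unfolding is_path_def by (metis hd_in_set last_in_set)

lemma not_sep_on_path:
  assumes "a \<in> V" "b \<in> V" "x \<in> set (tpath T a b)" "\<not> sep e a b" "e \<in> E"
  shows "\<not> sep e a x"
proof -
  let ?p = "tpath T a b"
  note pn = is_path_nth[OF tpath[OF assms(1,2)]]
  obtain m where m: "m < length ?p" "?p ! m = x" using assms(3) by (auto simp: in_set_conv_nth)
  have "e \<notin> path_edges ?p" using tpath_edges assms by simp
  then have "(?p ! 0, ?p ! m) \<in> (adj (E - {e}))\<^sup>*"
    using pn(6) m(1) by (intro nth_rtrancl) (auto simp: path_edges_def)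
  then show ?thesis using pn m by (simp add: sep_def)
qed

text \<open>Take the first vertex of the path from x to a that lies on the path from a to b.\<close>

lemma gate:
  assumes "x \<in> V" "a \<in> V" "b \<in> V"
  obtains w where "w \<in> set (tpath T a b)" "set (tpath T x w) \<inter> set (tpath T a b) = {w}"
proof -
  let ?q = "tpath T x a"
  have q: "is_path T x a ?q" using assms by (simp add: tpath)
  have "\<exists>y\<in>set ?q. y \<in> set (tpath T a b)" using ends_in_path assms by blast
  then obtain xs w ys where w: "?q = xs @ w # ys" "w \<in> set (tpath T a b)" "\<forall>y\<in>set xs. y \<notin> set (tpath T a b)"
    using split_list_first_prop[of ?q "\<lambda>y. y \<in> set (tpath T a b)"] by auto
  have "is_path T x w (xs @ [w])"
    using q successively_prefix[of _ xs w ys] unfolding w(1) by (cases xs) (auto simp: is_path_def)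
  then have "tpath T x w = xs @ [w]" by (rule tpath_eq)
  then show ?thesis using that[OF w(2)] w by auto
qed

lemma sep_exists:
  assumes "a \<in> V" "b \<in> V" "a \<noteq> b" shows "\<exists>e\<in>E. sep e a b"
proof -
  note pn = is_path_nth[OF tpath[OF assms(1,2)]]
  have "Suc 0 < length (tpath T a b)"
  proof (rule ccontr)
    assume "\<not> Suc 0 < length (tpath T a b)"
    then have "length (tpath T a b) - 1 = 0" by simp
    then show False using pn(2,3) assms(3) by simp
  qed
  then have "path_edges (tpath T a b) \<noteq> {}" by (auto simp: path_edges_def)
  then show ?thesis using tpath_edges assms by auto
qed

text \<open>If x is off the path, an edge between x and its gate separates x from both ends.\<close>

lemma on_path_iff:
  assumes "a \<in> V" "b \<in> V" "x \<in> V"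
  shows "x \<in> set (tpath T a b) \<longleftrightarrow> (\<forall>e\<in>E. \<not> (sep e a x \<and> sep e x b))"
proof
  assume x: "x \<in> set (tpath T a b)"
  show "\<forall>e\<in>E. \<not> (sep e a x \<and> sep e x b)"
    using not_sep_on_path[OF assms(1,2) x] sep_xor[OF _ assms(1,3,2)] by blast
next
  assume *: "\<forall>e\<in>E. \<not> (sep e a x \<and> sep e x b)"
  obtain w where w: "w \<in> set (tpath T a b)" "set (tpath T x w) \<inter> set (tpath T a b) = {w}"
    using gate assms by blast
  have wV: "w \<in> V" using w tpath_subset assms by blast
  show "x \<in> set (tpath T a b)"
  proof (cases "x = w")
    case False
    then obtain e where e: "e \<in> E" "sep e x w" using sep_exists assms wV by blast
    have "\<not> sep e a b"
    proof
      assume "sep e a b"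
      then have "e \<subseteq> set (tpath T x w) \<inter> set (tpath T a b)"
        using sep_edge_in_path e assms wV by auto
      then show False using w(2) edge_not_subset_singleton[OF e(1)] by simp
    qed
    then have "\<not> sep e a w" using not_sep_on_path[OF assms(1,2) w(1)] e by blast
    then have "sep e a x" "sep e x b"
      using sep_xor[OF e(1)] assms wV e(2) \<open>\<not> sep e a b\<close> sep_sym by metis+
    then show ?thesis using * e by blast
  qed (use w in simp)
qed

lemma first_edge:
  assumes "a \<in> V" "b \<in> V" "a \<noteq> b"
  obtains f where "f \<in> E" "a \<in> f" "sep f a b"
proof -
  let ?p = "tpath T a b"
  note pn = is_path_nth[OF tpath[OF assms(1,2)]]
  have len: "Suc 0 < length ?p"
  proof (rule ccontr)
    assume "\<not> Suc 0 < length ?p"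
    then have "length ?p - 1 = 0" by simp
    then show False using pn(2,3) assms(3) by simp
  qed
  then have "{?p ! 0, ?p ! Suc 0} \<in> path_edges ?p" by (auto simp: path_edges_def)
  then show ?thesis using that tpath_edges assms pn(2) by auto
qed

lemma first_edge_unique:
  assumes "f \<in> E" "g \<in> E" "a \<in> f" "a \<in> g" "sep f a b" "sep g a b" "a \<in> V" "b \<in> V"
  shows "f = g"
proof -
  let ?p = "tpath T a b"
  note pn = is_path_nth[OF tpath[OF assms(7,8)]]
  have "h = {?p ! 0, ?p ! Suc 0}" if "h \<in> E" "a \<in> h" "sep h a b" for h
  proof -
    have "h \<in> path_edges ?p" using that tpath_edges assms by simp
    then obtain m where m: "Suc m < length ?p" "h = {?p ! m, ?p ! Suc m}" by (auto simp: path_edges_def)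
    have "m = 0"
    proof (rule ccontr)
      assume "m \<noteq> 0"
      then have "?p ! m \<noteq> ?p ! 0" "?p ! Suc m \<noteq> ?p ! 0"
        using m(1) pn(1) \<open>m \<noteq> 0\<close> nth_eq_iff_index_eq[OF pn(4), of m 0] nth_eq_iff_index_eq[OF pn(4), of "Suc m" 0] by auto
      then show False using that(2) m(2) pn(2) by auto
    qed
    then show ?thesis using m by simp
  qed
  then show ?thesis using assms by metis
qed

text \<open>Splits of a tree never cross: an end of f lies on the path from a to b and on the path
  from c to d, and neither path uses e.\<close>

lemma split_compat:
  assumes "e \<in> E" "f \<in> E" "a \<in> V" "b \<in> V" "c \<in> V" "d \<in> V"
    and "\<not> sep e a b" "\<not> sep e c d" "sep f a b" "sep f c d"
  shows "\<not> sep e a c"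
proof -
  obtain x y where f: "f = {x, y}" using assms(2) by (rule edgeE)
  have "x \<in> set (tpath T a b)" "x \<in> set (tpath T c d)"
    using sep_edge_in_path assms f by blast+
  then have "\<not> sep e a x" "\<not> sep e c x" using not_sep_on_path assms by blast+
  then show ?thesis using not_sep_trans sep_sym by metis
qed

subsection \<open>Leaves\<close>

lemma leaf_edge_unique:
  assumes "l \<in> leaves T" "e \<in> E" "f \<in> E" "l \<in> e" "l \<in> f" shows "e = f"
proof -
  have "card {e \<in> E. l \<in> e} = 1" using assms(1) by (simp add: leaves_def deg_def)
  then obtain g where g: "{e \<in> E. l \<in> e} = {g}" by (auto simp: card_1_singleton_iff)
  have "e \<in> {e \<in> E. l \<in> e}" "f \<in> {e \<in> E. l \<in> e}" using assms by auto
  then show ?thesis unfolding g by simp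
qed

lemma leaves_V: "l \<in> leaves T \<Longrightarrow> l \<in> V"
  by (simp add: leaves_def)

text \<open>An inner vertex of a path has different first edges towards the two ends.\<close>

lemma leaf_on_path:
  assumes "l \<in> leaves T" "a \<in> V" "b \<in> V" "l \<in> set (tpath T a b)"
  shows "l = a \<or> l = b"
proof (rule ccontr)
  assume *: "\<not> (l = a \<or> l = b)"
  have lV: "l \<in> V" using assms leaves_V by blast
  obtain f where f: "f \<in> E" "l \<in> f" "sep f l a" using first_edge[OF lV assms(2)] * by blast
  obtain g where g: "g \<in> E" "l \<in> g" "sep g l b" using first_edge[OF lV assms(3)] * by blast
  have "f = g" using leaf_edge_unique assms f g by blast
  then show False using f g assms lV on_path_iff sep_sym by metis
qed

lemma leaf_edge_sep:
  assumes "l \<in> leaves T" "e \<in> E" "l \<in> e" "a \<in> V" "b \<in> V"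
  shows "sep e a b \<longleftrightarrow> (a = l) \<noteq> (b = l)"
proof -
  have *: "\<not> sep e y z" if "y \<in> V" "z \<in> V" "y \<noteq> l" "z \<noteq> l" for y z
  proof
    assume "sep e y z"
    then have "l \<in> set (tpath T y z)" using sep_edge_in_path assms that by blast
    then show False using leaf_on_path assms that by blast
  qed
  obtain x where x: "e = {l, x}" "x \<in> V" "x \<noteq> l" using assms(2,3) by (elim edgeE) auto
  have "sep e l x" using bridge[of l x] x assms by simp
  have l: "sep e l z" if "z \<in> V" "z \<noteq> l" for z
    using *[OF x(2) that(1) x(3) that(2)] \<open>sep e l x\<close> not_sep_trans sep_sym by metis
  show ?thesis
    using l[of a] l[of b] *[of a b] assms sep_sym[of e a l] by (cases "a = l"; cases "b = l") auto
qed

subsection \<open>Four-point conditions\<close>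

definition tdist :: "(nat set \<Rightarrow> real) \<Rightarrow> nat \<Rightarrow> nat \<Rightarrow> real" where
  "tdist \<omega> a b = (\<Sum>e\<in>path_edges (tpath T a b). \<omega> e)"

lemma tdist_eq:
  assumes "a \<in> V" "b \<in> V"
  shows "tdist \<omega> a b = (\<Sum>e\<in>E. if sep e a b then \<omega> e else 0)"
  unfolding tdist_def tpath_edges[OF assms] using finite_E by (simp add: sum.If_cases Int_def conj_commute)

text \<open>Compare edge by edge. An inner edge can contribute more to the left side only if it
  induces the split ab|cd, which is excluded. An edge at a leaf contributes equally to both sides,
  so its sign is irrelevant.\<close>

lemma four_point:
  assumes \<omega>: "\<And>e. e \<in> inner_edges T \<Longrightarrow> 0 \<le> \<omega> e"
    and l: "a \<in> V" "b \<in> V" "c \<in> V" "d \<in> V" "distinct [a, b, c, d]"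
    and ns: "\<And>e. e \<in> E \<Longrightarrow> \<not> (\<not> sep e a b \<and> \<not> sep e c d \<and> sep e a c)"
  shows "tdist \<omega> a c + tdist \<omega> b d \<le> tdist \<omega> a b + tdist \<omega> c d"
  unfolding tdist_eq[OF l(1,3)] tdist_eq[OF l(2,4)] tdist_eq[OF l(1,2)] tdist_eq[OF l(3,4)] sum.distrib[symmetric]
proof (rule sum_mono)
  fix e assume e: "e \<in> E"
  show "(if sep e a c then \<omega> e else 0) + (if sep e b d then \<omega> e else 0)
     \<le> (if sep e a b then \<omega> e else 0) + (if sep e c d then \<omega> e else 0)"
  proof (cases "e \<in> inner_edges T")
    case True
    have x1: "sep e a c \<longleftrightarrow> sep e a b \<noteq> sep e b c" using e l by (intro sep_xor)
    have x2: "sep e b d \<longleftrightarrow> sep e b c \<noteq> sep e c d" using e l by (intro sep_xor)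
    show ?thesis using \<omega>[OF True] x1 x2 ns[OF e] by (auto split: if_splits)
  next
    case False
    then obtain x where x: "x \<in> leaves T" "x \<in> e" using e by (auto simp: inner_edges_def)
    note leaf_edge_sep[OF x(1) e x(2)]
    then show ?thesis using l by auto
  qed
qed

end

section \<open>Branches, quartets and cherries\<close>

locale phylo = utree T for T +
  fixes n :: nat
  assumes leaves: "leaves T = {1..n}"
begin

lemma lV: "l \<in> {1..n} \<Longrightarrow> l \<in> V"
  using leaves leaves_V by blast

lemma path_vertices_V: "i \<in> {1..n} \<Longrightarrow> j \<in> {1..n} \<Longrightarrow> w \<in> path_vertices T i j \<Longrightarrow> w \<in> V \<and> w \<in> set (tpath T i j)"
  using tpath_subset[OF lV lV] by (auto simp: path_vertices_def)

context
  fixes i j assumes ij: "i \<in> {1..n}" "j \<in> {1..n}" "i \<noteq> j"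
begin

lemma branch_iff: "k \<in> branch n T i j w \<Longrightarrow> k \<in> {1..n} \<and> k \<noteq> i \<and> k \<noteq> j"
  by (simp add: branch_def)

lemma branch_sep:
  assumes k: "k \<in> branch n T i j w" and w: "w \<in> path_vertices T i j" and f: "f \<in> E" "sep f i j"
  shows "\<not> sep f k w"
proof
  assume s: "sep f k w"
  have kV: "k \<in> V" using branch_iff[OF k] lV by blast
  have wV: "w \<in> V" using path_vertices_V[OF ij(1,2) w] by simp
  have "f \<subseteq> set (tpath T k w) \<inter> set (tpath T i j)"
    using sep_edge_in_path[OF f(1) s kV wV] sep_edge_in_path[OF f lV[OF ij(1)] lV[OF ij(2)]] by blast
  moreover have "set (tpath T k w) \<inter> set (tpath T i j) = {w}" using k by (simp add: branch_def)
  ultimately show False using edge_not_subset_singleton[OF f(1)] by blast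
qed

lemma gate_separation:
  assumes "w \<in> path_vertices T i j" "w' \<in> path_vertices T i j" "w \<noteq> w'"
  obtains f where "f \<in> E" "sep f i j" "sep f w w'"
proof -
  have V: "w \<in> V" "w' \<in> V" "w \<in> set (tpath T i j)" "w' \<in> set (tpath T i j)"
    using path_vertices_V ij assms by blast+
  obtain f where f: "f \<in> E" "sep f w w'" using sep_exists V assms(3) by blast
  have "sep f i j"
  proof (rule ccontr)
    assume "\<not> sep f i j"
    then have "\<not> sep f i w" "\<not> sep f i w'" using not_sep_on_path[OF lV[OF ij(1)] lV[OF ij(2)]] V f by blast+
    then show False using f(2) not_sep_trans sep_sym by metis
  qed
  then show ?thesis using that f by blast
qed

lemma branch_disjoint:
  assumes "k \<in> branch n T i j w" "k \<in> branch n T i j w'" "w \<in> path_vertices T i j" "w' \<in> path_vertices T i j"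
  shows "w = w'"
proof (rule ccontr)
  assume "w \<noteq> w'"
  then obtain f where f: "f \<in> E" "sep f i j" "sep f w w'" using gate_separation assms by blast
  then have "\<not> sep f k w" "\<not> sep f k w'" using branch_sep assms by blast+
  then show False using f(3) not_sep_trans sep_sym by metis
qed

text \<open>An edge between the two gates separates i from j and k from l, and a split ij|kl would
  cross it.\<close>

lemma branch_different:
  assumes k: "k \<in> branch n T i j w" "w \<in> path_vertices T i j"
    and l: "l \<in> branch n T i j w'" "w' \<in> path_vertices T i j" and ne: "w \<noteq> w'" and e: "e \<in> E"
  shows "\<not> (\<not> sep e i j \<and> \<not> sep e k l \<and> sep e i k)"
proof
  assume *: "\<not> sep e i j \<and> \<not> sep e k l \<and> sep e i k"
  obtain f where f: "f \<in> E" "sep f i j" "sep f w w'" using gate_separation k l ne by blast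
  have V: "i \<in> V" "j \<in> V" "k \<in> V" "l \<in> V" "w \<in> V" "w' \<in> V"
    using lV ij branch_iff k l path_vertices_V by blast+
  have w: "\<not> sep f k w" "\<not> sep f l w'" using branch_sep k l f by blast+
  then have kl: "sep f k l" using f(3) not_sep_trans sep_sym by metis
  have "\<not> sep e i k" by (rule split_compat[OF e f(1) V(1,2,3,4)]) (use * f kl in auto)
  then show False using * by blast
qed

lemma branch_same:
  assumes "k \<in> branch n T i j w" "l \<in> branch n T i j w" "w \<in> path_vertices T i j" "e \<in> E" "sep e i j"
  shows "\<not> sep e k l"
proof -
  have "\<not> sep e k w" "\<not> sep e l w" using branch_sep assms by blast+
  then show ?thesis using not_sep_trans sep_sym by metis
qed

lemma in_branch:
  assumes k: "k \<in> {1..n} - {i, j}"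
  obtains w where "w \<in> path_vertices T i j" "k \<in> branch n T i j w"
proof -
  have V: "k \<in> V" "i \<in> V" "j \<in> V" using k ij lV by auto
  obtain w where w: "w \<in> set (tpath T i j)" "set (tpath T k w) \<inter> set (tpath T i j) = {w}"
    using gate[OF V] by blast
  have wV: "w \<in> V" using w(1) tpath_subset V by blast
  \<comment> \<open>If the gate were i or j, the only edge at that leaf would belong both to the
    path and to the way to k.\<close>
  have *: "w \<noteq> x" if x: "x \<in> {i, j}" for x
  proof
    assume eq: "w = x"
    have xl: "x \<in> leaves T" "x \<noteq> k" using x ij k leaves by auto
    then have xV: "x \<in> V" using leaves_V by blast
    obtain y where y: "y \<in> {i, j}" "y \<noteq> x" using x ij by blast
    then have yV: "y \<in> V" using V by auto
    obtain f where f: "f \<in> E" "x \<in> f" "sep f x k" using first_edge[OF xV V(1) xl(2)] by blast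
    obtain g where g: "g \<in> E" "x \<in> g" "sep g x y" using first_edge[OF xV yV] y by metis
    have "f = g" using leaf_edge_unique[OF xl(1)] f g by blast
    then have "sep f i j" using g x y sep_sym by auto
    then have "f \<subseteq> set (tpath T i j)" using sep_edge_in_path f V by blast
    moreover have "f \<subseteq> set (tpath T k w)" using sep_edge_in_path[OF f(1) _ V(1) wV] f(3) eq sep_sym by auto
    ultimately have "f \<subseteq> {w}" using w(2) by blast
    then show False using edge_not_subset_singleton[OF f(1)] by blast
  qed
  have "w \<in> path_vertices T i j" using w(1) * by (auto simp: path_vertices_def)
  moreover have "k \<in> branch n T i j w" using w(2) k by (simp add: branch_def)
  ultimately show ?thesis using that by blast
qed

end

section \<open>Spanned subtrees, quartets and cherries\<close>

lemma spanned_edges: "A \<subseteq> {1..n} \<Longrightarrow> gedges (spanned T A) = {e \<in> E. \<exists>a\<in>A. \<exists>b\<in>A. sep e a b}"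
proof -
  assume A: "A \<subseteq> {1..n}"
  have "path_edges (tpath T a b) = {e \<in> E. sep e a b}" if "a \<in> A" "b \<in> A" for a b
    using tpath_edges that A lV by blast
  then show ?thesis by (auto simp: spanned_def)
qed

lemma spanned_verts: "A \<subseteq> {1..n} \<Longrightarrow> gverts (spanned T A) \<subseteq> V"
proof
  fix x assume A: "A \<subseteq> {1..n}" and "x \<in> gverts (spanned T A)"
  then obtain a b where ab: "a \<in> A" "b \<in> A" "x \<in> set (tpath T a b)" by (auto simp: spanned_def)
  then have "a \<in> V" "b \<in> V" using A lV by blast+
  then show "x \<in> V" using tpath_subset ab(3) by blast
qed

lemma spanned_path:
  assumes "A \<subseteq> {1..n}" "is_path (spanned T A) a b p" shows "is_path T a b p"
proof -
  have "successively (\<lambda>c d. {c, d} \<in> E) p"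
    using assms(2) spanned_edges[OF assms(1)] unfolding is_path_def
    by (auto elim!: successively_mono)
  then show ?thesis using assms(2) spanned_verts[OF assms(1)] unfolding is_path_def by blast
qed

lemma deg_leaf_le:
  assumes "A \<subseteq> {1..n}" "a \<in> {1..n}" shows "deg (spanned T A) a \<noteq> 2"
proof -
  have "{e \<in> gedges (spanned T A). a \<in> e} \<subseteq> {e \<in> E. a \<in> e}" using spanned_edges[OF assms(1)] by auto
  moreover have "card {e \<in> E. a \<in> e} = 1" using assms(2) leaves unfolding leaves_def deg_def by blast
  moreover have "finite {e \<in> E. a \<in> e}" using finite_E by simp
  ultimately have "deg (spanned T A) a \<le> 1" unfolding deg_def by (metis card_mono)
  then show ?thesis by simp
qed

text \<open>Starting at a leaf and passing only vertices of degree two there is never a choice, so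
  the walk coincides with the path to any other leaf c as far as it goes.\<close>

lemma forced_path:
  assumes A: "A \<subseteq> {1..n}" "a \<in> A" "c \<in> A" "c \<noteq> a" and p: "is_path (spanned T A) a w p"
    and d2: "\<forall>x\<in>set p - {a, w}. deg (spanned T A) x = 2" and e: "e \<in> path_edges p"
  shows "sep e a c"
proof -
  let ?G = "spanned T A"
  have pT: "is_path T a w p" by (rule spanned_path[OF A(1) p])
  note pn = is_path_nth[OF pT] and gn = is_path_nth[OF p]
  have V: "a \<in> V" "c \<in> V" using A lV by blast+
  have al: "a \<in> leaves T" using A leaves by blast
  have "sep {p ! m, p ! Suc m} a c" if "Suc m < length p" for m using that
  proof (induction m)
    case 0
    obtain f where f: "f \<in> E" "a \<in> f" "sep f a c" using first_edge[OF V] A by blast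
    have "{p ! 0, p ! Suc 0} \<in> E" "a \<in> {p ! 0, p ! Suc 0}" using pn(2,6) 0 by auto
    then have "f = {p ! 0, p ! Suc 0}" using leaf_edge_unique[OF al] f by blast
    then show ?case using f by simp
  next
    case (Suc m)
    define f g x where "f = {p ! m, p ! Suc m}" and "g = {p ! Suc m, p ! Suc (Suc m)}" and "x = p ! Suc m"
    have f: "sep f a c" "f \<in> E" "f \<in> gedges ?G" using Suc pn(6) gn(6) by (auto simp: f_def)
    have g: "g \<in> gedges ?G" "g \<in> E" using Suc.prems pn(6) gn(6) by (auto simp: g_def)
    have "f \<noteq> g" using distinct_consecutive[OF pn(4), of m "Suc m"] Suc.prems by (auto simp: f_def g_def)
    have xp: "x \<in> set p" using Suc.prems by (simp add: x_def)
    have xV: "x \<in> V" using xp pn(5) by blast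
    have "x \<noteq> a" using nth_eq_iff_index_eq[OF pn(4), of "Suc m" 0] Suc.prems pn(1,2) by (auto simp: x_def)
    moreover have "x \<noteq> w" using nth_eq_iff_index_eq[OF pn(4), of "Suc m" "length p - 1"] Suc.prems pn(1,3) by (auto simp: x_def)
    ultimately have dx: "deg ?G x = 2" using d2 xp by blast
    have "x \<noteq> c" using dx deg_leaf_le[OF A(1)] A by blast
    have fin: "finite {e \<in> gedges ?G. x \<in> e}" using spanned_edges[OF A(1)] finite_E by simp
    have "{f, g} \<subseteq> {e \<in> gedges ?G. x \<in> e}" using f g by (auto simp: f_def g_def x_def)
    moreover have "card {f, g} = card {e \<in> gedges ?G. x \<in> e}" using \<open>f \<noteq> g\<close> dx by (simp add: deg_def)
    ultimately have fg: "{e \<in> gedges ?G. x \<in> e} = {f, g}" using card_subset_eq[OF fin] by blast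
    \<comment> \<open>The path to c leaves x by one of its two edges. It is not the one just used,
      since that one separates a from x.\<close>
    obtain h where h: "h \<in> E" "x \<in> h" "sep h x c" using first_edge[OF xV V(2) \<open>x \<noteq> c\<close>] by blast
    have "x \<in> set (tpath T a c)" using sep_edge_in_path[OF f(2,1) V] by (auto simp: f_def x_def)
    then have "\<not> sep h a x" using on_path_iff[OF V xV] h by blast
    then have hac: "sep h a c" using sep_xor[OF h(1) V(1) xV V(2)] h by blast
    then have "h \<in> {e \<in> gedges ?G. x \<in> e}" using spanned_edges[OF A(1)] A h by auto
    then have "h = f \<or> h = g" unfolding fg by simp
    moreover have "h \<noteq> f"
    proof
      assume "h = f"
      have tk: "is_path T a x (take (Suc (Suc m)) p)" unfolding x_def using is_path_take[OF pT] Suc.prems by simp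
      have "f \<in> path_edges (take (Suc (Suc m)) p)"
        using Suc.prems unfolding path_edges_def f_def by (auto intro!: exI[of _ m])
      then have "sep f a x" using path_edges_eq[OF tk] by blast
      then show False using \<open>h = f\<close> \<open>\<not> sep h a x\<close> by blast
    qed
    ultimately show ?case using hac by (simp add: g_def)
  qed
  then show ?thesis using e by (auto simp: path_edges_def)
qed

lemma suppress_edgeE:
  assumes "{a, w} \<in> gedges (suppress G)"
  obtains p where "is_path G a w p" "\<forall>x\<in>set p - {a, w}. deg G x = 2" "a \<noteq> w" "deg G w \<noteq> 2"
proof -
  obtain x y p where xy: "{a, w} = {x, y}" "x \<noteq> y" "deg G x \<noteq> 2" "deg G y \<noteq> 2" "is_path G x y p"
    "\<forall>c\<in>set p - {x, y}. deg G c = 2"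
    using assms unfolding suppress_def by auto
  then consider "a = x" "w = y" | "a = y" "w = x" by (auto simp: doubleton_eq_iff)
  then show ?thesis
  proof cases
    case 1 then show ?thesis using that[of p] xy by simp
  next
    case 2
    then show ?thesis using that[of "rev p"] xy is_path_rev[OF xy(5)] by (simp add: insert_commute)
  qed
qed

text \<open>The suppressed edge from a leaf to w lies on the paths to all other leaves of the
  quartet. So an edge with split ac|bd lies on neither of the two ways to w and cannot separate a
  from b.\<close>

lemma cherry_no_split:
  assumes A: "{a, b, c, d} \<subseteq> {1..n}" "distinct [a, b, c, d]"
    and ch: "cherry (quartet T {a, b, c, d}) a b" and e: "e \<in> E"
  shows "\<not> (sep e a b \<and> \<not> sep e a c \<and> \<not> sep e b d)"
proof
  assume *: "sep e a b \<and> \<not> sep e a c \<and> \<not> sep e b d"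
  let ?G = "spanned T {a, b, c, d}"
  obtain w where w: "{a, w} \<in> gedges (suppress ?G)" "{b, w} \<in> gedges (suppress ?G)"
    using ch unfolding cherry_def quartet_def by (elim conjE exE)
  have far: "\<not> sep e x w" if x: "x \<in> {a, b, c, d}" "{x, w} \<in> gedges (suppress ?G)"
    "z \<in> {a, b, c, d}" "z \<noteq> x" "\<not> sep e x z" for x z
  proof
    assume s: "sep e x w"
    obtain p where p: "is_path ?G x w p" "\<forall>y\<in>set p - {x, w}. deg ?G y = 2" "x \<noteq> w" "deg ?G w \<noteq> 2"
      by (rule suppress_edgeE[OF x(2)])
    have "e \<in> path_edges p" using path_edges_eq[OF spanned_path[OF A(1) p(1)]] e s by blast
    from forced_path[OF A(1) x(1,3,4) p(1,2) this] have "sep e x z" .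
    then show False using x by blast
  qed
  have "\<not> sep e a w" "\<not> sep e b w" using far[of a c] far[of b d] w * A(2) by auto
  then show False using * not_sep_trans sep_sym by metis
qed

text \<open>Here w is the median of a, b, c. If the split ad|bc does not occur, the path to d does
  not branch off strictly between a and w, so suppression turns this piece into a single
  edge.\<close>

lemma cherry_edge:
  assumes A: "{a, b, c, d} \<subseteq> {1..n}" "distinct [a, b, c, d]"
    and ns: "\<And>e. e \<in> E \<Longrightarrow> \<not> (sep e a b \<and> \<not> sep e a d \<and> \<not> sep e b c)"
    and w: "w \<in> set (tpath T a b)" "w \<in> set (tpath T a c)" "w \<in> set (tpath T b c)"
  shows "{a, w} \<in> gedges (quartet T {a, b, c, d}) \<and> {e \<in> gedges (quartet T {a, b, c, d}). a \<in> e} = {{a, w}} \<and>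
    a \<in> leaves (quartet T {a, b, c, d})"
proof -
  let ?A = "{a, b, c, d}" and ?G = "spanned T {a, b, c, d}"
  note GE = spanned_edges[OF A(1)]
  have V: "a \<in> V" "b \<in> V" "c \<in> V" "d \<in> V" using A lV by auto
  have wV: "w \<in> V" using w tpath_subset V by blast
  have wl: "w \<notin> leaves T"
  proof
    assume l: "w \<in> leaves T"
    have "w = a \<or> w = b" "w = a \<or> w = c" "w = b \<or> w = c" using leaf_on_path[OF l] V w by blast+
    then show False using A(2) by auto
  qed
  then have wne: "w \<noteq> a" "w \<noteq> b" "w \<noteq> c" "w \<noteq> d" using A leaves by auto
  have wab: "\<not> (sep e a w \<and> sep e w b)" if "e \<in> E" for e using on_path_iff[OF V(1,2) wV] w that by blast
  have wac: "\<not> (sep e a w \<and> sep e w c)" if "e \<in> E" for e using on_path_iff[OF V(1,3) wV] w that by blast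
  have wbc: "\<not> (sep e b w \<and> sep e w c)" if "e \<in> E" for e using on_path_iff[OF V(2,3) wV] w that by blast
  have finG: "finite {e \<in> gedges ?G. x \<in> e}" for x using GE finite_E by simp
  have degw: "deg ?G w \<noteq> 2"
  proof -
    obtain ea where ea: "ea \<in> E" "w \<in> ea" "sep ea w a" using first_edge[OF wV V(1) wne(1)] by blast
    obtain eb where eb: "eb \<in> E" "w \<in> eb" "sep eb w b" using first_edge[OF wV V(2) wne(2)] by blast
    obtain ec where ec: "ec \<in> E" "w \<in> ec" "sep ec w c" using first_edge[OF wV V(3) wne(3)] by blast
    have ne: "ea \<noteq> eb" "ea \<noteq> ec" "eb \<noteq> ec" using ea eb ec wab wac wbc sep_sym by metis+
    have "sep ea a b" using sep_xor[OF ea(1) V(1) wV V(2)] ea wab sep_sym by metis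
    moreover have "sep eb a b" using sep_xor[OF eb(1) V(1) wV V(2)] eb wab sep_sym by metis
    moreover have "sep ec a c" using sep_xor[OF ec(1) V(1) wV V(3)] ec wac sep_sym by metis
    ultimately have "{ea, eb, ec} \<subseteq> {e \<in> gedges ?G. w \<in> e}" using ea eb ec GE by auto
    then have "card {ea, eb, ec} \<le> card {e \<in> gedges ?G. w \<in> e}" by (rule card_mono[OF finG])
    then show ?thesis using ne by (simp add: deg_def)
  qed
  have interior: "deg ?G x = 2" if x: "x \<in> set (tpath T a w) - {a, w}" for x
  proof -
    have xV: "x \<in> V" using x tpath_subset[OF V(1) wV] by blast
    have xaw: "\<not> (sep e a x \<and> sep e x w)" if "e \<in> E" for e using on_path_iff[OF V(1) wV xV] x that by blast
    obtain e1 where e1: "e1 \<in> E" "x \<in> e1" "sep e1 x a" using first_edge[OF xV V(1)] x by blast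
    obtain e2 where e2: "e2 \<in> E" "x \<in> e2" "sep e2 x w" using first_edge[OF xV wV] x by blast
    have ne: "e1 \<noteq> e2" using e1 e2 xaw sep_sym by metis
    have ab: "sep e a b" if "e \<in> E" "sep e a w" for e
      using that wab sep_xor[OF that(1) V(1) wV V(2)] by blast
    have e1G: "sep e1 a b" using ab[OF e1(1)] sep_xor[OF e1(1) V(1) xV wV] e1 xaw sep_sym by metis
    have e2aw: "sep e2 a w" "\<not> sep e2 a x" using sep_xor[OF e2(1) V(1) xV wV] e2 xaw by metis+
    have e2wb: "\<not> sep e2 w b" "\<not> sep e2 w c" using wab[OF e2(1)] wac[OF e2(1)] e2aw by blast+
    \<comment> \<open>A third edge at x could only lead to d; the edge from x towards w would then
      induce the excluded split.\<close>
    have "f \<in> {e1, e2}" if f: "f \<in> gedges ?G" "x \<in> f" for f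
    proof (rule ccontr)
      assume "f \<notin> {e1, e2}"
      have fE: "f \<in> E" using f GE by blast
      have xa: "\<not> sep f x a" using first_edge_unique[OF fE e1(1) f(2) e1(2) _ e1(3) xV V(1)] \<open>f \<notin> {e1, e2}\<close> by blast
      have xw: "\<not> sep f x w" using first_edge_unique[OF fE e2(1) f(2) e2(2) _ e2(3) xV wV] \<open>f \<notin> {e1, e2}\<close> by blast
      have wz: "\<not> sep f w z" if z: "z \<in> V" "\<not> sep e2 w z" for z
      proof
        assume "sep f w z"
        then have "x \<in> set (tpath T w z)" using sep_edge_in_path fE f(2) wV z by blast
        moreover have "sep e2 x z" using sep_xor[OF e2(1) xV wV z(1)] e2 z by blast
        ultimately show False using on_path_iff[OF wV z(1) xV] e2 sep_sym by metis
      qed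
      have "\<not> sep f x b" "\<not> sep f x c"
        using wz[OF V(2) e2wb(1)] wz[OF V(3) e2wb(2)] xw not_sep_trans by blast+
      moreover obtain y z where "y \<in> ?A" "z \<in> ?A" "sep f y z" using f GE by blast
      ultimately have xd: "sep f x d" using xa not_sep_trans sep_sym by (metis insertE singletonD)
      have "\<not> sep e2 x d" using first_edge_unique[OF fE e2(1) f(2) e2(2) xd _ xV V(4)] \<open>f \<notin> {e1, e2}\<close> by blast
      then have "\<not> sep e2 a d" using e2aw(2) not_sep_trans by blast
      moreover have "\<not> sep e2 b c" using e2wb not_sep_trans sep_sym by metis
      ultimately show False using ns[OF e2(1)] ab[OF e2(1) e2aw(1)] by blast
    qed
    moreover have "e1 \<in> gedges ?G" "e2 \<in> gedges ?G" using e1G ab[OF e2(1) e2aw(1)] e1(1) e2(1) GE by auto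
    ultimately have "{e \<in> gedges ?G. x \<in> e} = {e1, e2}" using e1(2) e2(2) by blast
    then show ?thesis using ne by (simp add: deg_def)
  qed
  have dega: "deg ?G a \<noteq> 2" by (rule deg_leaf_le[OF A(1)]) (use A in auto)
  have path: "is_path ?G a w (tpath T a w)"
  proof -
    note tp = tpath[OF V(1) wV]
    have sub: "set (tpath T a w) \<subseteq> set (tpath T a b)"
    proof
      fix x assume x: "x \<in> set (tpath T a w)"
      then have xV: "x \<in> V" using tpath_subset[OF V(1) wV] by blast
      have "\<not> (sep e a x \<and> sep e x b)" if e: "e \<in> E" for e
      proof
        assume *: "sep e a x \<and> sep e x b"
        have "\<not> sep e x w" using on_path_iff[OF V(1) wV xV] x e * by blast
        then have "sep e a w" "sep e w b"
          using * sep_xor[OF e V(1) xV wV] sep_xor[OF e xV wV V(2)] by blast+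
        then show False using wab[OF e] by blast
      qed
      then show "x \<in> set (tpath T a b)" using on_path_iff[OF V(1,2) xV] by blast
    qed
    have ed: "{c, d} \<in> gedges ?G" if "{c, d} \<in> path_edges (tpath T a w)" for c d
    proof -
      have e: "{c, d} \<in> E" "sep {c, d} a w" using that tpath_edges[OF V(1) wV] by auto
      then have "sep {c, d} a b" using wab sep_xor[OF e(1) V(1) wV V(2)] by blast
      then show ?thesis using e GE by auto
    qed
    have "successively (\<lambda>c d. {c, d} \<in> gedges ?G) (tpath T a w)"
      unfolding successively_conv_nth using ed by (auto simp: path_edges_def)
    moreover have "set (tpath T a w) \<subseteq> gverts ?G" using sub by (auto simp: spanned_def)
    ultimately show ?thesis using tp by (simp add: is_path_def)
  qed
  have edge: "{a, w} \<in> gedges (suppress ?G)"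
    unfolding suppress_def using wne dega degw path interior by auto
  have only: "w' = w" if e': "{a, w'} \<in> gedges (suppress ?G)" for w'
  proof (rule ccontr)
    assume "w' \<noteq> w"
    obtain p where p: "is_path ?G a w' p" "\<forall>x\<in>set p - {a, w'}. deg ?G x = 2" "a \<noteq> w'" "deg ?G w' \<noteq> 2"
      by (rule suppress_edgeE[OF e'])
    have pT: "is_path T a w' p" by (rule spanned_path[OF A(1) p(1)])
    then have ptp: "p = tpath T a w'" using tpath_eq by simp
    have w'V: "w' \<in> V" using pT ends_in_path by (metis is_path_def last_in_set subsetD)
    have "sep e a b" if "e \<in> E" "sep e a w'" for e
      using forced_path[OF A(1) _ _ _ p(1,2), of b e] path_edges_eq[OF pT] that A by auto
    then have w'ab: "\<not> (sep e a w' \<and> sep e w' b)" if "e \<in> E" for e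
      using that sep_xor[OF that V(1) w'V V(2)] by blast
    \<comment> \<open>Otherwise two edges would induce crossing splits of a, w, w', b. If one of the
      two vertices lies on the path to the other, it is an interior vertex whose degree is not
      2.\<close>
    have "w' \<in> set (tpath T a w) \<or> w \<in> set (tpath T a w')"
    proof (rule ccontr)
      assume "\<not> ?thesis"
      then obtain e f where e: "e \<in> E" "sep e a w'" "sep e w' w" and f: "f \<in> E" "sep f a w" "sep f w w'"
        using on_path_iff[OF V(1) wV w'V] on_path_iff[OF V(1) w'V wV] by blast
      have "\<not> sep e a w" using sep_xor[OF e(1) V(1) w'V wV] e by blast
      moreover have "\<not> sep e w' b" using w'ab e by blast
      moreover have "sep f w' b"
        using sep_xor[OF f(1) w'V wV V(2)] wab[OF f(1)] f sep_sym by metis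
      ultimately have "\<not> sep e a w'" using split_compat[OF e(1) f(1) V(1) wV w'V V(2)] f by blast
      then show False using e by blast
    qed
    then show False
      using interior[of w'] bspec[OF p(2), of w] p(3,4) degw wne \<open>w' \<noteq> w\<close> ptp by blast
  qed
  have "{e \<in> gedges (suppress ?G). a \<in> e} = {{a, w}}"
  proof (intro set_eqI iffI)
    fix e assume "e \<in> {e \<in> gedges (suppress ?G). a \<in> e}"
    then have e: "e \<in> gedges (suppress ?G)" "a \<in> e" by auto
    then obtain x y where "e = {x, y}" by (auto simp: suppress_def)
    then obtain w' where "e = {a, w'}" using e(2) by auto
    then show "e \<in> {{a, w}}" using only e by auto
  qed (use edge in auto)
  moreover have "a \<in> gverts ?G" using ends_in_path[OF V(1,1)] by (auto simp: spanned_def)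
  ultimately show ?thesis
    using edge dega by (simp add: quartet_def leaves_def deg_def suppress_def)
qed

text \<open>Converse to \<open>cherry_no_split\<close>, with w the gate of c on the path from a to
  b; both excluded splits are needed, one for the edge at a and one for the edge at b.\<close>

lemma cherryI:
  assumes A: "{a, b, c, d} \<subseteq> {1..n}" "distinct [a, b, c, d]"
    and ns1: "\<And>e. e \<in> E \<Longrightarrow> \<not> (sep e a b \<and> \<not> sep e a c \<and> \<not> sep e b d)"
    and ns2: "\<And>e. e \<in> E \<Longrightarrow> \<not> (sep e a b \<and> \<not> sep e a d \<and> \<not> sep e b c)"
  shows "cherry (quartet T {a, b, c, d}) a b"
proof -
  have V: "a \<in> V" "b \<in> V" "c \<in> V" "d \<in> V" using A lV by auto
  obtain w where w: "w \<in> set (tpath T a b)" "set (tpath T c w) \<inter> set (tpath T a b) = {w}"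
    using gate[OF V(3,1,2)] by blast
  have wV: "w \<in> V" using w(1) tpath_subset V by blast
  have wab: "\<not> (sep e a w \<and> sep e w b)" if "e \<in> E" for e using on_path_iff[OF V(1,2) wV] w(1) that by blast
  have wx: "w \<in> set (tpath T x c)" if x: "x \<in> {a, b}" for x
  proof -
    have xV: "x \<in> V" using x V by auto
    have "\<not> (sep e x w \<and> sep e w c)" if e: "e \<in> E" for e
    proof
      assume *: "sep e x w \<and> sep e w c"
      have "sep e a b" using * x wab[OF e] sep_xor[OF e V(1) wV V(2)] sep_sym by (metis insertE singletonD)
      then have "e \<subseteq> set (tpath T c w) \<inter> set (tpath T a b)"
        using sep_edge_in_path[OF e _ V(3) wV] sep_edge_in_path[OF e _ V(1,2)] * sep_sym by blast
      then show False using w(2) edge_not_subset_singleton[OF e] by simp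
    qed
    then show ?thesis using on_path_iff[OF xV V(3) wV] by blast
  qed
  have a: "{a, w} \<in> gedges (quartet T {a, b, c, d}) \<and> a \<in> leaves (quartet T {a, b, c, d})"
    using cherry_edge[OF A ns2 w(1) wx wx] by simp
  have rev: "w \<in> set (tpath T b a)"
    using on_path_iff[OF V(2,1) wV] wab sep_sym by metis
  have A': "{b, a, c, d} \<subseteq> {1..n}" "distinct [b, a, c, d]" using A by auto
  have "\<not> (sep e b a \<and> \<not> sep e b d \<and> \<not> sep e a c)" if "e \<in> E" for e
    using ns1[OF that] sep_sym by blast
  then have "{b, w} \<in> gedges (quartet T {b, a, c, d}) \<and> b \<in> leaves (quartet T {b, a, c, d})"
    using cherry_edge[OF A' _ rev wx wx] by simp
  then show ?thesis using a A(2) unfolding cherry_def insert_commute[of b a] by auto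
qed

end

section \<open>Planar orders\<close>

text \<open>A laminar family can be numbered so that all its members are intervals. A maximal proper
  member C meets no other member partially, so C and its complement can be numbered separately, C
  first.\<close>

lemma convex_numbering:
  fixes S :: "nat set"
  assumes "finite S" "\<And>C D. C \<in> \<F> \<Longrightarrow> D \<in> \<F> \<Longrightarrow> C \<inter> D = {} \<or> C \<subseteq> D \<or> D \<subseteq> C" "\<And>C. C \<in> \<F> \<Longrightarrow> C \<subseteq> S"
  shows "\<exists>pos::nat \<Rightarrow> nat. inj_on pos S \<and>
    (\<forall>C\<in>\<F>. \<forall>k\<in>S. \<forall>l\<in>S. \<forall>m\<in>S. k \<in> C \<longrightarrow> m \<in> C \<longrightarrow> pos k < pos l \<longrightarrow> pos l < pos m \<longrightarrow> l \<in> C)"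
  using assms
proof (induction "card S" arbitrary: S \<F> rule: less_induct)
  case less
  show ?case
  proof (cases "\<exists>C\<in>\<F>. C \<noteq> {} \<and> C \<noteq> S")
    case False
    show ?thesis
    proof (intro exI[of _ "\<lambda>x. x"] conjI ballI impI)
      fix C k l m assume "C \<in> \<F>" "k \<in> C" "l \<in> S"
      then show "l \<in> C" using False by blast
    qed simp
  next
    case True
    let ?P = "{C \<in> \<F>. C \<noteq> {} \<and> C \<noteq> S}"
    have "?P \<subseteq> Pow S" using less.prems(3) by blast
    then have "finite ?P" using less.prems(1) by (simp add: finite_subset)
    then obtain C where C: "C \<in> ?P" "\<And>D. D \<in> ?P \<Longrightarrow> C \<subseteq> D \<Longrightarrow> C = D"
      using finite_has_maximal[of ?P] True by blast
    have CS: "C \<subset> S" using C(1) less.prems(3)[of C] by auto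
    have finC: "finite C" using CS less.prems(1) finite_subset by blast
    have "\<exists>pos::nat \<Rightarrow> nat. inj_on pos C \<and> (\<forall>D\<in>{D \<in> \<F>. D \<subseteq> C}. \<forall>k\<in>C. \<forall>l\<in>C. \<forall>m\<in>C.
        k \<in> D \<longrightarrow> m \<in> D \<longrightarrow> pos k < pos l \<longrightarrow> pos l < pos m \<longrightarrow> l \<in> D)"
    proof (rule less.hyps[OF _ finC])
      show "card C < card S" using CS less.prems(1) by (rule psubset_card_mono[rotated])
      show "\<And>A B. A \<in> {D \<in> \<F>. D \<subseteq> C} \<Longrightarrow> B \<in> {D \<in> \<F>. D \<subseteq> C} \<Longrightarrow> A \<inter> B = {} \<or> A \<subseteq> B \<or> B \<subseteq> A"
        using less.prems(2) by blast
    qed auto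
    then obtain p1 :: "nat \<Rightarrow> nat" where p1: "inj_on p1 (C)"
      "\<forall>D\<in>{D \<in> \<F>. D \<subseteq> C}. \<forall>k\<in>C. \<forall>l\<in>C. \<forall>m\<in>C.
        k \<in> D \<longrightarrow> m \<in> D \<longrightarrow> p1 k < p1 l \<longrightarrow> p1 l < p1 m \<longrightarrow> l \<in> D"
      by (elim exE conjE)
    have "\<exists>pos::nat \<Rightarrow> nat. inj_on pos (S - C) \<and> (\<forall>D\<in>{D \<in> \<F>. D \<subseteq> S - C}. \<forall>k\<in>S - C. \<forall>l\<in>S - C. \<forall>m\<in>S - C.
        k \<in> D \<longrightarrow> m \<in> D \<longrightarrow> pos k < pos l \<longrightarrow> pos l < pos m \<longrightarrow> l \<in> D)"
    proof (rule less.hyps)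
      have "S - C \<subset> S" using C(1) CS by auto
      then show "card (S - C) < card S" using less.prems(1) by (rule psubset_card_mono[rotated])
      show "finite (S - C)" using less.prems(1) by simp
      show "\<And>A B. A \<in> {D \<in> \<F>. D \<subseteq> S - C} \<Longrightarrow> B \<in> {D \<in> \<F>. D \<subseteq> S - C} \<Longrightarrow> A \<inter> B = {} \<or> A \<subseteq> B \<or> B \<subseteq> A"
        using less.prems(2) by blast
    qed auto
    then obtain p2 :: "nat \<Rightarrow> nat" where p2: "inj_on p2 (S - C)"
      "\<forall>D\<in>{D \<in> \<F>. D \<subseteq> S - C}. \<forall>k\<in>S - C. \<forall>l\<in>S - C. \<forall>m\<in>S - C.
        k \<in> D \<longrightarrow> m \<in> D \<longrightarrow> p2 k < p2 l \<longrightarrow> p2 l < p2 m \<longrightarrow> l \<in> D"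
      by (elim exE conjE)
    \<comment> \<open>An offset above all numbers used on C.\<close>
    define b where "b = Suc (Max (p1 ` C))"
    define pos where "pos x = (if x \<in> C then p1 x else p2 x + b)" for x
    have low: "p1 x < b" if "x \<in> C" for x
      using that finC by (simp add: b_def le_imp_less_Suc)
    have "inj_on pos S"
    proof (rule inj_onI)
      fix x y assume xy: "x \<in> S" "y \<in> S" "pos x = pos y"
      then show "x = y"
        using low[of x] low[of y] inj_onD[OF p1(1), of x y] inj_onD[OF p2(1), of x y]
        by (cases "x \<in> C"; cases "y \<in> C") (auto simp: pos_def)
    qed
    moreover have "l \<in> D" if D: "D \<in> \<F>" and klm: "k \<in> S" "l \<in> S" "m \<in> S" "k \<in> D" "m \<in> D" "pos k < pos l" "pos l < pos m"
      for D k l m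
    proof -
      have "C \<inter> D = {} \<or> D \<subseteq> C \<or> C \<subset> D" using less.prems(2)[of C D] C(1) D by auto
      moreover have "D = S" if "C \<subset> D"
        using C(2)[of D] that D by auto
      ultimately consider "D \<subseteq> C" | "D \<subseteq> S - C" | "D = S" using less.prems(3)[OF D] by blast
      then show ?thesis
      proof cases
        case 1
        then have km: "k \<in> C" "m \<in> C" using klm by auto
        have "l \<in> C"
        proof (rule ccontr)
          assume "l \<notin> C"
          then show False using klm(7) km low[OF km(2)] by (simp add: pos_def)
        qed
        moreover from this have "p1 k < p1 l" "p1 l < p1 m" using klm(6,7) km by (simp_all add: pos_def)
        ultimately show ?thesis using p1(2) D 1 km klm(4,5) by blast
      next
        case 2
        then have km: "k \<in> S - C" "m \<in> S - C" using klm by auto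
        have "l \<notin> C"
        proof
          assume "l \<in> C"
          then show False using klm(6) km low[of l] by (simp add: pos_def)
        qed
        moreover from this have "p2 k < p2 l" "p2 l < p2 m" using klm(6,7) km by (simp_all add: pos_def)
        ultimately show ?thesis using p2(2) D 2 km klm(2,4,5) by blast
      qed (use klm in simp)
    qed
    ultimately show ?thesis by blast
  qed
qed

context phylo
begin

text \<open>The label sets cut off from i by edges form a laminar family, and numbering them by
  intervals amounts to a planar drawing of the tree rooted at i. If l lies between k and m,
  convexity excludes the split il|km; at most one of the other two splits occurs, which leaves kl or
  lm as a cherry.\<close>

lemma cherry_order_exists:
  assumes ij: "i \<in> {1..n}" "j \<in> {1..n}" "i \<noteq> j"
  shows "\<exists>r. cherry_property n T i j r"
proof -
  let ?S = "{1..n} - {i, j}"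
  define \<F> where "\<F> = (\<lambda>e. {l \<in> ?S. sep e i l}) ` E"
  have lam: "C \<inter> D = {} \<or> C \<subseteq> D \<or> D \<subseteq> C" if CD: "C \<in> \<F>" "D \<in> \<F>" for C D
  proof (rule ccontr)
    assume *: "\<not> ?thesis"
    obtain e f where e: "e \<in> E" "C = {l \<in> ?S. sep e i l}" and f: "f \<in> E" "D = {l \<in> ?S. sep f i l}"
      using CD unfolding \<F>_def by blast
    obtain k l m where k: "k \<in> C" "k \<in> D" and l: "l \<in> C" "l \<notin> D" and m: "m \<in> D" "m \<notin> C" using * by blast
    have S: "k \<in> ?S" "l \<in> ?S" "m \<in> ?S" using k l m e f by auto
    then have V: "i \<in> V" "k \<in> V" "l \<in> V" "m \<in> V" using ij lV by auto
    have s: "sep e i k" "sep e i l" "\<not> sep e i m" "sep f i k" "\<not> sep f i l" "sep f i m"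
      using k l m e f S by auto
    have "\<not> sep e k l" using sep_xor[OF e(1) V(2,1,3)] s sep_sym by metis
    moreover have "sep f k l" using sep_xor[OF f(1) V(2,1,3)] s sep_sym by metis
    ultimately have "\<not> sep e i k" using split_compat[OF e(1) f(1) V(1,4,2,3)] s by blast
    then show False using s by blast
  qed
  have sub: "\<And>C. C \<in> \<F> \<Longrightarrow> C \<subseteq> ?S" and fin: "finite ?S" by (auto simp: \<F>_def)
  have "\<exists>pos::nat \<Rightarrow> nat. inj_on pos ?S \<and>
    (\<forall>C\<in>\<F>. \<forall>k\<in>?S. \<forall>l\<in>?S. \<forall>m\<in>?S. k \<in> C \<longrightarrow> m \<in> C \<longrightarrow> pos k < pos l \<longrightarrow> pos l < pos m \<longrightarrow> l \<in> C)"
    using fin lam sub by (rule convex_numbering)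
  then obtain pos :: "nat \<Rightarrow> nat" where pos: "inj_on pos ?S"
    "\<forall>C\<in>\<F>. \<forall>k\<in>?S. \<forall>l\<in>?S. \<forall>m\<in>?S. k \<in> C \<longrightarrow> m \<in> C \<longrightarrow> pos k < pos l \<longrightarrow> pos l < pos m \<longrightarrow> l \<in> C"
    by (elim exE conjE)
  have conv: "\<not> (sep e i k \<and> sep e i m \<and> \<not> sep e i l)"
    if "e \<in> E" "k \<in> ?S" "l \<in> ?S" "m \<in> ?S" "pos k < pos l" "pos l < pos m" for e k l m
  proof
    assume *: "sep e i k \<and> sep e i m \<and> \<not> sep e i l"
    let ?C = "{l \<in> ?S. sep e i l}"
    have C: "?C \<in> \<F>" unfolding \<F>_def using that(1) by (rule imageI)
    have km: "k \<in> ?C" "m \<in> ?C" using * that by auto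
    have "l \<in> ?C"
      by (rule pos(2)[THEN bspec, OF C, THEN bspec, OF that(2), THEN bspec, OF that(3), THEN bspec, OF that(4),
            THEN mp, OF km(1), THEN mp, OF km(2), THEN mp, OF that(5), THEN mp, OF that(6)])
    then show False using * by simp
  qed
  define r where "r = {(k, l). \<exists>w\<in>path_vertices T i j. k \<in> branch n T i j w \<and> l \<in> branch n T i j w \<and> pos k \<le> pos l}"
  note bS = branch_iff[OF ij]
  have rS: "k \<in> ?S \<and> l \<in> ?S" if "(k, l) \<in> r" for k l using that bS by (auto simp: r_def)
  have "partial_order_on ?S r"
    unfolding partial_order_on_def preorder_on_def
  proof (intro conjI)
    show "r \<subseteq> ?S \<times> ?S" using rS by auto
    show "refl_on ?S r"
    proof (rule refl_onI)
      fix k assume "k \<in> ?S"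
      then obtain w where "w \<in> path_vertices T i j" "k \<in> branch n T i j w" using in_branch[OF ij] by blast
      then show "(k, k) \<in> r" by (auto simp: r_def)
    qed
    show "trans r"
    proof (rule transI)
      fix k l m assume "(k, l) \<in> r" "(l, m) \<in> r"
      then show "(k, m) \<in> r" using branch_disjoint[OF ij] unfolding r_def
        by clarsimp (metis order_trans)
    qed
    show "antisym r"
    proof (rule antisymI)
      fix k l assume kl: "(k, l) \<in> r" "(l, k) \<in> r"
      then have "pos k = pos l" by (auto simp: r_def)
      then show "k = l" using inj_onD[OF pos(1)] rS[OF kl(1)] by blast
    qed
  qed
  moreover have "(k, l) \<notin> r" if "a \<in> path_vertices T i j" "b \<in> path_vertices T i j" "a \<noteq> b"
    "k \<in> branch n T i j a" "l \<in> branch n T i j b" for a b k l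
  proof
    assume "(k, l) \<in> r"
    then obtain w where "w \<in> path_vertices T i j" "k \<in> branch n T i j w" "l \<in> branch n T i j w" by (auto simp: r_def)
    then show False using branch_disjoint[OF ij] that by metis
  qed
  moreover have "total_on (branch n T i j a) r" if "a \<in> path_vertices T i j" for a
    unfolding total_on_def r_def using that by (auto intro!: bexI[of _ a])
  moreover have "cherry (quartet T {i, k, l, m}) k l \<or> cherry (quartet T {i, k, l, m}) l m"
    if h: "(k, l) \<in> r" "k \<noteq> l" "(l, m) \<in> r" "l \<noteq> m" for k l m
  proof -
    have S: "k \<in> ?S" "l \<in> ?S" "m \<in> ?S" using rS h by blast+
    then have V: "i \<in> V" "k \<in> V" "l \<in> V" "m \<in> V" using ij lV by auto
    have "pos k \<le> pos l" "pos l \<le> pos m" using h by (auto simp: r_def)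
    then have lt: "pos k < pos l" "pos l < pos m"
      using inj_onD[OF pos(1)] S h by (metis le_neq_implies_less)+
    have no: "\<not> (sep e i k \<and> sep e i m \<and> \<not> sep e i l)" if "e \<in> E" for e using conv[OF that S lt] .
    have A: "{k, l, i, m} \<subseteq> {1..n}" "distinct [k, l, i, m]" "{l, m, k, i} \<subseteq> {1..n}" "distinct [l, m, k, i]"
      using S ij lt by auto
    have eq: "{i, k, l, m} = {k, l, i, m}" "{i, k, l, m} = {l, m, k, i}" by auto
    show ?thesis
    \<comment> \<open>The question is whether the split ik|lm occurs: it is the remaining
      obstruction for the cherry kl, and if present it excludes the one for the cherry lm.\<close>
    proof (cases "\<exists>e\<in>E. sep e k l \<and> \<not> sep e k i \<and> \<not> sep e l m")
      case False
      have "cherry (quartet T {k, l, i, m}) k l"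
      proof (rule cherryI[OF A(1,2)])
        fix e assume e: "e \<in> E"
        show "\<not> (sep e k l \<and> \<not> sep e k i \<and> \<not> sep e l m)" using False e by blast
        show "\<not> (sep e k l \<and> \<not> sep e k m \<and> \<not> sep e l i)"
          using no[OF e] sep_xor[OF e V(2,1,3)] sep_xor[OF e V(2,1,4)] sep_sym by metis
      qed
      then show ?thesis using eq by simp
    next
      case True
      then obtain e where e: "e \<in> E" "sep e k l" "\<not> sep e k i" "\<not> sep e l m" by blast
      have "cherry (quartet T {l, m, k, i}) l m"
      proof (rule cherryI[OF A(3,4)])
        fix f assume f: "f \<in> E"
        show "\<not> (sep f l m \<and> \<not> sep f l k \<and> \<not> sep f m i)"
        proof
          assume *: "sep f l m \<and> \<not> sep f l k \<and> \<not> sep f m i"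
          have "sep f k i" using sep_xor[OF f V(2,3,1)] sep_xor[OF f V(3,4,1)] * sep_sym by metis
          then have "\<not> sep e k l" using split_compat[OF e(1) f V(2,1,3,4)] e * by blast
          then show False using e by blast
        qed
        show "\<not> (sep f l m \<and> \<not> sep f l i \<and> \<not> sep f m k)"
          using no[OF f] sep_xor[OF f V(3,1,4)] sep_xor[OF f V(4,1,2)] sep_sym by metis
      qed
      then show ?thesis using eq by simp
    qed
  qed
  ultimately have "cherry_property n T i j r"
    unfolding cherry_property_def by blast
  then show ?thesis by blast
qed

end

section \<open>The tree of a laminar family\<close>

text \<open>The tree is rooted at the leaf n: a member of \<open>L\<close> is the set of leaves
  below a vertex, \<open>{1..n}\<close> stands for the leaf n itself and \<open>{1..<n}\<close> for
  its only neighbour. The values of \<open>h\<close> are heights of vertices.\<close>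

locale laminar =
  fixes n :: nat and L :: "nat set set" and h :: "nat set \<Rightarrow> real"
  assumes n: "2 \<le> n"
    and top: "{1..n} \<in> L" and second: "{1..<n} \<in> L" and singletons: "\<And>k. k \<in> {1..<n} \<Longrightarrow> {k} \<in> L"
    and proper: "\<And>C. C \<in> L \<Longrightarrow> C \<noteq> {1..n} \<Longrightarrow> C \<subseteq> {1..<n}" and nonempty: "{} \<notin> L"
    and lam: "\<And>C D. C \<in> L \<Longrightarrow> D \<in> L \<Longrightarrow> C \<inter> D = {} \<or> C \<subseteq> D \<or> D \<subseteq> C"
begin

abbreviation "U \<equiv> {1..n}"
abbreviation "S \<equiv> {1..<n}"

lemma L_sub: "C \<in> L \<Longrightarrow> C \<subseteq> U"
proof (cases "C = U")
  case False
  moreover assume "C \<in> L"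
  ultimately have "C \<subseteq> S" using proper by blast
  then show ?thesis by auto
qed simp

lemma finite_L: "finite L"
proof -
  have "L \<subseteq> Pow U" using L_sub by blast
  then show ?thesis by (rule finite_subset) simp
qed

lemma finite_C: "C \<in> L \<Longrightarrow> finite C"
  using L_sub finite_subset by blast

lemma S_U: "S \<noteq> U" "S \<subset> U" "n \<in> U" "n \<notin> S"
  using n by auto

definition par :: "nat set \<Rightarrow> nat set" where
  "par C = \<Inter>{D \<in> L. C \<subset> D}"

lemma par:
  assumes C: "C \<in> L" "C \<noteq> U"
  shows "par C \<in> L" "C \<subset> par C" "\<And>D. D \<in> L \<Longrightarrow> C \<subset> D \<Longrightarrow> par C \<subseteq> D"
proof -
  let ?P = "{D \<in> L. C \<subset> D}"
  have fin: "finite ?P" using finite_L by simp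
  have "U \<in> ?P" using C L_sub top by auto
  then have "?P \<noteq> {}" by (metis empty_iff)
  from finite_has_minimal[OF fin this] obtain M where M: "M \<in> ?P" "\<forall>D\<in>?P. D \<le> M \<longrightarrow> M = D"
    by (elim bexE)
  have "C \<noteq> {}" using C nonempty by auto
  have "M \<subseteq> D" if D: "D \<in> ?P" for D
  proof -
    have "M \<inter> D \<noteq> {}" using M(1) D \<open>C \<noteq> {}\<close> by blast
    then have "M \<subseteq> D \<or> D \<subseteq> M" using lam[of M D] M(1) D by auto
    then show ?thesis using bspec[OF M(2) D] by auto
  qed
  then have "par C = M" unfolding par_def using M(1) by blast
  then show "par C \<in> L" "C \<subset> par C" "\<And>D. D \<in> L \<Longrightarrow> C \<subset> D \<Longrightarrow> par C \<subseteq> D"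
    using M(1) \<open>\<And>D. D \<in> ?P \<Longrightarrow> M \<subseteq> D\<close> by auto
qed

text \<open>Leaves must carry their labels as names; all other vertices receive numbers above
  n.\<close>

definition enc :: "nat set \<Rightarrow> nat" where
  "enc C = (if C = U then n else if is_singleton C then the_elem C else n + 1 + set_encode C)"

lemma enc_U [simp]: "enc U = n" and enc_single: "k \<in> S \<Longrightarrow> enc {k} = k"
proof -
  assume k: "k \<in> S"
  have "{k} \<noteq> U"
  proof
    assume "{k} = U"
    moreover have "1 \<in> U" "n \<in> U" using n by auto
    ultimately have "1 = k" "n = k" by blast+
    then show False using n by simp
  qed
  then show "enc {k} = k" by (simp add: enc_def)
qed (simp add: enc_def)

lemma enc_Suc0 [simp]: "enc {Suc 0..n} = n"
  using enc_U by (simp only: One_nat_def)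

lemma enc_cases:
  assumes "C \<in> L"
  obtains "C = U" "enc C = n" | k where "k \<in> S" "C = {k}" "enc C = k"
  | "C \<noteq> U" "\<not> is_singleton C" "enc C = n + 1 + set_encode C"
proof (cases "C = U")
  case False
  show ?thesis
  proof (cases "is_singleton C")
    case True
    then obtain k where "C = {k}" by (auto simp: is_singleton_def)
    then show ?thesis using that(2)[of k] proper[OF assms False] enc_single by auto
  next
    case False
    then show ?thesis using that(3) \<open>C \<noteq> U\<close> by (simp add: enc_def)
  qed
next
  case True
  then have "enc C = n" by (simp only: enc_U)
  then show ?thesis using that(1) True by blast
qed

lemma inj_enc: "inj_on enc L"
proof (rule inj_onI)
  fix C D assume CD: "C \<in> L" "D \<in> L" "enc C = enc D"
  have se: "set_encode C = set_encode D \<Longrightarrow> C = D"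
    using inj_on_set_encode finite_C[OF CD(1)] finite_C[OF CD(2)] by (auto simp: inj_on_def)
  show "C = D"
    by (rule enc_cases[OF CD(1)]; rule enc_cases[OF CD(2)]) (use CD(3) se in auto)
qed

lemma enc_eq: "C \<in> L \<Longrightarrow> D \<in> L \<Longrightarrow> enc C = enc D \<longleftrightarrow> C = D"
  using inj_enc by (auto simp: inj_on_def)

text \<open>The edge above the vertex C; every edge arises once in this way.\<close>

definition eg :: "nat set \<Rightarrow> nat set" where
  "eg C = {enc C, enc (par C)}"

definition LT :: ugraph where
  "LT = \<lparr>gverts = enc ` L, gedges = eg ` (L - {U})\<rparr>"

lemma LT_simps [simp]: "gverts LT = enc ` L" "gedges LT = eg ` (L - {U})"
  by (simp_all add: LT_def)

lemma eg_inj: "inj_on eg (L - {U})"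
proof (rule inj_onI)
  fix C D assume CD: "C \<in> L - {U}" "D \<in> L - {U}" "eg C = eg D"
  have "C = D \<or> (C = par D \<and> par C = D)"
    using CD par(1)[of C] par(1)[of D] by (auto simp: eg_def doubleton_eq_iff enc_eq)
  then show "C = D" using par(2)[of C] par(2)[of D] CD by auto
qed

lemma eg_enc_iff:
  assumes "C \<in> L" "D \<in> L"
  shows "{enc C, enc D} \<in> gedges LT \<longleftrightarrow> (C \<noteq> U \<and> D = par C) \<or> (D \<noteq> U \<and> C = par D)"
proof
  assume "{enc C, enc D} \<in> gedges LT"
  then obtain F where F: "F \<in> L" "F \<noteq> U" "{enc C, enc D} = {enc F, enc (par F)}" by (auto simp: eg_def)
  then show "(C \<noteq> U \<and> D = par C) \<or> (D \<noteq> U \<and> C = par D)"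
    using assms par(1)[OF F(1,2)] by (auto simp: doubleton_eq_iff enc_eq)
next
  assume "(C \<noteq> U \<and> D = par C) \<or> (D \<noteq> U \<and> C = par D)"
  then have "{enc C, enc D} = eg C \<and> C \<in> L - {U} \<or> {enc C, enc D} = eg D \<and> D \<in> L - {U}"
    using assms by (auto simp: eg_def)
  then show "{enc C, enc D} \<in> gedges LT" by auto
qed

lemma LT_edge_sub: "e \<in> gedges LT \<Longrightarrow> e \<subseteq> gverts LT"
  using par(1) by (auto simp: eg_def)

lemma LT_edge_vertex: "e \<in> gedges LT \<Longrightarrow> x \<in> e \<Longrightarrow> \<exists>C\<in>L. x = enc C"
  using LT_edge_sub by auto

lemma LT_simple: "simple_graph LT"
proof -
  have "eg C \<in> {{a, b} |a b. a \<in> enc ` L \<and> b \<in> enc ` L \<and> a \<noteq> b}" if C: "C \<in> L" "C \<noteq> U" for C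
  proof -
    have "enc C \<noteq> enc (par C)" using enc_eq[OF C(1) par(1)[OF C]] par(2)[OF C] by auto
    then show ?thesis using C par(1)[OF C] by (auto simp: eg_def)
  qed
  then show ?thesis using finite_L by (auto simp: simple_graph_def)
qed

lemma LT_to_top: "C \<in> L \<Longrightarrow> (enc C, enc U) \<in> (adj (gedges LT))\<^sup>*"
proof (induction "card (U - C)" arbitrary: C rule: less_induct)
  case less
  show ?case
  proof (cases "C = U")
    case False
    note p = par[OF less.prems False]
    have "U - par C \<subset> U - C" using p(1,2) L_sub by blast
    then have "card (U - par C) < card (U - C)" by (intro psubset_card_mono) auto
    then have "(enc (par C), enc U) \<in> (adj (gedges LT))\<^sup>*" using less.hyps p(1) by blast
    moreover have "(enc C, enc (par C)) \<in> adj (gedges LT)"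
      using eg_enc_iff[OF less.prems p(1)] False by (simp add: adj_def)
    ultimately show ?thesis by (meson converse_rtrancl_into_rtrancl)
  qed simp
qed

lemma LT_connected: "connected_graph LT"
  unfolding connected_graph_def
proof (intro ballI)
  fix a b assume ab: "a \<in> gverts LT" "b \<in> gverts LT"
  then have "(a, enc U) \<in> (adj (gedges LT))\<^sup>*" "(enc U, b) \<in> (adj (gedges LT))\<^sup>*"
    using LT_to_top adj_sym by auto
  then have "(a, b) \<in> (adj (gedges LT))\<^sup>*" by (rule rtrancl_trans)
  then obtain p where p: "p \<noteq> []" "hd p = a" "last p = b" "distinct p"
    "successively (\<lambda>c d. {c, d} \<in> gedges LT) p"
    using rtrancl_imp_simple_path by blast
  have "p ! m \<in> gverts LT" if m: "m < length p" for m
  proof (cases m)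
    case 0
    then show ?thesis using p(1,2) ab(1) by (simp add: hd_conv_nth)
  next
    case (Suc k)
    then have "{p ! k, p ! m} \<in> gedges LT" using p(5) m by (simp add: successively_conv_nth)
    then show ?thesis using LT_edge_sub by blast
  qed
  then have "set p \<subseteq> gverts LT" by (auto simp: in_set_conv_nth)
  then show "\<exists>p. is_path LT a b p" using p unfolding is_path_def by blast
qed

text \<open>Both neighbours on a cycle of its smallest member would be the parent of this member.\<close>

lemma LT_acyclic: "acyclic_graph LT"
  unfolding acyclic_graph_def
proof
  assume "\<exists>p. 3 \<le> length p \<and> distinct p \<and> successively (\<lambda>c d. {c, d} \<in> gedges LT) p \<and> {last p, hd p} \<in> gedges LT"
  then obtain p where p: "3 \<le> length p" "distinct p" "successively (\<lambda>c d. {c, d} \<in> gedges LT) p"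
    "{last p, hd p} \<in> gedges LT" by blast
  have ne: "p \<noteq> []" using p(1) by auto
  let ?len = "length p"
  have edge: "{p ! q, p ! (Suc q mod ?len)} \<in> gedges LT" if "q < ?len" for q
  proof (cases "Suc q = ?len")
    case True
    then have "q = ?len - 1" "Suc q mod ?len = 0" by simp_all
    then show ?thesis using p(4) ne by (simp add: last_conv_nth hd_conv_nth)
  next
    case False
    then have "Suc q < ?len" using that by simp
    then show ?thesis using p(3) by (simp add: successively_conv_nth)
  qed
  have "\<exists>C\<in>L. p ! q = enc C" if "q < ?len" for q
    using LT_edge_vertex[OF edge[OF that], of "p ! q"] by simp
  then obtain c where c: "\<And>q. q < ?len \<Longrightarrow> c q \<in> L \<and> p ! q = enc (c q)" by metis
  obtain m where m: "m < ?len" "\<And>q. q < ?len \<Longrightarrow> card (c m) \<le> card (c q)"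
  proof -
    have "0 < ?len" using ne by simp
    from ex_has_least_nat[of "\<lambda>q. q < ?len", OF this, of "\<lambda>q. card (c q)"] that show ?thesis by (elim exE conjE) blast
  qed
  have up: "p ! q = enc (par (c m))" if q: "q < ?len" "{p ! m, p ! q} \<in> gedges LT" for q
  proof -
    have cm: "c m \<in> L" "c q \<in> L" using c m(1) q(1) by auto
    have "(c m \<noteq> U \<and> c q = par (c m)) \<or> (c q \<noteq> U \<and> c m = par (c q))"
      using q(2) eg_enc_iff[OF cm] c m(1) q(1) by simp
    then show ?thesis
    proof
      assume "c q \<noteq> U \<and> c m = par (c q)"
      then have "c q \<subset> c m" using par(2)[OF cm(2)] by simp
      then have "card (c q) < card (c m)" using finite_C[OF cm(1)] by (rule psubset_card_mono[rotated])
      then show ?thesis using m(2)[OF q(1)] by simp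
    qed (use c q in auto)
  qed
  define s where "s = Suc m mod ?len"
  define t where "t = (if m = 0 then ?len - 1 else m - 1)"
  have s: "s < ?len" unfolding s_def by (rule mod_less_divisor) (simp add: ne)
  have t: "t < ?len" "Suc t mod ?len = m" using p(1) m(1) by (auto simp: t_def)
  have "p ! s = enc (par (c m))" using up[OF s] edge[OF m(1)] s_def by simp
  moreover have "p ! t = enc (par (c m))" using up[OF t(1)] edge[OF t(1)] t(2) by (simp add: insert_commute)
  ultimately have "s = t" using nth_eq_iff_index_eq[OF p(2) s t(1)] by simp
  moreover have "s = (if Suc m = ?len then 0 else Suc m)" using m(1) by (simp add: s_def)
  ultimately show False using p(1) m(1) by (auto simp: t_def split: if_splits)
qed

lemma LT_incident:
  assumes "C \<in> L"
  shows "{e \<in> gedges LT. enc C \<in> e} = eg ` {D \<in> L - {U}. D = C \<or> par D = C}"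
proof -
  have "enc C \<in> eg D \<longleftrightarrow> D = C \<or> par D = C" if "D \<in> L - {U}" for D
    using that assms par(1)[of D] by (auto simp: eg_def enc_eq)
  then show ?thesis by auto
qed

lemma LT_deg: "C \<in> L \<Longrightarrow> deg LT (enc C) = card {D \<in> L - {U}. D = C \<or> par D = C}"
  unfolding deg_def LT_incident
  by (rule card_image) (rule inj_on_subset[OF eg_inj], auto)

lemma deg_U: "deg LT n = 1"
proof -
  have "{D \<in> L - {U}. D = U \<or> par D = U} = {S}"
  proof (intro set_eqI iffI)
    fix D assume "D \<in> {D \<in> L - {U}. D = U \<or> par D = U}"
    then have D: "D \<in> L" "D \<noteq> U" "par D = U" by auto
    then have "D \<subseteq> S" using proper by blast
    moreover have "\<not> D \<subset> S" using par(3)[OF D(1,2) second] D(3) S_U by auto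
    ultimately show "D \<in> {S}" by auto
  next
    fix D assume "D \<in> {S}"
    then have D: "D = S" by simp
    note p = par[OF second S_U(1)]
    have "par S = U" using p(2) proper[OF p(1)] by blast
    then show "D \<in> {D \<in> L - {U}. D = U \<or> par D = U}" using D second S_U by auto
  qed
  then show ?thesis using LT_deg[OF top] by simp
qed

lemma deg_single:
  assumes "k \<in> S" shows "deg LT k = 1"
proof -
  have kL: "{k} \<in> L" "{k} \<noteq> U" using singletons[OF assms] assms S_U by auto
  have "{D \<in> L - {U}. D = {k} \<or> par D = {k}} = {{k}}"
  proof -
    have "D = {k}" if "D \<in> L" "D \<noteq> U" "par D = {k}" for D
      using par(2)[OF that(1,2)] that nonempty by (metis subset_singletonD psubset_imp_subset)
    then show ?thesis using kL by auto
  qed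
  then show ?thesis using LT_deg[OF kL(1)] enc_single[OF assms] by simp
qed

lemma child_exists:
  assumes C: "C \<in> L" "C \<noteq> U" "\<not> is_singleton C" "k \<in> C"
  obtains D where "D \<in> L" "k \<in> D" "D \<subset> C" "par D = C"
proof -
  have kS: "k \<in> S" using C proper by blast
  let ?P = "{D \<in> L. k \<in> D \<and> D \<subset> C}"
  have "{k} \<in> ?P" using singletons[OF kS] C by (auto simp: is_singleton_def)
  then have ne: "?P \<noteq> {}" by (metis empty_iff)
  have fin: "finite ?P" using finite_L by simp
  from finite_has_maximal[OF fin ne] obtain D where D: "D \<in> ?P" "\<forall>F\<in>?P. D \<le> F \<longrightarrow> D = F"
    by (elim bexE)
  have DL: "D \<in> L" "D \<subset> C" "k \<in> D" using D by auto
  have DU: "D \<noteq> U" using DL C proper L_sub by blast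
  note p = par[OF DL(1) DU]
  have "par D \<subseteq> C" by (rule p(3)[OF C(1) DL(2)])
  moreover have "\<not> par D \<subset> C" using D(2) p(1,2) DL(3) by blast
  ultimately have "par D = C" by auto
  then show ?thesis using that DL by blast
qed

text \<open>A maximal proper submember does not exhaust C, so there are at least two children
  besides the edge upwards.\<close>

lemma deg_inner:
  assumes C: "C \<in> L" "C \<noteq> U" "\<not> is_singleton C"
  shows "3 \<le> deg LT (enc C)"
proof -
  have "C \<noteq> {}" using C(1) nonempty by auto
  then obtain k where k: "k \<in> C" by blast
  obtain D1 where D1: "D1 \<in> L" "k \<in> D1" "D1 \<subset> C" "par D1 = C" by (rule child_exists[OF C k])
  obtain l where l: "l \<in> C" "l \<notin> D1" using D1(3) by blast
  obtain D2 where D2: "D2 \<in> L" "l \<in> D2" "D2 \<subset> C" "par D2 = C" by (rule child_exists[OF C l(1)])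
  have ne: "D1 \<noteq> D2" using l D2 by blast
  have sub: "{D1, D2, C} \<subseteq> {D \<in> L - {U}. D = C \<or> par D = C}"
    using D1 D2 C L_sub[OF C(1)] by auto
  have fin: "finite {D \<in> L - {U}. D = C \<or> par D = C}" using finite_L by simp
  have "card {D1, D2, C} \<le> card {D \<in> L - {U}. D = C \<or> par D = C}" by (rule card_mono[OF fin sub])
  moreover have "card {D1, D2, C} = 3" using ne D1(3) D2(3) by auto
  ultimately show ?thesis using LT_deg[OF C(1)] by simp
qed

lemma leaf_enc: "k \<in> U \<Longrightarrow> \<exists>C\<in>L. enc C = k"
proof (cases "k = n")
  case True
  then show ?thesis using top by (intro bexI[of _ U]) simp_all
next
  case False
  moreover assume "k \<in> U"
  ultimately have "k \<in> S" by simp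
  then show ?thesis using singletons[of k] enc_single[of k] by (intro bexI[of _ "{k}"])
qed

lemma LT_leaves: "leaves LT = U"
proof (intro set_eqI iffI)
  fix a assume "a \<in> leaves LT"
  then obtain C where C: "C \<in> L" "a = enc C" "deg LT (enc C) = 1" by (auto simp: leaves_def)
  show "a \<in> U"
  proof (rule enc_cases[OF C(1)])
    assume "C \<noteq> U" "\<not> is_singleton C"
    then show ?thesis using deg_inner[OF C(1)] C(3) by simp
  qed (use C(2) n in auto)
next
  fix a assume a: "a \<in> U"
  then have "deg LT a = 1" using deg_U deg_single by (cases "a = n") auto
  then show "a \<in> leaves LT" using leaf_enc[OF a] by (auto simp: leaves_def)
qed

lemma LT_tree: "tree_on n LT"
proof -
  have "deg LT (enc C) \<noteq> 2" if C: "C \<in> L" for C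
  proof (rule enc_cases[OF C])
    assume "C \<noteq> U" "\<not> is_singleton C"
    then show ?thesis using deg_inner[OF C] by simp
  qed (use deg_U deg_single in auto)
  then show ?thesis
    using LT_simple LT_connected LT_acyclic LT_leaves by (auto simp: tree_on_def)
qed

sublocale phylo LT n
  using LT_simple LT_connected LT_acyclic LT_leaves by unfold_locales

lemma cut:
  assumes C: "C \<in> L" "C \<noteq> U" and ab: "\<not> sep (eg C) a b" and A: "A = enc ` {D \<in> L. D \<subseteq> C}"
  shows "a \<in> A \<Longrightarrow> b \<in> A"
proof -
  have step: "y \<in> A" if xy: "x \<in> A" "{x, y} \<in> gedges LT - {eg C}" for x y
  proof -
    obtain D where D: "D \<in> L" "D \<subseteq> C" "x = enc D" using xy(1) A by auto
    have "{x, y} \<in> gedges LT" using xy(2) by blast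
    from LT_edge_vertex[OF this, of y] obtain F where F: "F \<in> L" "y = enc F" by blast
    have "{enc D, enc F} \<in> gedges LT" using xy(2) D F by blast
    then have "(D \<noteq> U \<and> F = par D) \<or> (F \<noteq> U \<and> D = par F)"
      using eg_enc_iff[OF D(1) F(1)] by blast
    then have "F \<subseteq> C"
    proof
      assume "F \<noteq> U \<and> D = par F"
      then show ?thesis using par(2)[OF F(1)] D(2) by auto
    next
      assume h: "D \<noteq> U \<and> F = par D"
      have "D \<noteq> C" using xy(2) D F h by (auto simp: eg_def)
      then show ?thesis using par(3)[OF D(1) _ C(1)] h D(2) by auto
    qed
    then show ?thesis using F A by auto
  qed
  assume "a \<in> A"
  have "(a, b) \<in> (adj (gedges LT - {eg C}))\<^sup>*" using ab by (simp add: sep_def)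
  then show "b \<in> A"
    using \<open>a \<in> A\<close> by (induction rule: rtrancl_induct) (use step in \<open>auto simp: adj_def\<close>)
qed

text \<open>Without the edge above C one cannot leave the set of vertices below C, by
  \<open>cut\<close>; the two ends reach everything on their own sides.\<close>

lemma sep_eg:
  assumes C: "C \<in> L" "C \<noteq> U" and kl: "k \<in> U" "l \<in> U"
  shows "sep (eg C) k l \<longleftrightarrow> (k \<in> C) \<noteq> (l \<in> C)"
proof -
  define A where "A = enc ` {D \<in> L. D \<subseteq> C}"
  note cut = cut[OF C _ A_def]
  note p = par[OF C]
  have inA: "x \<in> A \<longleftrightarrow> x \<in> C" if x: "x \<in> U" for x
  proof (cases "x = n")
    case True
    have "\<not> U \<subseteq> C" using C L_sub by blast
    then have "n \<notin> A" using enc_eq[OF top] by (auto simp: A_def)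
    moreover have "n \<notin> C" using proper[OF C] by auto
    ultimately show ?thesis using True by simp
  next
    case False
    then have xS: "x \<in> S" using x by auto
    have "x \<in> A \<longleftrightarrow> {x} \<subseteq> C"
      using enc_single[OF xS] singletons[OF xS] enc_eq[OF singletons[OF xS]] by (auto simp: A_def)
    then show ?thesis by simp
  qed
  have eC: "enc C \<in> A" using C by (auto simp: A_def)
  have eP: "enc (par C) \<notin> A" using p enc_eq by (auto simp: A_def)
  have two: "\<not> sep (eg C) (enc C) x \<or> \<not> sep (eg C) (enc (par C)) x" if "x \<in> U" for x
    by (rule sep_two_sides[OF eg_def]) (use leaf_enc[OF that] C in auto)
  have side: "\<not> sep (eg C) (if x \<in> C then enc C else enc (par C)) x" if x: "x \<in> U" for x
  proof (cases "x \<in> C")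
    case True
    then have "x \<in> A" using inA[OF x] by simp
    then have "sep (eg C) x (enc (par C))" using cut[of x "enc (par C)"] eP by blast
    then have "sep (eg C) (enc (par C)) x" using sep_sym by simp
    then show ?thesis using two[OF x] True by simp
  next
    case False
    then have "x \<notin> A" using inA[OF x] by simp
    then have "sep (eg C) (enc C) x" using cut[of "enc C" x] eC by blast
    then show ?thesis using two[OF x] False by simp
  qed
  show ?thesis
  proof
    assume "sep (eg C) k l"
    show "(k \<in> C) \<noteq> (l \<in> C)"
    proof
      assume "(k \<in> C) = (l \<in> C)"
      then have "\<not> sep (eg C) k (if k \<in> C then enc C else enc (par C))"
        "\<not> sep (eg C) (if k \<in> C then enc C else enc (par C)) l"
        using side[OF kl(1)] side[OF kl(2)] sep_sym by simp_all
      then have "\<not> sep (eg C) k l" by (rule not_sep_trans)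
      then show False using \<open>sep (eg C) k l\<close> by simp
    qed
  next
    assume "(k \<in> C) \<noteq> (l \<in> C)"
    then show "sep (eg C) k l" using cut[of k l] cut[of l k] inA[OF kl(1)] inA[OF kl(2)] sep_sym[of "eg C" k l] by blast
  qed
qed

text \<open>Edge lengths are height differences. Heights belong to members of \<open>L\<close>, so
  the edge has to be decoded first.\<close>

definition wt :: "nat set \<Rightarrow> real" where
  "wt e = (let C = inv_into (L - {U}) eg e in h (par C) - h C)"

lemma wt_eg: "C \<in> L \<Longrightarrow> C \<noteq> U \<Longrightarrow> wt (eg C) = h (par C) - h C"
proof -
  assume "C \<in> L" "C \<noteq> U"
  then have "inv_into (L - {U}) eg (eg C) = C" by (intro inv_into_f_f[OF eg_inj]) blast
  then show ?thesis unfolding wt_def by (simp only: Let_def)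
qed

lemma telescope:
  assumes "C \<in> L" "P \<in> L" "C \<subseteq> P"
  shows "(\<Sum>D\<in>{D \<in> L. C \<subseteq> D \<and> D \<subset> P}. h (par D) - h D) = h P - h C"
  using assms
proof (induction "card (P - C)" arbitrary: C rule: less_induct)
  case less
  show ?case
  proof (cases "C = P")
    case True
    then have "{D \<in> L. C \<subseteq> D \<and> D \<subset> P} = {}" by auto
    then show ?thesis by (simp only: True sum.empty diff_self)
  next
    case False
    then have CP: "C \<subset> P" using less.prems by auto
    then have CU: "C \<noteq> U" using less.prems L_sub by blast
    note p = par[OF less.prems(1) CU]
    have pP: "par C \<subseteq> P" by (rule p(3)[OF less.prems(2) CP])
    have eq: "{D \<in> L. C \<subseteq> D \<and> D \<subset> P} = insert C {D \<in> L. par C \<subseteq> D \<and> D \<subset> P}"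
    proof (intro set_eqI iffI)
      fix D assume D: "D \<in> {D \<in> L. C \<subseteq> D \<and> D \<subset> P}"
      then show "D \<in> insert C {D \<in> L. par C \<subseteq> D \<and> D \<subset> P}"
        using p(3)[of D] by (cases "D = C") auto
    qed (use p CP less.prems in auto)
    have "P - par C \<subset> P - C" using p(2) pP by blast
    then have "card (P - par C) < card (P - C)" using finite_C[OF less.prems(2)] by (intro psubset_card_mono) auto
    then have IH: "(\<Sum>D\<in>{D \<in> L. par C \<subseteq> D \<and> D \<subset> P}. h (par D) - h D) = h P - h (par C)"
      using less.hyps p(1) less.prems(2) pP by blast
    have "C \<notin> {D \<in> L. par C \<subseteq> D \<and> D \<subset> P}" using p(2) by auto
    then show ?thesis unfolding eq using finite_L IH by simp
  qed
qed

text \<open>The vertex of the leaf k; the root leaf n is the whole set.\<close>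

definition lf :: "nat \<Rightarrow> nat set" where
  "lf k = (if k = n then U else {k})"

lemma lf_L: "k \<in> U \<Longrightarrow> lf k \<in> L"
  using top singletons by (auto simp: lf_def)

lemma lf_sub: "k \<in> U \<Longrightarrow> C \<in> L \<Longrightarrow> lf k \<subseteq> C \<longleftrightarrow> k \<in> C"
proof -
  assume C: "C \<in> L"
  show ?thesis
  proof (cases "k = n")
    case True
    have "C = U" if "n \<in> C"
    proof (rule ccontr)
      assume "C \<noteq> U"
      then have "n \<in> S" using proper[OF C] that by blast
      then show False by simp
    qed
    moreover have "n \<in> C" if "U \<subseteq> C" using that n by auto
    moreover have "lf k = U" using True by (simp add: lf_def)
    ultimately show ?thesis using True by blast
  qed (simp add: lf_def)
qed

text \<open>P is the lowest common ancestor of k and l. The path climbs from each of the two leaves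
  to P, and the height differences telescope on both halves.\<close>

lemma tdist_LT:
  assumes kl: "k \<in> U" "l \<in> U" "k \<noteq> l" and P: "P \<in> L" "k \<in> P" "l \<in> P" "\<And>D. D \<in> L \<Longrightarrow> k \<in> D \<Longrightarrow> l \<in> D \<Longrightarrow> P \<subseteq> D"
  shows "(\<Sum>e\<in>path_edges (tpath LT k l). wt e) = 2 * h P - h (lf k) - h (lf l)"
proof -
  have V: "k \<in> gverts LT" "l \<in> gverts LT" using leaf_enc kl by auto
  have half: "{C \<in> L - {U}. a \<in> C \<and> b \<notin> C} = {C \<in> L. lf a \<subseteq> C \<and> C \<subset> P}"
    if ab: "a \<in> U" "b \<in> U" "a \<in> P" "b \<in> P" "\<And>D. D \<in> L \<Longrightarrow> a \<in> D \<Longrightarrow> b \<in> D \<Longrightarrow> P \<subseteq> D" for a b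
  proof (intro set_eqI iffI)
    fix C assume C: "C \<in> {C \<in> L - {U}. a \<in> C \<and> b \<notin> C}"
    then have "C \<inter> P \<noteq> {}" using ab by blast
    then have "C \<subseteq> P \<or> P \<subseteq> C" using lam[of C P] P(1) C by auto
    then have "C \<subset> P" using C ab by auto
    then show "C \<in> {C \<in> L. lf a \<subseteq> C \<and> C \<subset> P}" using C lf_sub[OF ab(1)] by auto
  next
    fix C assume C: "C \<in> {C \<in> L. lf a \<subseteq> C \<and> C \<subset> P}"
    then have "a \<in> C" using lf_sub[OF ab(1)] by auto
    moreover have "b \<notin> C" using ab(5)[of C] C \<open>a \<in> C\<close> by auto
    moreover have "C \<noteq> U" using C L_sub[OF P(1)] by auto
    ultimately show "C \<in> {C \<in> L - {U}. a \<in> C \<and> b \<notin> C}" using C by auto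
  qed
  have sum_half: "(\<Sum>C\<in>{C \<in> L - {U}. a \<in> C \<and> b \<notin> C}. h (par C) - h C) = h P - h (lf a)"
    if ab: "a \<in> U" "b \<in> U" "a \<in> P" "b \<in> P" "\<And>D. D \<in> L \<Longrightarrow> a \<in> D \<Longrightarrow> b \<in> D \<Longrightarrow> P \<subseteq> D" for a b
    using telescope[OF lf_L[OF ab(1)] P(1)] lf_sub[OF ab(1) P(1)] ab(3) half[OF ab] by simp
  have "path_edges (tpath LT k l) = {e \<in> gedges LT. sep e k l}" by (rule tpath_edges[OF V])
  also have "\<dots> = eg ` {C \<in> L - {U}. (k \<in> C) \<noteq> (l \<in> C)}" using sep_eg kl by auto
  finally have pe: "path_edges (tpath LT k l) = eg ` {C \<in> L - {U}. (k \<in> C) \<noteq> (l \<in> C)}" .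
  have inj: "inj_on eg {C \<in> L - {U}. (k \<in> C) \<noteq> (l \<in> C)}" by (rule inj_on_subset[OF eg_inj]) blast
  have "(\<Sum>e\<in>path_edges (tpath LT k l). wt e) = (\<Sum>C\<in>{C \<in> L - {U}. (k \<in> C) \<noteq> (l \<in> C)}. wt (eg C))"
    unfolding pe by (simp only: sum.reindex[OF inj] o_def)
  also have "\<dots> = (\<Sum>C\<in>{C \<in> L - {U}. (k \<in> C) \<noteq> (l \<in> C)}. h (par C) - h C)"
    by (intro sum.cong) (auto simp: wt_eg)
  also have "{C \<in> L - {U}. (k \<in> C) \<noteq> (l \<in> C)} = {C \<in> L - {U}. k \<in> C \<and> l \<notin> C} \<union> {C \<in> L - {U}. l \<in> C \<and> k \<notin> C}" by blast
  also have "(\<Sum>C\<in>\<dots>. h (par C) - h C) = (h P - h (lf k)) + (h P - h (lf l))"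
  proof (subst sum.union_disjoint)
    have "P \<subseteq> D" if "D \<in> L" "l \<in> D" "k \<in> D" for D using P(4) that by blast
    then show "(\<Sum>C\<in>{C \<in> L - {U}. k \<in> C \<and> l \<notin> C}. h (par C) - h C) + (\<Sum>C\<in>{C \<in> L - {U}. l \<in> C \<and> k \<notin> C}. h (par C) - h C)
      = (h P - h (lf k)) + (h P - h (lf l))"
      using sum_half[OF kl(1,2) P(2,3,4)] sum_half[OF kl(2,1) P(3,2)] by simp
  qed (use finite_L in auto)
  finally show ?thesis by simp
qed

text \<open>Inner edges end neither in a singleton nor in the root, so monotonicity of the heights
  is demanded only away from them.\<close>

lemma wt_inner:
  assumes mono: "\<And>C D. C \<in> L \<Longrightarrow> D \<in> L \<Longrightarrow> C \<subseteq> D \<Longrightarrow> D \<noteq> U \<Longrightarrow> \<not> is_singleton C \<Longrightarrow> h C \<le> h D"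
    and e: "e \<in> inner_edges LT"
  shows "0 \<le> wt e"
proof -
  obtain C where C: "C \<in> L" "C \<noteq> U" "e = eg C" and nl: "e \<inter> U = {}" using e LT_leaves by (auto simp: inner_edges_def)
  note p = par[OF C(1,2)]
  have eC: "enc C \<notin> U" and eP: "enc (par C) \<notin> U" using nl C(3) by (auto simp: eg_def)
  have "\<not> is_singleton C"
  proof
    assume s: "is_singleton C"
    show False
      by (rule enc_cases[OF C(1)]) (use eC s C(2) in auto)
  qed
  moreover have "par C \<noteq> U"
  proof
    assume "par C = U"
    then have "enc (par C) = n" by (simp only: enc_U)
    then show False using eP n by simp
  qed
  ultimately have "h C \<le> h (par C)" using mono[OF C(1) p(1)] p(2) by auto
  then show ?thesis using wt_eg[OF C(1,2)] C(3) by simp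
qed

end

section \<open>Trees of tropical Pluecker vectors\<close>

definition tree_verts :: "nat \<Rightarrow> nat set" where
  "tree_verts n = {1..n} \<union> (\<lambda>C. n + 1 + set_encode C) ` Pow {1..n}"

text \<open>A finite set of trees that represents all isomorphism classes.\<close>

definition std_trees :: "nat \<Rightarrow> ugraph set" where
  "std_trees n = {T. tree_on n T \<and> gverts T \<subseteq> tree_verts n \<and> gedges T \<subseteq> Pow (tree_verts n)}"

lemma finite_std_trees: "finite (std_trees n)"
proof -
  have fin: "finite (tree_verts n)" by (simp add: tree_verts_def)
  have "std_trees n \<subseteq> (\<lambda>(a, b). \<lparr>gverts = a, gedges = b\<rparr>) ` (Pow (tree_verts n) \<times> Pow (Pow (tree_verts n)))"
  proof
    fix T assume "T \<in> std_trees n"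
    then show "T \<in> (\<lambda>(a, b). \<lparr>gverts = a, gedges = b\<rparr>) ` (Pow (tree_verts n) \<times> Pow (Pow (tree_verts n)))"
      by (intro image_eqI[of _ _ "(gverts T, gedges T)"]) (auto simp: std_trees_def)
  qed
  then show ?thesis by (rule finite_subset) (simp add: fin)
qed

text \<open>Relative to the root n the four-point condition becomes the ultrametric inequality for
  \<open>\<delta>\<close>, and an ultrametric is the same as a laminar family of clusters with
  diameters as heights. No sign condition on \<open>x\<close> is required, since edges at leaves may
  have any length.\<close>

lemma tree_of_metric:
  fixes x :: "nat set \<Rightarrow> real"
  assumes n: "2 \<le> n"
    and fp: "\<And>a b c d. {a, b, c, d} \<subseteq> {1..n} \<Longrightarrow> distinct [a, b, c, d] \<Longrightarrow>
      x {a, b} + x {c, d} \<le> max (x {a, c} + x {b, d}) (x {a, d} + x {b, c})"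
  obtains T \<omega> where "T \<in> std_trees n" "\<And>e. e \<in> inner_edges T \<Longrightarrow> 0 \<le> \<omega> e"
    "\<And>k l. k \<in> {1..n} \<Longrightarrow> l \<in> {1..n} \<Longrightarrow> k \<noteq> l \<Longrightarrow> x {k, l} = (\<Sum>e\<in>path_edges (tpath T k l). \<omega> e)"
proof -
  let ?U = "{1..n}" and ?S = "{1..<n}"
  define \<delta> where "\<delta> k l = x {k, l} - x {k, n} - x {l, n}" for k l
  have \<delta>_sym: "\<delta> k l = \<delta> l k" for k l by (simp add: \<delta>_def insert_commute)
  have ultra: "\<delta> k m \<le> max (\<delta> k l) (\<delta> l m)" if "{k, l, m} \<subseteq> ?S" "distinct [k, l, m]" for k l m
  proof -
    have sub: "{k, m, l, n} \<subseteq> ?U" "distinct [k, m, l, n]" using that by auto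
    show ?thesis using fp[OF sub] by (auto simp: \<delta>_def insert_commute max_def split: if_splits)
  qed
  \<comment> \<open>A cluster: mutual distances are strictly smaller than distances to the outside,
    which prevents two clusters from crossing.\<close>
  define cl where "cl C \<longleftrightarrow> (\<forall>a\<in>C. \<forall>b\<in>C. \<forall>m\<in>?S - C. a \<noteq> b \<longrightarrow> \<delta> a b < \<delta> a m)" for C
  have clD: "\<delta> a b < \<delta> a m" if c: "cl C" "a \<in> C" "b \<in> C" "m \<in> ?S" "m \<notin> C" "a \<noteq> b" for C a b m
  proof -
    have "m \<in> ?S - C" using c by blast
    from c(1)[unfolded cl_def, THEN bspec, OF c(2), THEN bspec, OF c(3), THEN bspec, OF this, THEN mp, OF c(6)]
    show ?thesis .
  qed
  define L where "L = insert ?U {C. C \<subseteq> ?S \<and> C \<noteq> {} \<and> cl C}"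
  define pr where "pr C = {(a, b). a \<in> C \<and> b \<in> C \<and> a \<noteq> b}" for C :: "nat set"
  define diam where "diam C = Max ((\<lambda>(a, b). \<delta> a b) ` pr C)" for C
  \<comment> \<open>Chosen so that twice the height of the common ancestor minus the heights of the
    two leaves gives back \<open>x\<close>: half the diameter cancels the factor 2, and the heights
    of leaves restore the terms x_kn and x_ln removed in \<open>\<delta>\<close>.\<close>
  define h where "h C = (if C = ?U then 0 else if is_singleton C then - x {the_elem C, n} else diam C / 2)" for C
  have notU: "C \<noteq> ?U" if "C \<subseteq> ?S" for C
  proof
    assume "C = ?U"
    moreover have "n \<in> ?U" using n by simp
    ultimately have "n \<in> ?S" using that by blast
    then show False by simp
  qed
  have finpr: "finite (pr C)" if "C \<subseteq> ?S" for C
    by (rule finite_subset[of _ "?S \<times> ?S"]) (use that in \<open>auto simp: pr_def\<close>)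
  interpret lm: laminar n L h
  proof
    show "2 \<le> n" by (rule n)
    show "?U \<in> L" "?S \<in> L" using n by (auto simp: L_def cl_def)
    show "{k} \<in> L" if "k \<in> ?S" for k using that by (auto simp: L_def cl_def)
    show "C \<subseteq> ?S" if "C \<in> L" "C \<noteq> ?U" for C using that by (auto simp: L_def)
    show "{} \<notin> L" using n by (auto simp: L_def)
    show "C \<inter> D = {} \<or> C \<subseteq> D \<or> D \<subseteq> C" if CD: "C \<in> L" "D \<in> L" for C D
    proof (rule ccontr)
      assume "\<not> ?thesis"
      then obtain a b d where abd: "a \<in> C" "a \<in> D" "b \<in> C" "b \<notin> D" "d \<in> D" "d \<notin> C" by blast
      have sub: "F \<subseteq> ?U" if "F \<in> L" for F using that by (auto simp: L_def)
      have "C \<noteq> ?U" "D \<noteq> ?U" using abd sub[OF CD(1)] sub[OF CD(2)] by auto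
      then have cl: "C \<subseteq> ?S" "cl C" "D \<subseteq> ?S" "cl D" using CD by (auto simp: L_def)
      have "\<delta> a b < \<delta> a d" using clD[OF cl(2) abd(1,3) subsetD[OF cl(3) abd(5)] abd(6)] abd(2,4) by blast
      moreover have "\<delta> a d < \<delta> a b" using clD[OF cl(4) abd(2,5) subsetD[OF cl(1) abd(3)] abd(4)] abd(1,6) by blast
      ultimately show False by simp
    qed
  qed
  have T: "lm.LT \<in> std_trees n"
  proof -
    have "lm.enc C \<in> tree_verts n" if C: "C \<in> L" for C
      by (rule lm.enc_cases[OF C]) (use lm.L_sub[OF C] n in \<open>auto simp: tree_verts_def\<close>)
    then have V: "gverts lm.LT \<subseteq> tree_verts n" by auto
    then have "gedges lm.LT \<subseteq> Pow (tree_verts n)" using lm.LT_edge_sub by blast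
    then show ?thesis using lm.LT_tree V by (simp add: std_trees_def)
  qed
  moreover have "0 \<le> lm.wt e" if e: "e \<in> inner_edges lm.LT" for e
  proof (rule lm.wt_inner[OF _ e])
    fix C D assume CD: "C \<in> L" "D \<in> L" "C \<subseteq> D" "D \<noteq> ?U" "\<not> is_singleton C"
    have DS: "D \<subseteq> ?S" using lm.proper CD by blast
    then have CS: "C \<subseteq> ?S" using CD by blast
    have CU: "C \<noteq> ?U" by (rule notU[OF CS])
    have "C \<noteq> {}" using CD lm.nonempty by auto
    then obtain a where a: "a \<in> C" by blast
    then obtain b where b: "b \<in> C" "b \<noteq> a" using CD(5) unfolding is_singleton_def by blast
    have "\<not> is_singleton D" using a b CD(3) by (auto simp: is_singleton_def)
    moreover have "(a, b) \<in> pr C" using a b by (auto simp: pr_def)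
    then have "diam C \<le> diam D" unfolding diam_def
      using CD(3) finpr[OF DS] by (intro Max_mono image_mono) (auto simp: pr_def)
    ultimately show "h C \<le> h D" using CD CU by (simp add: h_def)
  qed
  moreover have "x {k, l} = (\<Sum>e\<in>path_edges (tpath lm.LT k l). lm.wt e)" if kl: "k \<in> ?U" "l \<in> ?U" "k \<noteq> l" for k l
  proof (cases "k = n \<or> l = n")
    case True
    define m where "m = (if k = n then l else k)"
    have m: "m \<in> ?S" "{k, l} = {m, n}" using True kl by (auto simp: m_def)
    have "?U \<subseteq> D" if "D \<in> L" "k \<in> D" "l \<in> D" for D
      using that True lm.proper[of D] by (cases "D = ?U") auto
    then have "(\<Sum>e\<in>path_edges (tpath lm.LT k l). lm.wt e) = 2 * h ?U - h (lm.lf k) - h (lm.lf l)"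
      using kl by (intro lm.tdist_LT lm.top) auto
    also have "\<dots> = - h {m}" using True kl by (auto simp: lm.lf_def h_def m_def)
    also have "\<dots> = x {m, n}"
    proof -
      have "{m} \<noteq> ?U" using m(1) lm.S_U by auto
      then show ?thesis by (simp add: h_def)
    qed
    finally show ?thesis using m by simp
  next
    case False
    then have klS: "k \<in> ?S" "l \<in> ?S" using kl by auto
    \<comment> \<open>The ball around k with radius \<open>\<delta> k l\<close> is the smallest
      cluster containing k and l.\<close>
    define B where "B = {m \<in> ?S. m = k \<or> \<delta> k m \<le> \<delta> k l}"
    have BS: "B \<subseteq> ?S" "k \<in> B" "l \<in> B" using klS by (auto simp: B_def)
    have in1: "\<delta> a b \<le> \<delta> k l" if "a \<in> B" "b \<in> B" "a \<noteq> b" for a b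
    proof (cases "a = k \<or> b = k")
      case True then show ?thesis using that \<delta>_sym[of a b] by (auto simp: B_def)
    next
      case False
      then have "\<delta> a b \<le> max (\<delta> a k) (\<delta> k b)" using that klS by (intro ultra) (auto simp: B_def)
      then show ?thesis using that False \<delta>_sym[of a k] by (auto simp: B_def)
    qed
    have out: "\<delta> k l < \<delta> a m" if "a \<in> B" "m \<in> ?S - B" for a m
    proof (cases "a = k")
      case True then show ?thesis using that by (auto simp: B_def)
    next
      case False
      then have "\<delta> k m \<le> max (\<delta> k a) (\<delta> a m)" using that klS by (intro ultra) (auto simp: B_def)
      then show ?thesis using that False by (auto simp: B_def)
    qed
    have "cl B" unfolding cl_def
    proof (intro ballI impI)
      fix a b m assume "a \<in> B" "b \<in> B" "m \<in> ?S - B" "a \<noteq> b"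
      then show "\<delta> a b < \<delta> a m" using in1[of a b] out[of a m] by linarith
    qed
    then have BL: "B \<in> L" using BS by (auto simp: L_def)
    have "B \<subseteq> D" if D: "D \<in> L" "k \<in> D" "l \<in> D" for D
    proof (cases "D = ?U")
      case True then show ?thesis using BS by auto
    next
      case False
      then have "cl D" using D by (auto simp: L_def)
      show ?thesis
      proof
        fix m assume m: "m \<in> B"
        show "m \<in> D"
        proof (rule ccontr)
          assume "m \<notin> D"
          then have "\<delta> k l < \<delta> k m" by (rule clD[OF \<open>cl D\<close> D(2,3) subsetD[OF BS(1) m] _ kl(3)])
          moreover have "m \<noteq> k" using \<open>m \<notin> D\<close> D by auto
          ultimately show False using m by (auto simp: B_def)
        qed
      qed
    qed
    then have "(\<Sum>e\<in>path_edges (tpath lm.LT k l). lm.wt e) = 2 * h B - h (lm.lf k) - h (lm.lf l)"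
      using kl BL BS by (intro lm.tdist_LT) auto
    moreover have "h (lm.lf k) = - x {k, n}" "h (lm.lf l) = - x {l, n}"
    proof -
      have "{k} \<noteq> ?U" "{l} \<noteq> ?U" using klS lm.S_U by auto
      then show "h (lm.lf k) = - x {k, n}" "h (lm.lf l) = - x {l, n}" using False by (simp_all add: h_def lm.lf_def)
    qed
    moreover have "h B = \<delta> k l / 2"
    proof -
      have "diam B = \<delta> k l" unfolding diam_def
        using finpr[OF BS(1)] in1 BS kl(3) by (intro Max_eqI) (force simp: pr_def)+
      moreover have "B \<noteq> ?U" by (rule notU[OF BS(1)])
      moreover have "\<not> is_singleton B" using BS kl(3) by (auto simp: is_singleton_def)
      ultimately show ?thesis by (simp add: h_def)
    qed
    ultimately show ?thesis by (simp add: \<delta>_def field_simps)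
  qed
  ultimately show ?thesis using that by blast
qed

section \<open>Compatible index sets\<close>

lemma relation_maximal:
  assumes r: "partial_order_on A r" and A: "finite A" and K: "K \<subseteq> A" "K \<noteq> {}"
  obtains k where "k \<in> K" "\<forall>l\<in>K. (k, l) \<in> r \<longrightarrow> l = k"
proof -
  have "r \<subseteq> A \<times> A" using r by (rule partial_order_onD)
  then have "finite (r - Id)" using A by (meson finite_Diff finite_SigmaI finite_subset)
  then have wf: "wf ((r - Id)\<inverse>)" using partial_order_on_acyclic[OF r] by (rule finite_acyclic_wf_converse)
  obtain k0 where "k0 \<in> K" using K by blast
  from wfE_min[OF wf this] obtain k where k: "k \<in> K" "\<And>y. (y, k) \<in> (r - Id)\<inverse> \<Longrightarrow> y \<notin> K" by metis
  have "\<forall>l\<in>K. (k, l) \<in> r \<longrightarrow> l = k"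
  proof (intro ballI impI, rule ccontr)
    fix l assume "l \<in> K" "(k, l) \<in> r" "l \<noteq> k"
    then show False using k(2)[of l] by auto
  qed
  then show ?thesis using that k(1) by blast
qed

lemma tree_on_phylo: "tree_on n T \<Longrightarrow> phylo T n"
  by unfold_locales (auto simp: tree_on_def)

context chart
begin

text \<open>The inequalities of \<open>four_point\<close> in exponential form. They are closed
  conditions, so they survive in the closure of the tree cone, vanishing weights included.\<close>

definition tree_bounded :: "ugraph \<Rightarrow> (nat set \<Rightarrow> real) \<Rightarrow> bool" where
  "tree_bounded T w \<longleftrightarrow> (\<forall>a b c d. {a, b, c, d} \<subseteq> {1..n} \<longrightarrow> distinct [a, b, c, d] \<longrightarrow>
     (\<forall>e\<in>gedges T. \<not> (\<not> utree.sep T e a b \<and> \<not> utree.sep T e c d \<and> utree.sep T e a c)) \<longrightarrow>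
     wd w a c * wd w b d \<le> wd w a b * wd w c d)"

context
  fixes T r w
  assumes tree: "tree_on n T" and w: "tplu w" and tb: "tree_bounded T w" and ch: "cherry_property n T i j r"
begin

interpretation ph: phylo T n by (rule tree_on_phylo[OF tree])

lemma tb_le:
  assumes "{a, b, c, d} \<subseteq> {1..n}" "distinct [a, b, c, d]"
    "\<And>e. e \<in> gedges T \<Longrightarrow> \<not> (\<not> ph.sep e a b \<and> \<not> ph.sep e c d \<and> ph.sep e a c)"
  shows "wd w a c * wd w b d \<le> wd w a b * wd w c d"
  using tb assms unfolding tree_bounded_def by meson

lemma order_r: "partial_order_on ({1..n} - {i, j}) r"
  and r_branch: "\<And>a b k l. a \<in> path_vertices T i j \<Longrightarrow> b \<in> path_vertices T i j \<Longrightarrow> a \<noteq> b \<Longrightarrow>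
    k \<in> branch n T i j a \<Longrightarrow> l \<in> branch n T i j b \<Longrightarrow> (k, l) \<notin> r"
  and r_total: "\<And>a. a \<in> path_vertices T i j \<Longrightarrow> total_on (branch n T i j a) r"
  and r_cherry: "\<And>k l m. (k, l) \<in> r \<Longrightarrow> k \<noteq> l \<Longrightarrow> (l, m) \<in> r \<Longrightarrow> l \<noteq> m \<Longrightarrow>
    cherry (quartet T {i, k, l, m}) k l \<or> cherry (quartet T {i, k, l, m}) l m"
  using ch unfolding cherry_property_def by blast+

lemma r_sub: "(k, l) \<in> r \<Longrightarrow> k \<in> {1..n} - {i, j} \<and> l \<in> {1..n} - {i, j}"
  using partial_order_onD(4)[OF order_r] by blast

lemma r_same_branch:
  assumes "(k, l) \<in> r" "l \<in> branch n T i j a" "a \<in> path_vertices T i j"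
  shows "k \<in> branch n T i j a"
proof -
  obtain b where b: "b \<in> path_vertices T i j" "k \<in> branch n T i j b"
    using ph.in_branch[OF ij(1,2,4)] r_sub[OF assms(1)] by blast
  then show ?thesis using r_branch[OF b(1) assms(3) _ b(2) assms(2)] assms(1) by blast
qed

lemma nn: "a \<in> {1..n} \<Longrightarrow> b \<in> {1..n} \<Longrightarrow> 0 \<le> wd w a b"
  by (rule wd_nonneg[OF w])

context
  fixes a k assumes a: "a \<in> path_vertices T i j" and k: "k \<in> branch n T i j a"
begin

lemma kA: "k \<in> {1..n}" "k \<noteq> i" "k \<noteq> j"
  using ph.branch_iff[OF ij(1,2,4) k] by auto

lemma other_branch:
  assumes l: "l \<in> branch n T i j b" "b \<in> path_vertices T i j" "b \<noteq> a"
  shows "wd w i l * wd w j k \<le> wd w i j * wd w l k"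
proof -
  have lA: "l \<in> {1..n}" "l \<noteq> i" "l \<noteq> j" using ph.branch_iff[OF ij(1,2,4) l(1)] by auto
  have "l \<noteq> k" using ph.branch_disjoint[OF ij(1,2,4) l(1) _ l(2) a] k l(3) by blast
  then show ?thesis
    using kA lA ij ph.branch_different[OF ij(1,2,4) l(1,2) k a l(3)]
    by (intro tb_le) auto
qed

text \<open>A split ik|jl or il|jk would come from an edge of the path from i to j, and such an edge
  does not separate two labels of one branch. Only ij|kl remains possible.\<close>

lemma same_branch:
  assumes l: "l \<in> branch n T i j a" "l \<noteq> k"
  shows "wd w i k * wd w j l = wd w i l * wd w j k" "wd w k l \<le> wd w i k * wd w j l"
proof -
  have lA: "l \<in> {1..n}" "l \<noteq> i" "l \<noteq> j" using ph.branch_iff[OF ij(1,2,4) l(1)] by auto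
  have V: "i \<in> gverts T" "j \<in> gverts T" "k \<in> gverts T" "l \<in> gverts T" using ph.lV ij kA lA by auto
  have ns: "\<not> (\<not> ph.sep e i y \<and> \<not> ph.sep e z j \<and> ph.sep e y z)"
    if "e \<in> gedges T" "y \<in> {k, l}" "z \<in> {k, l}" "ph.sep e i z" for e y z
  proof
    assume *: "\<not> ph.sep e i y \<and> \<not> ph.sep e z j \<and> ph.sep e y z"
    have "y \<in> gverts T" "z \<in> gverts T" using that V by auto
    then have "ph.sep e i j" using ph.sep_xor[OF that(1) V(1) _ V(2), of z] that(4) * by blast
    then have "\<not> ph.sep e k l" using ph.branch_same[OF ij(1,2,4) k l(1) a that(1)] by blast
    then have "\<not> ph.sep e l k" using ph.sep_sym by simp
    then show False using * \<open>\<not> ph.sep e k l\<close> that(2,3) by auto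
  qed
  have ns': "\<not> (\<not> ph.sep e i y \<and> \<not> ph.sep e z j \<and> ph.sep e i z)"
    if e: "e \<in> gedges T" "y \<in> {k, l}" "z \<in> {k, l}" for e y z
  proof
    assume *: "\<not> ph.sep e i y \<and> \<not> ph.sep e z j \<and> ph.sep e i z"
    have "y \<in> gverts T" "z \<in> gverts T" using e V by auto
    then have "ph.sep e y z" using ph.sep_xor[OF e(1) V(1), of y z] * by blast
    then show False using ns[OF e] * by blast
  qed
  have ns'': "\<not> (\<not> ph.sep e i y \<and> \<not> ph.sep e j z \<and> ph.sep e i j)"
    if e: "e \<in> gedges T" "y \<in> {k, l}" "z \<in> {k, l}" for e y z
  proof
    assume *: "\<not> ph.sep e i y \<and> \<not> ph.sep e j z \<and> ph.sep e i j"
    have "z \<in> gverts T" using e V by auto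
    then have "ph.sep e i z" using ph.sep_xor[OF e(1) V(1,2), of z] * by blast
    moreover have "\<not> ph.sep e z j" using * ph.sep_sym by simp
    ultimately show False using ns'[OF e] * by blast
  qed
  have d: "{i, k, l, j} \<subseteq> {1..n}" "distinct [i, k, l, j]" "{i, l, k, j} \<subseteq> {1..n}" "distinct [i, l, k, j]"
    "{i, k, j, l} \<subseteq> {1..n}" "distinct [i, k, j, l]"
    using kA lA ij l by auto
  have 1: "wd w i l * wd w k j \<le> wd w i k * wd w l j" by (rule tb_le[OF d(1,2)]) (use ns' in blast)
  have 2: "wd w i k * wd w l j \<le> wd w i l * wd w k j" by (rule tb_le[OF d(3,4)]) (use ns' in blast)
  have 3: "wd w i j * wd w k l \<le> wd w i k * wd w j l" by (rule tb_le[OF d(5,6)]) (use ns'' in blast)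
  show "wd w i k * wd w j l = wd w i l * wd w j k" using 1 2 by (simp add: wd_swap[of w k j] wd_swap[of w l j])
  show "wd w k l \<le> wd w i k * wd w j l" using 3 wd_ij[OF w] by simp
qed

text \<open>The cherry property enters here: either cherry excludes the split it|lk.\<close>

lemma below_below:
  assumes t: "(l, t) \<in> r" "l \<noteq> t" "(t, k) \<in> r" "t \<noteq> k"
  shows "wd w i l * wd w t k \<le> wd w i t * wd w l k"
proof -
  have lA: "l \<in> {1..n}" "l \<noteq> i" and tA: "t \<in> {1..n}" "t \<noteq> i" using r_sub t by auto
  have "l \<noteq> k" using partial_order_onD(3)[OF order_r] t by (auto dest: antisymD)
  have V: "i \<in> gverts T" "k \<in> gverts T" "l \<in> gverts T" "t \<in> gverts T" using ph.lV ij kA lA tA by auto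
  have dis: "{l, t, k, i} \<subseteq> {1..n}" "distinct [l, t, k, i]" "{t, k, i, l} \<subseteq> {1..n}" "distinct [t, k, i, l]"
    using lA tA kA ij t \<open>l \<noteq> k\<close> by auto
  have eq: "{i, l, t, k} = {l, t, k, i}" "{i, l, t, k} = {t, k, i, l}" by auto
  have c: "cherry (quartet T {l, t, k, i}) l t \<or> cherry (quartet T {t, k, i, l}) t k"
    using r_cherry[OF t] eq by simp
  have "\<not> (\<not> ph.sep e i t \<and> \<not> ph.sep e l k \<and> ph.sep e i l)" if e: "e \<in> gedges T" for e
  proof
    assume *: "\<not> ph.sep e i t \<and> \<not> ph.sep e l k \<and> ph.sep e i l"
    have lt: "ph.sep e l t" using ph.sep_xor[OF e V(3,1,4)] * ph.sep_sym by simp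
    have tk: "ph.sep e t k" using ph.sep_xor[OF e V(4,3,2)] lt * ph.sep_sym by simp
    from c show False
    proof
      assume "cherry (quartet T {l, t, k, i}) l t"
      then show ?thesis using ph.cherry_no_split[OF dis(1,2) _ e] lt * ph.sep_sym by blast
    next
      assume "cherry (quartet T {t, k, i, l}) t k"
      then show ?thesis using ph.cherry_no_split[OF dis(3,4) _ e] tk * ph.sep_sym by blast
    qed
  qed
  then show ?thesis using dis by (intro tb_le) auto
qed

text \<open>The predecessor t prescribed by conditions (ii) and (iii) is the best among all labels
  introduced before k, relative to either anchor. The premise on \<open>s\<close> lists the places
  where such a label can be.\<close>

lemma parent_best:
  assumes b: "b \<in> {i, j}" and t: "t \<in> branch n T i j a" "(t, k) \<in> r" "t \<noteq> k" "wd w i t \<noteq> 0" "wd w j t \<noteq> 0"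
    and max: "\<And>s. s \<in> branch n T i j a \<Longrightarrow> (s, k) \<in> r \<Longrightarrow> s \<noteq> k \<Longrightarrow> wd w i s \<noteq> 0 \<Longrightarrow> wd w j s \<noteq> 0 \<Longrightarrow> (s, t) \<in> r"
    and s: "s = i \<or> s = j \<or> (\<exists>b\<in>path_vertices T i j. b \<noteq> a \<and> s \<in> branch n T i j b) \<or>
      (s \<in> branch n T i j a \<and> (s, k) \<in> r \<and> s \<noteq> k)"
  shows "wd w b s * wd w t k \<le> wd w b t * wd w s k"
proof -
  have tA: "t \<in> {1..n}" "t \<noteq> i" "t \<noteq> j" using ph.branch_iff[OF ij(1,2,4) t(1)] by auto
  have bn: "b \<in> {1..n}" using b ij by auto
  have it: "0 < wd w i t" "0 < wd w j t" using nn[OF ij(1) tA(1)] nn[OF ij(2) tA(1)] t by auto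
  note st = same_branch[OF t(1,3)]
  have tk: "wd w t k \<le> wd w i k * wd w j t" "wd w t k \<le> wd w i t * wd w j k"
    using st wd_swap[of w t k] by simp_all
  consider "s = b" | "s \<in> {i, j}" "s \<noteq> b" | c where "c \<in> path_vertices T i j" "c \<noteq> a" "s \<in> branch n T i j c"
    | "s \<in> branch n T i j a" "(s, k) \<in> r" "s \<noteq> k"
    using s by blast
  then show ?thesis
  proof cases
    case 1
    then show ?thesis using nn[OF bn tA(1)] nn[OF bn kA(1)] by simp
  next
    case 2
    then have "(b = i \<and> s = j) \<or> (b = j \<and> s = i)" using b by auto
    then show ?thesis using tk wd_ij[OF w] by (auto simp: mult.commute)
  next
    case 3
    have sA: "s \<in> {1..n}" "s \<noteq> i" "s \<noteq> j" using ph.branch_iff[OF ij(1,2,4) 3(3)] by auto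
    have sk: "s \<noteq> k" "s \<noteq> t"
      using ph.branch_disjoint[OF ij(1,2,4) 3(3) _ 3(1) a] k t(1) 3(2) by blast+
    have V: "i \<in> gverts T" "j \<in> gverts T" "k \<in> gverts T" "s \<in> gverts T" "t \<in> gverts T"
      using ph.lV ij kA sA tA by auto
    have "\<not> (\<not> ph.sep e b t \<and> \<not> ph.sep e s k \<and> ph.sep e b s)" if e: "e \<in> gedges T" for e
    proof
      assume *: "\<not> ph.sep e b t \<and> \<not> ph.sep e s k \<and> ph.sep e b s"
      have bV: "b \<in> gverts T" using bn ph.lV by blast
      have bk: "ph.sep e b k" using ph.sep_xor[OF e bV V(4,3)] * by blast
      then have "ph.sep e t k" using ph.sep_xor[OF e bV V(5,3)] * by blast
      then have "\<not> ph.sep e i j" using ph.branch_same[OF ij(1,2,4) t(1) k a e] by blast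
      moreover have "ph.sep e i k"
        using bk b \<open>\<not> ph.sep e i j\<close> ph.sep_xor[OF e V(1,2,3)] by auto
      moreover have "\<not> ph.sep e k s" using * ph.sep_sym by simp
      ultimately show False using ph.branch_different[OF ij(1,2,4) k a 3(3,1) not_sym[OF 3(2)] e] by blast
    qed
    then show ?thesis using b ij tA sA kA sk t(3) by (intro tb_le) auto
  next
    case 4
    have sA: "s \<in> {1..n}" using r_sub[OF 4(2)] by auto
    show ?thesis
    proof (cases "s = t")
      case True then show ?thesis by simp
    next
      case False
      have "t \<in> branch n T i j a" "s \<in> branch n T i j a" by fact+
      have e: "wd w i t * wd w j s = wd w i s * wd w j t"
      proof -
        have ts: "wd w i t * wd w j k = wd w i k * wd w j t" "wd w i k * wd w j s = wd w i s * wd w j k"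
          using same_branch[OF t(1,3)] same_branch[OF 4(1,3)] by simp_all
        have V: "i \<in> gverts T" "j \<in> gverts T" "s \<in> gverts T" "t \<in> gverts T" using ph.lV ij sA tA by auto
        have sne: "s \<noteq> i" "s \<noteq> j" using r_sub[OF 4(2)] by auto
        have ns: "\<not> (\<not> ph.sep e i y \<and> \<not> ph.sep e z j \<and> ph.sep e i z)"
          if e: "e \<in> gedges T" "y \<in> {s, t}" "z \<in> {s, t}" for e y z
        proof
          assume *: "\<not> ph.sep e i y \<and> \<not> ph.sep e z j \<and> ph.sep e i z"
          have yz: "y \<in> gverts T" "z \<in> gverts T" using e V by auto
          have "ph.sep e i j" using ph.sep_xor[OF e(1) V(1) yz(2) V(2)] * by blast
          then have "\<not> ph.sep e s t" using ph.branch_same[OF ij(1,2,4) 4(1) t(1) a e(1)] by blast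
          then have "\<not> ph.sep e y z" using e(2,3) ph.sep_sym[of e s t] by auto
          then show False using ph.sep_xor[OF e(1) V(1) yz] * by blast
        qed
        have d: "{i, s, t, j} \<subseteq> {1..n}" "distinct [i, s, t, j]" "{i, t, s, j} \<subseteq> {1..n}" "distinct [i, t, s, j]"
          using sA tA ij sne False by auto
        have "wd w i t * wd w s j \<le> wd w i s * wd w t j" by (rule tb_le[OF d(1,2)]) (use ns in blast)
        moreover have "wd w i s * wd w t j \<le> wd w i t * wd w s j" by (rule tb_le[OF d(3,4)]) (use ns in blast)
        ultimately show ?thesis by (simp add: wd_swap[of w s j] wd_swap[of w t j])
      qed
      have nns: "0 \<le> wd w b t * wd w s k" using nn[OF bn tA(1)] nn[OF sA kA(1)] by simp
      show ?thesis
      \<comment> \<open>By the proportionality \<open>e\<close> one vanishing coordinate of s forces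
        the other to vanish, and the left side is 0. If none vanishes, s precedes t by maximality
        and \<open>below_below\<close> applies; \<open>e\<close> carries the result from the anchor
        i to j.\<close>
      proof (cases "wd w i s = 0 \<or> wd w j s = 0")
        case True
        then have "wd w i s = 0" "wd w j s = 0" using e it by auto
        then have "wd w b s = 0" using b by auto
        then show ?thesis using nns by simp
      next
        case good: False
        then have "(s, t) \<in> r" using max 4 by blast
        then have i_le: "wd w i s * wd w t k \<le> wd w i t * wd w s k" using below_below False t(2,3) by blast
        show ?thesis
        proof (cases "b = i")
          case False
          then have bj: "b = j" using b by simp
          have "wd w i t * (wd w j s * wd w t k) = wd w j t * (wd w i s * wd w t k)"
            using e by (metis mult.assoc mult.commute)
          also have "\<dots> \<le> wd w j t * (wd w i t * wd w s k)" using i_le it by simp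
          finally have "wd w i t * (wd w j s * wd w t k) \<le> wd w i t * (wd w j t * wd w s k)" by (simp add: algebra_simps)
          then show ?thesis using it bj by simp
        qed (use i_le in simp)
      qed
    qed
  qed
qed

end

lemma best_single:
  assumes "b \<in> {1..n}" "t \<in> {1..n}" "l \<in> {1..n}" "s \<in> {1..n}"
    and "wd w b s * wd w t l \<le> wd w b t * wd w s l"
  shows "wd w s l * wd w b t = max (wd w b l * wd w s t) (wd w t l * wd w s b)"
  by (rule best_condition[OF w, of "{s, t}"]) (use assms in auto)

text \<open>Labels are introduced along the order: condition (i) attaches k to the pair i, j,
  conditions (ii) and (iii) attach it to an anchor and the maximal predecessor t with two
  nonvanishing coordinates.\<close>

lemma choice_adapted:
  assumes comp: "compatible n T i j r ({e \<in> pairs n. w e = 0} \<inter> Iset n i j) I"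
  shows "adapted n i j w {1..n} I"
proof -
  let ?A = "{1..n} - {i, j}" and ?J = "{e \<in> pairs n. w e = 0} \<inter> Iset n i j"
  have I: "I \<subseteq> pairs n" "card I = 2 * (n - 2)" "{i, j} \<notin> I" using comp by (auto simp: compatible_def)
  have J: "{b, l} \<in> ?J \<longleftrightarrow> wd w b l = 0" if "b \<in> {i, j}" "l \<in> ?A" for b l
    using that ij by (auto simp: Iset_iff[OF chart] pairs_iff wd_def doubleton_eq_iff)
  have cases: "compat_i r ?J I i j k \<or> compat_ii r ?J I (branch n T i j a) i j k \<or> compat_ii r ?J I (branch n T i j a) j i k"
    if "a \<in> path_vertices T i j" "k \<in> branch n T i j a" for a k
    using comp that unfolding compatible_def Let_def by blast
  \<comment> \<open>The induction runs over down-closed sets of labels. The last clause ensures that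
    the coordinate needed as divisor for a later label is already in \<open>D\<close>.\<close>
  have "\<exists>D\<subseteq>I. adapted n i j w ({i, j} \<union> K) D \<and> (\<forall>t\<in>K. \<forall>b\<in>{i, j}. {b, t} \<in> I \<longrightarrow> {b, t} \<in> D)"
    if "K \<subseteq> ?A" "\<And>k l. k \<in> K \<Longrightarrow> (l, k) \<in> r \<Longrightarrow> l \<in> K" for K
    using that
  proof (induction "card K" arbitrary: K rule: less_induct)
    case less
    have finK: "finite K" using less.prems(1) finite_subset by blast
    show ?case
    proof (cases "K = {}")
      case True
      then show ?thesis using adapted.base[of n i j w] by (intro exI[of _ "{}"]) simp
    next
      case False
      obtain k where k: "k \<in> K" "\<forall>l\<in>K. (k, l) \<in> r \<longrightarrow> l = k"
        by (rule relation_maximal[OF order_r _ less.prems(1) False]) auto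
      let ?K = "K - {k}" and ?S = "{i, j} \<union> (K - {k})"
      have "card ?K < card K" using finK k(1) by (rule card_Diff1_less)
      moreover have "?K \<subseteq> ?A" using less.prems(1) by blast
      moreover have "m \<in> ?K" if "l \<in> ?K" "(m, l) \<in> r" for l m
        using less.prems(2)[of l m] that k(2) by blast
      ultimately have "\<exists>D\<subseteq>I. adapted n i j w ?S D \<and> (\<forall>t\<in>?K. \<forall>b\<in>{i, j}. {b, t} \<in> I \<longrightarrow> {b, t} \<in> D)"
        by (rule less.hyps)
      then obtain D where D: "D \<subseteq> I" "adapted n i j w ?S D" "\<forall>t\<in>?K. \<forall>b\<in>{i, j}. {b, t} \<in> I \<longrightarrow> {b, t} \<in> D"
        by (elim exE conjE)
      have kA: "k \<in> {1..n}" "k \<noteq> i" "k \<noteq> j" using k(1) less.prems(1) by auto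
      have kS: "k \<notin> ?S" using kA by simp
      have SK: "insert k ?S = {i, j} \<union> K" using k(1) by auto
      obtain a where a: "a \<in> path_vertices T i j" "k \<in> branch n T i j a"
        using ph.in_branch[OF ij(1,2,4), of k] kA by blast
      have Sn: "?S \<subseteq> {1..n}" using less.prems(1) ij by auto
      have Scases: "s = i \<or> s = j \<or> (\<exists>b\<in>path_vertices T i j. b \<noteq> a \<and> s \<in> branch n T i j b) \<or>
        (s \<in> branch n T i j a \<and> (s, k) \<in> r \<and> s \<noteq> k)" if s: "s \<in> ?S" for s
      proof (cases "s \<in> {i, j}")
        case False
        then have sK: "s \<in> K" "s \<noteq> k" using s by auto
        then have "s \<in> ?A" using less.prems(1) by blast
        then obtain b where b: "b \<in> path_vertices T i j" "s \<in> branch n T i j b"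
          using ph.in_branch[OF ij(1,2,4)] by blast
        show ?thesis
        proof (cases "b = a")
          case True
          then have "(s, k) \<in> r \<or> (k, s) \<in> r"
            using r_total[OF a(1)] a(2) b(2) sK(2) by (auto simp: total_on_def)
          then have "(s, k) \<in> r" using k(2) sK by blast
          then show ?thesis using b True sK by blast
        qed (use b in blast)
      qed auto
      have finish: ?thesis
        if "adapted n i j w (insert k ?S) (insert {b, k} (insert {t, k} D))" "{b, k} \<in> I" "{t, k} \<in> I"
          "\<And>c. c \<in> {i, j} \<Longrightarrow> {c, k} \<in> I \<Longrightarrow> c = b \<or> c = t" for b t
      proof (intro exI[of _ "insert {b, k} (insert {t, k} D)"] conjI ballI impI)
        show "adapted n i j w ({i, j} \<union> K) (insert {b, k} (insert {t, k} D))" using that(1) SK by simp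
        fix s c assume "s \<in> K" "c \<in> {i, j}" "{c, s} \<in> I"
        then show "{c, s} \<in> insert {b, k} (insert {t, k} D)"
          using D(3) that(4)[of c] by (cases "s = k") auto
      qed (use that D(1) in auto)
      have parent: ?thesis if bb: "(b = i \<and> b' = j) \<or> (b = j \<and> b' = i)"
        and c: "compat_ii r ?J I (branch n T i j a) b' b k" for b b'
      proof -
        have b: "b \<in> {i, j}" "b' \<in> {i, j}" "{b', b} = {i, j}" using bb by auto
        obtain t where t: "t \<in> branch n T i j a" "(t, k) \<in> r" "t \<noteq> k" "{b', t} \<notin> ?J" "{b, t} \<notin> ?J"
          "\<forall>s\<in>branch n T i j a. (s, k) \<in> r \<and> s \<noteq> k \<and> {b', s} \<notin> ?J \<and> {b, s} \<notin> ?J \<longrightarrow> (s, t) \<in> r" "{k, t} \<in> I"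
          and h: "{b', k} \<notin> I" "\<forall>l\<in>branch n T i j a. {b, l} \<in> I"
          using c unfolding compat_ii_def by (elim conjE bexE) blast
        have tA: "t \<in> ?A" using r_sub[OF t(2)] by blast
        have tK: "t \<in> ?K" using less.prems(2)[OF k(1) t(2)] t(3) by blast
        have nz: "wd w i t \<noteq> 0" "wd w j t \<noteq> 0"
          using J[OF _ tA, of i] J[OF _ tA, of j] t(4,5) bb by auto
        have max: "(s, t) \<in> r" if s: "s \<in> branch n T i j a" "(s, k) \<in> r" "s \<noteq> k" "wd w i s \<noteq> 0" "wd w j s \<noteq> 0" for s
        proof -
          have "s \<in> ?A" using r_sub[OF s(2)] by blast
          then have "{b', s} \<notin> ?J" "{b, s} \<notin> ?J" using J[of b' s] J[of b s] s(4,5) bb b by auto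
          then show ?thesis using t(6) s(1-3) by blast
        qed
        have btI: "{b, t} \<in> I" using h(2) t(1) by blast
        then have "{b, t} \<in> D" using D(3) tK b(1) by blast
        moreover have "{b, t} \<in> Iset n i j" using b(1) tA ij by (auto simp: Iset_iff[OF chart] pairs_iff doubleton_eq_iff)
        ultimately have bt: "{b, t} = {i, j} \<or> {b, t} \<in> D \<inter> Iset n i j" by blast
        have bn: "b \<in> {1..n}" using b(1) ij by auto
        have tn: "t \<in> {1..n}" using tA by blast
        have "adapted n i j w (insert k ?S) (insert {b, k} (insert {t, k} D))"
        proof (rule adapted.step[OF D(2) kA(1) kS _ _ bt])
          show "b \<in> ?S" "t \<in> ?S" using b(1) tK by auto
          show "wd w b t \<noteq> 0" using nz b(1) by auto
          fix s assume s: "s \<in> ?S"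
          have "wd w b s * wd w t k \<le> wd w b t * wd w s k"
            by (rule parent_best[OF a b(1) t(1-3) nz max Scases[OF s]])
          then show "wd w s k * wd w b t = max (wd w b k * wd w s t) (wd w t k * wd w s b)"
            using s Sn by (intro best_single[OF bn tn kA(1)]) auto
        qed
        moreover have "{b, k} \<in> I" "{t, k} \<in> I" using h(2) a(2) t(7) by (auto simp: insert_commute)
        moreover have "c = b \<or> c = t" if "c \<in> {i, j}" "{c, k} \<in> I" for c
          using that h(1) bb by auto
        ultimately show ?thesis by (rule finish)
      qed
      from cases[OF a] show ?thesis
      proof (elim disjE)
        assume c: "compat_i r ?J I i j k"
        then have cI: "{i, k} \<in> I" "{j, k} \<in> I" and cl: "\<forall>l. (l, k) \<in> r \<and> l \<noteq> k \<longrightarrow> {i, l} \<in> ?J \<or> {j, l} \<in> ?J"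
          by (simp_all add: compat_i_def)
        have "adapted n i j w (insert k ?S) (insert {i, k} (insert {j, k} D))"
        proof (rule adapted.step[OF D(2) kA(1) kS])
          show "wd w i j \<noteq> 0" using wd_ij[OF w] by simp
          fix s assume s: "s \<in> ?S"
          then have sn: "s \<in> {1..n}" using Sn by blast
          have "wd w i s * wd w j k \<le> wd w i j * wd w s k"
          proof -
            consider "s = i" | "s = j" | b where "b \<in> path_vertices T i j" "b \<noteq> a" "s \<in> branch n T i j b"
              | "s \<in> branch n T i j a" "(s, k) \<in> r" "s \<noteq> k" using Scases[OF s] by blast
            then show ?thesis
            proof cases
              case 1 then show ?thesis using wd_ij[OF w] nn[OF ij(1) kA(1)] by simp
            next
              case 2 then show ?thesis by simp
            next
              case 3 then show ?thesis using other_branch[OF a 3(3,1,2)] by simp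
            next
              case 4
              have "s \<in> ?A" using r_sub[OF 4(2)] by blast
              \<comment> \<open>By condition (i) a predecessor s of k has a vanishing coordinate,
                and proportionality within the branch makes the product vanish in either
                case.\<close>
              then have "wd w i s = 0 \<or> wd w j s = 0" using cl 4 J[of i s] J[of j s] by blast
              then have "wd w i s * wd w j k = 0" using same_branch(1)[OF a 4(1,3)] by auto
              then show ?thesis using nn[OF sn kA(1)] by (simp only: wd_ij[OF w] mult_1_left)
            qed
          qed
          then show "wd w s k * wd w i j = max (wd w i k * wd w s j) (wd w j k * wd w s i)"
            by (rule best_single[OF ij(1,2) kA(1) sn])
        qed auto
        then show ?thesis by (rule finish) (use cI in auto)
      next
        assume "compat_ii r ?J I (branch n T i j a) i j k"
        then show ?thesis using parent[of j i] by blast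
      next
        assume "compat_ii r ?J I (branch n T i j a) j i k"
        then show ?thesis using parent[of i j] by blast
      qed
    qed
  qed
  from this[of ?A] have "\<exists>D\<subseteq>I. adapted n i j w ({i, j} \<union> ?A) D" using r_sub by blast
  then obtain D where D: "D \<subseteq> I" "adapted n i j w ({i, j} \<union> ?A) D" by blast
  have eq: "{i, j} \<union> ?A = {1..n}" using ij by auto
  \<comment> \<open>Both sets have twice n - 2 elements, so the inclusion is an equality.\<close>
  have "card D = 2 * (n - 2)" using adapted_basic[OF D(2)] unfolding eq by simp
  moreover have "finite I" by (rule finite_subset[OF I(1) finite_pairs])
  ultimately have "D = I" using card_subset_eq[OF _ D(1)] I(2) by simp
  then show ?thesis using D(2) unfolding eq by simp
qed

text \<open>Always use the anchor j: take every {j, k}, and in addition {i, k} or the pair of k with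
  its maximal predecessor having two nonvanishing coordinates. Condition (iii) never holds for this
  set.\<close>

lemma compatible_exists: "\<exists>I. compatible n T i j r ({e \<in> pairs n. w e = 0} \<inter> Iset n i j) I"
proof -
  let ?A = "{1..n} - {i, j}" and ?J = "{e \<in> pairs n. w e = 0} \<inter> Iset n i j"
  define Gd where "Gd k = {t. (t, k) \<in> r \<and> t \<noteq> k \<and> {i, t} \<notin> ?J \<and> {j, t} \<notin> ?J}" for k
  have tm: "\<exists>t\<in>Gd k. \<forall>s\<in>Gd k. (s, t) \<in> r" if k: "k \<in> ?A" "Gd k \<noteq> {}" for k
  proof -
    obtain a where a: "a \<in> path_vertices T i j" "k \<in> branch n T i j a" using ph.in_branch[OF ij(1,2,4) k(1)] by blast
    have sub: "Gd k \<subseteq> ?A" using r_sub by (auto simp: Gd_def)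
    obtain t where t: "t \<in> Gd k" "\<forall>l\<in>Gd k. (t, l) \<in> r \<longrightarrow> l = t"
      by (rule relation_maximal[OF order_r _ sub k(2)]) auto
    have br: "s \<in> branch n T i j a" if "s \<in> Gd k" for s using that r_same_branch[OF _ a(2,1)] by (simp add: Gd_def)
    have "(s, t) \<in> r" if s: "s \<in> Gd k" for s
    proof (cases "s = t")
      case True
      then show ?thesis using partial_order_onD(1)[OF order_r] sub s by (auto dest: refl_onD)
    next
      case False
      then have "(s, t) \<in> r \<or> (t, s) \<in> r" using r_total[OF a(1)] br[OF s] br[OF t(1)] by (auto simp: total_on_def)
      then show ?thesis using t(2) s False by blast
    qed
    then show ?thesis using t(1) by blast
  qed
  then obtain \<tau> where \<tau>: "\<And>k. k \<in> ?A \<Longrightarrow> Gd k \<noteq> {} \<Longrightarrow> \<tau> k \<in> Gd k \<and> (\<forall>s\<in>Gd k. (s, \<tau> k) \<in> r)" by metis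
  define q where "q k = (if Gd k = {} then i else \<tau> k)" for k
  define I where "I = (\<lambda>k. {j, k}) ` ?A \<union> (\<lambda>k. {k, q k}) ` ?A"
  have q: "q k = i \<or> (q k \<in> ?A \<and> (q k, k) \<in> r \<and> q k \<noteq> k)" if "k \<in> ?A" for k
    using \<tau>[OF that] r_sub by (auto simp: q_def Gd_def)
  have qn: "q k \<in> {1..n}" "q k \<noteq> j" "q k \<noteq> k" if k: "k \<in> ?A" for k
    using q[OF k] k ij by auto
  have inj1: "inj_on (\<lambda>k. {j, k}) ?A" by (auto simp: inj_on_def doubleton_eq_iff)
  \<comment> \<open>A coincidence would make k and l predecessors of each other.\<close>
  have inj2: "inj_on (\<lambda>k. {k, q k}) ?A"
  proof (rule inj_onI)
    fix k l assume kl: "k \<in> ?A" "l \<in> ?A" "{k, q k} = {l, q l}"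
    show "k = l"
    proof (rule ccontr)
      assume "k \<noteq> l"
      then have "k = q l" "l = q k" using kl(3) by (auto simp: doubleton_eq_iff)
      then have "(k, l) \<in> r" "(l, k) \<in> r" using q[OF kl(1)] q[OF kl(2)] kl(1,2) by auto
      then show False using partial_order_onD(3)[OF order_r] \<open>k \<noteq> l\<close> by (auto dest: antisymD)
    qed
  qed
  have "{j, x} \<noteq> {k, q k}" if "k \<in> ?A" for x k
    using qn(2)[OF that] that by (auto simp: doubleton_eq_iff)
  then have disj: "(\<lambda>k. {j, k}) ` ?A \<inter> (\<lambda>k. {k, q k}) ` ?A = {}" by blast
  have "card ?A = n - 2" using ij by (simp add: card_Diff_subset)
  then have card: "card I = 2 * (n - 2)"
    unfolding I_def using card_image[OF inj1] card_image[OF inj2] disj by (simp add: card_Un_disjoint)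
  have sub: "I \<subseteq> pairs n"
    unfolding I_def
  proof (intro Un_least image_subsetI)
    fix k assume k: "k \<in> ?A"
    show "{j, k} \<in> pairs n" using k ij by (simp add: pairs_iff)
    show "{k, q k} \<in> pairs n" using qn[OF k] k by (auto simp: pairs_iff)
  qed
  have ijI: "{i, j} \<notin> I"
  proof
    assume "{i, j} \<in> I"
    then obtain k where k: "k \<in> ?A" "{i, j} = {j, k} \<or> {i, j} = {k, q k}" unfolding I_def by blast
    then show False by (auto simp: doubleton_eq_iff)
  qed
  have jI: "{j, l} \<in> I" if "l \<in> ?A" for l using that by (auto simp: I_def)
  have qI: "{k, q k} \<in> I" if "k \<in> ?A" for k using that by (auto simp: I_def)
  have iI: "Gd k = {}" if k: "k \<in> ?A" "{i, k} \<in> I" for k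
  proof (rule ccontr)
    assume ne: "Gd k \<noteq> {}"
    obtain l where l: "l \<in> ?A" "{i, k} = {j, l} \<or> {i, k} = {l, q l}" using k(2) unfolding I_def by blast
    then have "k = l" "q l = i" using k(1) qn[OF l(1)] ij by (auto simp: doubleton_eq_iff)
    then have "\<tau> k = i" using ne by (simp add: q_def)
    then have "(i, k) \<in> r" using \<tau>[OF k(1) ne] by (simp add: Gd_def)
    then show False using r_sub by blast
  qed
  have "(compat_i r ?J I i j k \<and> \<not> compat_ii r ?J I (branch n T i j a) i j k \<and> \<not> compat_ii r ?J I (branch n T i j a) j i k) \<or>
    (\<not> compat_i r ?J I i j k \<and> compat_ii r ?J I (branch n T i j a) i j k \<and> \<not> compat_ii r ?J I (branch n T i j a) j i k)"
    if a: "a \<in> path_vertices T i j" and k: "k \<in> branch n T i j a" for a k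
  proof -
    have kA: "k \<in> ?A" using ph.branch_iff[OF ij(1,2,4) k] by blast
    have brA: "l \<in> ?A" if "l \<in> branch n T i j a" for l using ph.branch_iff[OF ij(1,2,4) that] by blast
    have iii: "\<not> compat_ii r ?J I (branch n T i j a) j i k" using jI[OF kA] unfolding compat_ii_def by blast
    show ?thesis
    proof (cases "Gd k = {}")
      case True
      then have "{i, k} \<in> I" using qI[OF kA] by (simp add: q_def insert_commute)
      moreover have "{i, l} \<in> ?J \<or> {j, l} \<in> ?J" if "(l, k) \<in> r \<and> l \<noteq> k" for l
      proof -
        have "l \<notin> Gd k" using True by blast
        then show ?thesis using that unfolding Gd_def by blast
      qed
      ultimately have "compat_i r ?J I i j k" using jI[OF kA] unfolding compat_i_def by blast
      moreover have "\<not> compat_ii r ?J I (branch n T i j a) i j k" using \<open>{i, k} \<in> I\<close> unfolding compat_ii_def by blast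
      ultimately show ?thesis using iii by blast
    next
      case False
      have ikI: "{i, k} \<notin> I" using iI[OF kA] False by blast
      then have "\<not> compat_i r ?J I i j k" unfolding compat_i_def by blast
      moreover have "compat_ii r ?J I (branch n T i j a) i j k"
        unfolding compat_ii_def
      proof (intro conjI ballI ikI bexI[of _ "\<tau> k"])
        have t: "\<tau> k \<in> Gd k" "\<forall>s\<in>Gd k. (s, \<tau> k) \<in> r" using \<tau>[OF kA False] by blast+
        then show "(\<tau> k, k) \<in> r" "\<tau> k \<noteq> k" "{i, \<tau> k} \<notin> ?J" "{j, \<tau> k} \<notin> ?J" unfolding Gd_def by blast+
        then show "\<tau> k \<in> branch n T i j a" using r_same_branch k a by blast
        show "{k, \<tau> k} \<in> I" using qI[OF kA] False by (simp add: q_def)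
        fix s assume "s \<in> branch n T i j a"
        then show "{j, s} \<in> I" using jI brA by blast
        show "(s, k) \<in> r \<and> s \<noteq> k \<and> {i, s} \<notin> ?J \<and> {j, s} \<notin> ?J \<longrightarrow> (s, \<tau> k) \<in> r"
          using t(2) unfolding Gd_def by blast
      qed
      ultimately show ?thesis using iii by blast
    qed
  qed
  then have "compatible n T i j r ?J I"
    unfolding compatible_def Let_def using sub card ijI by blast
  then show ?thesis by blast
qed

end

end

section \<open>Gluing\<close>

definition hmono :: "nat \<Rightarrow> nat \<Rightarrow> nat \<Rightarrow> (nat \<Rightarrow>\<^sub>0 nat) \<Rightarrow> 'k::field mpoly" where
  "hmono n i j \<alpha> = (\<Prod>e\<in>pairs n. ucoord i j e ^ lookup \<alpha> (pvar e))"

text \<open>Dehomogenization: a polynomial in the Pluecker coordinates of all pairs is restricted to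
  the chart p_ij = 1.\<close>

definition heval :: "nat \<Rightarrow> nat \<Rightarrow> nat \<Rightarrow> 'k::field mpoly \<Rightarrow> 'k mpoly" where
  "heval n i j = geval Const (hmono n i j)"

definition pdeg :: "nat \<Rightarrow> (nat \<Rightarrow>\<^sub>0 nat) \<Rightarrow> nat" where
  "pdeg n \<alpha> = (\<Sum>e\<in>pairs n. lookup \<alpha> (pvar e))"

definition homog :: "nat \<Rightarrow> nat \<Rightarrow> 'k::field mpoly \<Rightarrow> bool" where
  "homog n d F \<longleftrightarrow> (\<forall>\<alpha>\<in>keys F. pdeg n \<alpha> = d)"

text \<open>
  The coordinate-free form of \<open>glued\<close>, which is visibly an equivalence relation: a point of the
  projective variety is a multiplicative seminorm on the homogeneous polynomials up to scaling.
\<close>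

definition proportional :: "nat \<Rightarrow> 'k::field chart_point \<Rightarrow> 'k chart_point \<Rightarrow> bool" where
  "proportional n p q \<longleftrightarrow> (\<exists>c>0. \<forall>d F. homog n d F \<longrightarrow>
     snd q (heval n (fst (fst q)) (snd (fst q)) F) = c ^ d * snd p (heval n (fst (fst p)) (snd (fst p)) F))"

lemma proportional_iff:
  "proportional n ((i, j), \<gamma>) ((k, l), \<delta>) \<longleftrightarrow>
     (\<exists>c>0. \<forall>d F. homog n d F \<longrightarrow> \<delta> (heval n k l F) = c ^ d * \<gamma> (heval n i j F))"
  by (simp add: proportional_def)

lemma proportional_refl: "proportional n p p"
  unfolding proportional_def by (rule exI[of _ 1]) simp

lemma proportional_sym:
  assumes "proportional n p q" shows "proportional n q p"
proof -
  obtain c where c: "c > 0" "\<And>d F. homog n d F \<Longrightarrow>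
     snd q (heval n (fst (fst q)) (snd (fst q)) F) = c ^ d * snd p (heval n (fst (fst p)) (snd (fst p)) F)"
    using assms unfolding proportional_def by blast
  have "snd p (heval n (fst (fst p)) (snd (fst p)) F) = inverse c ^ d * snd q (heval n (fst (fst q)) (snd (fst q)) F)"
    if "homog n d F" for d F
    using c(1) c(2)[OF that] by (simp add: power_inverse)
  then show ?thesis unfolding proportional_def using c(1) by (intro exI[of _ "inverse c"]) simp
qed

lemma proportional_trans:
  assumes "proportional n p q" "proportional n q s" shows "proportional n p s"
proof -
  obtain c where c: "c > 0" "\<And>d F. homog n d F \<Longrightarrow>
     snd q (heval n (fst (fst q)) (snd (fst q)) F) = c ^ d * snd p (heval n (fst (fst p)) (snd (fst p)) F)"
    using assms(1) unfolding proportional_def by blast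
  obtain c' where c': "c' > 0" "\<And>d F. homog n d F \<Longrightarrow>
     snd s (heval n (fst (fst s)) (snd (fst s)) F) = c' ^ d * snd q (heval n (fst (fst q)) (snd (fst q)) F)"
    using assms(2) unfolding proportional_def by blast
  show ?thesis unfolding proportional_def
    using c c' by (intro exI[of _ "c' * c"]) (simp add: power_mult_distrib)
qed

lemma rhom_heval: "rhom (heval n i j)"
  unfolding heval_def
  by (rule rhom_geval[OF rhom_Const]) (simp_all add: hmono_def lookup_add power_add prod.distrib)

lemma heval_single: "heval n i j (single \<alpha> a) = Const a * hmono n i j \<alpha>"
  unfolding heval_def by (rule geval_single[OF rhom_Const])

lemma hmono_pvar:
  assumes "e \<in> pairs n" shows "hmono n i j (single (pvar e) m) = ucoord i j e ^ m"
proof -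
  have "hmono n i j (single (pvar e) m) = (\<Prod>f\<in>pairs n. if f = e then ucoord i j e ^ m else 1)"
    unfolding hmono_def using assms inj_on_pvar[of n]
    by (intro prod.cong) (auto simp: lookup_single when_def inj_on_def)
  then show ?thesis using assms by simp
qed

lemma heval_Var: "e \<in> pairs n \<Longrightarrow> heval n i j (Var e) = ucoord i j e"
  by (simp add: Var_def heval_single hmono_pvar Const_1)

lemma pdeg_pvar:
  assumes "e \<in> pairs n" shows "pdeg n (single (pvar e) m) = m"
proof -
  have "pdeg n (single (pvar e) m) = (\<Sum>f\<in>pairs n. if f = e then m else 0)"
    unfolding pdeg_def using assms inj_on_pvar[of n]
    by (intro sum.cong) (auto simp: lookup_single when_def inj_on_def)
  then show ?thesis using assms by simp
qed

lemma pdeg_add: "pdeg n (\<alpha> + \<beta>) = pdeg n \<alpha> + pdeg n \<beta>"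
  by (simp add: pdeg_def lookup_add sum.distrib)

lemma hmono_add: "hmono n i j (\<alpha> + \<beta>) = hmono n i j \<alpha> * hmono n i j \<beta>"
  by (simp add: hmono_def lookup_add power_add prod.distrib)

lemma homog_Var: "e \<in> pairs n \<Longrightarrow> homog n 1 (Var e)"
  using pdeg_pvar[of e n 1] by (simp add: homog_def Var_def)

lemma chart_pair: "(i, j) \<in> charts n \<Longrightarrow> {i, j} \<in> pairs n"
  by (auto simp: charts_def pairs_iff)

lemma heval_chart_ring:
  assumes "(i, j) \<in> charts n" shows "heval n i j F \<in> chart_ring n i j"
  unfolding heval_def geval_def hmono_def
  by (intro chart_ring_sum chart_ring_mult chart_ring_Const chart_ring_prod chart_ring_power ucoord_chart_ring[OF assms])

text \<open>Every monomial is filled up with a power of p_kl, which is 1 on the chart.\<close>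

lemma homogenize:
  fixes f :: "'k::field mpoly"
  assumes kl: "(k, l) \<in> charts n" and f: "f \<in> chart_ring n k l"
  obtains d and F :: "'k mpoly" where "homog n d F" "heval n k l F = f"
proof -
  \<comment> \<open>Any common upper bound of the degrees would do; the sum of all degrees is
    one.\<close>
  define d where "d = (\<Sum>\<alpha>\<in>keys f. pdeg n \<alpha>)"
  define up where "up \<alpha> = \<alpha> + single (pvar {k, l}) (d - pdeg n \<alpha>)" for \<alpha>
  define F where "F = (\<Sum>\<alpha>\<in>keys f. single (up \<alpha>) (lookup f \<alpha>))"
  note klp = chart_pair[OF kl]
  have "pdeg n (up \<alpha>) = d" if "\<alpha> \<in> keys f" for \<alpha>
  proof -
    have "pdeg n \<alpha> \<le> d" unfolding d_def using that by (intro member_le_sum) auto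
    then show ?thesis by (simp add: up_def pdeg_add pdeg_pvar[OF klp])
  qed
  moreover have "keys F \<subseteq> up ` keys f"
    unfolding F_def using keys_sum[of "\<lambda>\<alpha>. single (up \<alpha>) (lookup f \<alpha>)" "keys f"] by (auto split: if_splits)
  ultimately have "homog n d F" unfolding homog_def by blast
  moreover have "heval n k l F = f"
  proof -
    have "hmono n k l (up \<alpha>) = (Vmono n k l Var \<alpha> :: 'k mpoly)" if \<alpha>: "\<alpha> \<in> keys f" for \<alpha>
    proof -
      have sub: "keys \<alpha> \<subseteq> pvar ` Iset n k l" using f \<alpha> by (auto simp: chart_ring_def)
      have "hmono n k l (up \<alpha>) = (\<Prod>e\<in>pairs n. ucoord k l e ^ lookup \<alpha> (pvar e))"
        by (simp only: up_def hmono_add hmono_pvar[OF klp] ucoord_ij power_one mult_1_right) (simp add: hmono_def)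
      also have "\<dots> = (\<Prod>e\<in>Iset n k l. ucoord k l e ^ lookup \<alpha> (pvar e))"
      proof (rule prod.mono_neutral_right)
        show "\<forall>e\<in>pairs n - Iset n k l. ucoord k l e ^ lookup \<alpha> (pvar e) = 1"
        proof
          fix e assume e: "e \<in> pairs n - Iset n k l"
          have "pvar e \<notin> pvar ` Iset n k l"
          proof
            assume "pvar e \<in> pvar ` Iset n k l"
            then obtain e' where e': "e' \<in> Iset n k l" "pvar e = pvar e'" by blast
            then have "e = e'" using inj_onD[OF inj_on_pvar[of n]] e Iset_subset[OF kl] by blast
            then show False using e e' by blast
          qed
          then have "lookup \<alpha> (pvar e) = 0" using sub by (auto simp: in_keys_iff)
          then show "ucoord k l e ^ lookup \<alpha> (pvar e) = 1" by simp
        qed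
      qed (use Iset_subset[OF kl] in auto)
      also have "\<dots> = Vmono n k l Var \<alpha>"
        unfolding Vmono_def by (intro prod.cong) (simp_all add: ucoord_Iset[OF kl])
      finally show ?thesis .
    qed
    moreover have "heval n k l F = (\<Sum>\<alpha>\<in>keys f. Const (lookup f \<alpha>) * hmono n k l (up \<alpha>))"
      by (simp add: F_def rhom_sum[OF rhom_heval] heval_single)
    ultimately have "heval n k l F = geval Const (Vmono n k l Var) f"
      by (simp only: geval_def cong: sum.cong)
    then show ?thesis by (simp only: chart_expand[OF kl f])
  qed
  ultimately show ?thesis using that by blast
qed

section \<open>Change of charts\<close>

context
  fixes n i j k l :: nat
  assumes ij: "(i, j) \<in> charts n" and kl: "(k, l) \<in> charts n"
begin

abbreviation "tr \<equiv> transition n i j k l"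
abbreviation "TU \<equiv> to_frac (ucoord i j {k, l})"

lemma rhom_tC': "rhom (\<lambda>a::'k::field. to_frac (Const a))"
  using rhom_comp[OF rhom_to_frac rhom_Const] .

lemma tr_geval: "tr = geval (\<lambda>a. to_frac (Const a)) (Vmono n k l (\<lambda>e. to_frac (ucoord i j e) / TU))"
  by (rule ext) (simp add: transition_def geval_def Vmono_def)

lemma rhom_tr: "rhom (tr :: 'k::field mpoly \<Rightarrow> _)"
  unfolding tr_geval by (rule rhom_chart_eval[OF rhom_tC'])

lemma tr_Const: "tr (Const a) = to_frac (Const a)"
  unfolding tr_geval by (rule geval_Const[OF rhom_tC'])

lemma tr_Var: "e \<in> Iset n k l \<Longrightarrow> tr (Var e) = to_frac (ucoord i j e) / TU"
  unfolding tr_geval by (rule geval_Var[OF rhom_tC' kl])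

lemma TU_neq_0:
  fixes v :: "'k::field \<Rightarrow> real"
  assumes "chart v n i j" shows "(TU :: 'k mpoly fract) \<noteq> 0"
  by (rule chart.tu_neq_0[OF assms chart_pair[OF kl]])

text \<open>The transition map is given on the variables only; for the remaining coordinates this
  amounts to a Pluecker relation on the other chart.\<close>

lemma tr_ucoord:
  assumes "(TU :: 'k::field mpoly fract) \<noteq> 0" and e: "e \<in> pairs n"
  shows "tr (ucoord k l e :: 'k mpoly) = to_frac (ucoord i j e) / TU"
proof -
  note tfs = rhom_simps[OF rhom_to_frac] and trs = rhom_simps[OF rhom_tr]
  have klc: "k < l" "k \<noteq> l" "i < j" using kl ij by (auto simp: charts_def)
  have TU: "TU = to_frac (sp i j k l)" using klc by (simp add: sp_def)
  have base: "tr (sp k l c x :: 'k mpoly) = to_frac (sp i j c x) / TU" if c: "c \<in> {k, l}" "x \<in> {1..n}" for c x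
  proof -
    have "c \<in> {1..n}" using c kl by (auto simp: charts_def)
    then have "{c, x} \<in> pairs n" if "c \<noteq> x" using c(2) that unfolding pairs_def by blast
    then have "{c, x} \<in> Iset n k l" if "c \<noteq> x" "{c, x} \<noteq> {k, l}"
      using c that unfolding Iset_iff[OF kl] by blast
    then consider "c = x" | "{c, x} = {k, l}" "c \<noteq> x" | "c \<noteq> x" "{c, x} \<in> Iset n k l" by blast
    then show ?thesis
    proof cases
      case 1 then show ?thesis by (simp add: trs tfs)
    next
      case 2
      then have "(c = k \<and> x = l) \<or> (c = l \<and> x = k)" by (auto simp: doubleton_eq_iff)
      then show ?thesis
      proof
        assume "c = k \<and> x = l"
        then show ?thesis using assms(1) klc by (simp add: sp_ij trs TU[symmetric])
      next
        assume "c = l \<and> x = k"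
        moreover have "to_frac (sp i j l k) = - (TU :: 'k mpoly fract)"
          unfolding TU by (subst sp_swap) (simp add: tfs)
        ultimately show ?thesis using assms(1) klc by (simp add: sp_ji trs)
      qed
    next
      case 3
      have "tr (ucoord k l {c, x} :: 'k mpoly) = to_frac (ucoord i j {c, x}) / TU"
        by (simp only: ucoord_Iset[OF kl 3(2)] tr_Var[OF 3(2)])
      then show ?thesis using 3(1) by (simp add: sp_def trs tfs)
    qed
  qed
  obtain a b where ab: "e = {a, b}" "a \<in> {1..n}" "b \<in> {1..n}" "a < b" using e by (rule pairsE)
  have "tr (ucoord k l e :: 'k mpoly) = tr (sp k l k a * sp k l l b - sp k l k b * sp k l l a)"
    using ab sp_expand[OF klc(1), of a b, where 'a = 'k] by (simp add: ucoord_sp)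
  also have "\<dots> = (to_frac (sp i j k a) * to_frac (sp i j l b) - to_frac (sp i j k b) * to_frac (sp i j l a)) / TU ^ 2"
    using ab base by (simp add: trs diff_divide_distrib power2_eq_square)
  also have "to_frac (sp i j k a) * to_frac (sp i j l b) - to_frac (sp i j k b) * to_frac (sp i j l a)
      = to_frac (sp i j a b) * (TU :: 'k mpoly fract)"
  proof -
    have "(sp i j a b * sp i j k l :: 'k mpoly) = sp i j k a * sp i j l b - sp i j k b * sp i j l a"
      unfolding sp_plucker[OF klc(3), of a b k l] sp_swap[of i j a k] sp_swap[of i j b l] sp_swap[of i j a l] sp_swap[of i j b k]
      by (simp add: algebra_simps)
    then show ?thesis unfolding TU by (simp only: tfs[symmetric])
  qed
  also have "to_frac (sp i j a b) * TU / TU ^ 2 = to_frac (ucoord i j e) / (TU :: 'k mpoly fract)"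
    using assms(1) ab by (simp add: power2_eq_square ucoord_sp)
  finally show ?thesis .
qed

lemma tr_heval:
  assumes "(TU :: 'k::field mpoly fract) \<noteq> 0" and F: "homog n d (F :: 'k mpoly)"
  shows "tr (heval n k l F) * TU ^ d = to_frac (heval n i j F)"
proof -
  note tfs = rhom_simps[OF rhom_to_frac] rhom_sum[OF rhom_to_frac] rhom_prod[OF rhom_to_frac]
    and trs = rhom_simps[OF rhom_tr] rhom_sum[OF rhom_tr] rhom_prod[OF rhom_tr]
  have "tr (hmono n k l \<alpha> :: 'k mpoly) * TU ^ d = to_frac (hmono n i j \<alpha>)" if "\<alpha> \<in> keys F" for \<alpha>
  proof -
    have "tr (hmono n k l \<alpha> :: 'k mpoly) = (\<Prod>e\<in>pairs n. to_frac (ucoord i j e) ^ lookup \<alpha> (pvar e) / TU ^ lookup \<alpha> (pvar e))"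
      unfolding hmono_def trs by (intro prod.cong) (simp_all add: tr_ucoord[OF assms(1)] power_divide)
    also have "\<dots> = to_frac (hmono n i j \<alpha>) / TU ^ pdeg n \<alpha>"
      by (simp add: prod_dividef hmono_def tfs power_sum pdeg_def)
    also have "pdeg n \<alpha> = d" using F that by (simp add: homog_def)
    finally show ?thesis using assms(1) by simp
  qed
  then have "tr (heval n k l F) * TU ^ d = (\<Sum>\<alpha>\<in>keys F. to_frac (Const (lookup F \<alpha>)) * to_frac (hmono n i j \<alpha>))"
    by (simp add: heval_def geval_def trs tr_Const sum_distrib_right mult.assoc)
  then show ?thesis by (simp add: heval_def geval_def tfs)
qed

end

context complete_nonarch_field
begin

lemma chartI: "(i, j) \<in> charts n \<Longrightarrow> chart v n i j"
  by unfold_locales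

text \<open>Coordinates are homogeneous of degree one, and the coordinate of {k, l}, which is 1 on
  the second chart, determines the scaling factor.\<close>

lemma ms_values:
  assumes ij: "(i, j) \<in> charts n" and kl: "(k, l) \<in> charts n"
    and \<gamma>: "\<gamma> \<in> mult_seminorms v (chart_ring n i j)" and \<delta>: "\<delta> \<in> mult_seminorms v (chart_ring n k l)"
    and p: "c > 0" "\<And>d F. homog n d F \<Longrightarrow> \<delta> (heval n k l F) = c ^ d * \<gamma> (heval n i j F)"
  shows "e \<in> pairs n \<Longrightarrow> \<delta> (ucoord k l e) = c * \<gamma> (ucoord i j e)"
    and "c = 1 / \<gamma> (ucoord i j {k, l})" "\<gamma> (ucoord i j {k, l}) \<noteq> 0"
proof -
  interpret C2: chart v n k l by (rule chartI[OF kl])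
  have u: "\<delta> (ucoord k l e) = c * \<gamma> (ucoord i j e)" if "e \<in> pairs n" for e
    using p(2)[OF homog_Var[OF that]] by (simp add: heval_Var[OF that])
  then show "e \<in> pairs n \<Longrightarrow> \<delta> (ucoord k l e) = c * \<gamma> (ucoord i j e)" .
  have one: "1 = c * \<gamma> (ucoord i j {k, l})" using u[OF chart_pair[OF kl]] C2.ms_1[OF \<delta>] by simp
  then show nz: "\<gamma> (ucoord i j {k, l}) \<noteq> 0" by auto
  then show "c = 1 / \<gamma> (ucoord i j {k, l})" using one by (simp add: eq_divide_eq)
qed

text \<open>Both directions compare a function with its homogenization. Symmetry and transitivity
  are not evident for \<open>glued\<close> but immediate for proportionality.\<close>

lemma glued_iff:
  assumes ij: "(i, j) \<in> charts n" and kl: "(k, l) \<in> charts n"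
    and \<gamma>: "\<gamma> \<in> mult_seminorms v (chart_ring n i j)" and \<delta>: "\<delta> \<in> mult_seminorms v (chart_ring n k l)"
  shows "glued n ((i, j), \<gamma>) ((k, l), \<delta>) \<longleftrightarrow> proportional n ((i, j), \<gamma>) ((k, l), \<delta>)"
proof
  interpret C: chart v n i j by (rule chartI[OF ij])
  let ?u = "ucoord i j {k, l} :: 'k mpoly"
  note TU = TU_neq_0[OF ij kl C.chart_axioms]
  have uR: "?u \<in> chart_ring n i j" by (rule ucoord_chart_ring[OF ij chart_pair[OF kl]])
  {
    assume g: "glued n ((i, j), \<gamma>) ((k, l), \<delta>)"
    then have nz: "\<gamma> ?u \<noteq> 0" by (simp add: glued_def)
    then have pos: "\<gamma> ?u > 0" using C.ms_nonneg[OF \<gamma> uR] by simp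
    have "\<delta> (heval n k l F) = (1 / \<gamma> ?u) ^ d * \<gamma> (heval n i j F)" if F: "homog n d F" for d F
    proof -
      have "transition n i j k l (heval n k l F) = to_frac (heval n i j F) / to_frac ?u ^ d"
        using tr_heval[OF ij kl TU F] TU by (simp add: field_simps)
      then have "\<delta> (heval n k l F) = \<gamma> (heval n i j F) / \<gamma> ?u ^ d"
        using g heval_chart_ring[OF kl, of F] heval_chart_ring[OF ij, of F] unfolding glued_def prod.case by blast
      then show ?thesis by (simp add: power_divide)
    qed
    then show "proportional n ((i, j), \<gamma>) ((k, l), \<delta>)"
      unfolding proportional_iff using pos by (intro exI[of _ "1 / \<gamma> ?u"]) simp
  next
    assume "proportional n ((i, j), \<gamma>) ((k, l), \<delta>)"
    then obtain c where c: "c > 0" "\<And>d F. homog n d F \<Longrightarrow> \<delta> (heval n k l F) = c ^ d * \<gamma> (heval n i j F)"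
      unfolding proportional_iff by blast
    have nz: "\<gamma> ?u \<noteq> 0" and cu: "c = 1 / \<gamma> ?u" using ms_values[OF ij kl \<gamma> \<delta> c] by blast+
    have "\<delta> f = \<gamma> g / \<gamma> ?u ^ m"
      if f: "f \<in> chart_ring n k l" and g: "g \<in> chart_ring n i j" and e: "transition n i j k l f = to_frac g / to_frac ?u ^ m"
      for f g m
    proof -
      obtain d F where F: "homog n d F" "heval n k l F = f" using homogenize[OF kl f] by blast
      have "transition n i j k l f * to_frac ?u ^ d = to_frac (heval n i j F)"
        using tr_heval[OF ij kl TU F(1)] F(2) by simp
      then have "to_frac g * to_frac ?u ^ d = to_frac (heval n i j F) * to_frac ?u ^ m"
        using e TU by (simp add: field_simps)
      then have "g * ?u ^ d = heval n i j F * ?u ^ m"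
        unfolding rhom_simps(2,7)[OF rhom_to_frac, symmetric] by (simp only: to_frac_eq_iff)
      then have "\<gamma> (g * ?u ^ d) = \<gamma> (heval n i j F * ?u ^ m)" by simp
      then have "\<gamma> g * \<gamma> ?u ^ d = \<gamma> (heval n i j F) * \<gamma> ?u ^ m"
        by (simp add: C.ms_mult[OF \<gamma>] C.ms_power[OF \<gamma>] g uR heval_chart_ring[OF ij] chart_ring_power)
      moreover have "\<gamma> (heval n i j F) = \<delta> f * \<gamma> ?u ^ d"
        using c(2)[OF F(1)] F(2) nz by (simp add: cu field_simps)
      ultimately have "\<gamma> g * \<gamma> ?u ^ d = (\<delta> f * \<gamma> ?u ^ m) * \<gamma> ?u ^ d" by simp
      then have "\<gamma> g = \<delta> f * \<gamma> ?u ^ m" using nz by (simp only: mult_cancel_right) simp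
      then show ?thesis using nz by simp
    qed
    then show "glued n ((i, j), \<gamma>) ((k, l), \<delta>)" using nz by (simp add: glued_def)
  }
qed

text \<open>Extend the seminorm to the localization by quotients and pull it back along the
  transition map; multiplicativity makes the value independent of the fraction.\<close>

lemma transport:
  assumes ij: "(i, j) \<in> charts n" and kl: "(k, l) \<in> charts n"
    and \<gamma>: "\<gamma> \<in> mult_seminorms v (chart_ring n i j)" and nz: "\<gamma> (ucoord i j {k, l}) \<noteq> 0"
  obtains \<delta> where "\<delta> \<in> mult_seminorms v (chart_ring n k l)" "proportional n ((i, j), \<gamma>) ((k, l), \<delta>)"
proof -
  interpret C: chart v n i j by (rule chartI[OF ij])
  let ?u = "ucoord i j {k, l} :: 'k mpoly" and ?tr = "transition n i j k l :: 'k mpoly \<Rightarrow> _"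
  note TU = TU_neq_0[OF ij kl C.chart_axioms] and hom = rhom_tr[OF ij kl, where 'k = 'k]
  have uR: "?u \<in> chart_ring n i j" by (rule ucoord_chart_ring[OF ij chart_pair[OF kl]])
  have pos: "\<gamma> ?u > 0" using nz C.ms_nonneg[OF \<gamma> uR] by simp
  \<comment> \<open>The transition of f is the fraction with numerator g and denominator the m-th
    power of u_kl.\<close>
  define rep where "rep f g m \<longleftrightarrow> g \<in> chart_ring n i j \<and> ?tr f * to_frac ?u ^ m = to_frac g" for f g m
  have unique: "\<gamma> g / \<gamma> ?u ^ m = \<gamma> g' / \<gamma> ?u ^ m'" if r: "rep f g m" "rep f g' m'" for f g m g' m'
  proof -
    have "to_frac g * to_frac ?u ^ m' = (?tr f * to_frac ?u ^ m) * to_frac ?u ^ m'" using r(1) unfolding rep_def by simp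
    also have "\<dots> = (?tr f * to_frac ?u ^ m') * to_frac ?u ^ m" by (simp only: ac_simps)
    also have "?tr f * to_frac ?u ^ m' = to_frac g'" using r(2) unfolding rep_def by simp
    finally have "to_frac g * to_frac ?u ^ m' = to_frac g' * to_frac ?u ^ m" .
    then have "g * ?u ^ m' = g' * ?u ^ m"
      unfolding rhom_simps(2,7)[OF rhom_to_frac, symmetric] by (simp only: to_frac_eq_iff)
    then have "\<gamma> (g * ?u ^ m') = \<gamma> (g' * ?u ^ m)" by simp
    then have "\<gamma> g * \<gamma> ?u ^ m' = \<gamma> g' * \<gamma> ?u ^ m"
      using r by (simp add: rep_def C.ms_mult[OF \<gamma>] C.ms_power[OF \<gamma>] uR chart_ring_power)
    then show ?thesis using nz by (simp add: field_simps)
  qed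
  have ex: "\<exists>g m. rep f g m" if f: "f \<in> chart_ring n k l" for f
  proof -
    obtain d F where F: "homog n d F" "heval n k l F = f" using homogenize[OF kl f] by blast
    then have "rep f (heval n i j F) d"
      using tr_heval[OF ij kl TU F(1)] heval_chart_ring[OF ij] by (simp add: rep_def)
    then show ?thesis by blast
  qed
  define \<delta>0 where "\<delta>0 f = (SOME s. \<exists>g m. rep f g m \<and> s = \<gamma> g / \<gamma> ?u ^ m)" for f
  define \<delta> where "\<delta> = restrict \<delta>0 (chart_ring n k l)"
  have \<delta>: "\<delta> f = \<gamma> g / \<gamma> ?u ^ m" if f: "f \<in> chart_ring n k l" and r: "rep f g m" for f g m
  proof -
    have "\<exists>s g m. rep f g m \<and> s = \<gamma> g / \<gamma> ?u ^ m" using r by blast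
    then have "\<exists>g m. rep f g m \<and> \<delta>0 f = \<gamma> g / \<gamma> ?u ^ m" unfolding \<delta>0_def by (rule someI_ex)
    then obtain g' m' where g': "rep f g' m'" "\<delta>0 f = \<gamma> g' / \<gamma> ?u ^ m'" by (elim exE conjE)
    have "\<delta> f = \<delta>0 f" unfolding \<delta>_def using f by (rule restrict_apply')
    then show ?thesis using unique[OF g'(1) r] g'(2) by (simp only:)
  qed
  have "\<delta> \<in> mult_seminorms v (chart_ring n k l)"
    unfolding mult_seminorms_def
  proof (intro CollectI conjI ballI allI)
    show "\<delta> \<in> extensional (chart_ring n k l)" by (simp add: \<delta>_def)
    fix f :: "'k mpoly" assume f: "f \<in> chart_ring n k l"
    obtain g m where g: "rep f g m" using ex[OF f] by blast
    then have gR: "g \<in> chart_ring n i j" by (simp add: rep_def)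
    show "0 \<le> \<delta> f" using \<delta>[OF f g] C.ms_nonneg[OF \<gamma> gR] pos by simp
    fix f' :: "'k mpoly" assume f': "f' \<in> chart_ring n k l"
    obtain g' m' where g': "rep f' g' m'" using ex[OF f'] by blast
    then have g'R: "g' \<in> chart_ring n i j" by (simp add: rep_def)
    have "rep (f * f') (g * g') (m + m')"
      using g g' chart_ring_mult[OF gR g'R]
      by (auto simp: rep_def rhom_simps[OF hom] rhom_simps[OF rhom_to_frac] power_add algebra_simps)
    then show "\<delta> (f * f') = \<delta> f * \<delta> f'"
      using \<delta>[OF chart_ring_mult[OF f f']] \<delta>[OF f g] \<delta>[OF f' g'] C.ms_mult[OF \<gamma> gR g'R] by (simp add: power_add)
    have R: "g * ?u ^ m' \<in> chart_ring n i j" "g' * ?u ^ m \<in> chart_ring n i j"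
      using gR g'R uR by (auto intro: chart_ring_mult chart_ring_power)
    have "to_frac (g * ?u ^ m' + g' * ?u ^ m) = (?tr f * to_frac ?u ^ m) * to_frac ?u ^ m' + (?tr f' * to_frac ?u ^ m') * to_frac ?u ^ m"
      using g g' by (simp add: rep_def rhom_simps[OF rhom_to_frac])
    also have "\<dots> = ?tr (f + f') * to_frac ?u ^ (m + m')"
      by (simp add: rhom_simps[OF hom] power_add algebra_simps)
    finally have "rep (f + f') (g * ?u ^ m' + g' * ?u ^ m) (m + m')"
      using chart_ring_add[OF R] by (simp add: rep_def)
    then have "\<delta> (f + f') = \<gamma> (g * ?u ^ m' + g' * ?u ^ m) / \<gamma> ?u ^ (m + m')"
      by (rule \<delta>[OF chart_ring_add[OF f f']])
    also have "\<dots> \<le> (\<gamma> (g * ?u ^ m') + \<gamma> (g' * ?u ^ m)) / \<gamma> ?u ^ (m + m')"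
      using C.ms_triangle[OF \<gamma> R] pos by (intro divide_right_mono) auto
    also have "\<dots> = \<delta> f + \<delta> f'"
    proof -
      have "\<gamma> g = \<delta> f * \<gamma> ?u ^ m" "\<gamma> g' = \<delta> f' * \<gamma> ?u ^ m'" using \<delta>[OF f g] \<delta>[OF f' g'] nz by simp_all
      then have "\<gamma> (g * ?u ^ m') + \<gamma> (g' * ?u ^ m) = (\<delta> f + \<delta> f') * \<gamma> ?u ^ (m + m')"
        by (simp add: C.ms_mult[OF \<gamma>] C.ms_power[OF \<gamma>] uR gR g'R chart_ring_power power_add algebra_simps)
      then show ?thesis using nz by simp
    qed
    finally show "\<delta> (f + f') \<le> \<delta> f + \<delta> f'" .
  next
    fix a
    have "rep (Const a) (Const a) 0" by (simp add: rep_def tr_Const[OF ij kl])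
    then show "\<delta> (Const a) = v a" using \<delta>[OF chart_ring_Const, of a] C.ms_Const[OF \<gamma>] by simp
  qed
  moreover have "\<delta> (heval n k l F) = (1 / \<gamma> ?u) ^ d * \<gamma> (heval n i j F)" if F: "homog n d F" for d F
  proof -
    have "rep (heval n k l F) (heval n i j F) d"
      using tr_heval[OF ij kl TU F] heval_chart_ring[OF ij] by (simp add: rep_def)
    then show ?thesis using \<delta>[OF heval_chart_ring[OF kl]] by (simp add: power_divide)
  qed
  then have "proportional n ((i, j), \<gamma>) ((k, l), \<delta>)"
    unfolding proportional_iff using pos by (intro exI[of _ "1 / \<gamma> ?u"]) simp
  ultimately show ?thesis using that by blast
qed

text \<open>Transport is a bijection between the fibres that multiplies values in each degree by a
  fixed positive factor, so it respects the order and takes the maximum to the maximum.\<close>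

lemma smax_proportional:
  assumes ij: "(i, j) \<in> charts n" and kl: "(k, l) \<in> charts n"
    and w: "chart.tplu n i j w" and nz: "w {k, l} \<noteq> 0"
  shows "chart.tplu n k l (\<lambda>e. w e / w {k, l})"
    and "proportional n ((i, j), chart.smax v n i j w) ((k, l), chart.smax v n k l (\<lambda>e. w e / w {k, l}))"
proof -
  interpret C: chart v n i j by (rule chartI[OF ij])
  interpret D: chart v n k l by (rule chartI[OF kl])
  let ?w = "\<lambda>e. w e / w {k, l}"
  note ijp = chart_pair[OF ij] and klp = chart_pair[OF kl]
  define \<gamma> where "\<gamma> = C.smax w"
  have \<gamma>max: "C.is_max w \<gamma>" unfolding \<gamma>_def by (rule C.smax_is_max[OF w])
  then have \<gamma>: "\<gamma> \<in> mult_seminorms v (chart_ring n i j)" "\<And>e. e \<in> pairs n \<Longrightarrow> \<gamma> (ucoord i j e) = w e"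
    by (auto simp: C.is_max_def C.fiber_def)
  have "\<gamma> (ucoord i j {k, l}) \<noteq> 0" using \<gamma>(2)[OF klp] nz by simp
  then obtain \<delta> where \<delta>: "\<delta> \<in> mult_seminorms v (chart_ring n k l)" "proportional n ((i, j), \<gamma>) ((k, l), \<delta>)"
    using transport[OF ij kl \<gamma>(1)] by blast
  then obtain c where c: "c > 0" "\<And>d F. homog n d F \<Longrightarrow> \<delta> (heval n k l F) = c ^ d * \<gamma> (heval n i j F)"
    unfolding proportional_iff by blast
  have cw: "c = 1 / w {k, l}" using ms_values(2)[OF ij kl \<gamma>(1) \<delta>(1) c] \<gamma>(2)[OF klp] by simp
  have "\<delta> (ucoord k l e) = ?w e" if "e \<in> pairs n" for e
    using ms_values(1)[OF ij kl \<gamma>(1) \<delta>(1) c that] \<gamma>(2)[OF that] cw by simp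
  then have \<delta>f: "\<delta> \<in> D.fiber ?w" using \<delta>(1) by (simp add: D.fiber_def)
  then show "chart.tplu n k l ?w" by (rule D.fiber_tplu)
  have "\<delta>' f \<le> \<delta> f" if \<delta>': "\<delta>' \<in> D.fiber ?w" and f: "f \<in> chart_ring n k l" for \<delta>' f
  proof -
    have ms': "\<delta>' \<in> mult_seminorms v (chart_ring n k l)" "\<And>e. e \<in> pairs n \<Longrightarrow> \<delta>' (ucoord k l e) = ?w e"
      using \<delta>' by (auto simp: D.fiber_def)
    have wij: "w {i, j} = 1" using C.tplu_ij[OF w] .
    have nz': "\<delta>' (ucoord k l {i, j}) \<noteq> 0" using ms'(2)[OF ijp] wij nz by simp
    obtain \<gamma>' where \<gamma>': "\<gamma>' \<in> mult_seminorms v (chart_ring n i j)" "proportional n ((k, l), \<delta>') ((i, j), \<gamma>')"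
      using transport[OF kl ij ms'(1) nz'] by blast
    then obtain b where b: "b > 0" "\<And>d F. homog n d F \<Longrightarrow> \<gamma>' (heval n i j F) = b ^ d * \<delta>' (heval n k l F)"
      unfolding proportional_iff by blast
    have bw: "b = w {k, l}" using ms_values(2)[OF kl ij ms'(1) \<gamma>'(1) b] ms'(2)[OF ijp] wij by simp
    have "\<gamma>' (ucoord i j e) = w e" if "e \<in> pairs n" for e
      using ms_values(1)[OF kl ij ms'(1) \<gamma>'(1) b that] ms'(2)[OF that] bw nz by simp
    then have "\<gamma>' \<in> C.fiber w" using \<gamma>'(1) by (simp add: C.fiber_def)
    then have le: "\<gamma>' g \<le> \<gamma> g" if "g \<in> chart_ring n i j" for g using \<gamma>max that by (simp add: C.is_max_def)
    obtain d F where F: "homog n d F" "heval n k l F = f" using homogenize[OF kl f] by blast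
    have "b ^ d * \<delta>' f \<le> \<gamma> (heval n i j F)" using le[OF heval_chart_ring[OF ij], of F] b(2)[OF F(1)] F(2) by simp
    moreover have "\<gamma> (heval n i j F) = b ^ d * \<delta> f"
      using c(2)[OF F(1)] F(2) nz by (simp add: cw bw power_divide)
    ultimately show ?thesis using b(1) by simp
  qed
  then have "D.is_max ?w \<delta>" using \<delta>f by (simp add: D.is_max_def)
  then have "D.smax ?w = \<delta>" by (rule D.smax_eq)
  then show "proportional n ((i, j), chart.smax v n i j w) ((k, l), chart.smax v n k l ?w)"
    using \<delta>(2) \<gamma>_def by simp
qed

lemma topspace_U_an: "(i, j) \<in> charts n \<Longrightarrow> topspace (U_an n v (i, j)) = mult_seminorms v (chart_ring n i j)"
  by (auto simp: U_an_def mult_seminorms_def PiE_def)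

lemma topspace_U_sum: "p \<in> topspace (U_sum n v) \<longleftrightarrow>
    (\<exists>i j \<gamma>. p = ((i, j), \<gamma>) \<and> (i, j) \<in> charts n \<and> \<gamma> \<in> mult_seminorms v (chart_ring n i j))"
  unfolding U_sum_def topspace_sum_topology by (cases p) (auto simp: topspace_U_an)

lemma glue_eq:
  assumes "proportional n p q" "p \<in> topspace (U_sum n v)" "q \<in> topspace (U_sum n v)"
  shows "glue n v p = glue n v q"
proof -
  have gp: "glue n v p = {s \<in> topspace (U_sum n v). proportional n p s}" if p: "p \<in> topspace (U_sum n v)" for p
    unfolding glue_def
  proof (rule Collect_cong, rule conj_cong[OF refl])
    fix s assume s: "s \<in> topspace (U_sum n v)"
    obtain i j \<gamma> where 1: "p = ((i, j), \<gamma>)" "(i, j) \<in> charts n" "\<gamma> \<in> mult_seminorms v (chart_ring n i j)"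
      using p unfolding topspace_U_sum by blast
    obtain k l \<delta> where 2: "s = ((k, l), \<delta>)" "(k, l) \<in> charts n" "\<delta> \<in> mult_seminorms v (chart_ring n k l)"
      using s unfolding topspace_U_sum by blast
    show "glued n p s \<longleftrightarrow> proportional n p s" unfolding 1(1) 2(1) by (rule glued_iff[OF 1(2) 2(2) 1(3) 2(3)])
  qed
  have "proportional n p s \<longleftrightarrow> proportional n q s" for s
    using assms(1) proportional_sym proportional_trans by metis
  then show ?thesis unfolding gp[OF assms(2)] gp[OF assms(3)] by simp
qed

end

lemma elog_mult: "0 < c \<Longrightarrow> 0 \<le> s \<Longrightarrow> elog (c * s) = elog s + ereal (ln c)"
  by (auto simp: elog_def ln_mult)

lemma tclass_shift: "tclass n (\<lambda>e. x e + ereal c) = tclass n x"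
proof -
  have "\<exists>b'. (\<lambda>e\<in>pairs n. x e + ereal c + ereal b) = (\<lambda>e\<in>pairs n. x e + ereal b')" for b
    by (rule exI[of _ "c + b"]) (simp add: add.assoc)
  moreover have "\<exists>b'. (\<lambda>e\<in>pairs n. x e + ereal b) = (\<lambda>e\<in>pairs n. x e + ereal c + ereal b')" for b
    by (rule exI[of _ "b - c"]) (simp add: add.assoc)
  ultimately show ?thesis unfolding tclass_def by (auto; metis)
qed

lemma tclass_cong: "(\<And>e. e \<in> pairs n \<Longrightarrow> x e = y e) \<Longrightarrow> tclass n x = tclass n y"
  unfolding tclass_def by (metis (no_types, lifting) restrict_ext)

context complete_nonarch_field
begin

text \<open>The definite description is well defined because representatives in different charts
  scale all coordinates by one positive constant, whose logarithm is a common shift.\<close>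

lemma trop_glue:
  assumes ij: "(i, j) \<in> charts n" and \<gamma>: "\<gamma> \<in> mult_seminorms v (chart_ring n i j)"
  shows "trop n (glue n v ((i, j), \<gamma>)) = tclass n (\<lambda>e. elog (\<gamma> (ucoord i j e)))"
  unfolding trop_def
proof (rule the_equality)
  interpret C: chart v n i j by (rule chartI[OF ij])
  let ?p = "((i, j), \<gamma>)"
  have p: "?p \<in> topspace (U_sum n v)" using ij \<gamma> by (auto simp: topspace_U_sum)
  have "?p \<in> glue n v ?p"
    using p glued_iff[OF ij ij \<gamma> \<gamma>] proportional_refl by (simp add: glue_def)
  then show "\<exists>i' j' \<gamma>'. ((i', j'), \<gamma>') \<in> glue n v ?p \<and>
      tclass n (\<lambda>e. elog (\<gamma> (ucoord i j e))) = tclass n (\<lambda>e. elog (\<gamma>' (ucoord i' j' e)))" by blast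
  fix t assume "\<exists>i' j' \<gamma>'. ((i', j'), \<gamma>') \<in> glue n v ?p \<and> t = tclass n (\<lambda>e. elog (\<gamma>' (ucoord i' j' e)))"
  then obtain k l \<delta> where q: "((k, l), \<delta>) \<in> glue n v ?p" and t: "t = tclass n (\<lambda>e. elog (\<delta> (ucoord k l e)))" by blast
  then have kl: "(k, l) \<in> charts n" and \<delta>: "\<delta> \<in> mult_seminorms v (chart_ring n k l)"
    and g: "glued n ?p ((k, l), \<delta>)" unfolding glue_def topspace_U_sum by auto
  have "proportional n ?p ((k, l), \<delta>)" using glued_iff[OF ij kl \<gamma> \<delta>] g by simp
  then obtain c where c: "c > 0" "\<And>d F. homog n d F \<Longrightarrow> \<delta> (heval n k l F) = c ^ d * \<gamma> (heval n i j F)"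
    unfolding proportional_iff by blast
  have "elog (\<delta> (ucoord k l e)) = elog (\<gamma> (ucoord i j e)) + ereal (ln c)" if e: "e \<in> pairs n" for e
  proof -
    have "0 \<le> \<gamma> (ucoord i j e)" by (rule C.ms_nonneg[OF \<gamma> ucoord_chart_ring[OF ij e]])
    then show ?thesis using ms_values(1)[OF ij kl \<gamma> \<delta> c e] elog_mult[OF c(1)] by simp
  qed
  then have "t = tclass n (\<lambda>e. elog (\<gamma> (ucoord i j e)) + ereal (ln c))" unfolding t by (rule tclass_cong)
  then show "t = tclass n (\<lambda>e. elog (\<gamma> (ucoord i j e)))" by (simp only: tclass_shift)
qed

end

section \<open>Tropical projective space\<close>

lemma eexp_simps [simp]: "eexp (-\<infinity>) = 0" "eexp (ereal r) = exp r" "eexp x \<noteq> 0 \<longleftrightarrow> x \<noteq> -\<infinity>" "0 \<le> eexp x"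
  by (auto simp: eexp_def)

lemma eexp_add: "x \<noteq> \<infinity> \<Longrightarrow> y \<noteq> \<infinity> \<Longrightarrow> eexp (x + y) = eexp x * eexp y"
  by (cases x; cases y) (simp_all add: exp_add)

lemma eexp_sum: "(\<And>e. e \<in> A \<Longrightarrow> y e \<noteq> \<infinity>) \<Longrightarrow> eexp (\<Sum>e\<in>A. y e) = (\<Prod>e\<in>A. eexp (y e))"
proof (induction A rule: infinite_finite_induct)
  case (insert a A)
  have "(\<Sum>e\<in>A. y e) \<noteq> \<infinity>" using insert by (simp add: sum_Pinfty)
  then show ?case using insert by (simp add: eexp_add)
qed (simp_all add: zero_ereal_def)

lemma eexp_elog: "0 \<le> r \<Longrightarrow> eexp (elog r) = r"
  by (simp add: elog_def)

lemma elog_eexp: "x \<noteq> \<infinity> \<Longrightarrow> elog (eexp x) = x"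
  by (cases x) (simp_all add: elog_def)

lemma elog_neq: "elog r \<noteq> \<infinity>" "elog r \<noteq> -\<infinity> \<longleftrightarrow> r \<noteq> 0"
  by (auto simp: elog_def)

lemma topspace_rbar [simp]: "topspace rbar = {x. x \<noteq> \<infinity>}"
  by (simp add: rbar_def)

text \<open>At minus infinity, values below \<open>\<epsilon>\<close> correspond to arguments below
  \<open>ln \<epsilon>\<close>.\<close>

lemma continuous_eexp: "continuous_map rbar euclideanreal eexp"
  unfolding rbar_def continuous_map_iff_continuous continuous_on_def
proof
  fix x :: ereal assume "x \<in> {x. x \<noteq> \<infinity>}"
  then consider r where "x = ereal r" | "x = -\<infinity>" by (cases x) auto
  then show "(eexp \<longlongrightarrow> eexp x) (at x within {x. x \<noteq> \<infinity>})"
  proof cases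
    case 1
    have "((\<lambda>y. y) \<longlongrightarrow> ereal r) (at x within {x. x \<noteq> \<infinity>})" unfolding 1 by (rule tendsto_ident_at)
    then have "((\<lambda>y. exp (real_of_ereal y)) \<longlongrightarrow> exp r) (at x within {x. x \<noteq> \<infinity>})"
      by (intro tendsto_exp lim_real_of_ereal)
    moreover have "eventually (\<lambda>y. exp (real_of_ereal y) = eexp y) (at x within {x. x \<noteq> \<infinity>})"
      unfolding 1
      by (intro eventually_mono[OF tendsto_imp_eventually_ne[OF tendsto_ident_at, of "ereal r" "-\<infinity>"]]) (auto simp: eexp_def)
    ultimately show ?thesis unfolding 1 eexp_simps(2) by (rule Lim_transform_eventually)
  next
    case 2
    have "eventually (\<lambda>y. eexp y < \<epsilon>) (at x within {x. x \<noteq> \<infinity>})" if "\<epsilon> > 0" for \<epsilon>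
    proof -
      have "eventually (\<lambda>y. y < ereal (ln \<epsilon>)) (at x within {x. x \<noteq> \<infinity>})"
        unfolding 2 by (rule order_tendstoD(2)[OF tendsto_ident_at]) simp
      then show ?thesis
      proof (rule eventually_mono)
        fix y assume "y < ereal (ln \<epsilon>)"
        then show "eexp y < \<epsilon>" using that exp_less_cancel_iff[of "real_of_ereal y" "ln \<epsilon>"] by (cases y) auto
      qed
    qed
    then show ?thesis unfolding 2
      by (intro order_tendstoI) (auto intro: always_eventually less_le_trans[OF _ eexp_simps(4)])
  qed
qed

lemma tendsto_elog:
  assumes "(f \<longlongrightarrow> a) F" "0 \<le> a" "eventually (\<lambda>x. 0 \<le> f x) F"
  shows "((\<lambda>x. elog (f x)) \<longlongrightarrow> elog a) F"
proof (cases "a = 0")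
  case False
  then have "((\<lambda>x. ereal (ln (f x))) \<longlongrightarrow> ereal (ln a)) F" using assms by (intro tendsto_ereal tendsto_ln) auto
  moreover have "eventually (\<lambda>x. ereal (ln (f x)) = elog (f x)) F"
    by (rule eventually_mono[OF tendsto_imp_eventually_ne[OF assms(1) False]]) (simp add: elog_def)
  ultimately have "((\<lambda>x. elog (f x)) \<longlongrightarrow> ereal (ln a)) F" by (rule Lim_transform_eventually)
  then show ?thesis unfolding elog_def[of a] using False by simp
next
  case True
  have "eventually (\<lambda>x. elog (f x) < ereal r) F" for r
  proof -
    have "eventually (\<lambda>x. f x < exp r) F" using order_tendstoD(2)[OF assms(1), of "exp r"] True by simp
    with assms(3) show ?thesis
    proof eventually_elim
      case (elim x)
      then show ?case using ln_less_cancel_iff[of "f x" "exp r"] by (auto simp: elog_def)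
    qed
  qed
  then show ?thesis by (simp add: True elog_def tendsto_MInfty)
qed

definition coords :: "nat \<Rightarrow> (nat set \<Rightarrow> ereal) topology" where
  "coords n = subtopology (product_topology (\<lambda>_. rbar) (pairs n)) {x. \<exists>e\<in>pairs n. x e \<noteq> -\<infinity>}"

lemma TP_coords: "TP n = quotient_topology (coords n) (tclass n)"
  by (simp add: TP_def coords_def)

lemma quotient_TP: "quotient_map (coords n) (TP n) (tclass n)"
  unfolding TP_coords by (rule quotient_map_quotient_topology)

lemma topspace_coords:
  "x \<in> topspace (coords n) \<longleftrightarrow> x \<in> extensional (pairs n) \<and> (\<forall>e\<in>pairs n. x e \<noteq> \<infinity>) \<and> (\<exists>e\<in>pairs n. x e \<noteq> -\<infinity>)"
  by (auto simp: coords_def PiE_iff)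

lemma tclass_self: "x \<in> extensional (pairs n) \<Longrightarrow> x \<in> tclass n x"
  unfolding tclass_def by (rule CollectI, rule exI[of _ 0])
    (auto simp: extensional_def zero_ereal_def[symmetric])

lemma tclassD:
  assumes "y \<in> tclass n x" obtains c where "\<And>e. e \<in> pairs n \<Longrightarrow> y e = x e + ereal c" "y \<in> extensional (pairs n)"
  using assms unfolding tclass_def by auto

lemma tclass_shiftE:
  assumes "y \<in> tclass n x" obtains c where "\<forall>e\<in>pairs n. y e = x e + ereal c"
proof -
  obtain c where "y = (\<lambda>e\<in>pairs n. x e + ereal c)" using assms unfolding tclass_def by blast
  then have "\<forall>e\<in>pairs n. y e = x e + ereal c" by simp
  then show ?thesis by (rule that)
qed

lemma tclass_eq: "y \<in> tclass n x \<Longrightarrow> tclass n y = tclass n x"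
  by (elim tclassD) (metis tclass_cong tclass_shift)

lemma TP_rep:
  assumes t: "t \<in> topspace (TP n)" and x: "x \<in> t"
  shows "x \<in> topspace (coords n)" "tclass n x = t"
proof -
  obtain y where y: "y \<in> topspace (coords n)" "t = tclass n y" using t by (auto simp: TP_coords)
  then show "tclass n x = t" using tclass_eq x by blast
  obtain c where c: "\<And>e. e \<in> pairs n \<Longrightarrow> x e = y e + ereal c" "x \<in> extensional (pairs n)"
    using x y(2) by (auto elim: tclassD)
  have "x e \<noteq> \<infinity> \<and> (x e \<noteq> -\<infinity> \<longleftrightarrow> y e \<noteq> -\<infinity>)" if "e \<in> pairs n" for e
    using that y(1) c(1)[OF that] by (cases "y e") (auto simp: topspace_coords)
  then show "x \<in> topspace (coords n)" using y(1) c(2) by (auto simp: topspace_coords)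
qed

lemma TP_nonempty: assumes "t \<in> topspace (TP n)" shows "\<exists>x. x \<in> t"
proof -
  obtain y where "y \<in> topspace (coords n)" "t = tclass n y" using assms by (auto simp: TP_coords)
  then show ?thesis using tclass_self[of y n] by (auto simp: topspace_coords)
qed

section \<open>Normalized weights and charts of tropical projective space\<close>

definition rep :: "(nat set \<Rightarrow> ereal) set \<Rightarrow> nat set \<Rightarrow> ereal" where
  "rep t = (SOME x. x \<in> t)"

lemma rep_in: "t \<in> topspace (TP n) \<Longrightarrow> rep t \<in> t"
  unfolding rep_def using TP_nonempty by (rule someI_ex)

text \<open>The exponentials of x_e - x_ij. The value 0 away from pairs makes equality of weights an
  equality of functions, so that \<open>smax\<close> does not see the representative.\<close>

definition cw :: "nat \<Rightarrow> nat \<Rightarrow> nat \<Rightarrow> (nat set \<Rightarrow> ereal) \<Rightarrow> nat set \<Rightarrow> real" where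
  "cw n i j x = (\<lambda>e. if e \<in> pairs n then eexp (x e) / eexp (x {i, j}) else 0)"

lemma cw_invariant:
  assumes t: "t \<in> topspace (TP n)" and x: "x \<in> t" "y \<in> t" and ij: "(i, j) \<in> charts n"
  shows "cw n i j x = cw n i j y" "e \<in> pairs n \<Longrightarrow> x e = -\<infinity> \<longleftrightarrow> y e = -\<infinity>"
proof -
  have "y \<in> tclass n x" using TP_rep[OF t x(1)] x(2) by simp
  then obtain c where c: "\<And>e. e \<in> pairs n \<Longrightarrow> y e = x e + ereal c" by (auto elim: tclassD)
  have "x e \<noteq> \<infinity>" if "e \<in> pairs n" for e using TP_rep[OF t x(1)] that by (simp add: topspace_coords)
  then have e: "eexp (y e) = eexp (x e) * exp c" if "e \<in> pairs n" for e using c[OF that] that by (simp add: eexp_add)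
  then show "cw n i j x = cw n i j y" using chart_pair[OF ij] by (auto simp: cw_def)
  show "e \<in> pairs n \<Longrightarrow> x e = -\<infinity> \<longleftrightarrow> y e = -\<infinity>" using c[of e] by (cases "x e") auto
qed

definition TV :: "nat \<Rightarrow> nat \<Rightarrow> nat \<Rightarrow> (nat set \<Rightarrow> ereal) set set" where
  "TV n i j = {t \<in> topspace (TP n). \<exists>x\<in>t. x {i, j} \<noteq> -\<infinity>}"

lemma TV_iff:
  assumes "t \<in> topspace (TP n)" "x \<in> t" "(i, j) \<in> charts n" shows "t \<in> TV n i j \<longleftrightarrow> x {i, j} \<noteq> -\<infinity>"
proof
  assume "t \<in> TV n i j"
  then obtain y where "y \<in> t" "y {i, j} \<noteq> -\<infinity>" unfolding TV_def by blast
  then show "x {i, j} \<noteq> -\<infinity>"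
    using cw_invariant(2)[OF assms(1) \<open>y \<in> t\<close> assms(2,3) chart_pair[OF assms(3)]] by simp
qed (use assms(1,2) in \<open>unfold TV_def, blast\<close>)

lemma continuous_coords_proj: "e \<in> pairs n \<Longrightarrow> continuous_map (coords n) rbar (\<lambda>x. x e)"
  unfolding coords_def by (intro continuous_map_from_subtopology continuous_map_product_projection)

lemma continuous_coords_eexp: "e \<in> pairs n \<Longrightarrow> continuous_map (coords n) euclideanreal (\<lambda>x. eexp (x e))"
  using continuous_map_compose[OF continuous_coords_proj continuous_eexp, of e n] by (simp add: comp_def)

lemma TV_preimage:
  assumes ij: "(i, j) \<in> charts n"
  shows "{x \<in> topspace (coords n). tclass n x \<in> TV n i j} = {x \<in> topspace (coords n). eexp (x {i, j}) \<in> - {0}}"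
proof -
  have "tclass n x \<in> TV n i j \<longleftrightarrow> x {i, j} \<noteq> -\<infinity>" if x: "x \<in> topspace (coords n)" for x
    using x by (intro TV_iff[OF _ _ ij]) (auto simp: TP_coords intro: tclass_self simp: topspace_coords)
  then show ?thesis by auto
qed

lemma openin_TV:
  assumes ij: "(i, j) \<in> charts n" shows "openin (TP n) (TV n i j)"
proof -
  have "openin (coords n) {x \<in> topspace (coords n). eexp (x {i, j}) \<in> - {0}}"
    by (rule openin_continuous_map_preimage[OF continuous_coords_eexp[OF chart_pair[OF ij]]])
      (auto intro: open_Compl)
  moreover have "TV n i j \<subseteq> topspace (TP n)" by (auto simp: TV_def)
  ultimately show ?thesis using TV_preimage[OF ij] by (simp add: TP_coords openin_quotient_topology)
qed

text \<open>The quotient map stays a quotient map over an open set, so continuity may be checked on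
  coordinate vectors even though \<open>rep\<close> is an arbitrary choice.\<close>

lemma continuous_cw:
  assumes ij: "(i, j) \<in> charts n" and e: "e \<in> pairs n"
  shows "continuous_map (subtopology (TP n) (TV n i j)) euclideanreal (\<lambda>t. cw n i j (rep t) e)"
proof (rule continuous_compose_quotient_map)
  let ?U = "{x \<in> topspace (coords n). eexp (x {i, j}) \<in> - {0}}"
  show "quotient_map (subtopology (coords n) ?U) (subtopology (TP n) (TV n i j)) (tclass n)"
    by (rule quotient_map_restriction[OF quotient_TP TV_preimage[OF ij]]) (simp add: openin_TV[OF ij])
  have "continuous_map (subtopology (coords n) ?U) euclideanreal (\<lambda>x. eexp (x e) / eexp (x {i, j}))"
    using e chart_pair[OF ij]
    by (intro continuous_map_real_divide continuous_map_from_subtopology continuous_coords_eexp) auto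
  then show "continuous_map (subtopology (coords n) ?U) euclideanreal ((\<lambda>t. cw n i j (rep t) e) \<circ> tclass n)"
  proof (rule continuous_map_eq)
    fix x assume "x \<in> topspace (subtopology (coords n) ?U)"
    then have x: "x \<in> topspace (coords n)" by simp
    then have t: "tclass n x \<in> topspace (TP n)" "x \<in> tclass n x"
      by (auto simp: TP_coords topspace_coords intro: tclass_self)
    show "eexp (x e) / eexp (x {i, j}) = ((\<lambda>t. cw n i j (rep t) e) \<circ> tclass n) x"
      using fun_cong[OF cw_invariant(1)[OF t rep_in[OF t(1)] ij], of e] e by (simp add: cw_def)
  qed
qed

text \<open>Coordinatewise convergence suffices because the quotient map is continuous.\<close>

lemma limit_in_closure:
  assumes lim: "\<And>e. e \<in> pairs n \<Longrightarrow> ((\<lambda>s. Y s e) \<longlongrightarrow> x e) F" and F: "F \<noteq> bot"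
    and x: "x \<in> topspace (coords n)"
    and Y: "eventually (\<lambda>s. Y s \<in> topspace (coords n) \<and> tclass n (Y s) \<in> S) F"
  shows "tclass n x \<in> TP n closure_of S"
proof -
  have "limitin (coords n) Y x F"
    unfolding coords_def limitin_subtopology limitin_componentwise rbar_def
    using x Y lim by (auto simp: topspace_coords PiE_iff elim!: eventually_mono)
  then have "limitin (TP n) (tclass n \<circ> Y) (tclass n x) F"
    by (rule continuous_map_limit[OF quotient_imp_continuous_map[OF quotient_TP]])
  then have l: "limitin (TP n) (\<lambda>s. tclass n (Y s)) (tclass n x) F" by (simp add: comp_def)
  show ?thesis
    unfolding in_closure_of
  proof (intro conjI allI impI)
    show "tclass n x \<in> topspace (TP n)" using l by (rule limitin_topspace)
    fix U assume "tclass n x \<in> U \<and> openin (TP n) U"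
    then have "eventually (\<lambda>s. tclass n (Y s) \<in> U) F" using l by (simp add: limitin_def)
    with Y have "eventually (\<lambda>s. tclass n (Y s) \<in> U \<and> tclass n (Y s) \<in> S) F" by eventually_elim simp
    then show "\<exists>y. y \<in> S \<and> y \<in> U" using eventually_happens'[OF F] by blast
  qed
qed


section \<open>The section on a chart\<close>

text \<open>Matches the exponential of a sum in the definition of sigma with a weighted monomial.
  The last assumption excludes negative multiples of minus infinity.\<close>

lemma eexp_weight:
  assumes "x \<noteq> \<infinity>" "y \<noteq> \<infinity>" "y \<noteq> -\<infinity>" "x = -\<infinity> \<Longrightarrow> 0 \<le> m"
  shows "ereal (real_of_int m) * (x - y) \<noteq> \<infinity>" "eexp (ereal (real_of_int m) * (x - y)) = (eexp x / eexp y) powi m"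
proof -
  obtain s where s: "y = ereal s" using assms by (cases y) auto
  have "ereal (real_of_int m) * (x - y) \<noteq> \<infinity> \<and> eexp (ereal (real_of_int m) * (x - y)) = (eexp x / eexp y) powi m"
  proof (cases x)
    case (real r)
    then show ?thesis using s by (simp add: exp_diff[symmetric] exp_power_int)
  next
    case MInf
    then have "m = 0 \<or> m > 0" using assms(4) by auto
    then show ?thesis
    proof
      assume "m > 0"
      then show ?thesis using MInf s by (simp add: power_int_0_left_if)
    qed (simp add: MInf zero_ereal_def[symmetric], simp add: zero_ereal_def)
  qed (use assms in simp)
  then show "ereal (real_of_int m) * (x - y) \<noteq> \<infinity>" "eexp (ereal (real_of_int m) * (x - y)) = (eexp x / eexp y) powi m"
    by blast+
qed

lemma ln_max_le:
  fixes a b c d e f :: real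
  assumes "a * b \<le> max (c * d) (e * f)" "0 < a" "0 < b" "0 < c" "0 < d" "0 < e" "0 < f"
  shows "ln a + ln b \<le> max (ln c + ln d) (ln e + ln f)"
proof -
  have "ln (a * b) \<le> ln (c * d) \<or> ln (a * b) \<le> ln (e * f)" using assms by (auto simp: le_max_iff_disj)
  then show ?thesis using assms by (simp add: ln_mult_pos le_max_iff_disj)
qed

context complete_nonarch_field
begin

lemma TGr_point:
  assumes t: "t \<in> topspace (TGr n v)"
  obtains k l \<gamma> where "(k, l) \<in> charts n" "\<gamma> \<in> mult_seminorms v (chart_ring n k l)"
    "t = tclass n (\<lambda>e. elog (\<gamma> (ucoord k l e)))"
proof -
  have "t \<in> trop n ` topspace (Gr_an n v)" using t by (simp add: TGr_def)
  then obtain p where p: "p \<in> topspace (U_sum n v)" "t = trop n (glue n v p)" by (auto simp: Gr_an_def)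
  then obtain k l \<gamma> where 1: "p = ((k, l), \<gamma>)" "(k, l) \<in> charts n" "\<gamma> \<in> mult_seminorms v (chart_ring n k l)"
    unfolding topspace_U_sum by blast
  show ?thesis by (rule that[OF 1(2,3)]) (use p(2) trop_glue[OF 1(2,3)] 1(1) in simp)
qed

lemma TGr_TP: "t \<in> topspace (TGr n v) \<Longrightarrow> t \<in> topspace (TP n)"
  by (simp add: TGr_def)

text \<open>The point comes from some chart kl, possibly different from ij. Its coordinate values
  satisfy the Pluecker relations there, and these are carried to ij by
  \<open>smax_proportional\<close>.\<close>

lemma cw_tplu:
  assumes t: "t \<in> topspace (TGr n v)" and x: "x \<in> t" and ij: "(i, j) \<in> charts n" and nz: "x {i, j} \<noteq> -\<infinity>"
  shows "chart.tplu n i j (cw n i j x)"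
proof -
  obtain k l \<gamma> where kl: "(k, l) \<in> charts n" and \<gamma>: "\<gamma> \<in> mult_seminorms v (chart_ring n k l)"
    and teq: "t = tclass n (\<lambda>e. elog (\<gamma> (ucoord k l e)))" by (rule TGr_point[OF t])
  interpret C: chart v n k l by (rule chartI[OF kl])
  let ?w = "\<lambda>e. if e \<in> pairs n then \<gamma> (ucoord k l e) else 0"
  have "\<gamma> \<in> C.fiber ?w" using \<gamma> by (simp add: C.fiber_def)
  then have w: "C.tplu ?w" by (rule C.fiber_tplu)
  obtain c where "\<forall>e\<in>pairs n. x e = elog (\<gamma> (ucoord k l e)) + ereal c"
    using x unfolding teq by (rule tclass_shiftE)
  note c = bspec[OF this]
  have e: "eexp (x e) = ?w e * exp c" if "e \<in> pairs n" for e
    using c[OF that] that C.tplu_nonneg[OF w that] by (simp add: eexp_add elog_neq eexp_elog)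
  note ijp = chart_pair[OF ij]
  have "eexp (x {i, j}) \<noteq> 0" using nz by simp
  then have "?w {i, j} \<noteq> 0" using e[OF ijp] by simp
  then have "chart.tplu n i j (\<lambda>e. ?w e / ?w {i, j})" by (rule smax_proportional(1)[OF kl ij w])
  moreover have "(\<lambda>e. ?w e / ?w {i, j}) = cw n i j x" using e ijp by (auto simp: cw_def)
  ultimately show ?thesis by simp
qed

lemma smax_point:
  assumes ij: "(i, j) \<in> charts n" and w: "chart.tplu n i j w"
  shows "((i, j), chart.smax v n i j w) \<in> topspace (U_sum n v)"
proof -
  interpret C: chart v n i j by (rule chartI[OF ij])
  have "C.smax w \<in> mult_seminorms v (chart_ring n i j)"
    using C.smax_is_max[OF w] by (simp add: C.is_max_def C.fiber_def)
  then show ?thesis using ij unfolding topspace_U_sum by blast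
qed

lemma smax_chart_independent:
  assumes t: "t \<in> topspace (TGr n v)" and x: "x \<in> t" "y \<in> t" and ij: "(i, j) \<in> charts n" and kl: "(k, l) \<in> charts n"
    and nz: "x {i, j} \<noteq> -\<infinity>" "y {k, l} \<noteq> -\<infinity>"
  shows "glue n v ((i, j), chart.smax v n i j (cw n i j x)) = glue n v ((k, l), chart.smax v n k l (cw n k l y))"
proof -
  note tp = TGr_TP[OF t]
  let ?w = "cw n i j x"
  have xkl: "eexp (x {k, l}) \<noteq> 0" "eexp (x {i, j}) \<noteq> 0"
    using nz cw_invariant(2)[OF tp x ij chart_pair[OF kl]] by simp_all
  then have wkl: "?w {k, l} \<noteq> 0" using chart_pair[OF kl] by (simp add: cw_def)
  have "(\<lambda>e. ?w e / ?w {k, l}) = cw n k l x" using xkl chart_pair[OF kl] by (auto simp: cw_def)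
  then have eq: "(\<lambda>e. ?w e / ?w {k, l}) = cw n k l y" using cw_invariant(1)[OF tp x kl] by simp
  note w = cw_tplu[OF t x(1) ij nz(1)] and w' = cw_tplu[OF t x(2) kl nz(2)]
  show ?thesis
    using smax_proportional(2)[OF ij kl w wkl] unfolding eq
    by (rule glue_eq) (rule smax_point[OF ij w], rule smax_point[OF kl w'])
qed

text \<open>Violating the inequality is an open condition on classes, since a common shift only
  multiplies the difference by a positive factor. A violation at t would therefore occur in the tree
  cone, against \<open>four_point\<close>.\<close>

lemma tree_bounded_cw:
  assumes cl: "t \<in> TP n closure_of tree_cone n T" and T: "tree_on n T" and x: "x \<in> t" and ij: "(i, j) \<in> charts n"
  shows "chart.tree_bounded n T (cw n i j x)"
proof -
  interpret C: chart v n i j by (rule chartI[OF ij])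
  interpret ph: phylo T n by (rule tree_on_phylo[OF T])
  let ?w = "cw n i j x"
  have "wd ?w a c * wd ?w b d \<le> wd ?w a b * wd ?w c d"
    if abcd: "{a, b, c, d} \<subseteq> {1..n}" "distinct [a, b, c, d]"
      and ns: "\<forall>e\<in>gedges T. \<not> (\<not> utree.sep T e a b \<and> \<not> utree.sep T e c d \<and> utree.sep T e a c)" for a b c d
  proof -
    have p: "{a, b} \<in> pairs n" "{c, d} \<in> pairs n" "{a, c} \<in> pairs n" "{b, d} \<in> pairs n"
      using abcd by (simp_all add: pairs_iff)
    let ?F = "\<lambda>y. eexp (y {a, b}) * eexp (y {c, d}) - eexp (y {a, c}) * eexp (y {b, d})"
    have shift: "?F y = ?F z * (exp r * exp r)"
      if "\<And>e. e \<in> pairs n \<Longrightarrow> y e = z e + ereal r" "\<And>e. e \<in> pairs n \<Longrightarrow> z e \<noteq> \<infinity>" for y z r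
      using that p by (simp add: eexp_add algebra_simps)
    let ?O = "{s \<in> topspace (TP n). \<exists>y\<in>s. ?F y < 0}"
    have iff: "?F y < 0 \<longleftrightarrow> ?F z < 0" if z: "z \<in> topspace (coords n)" and y: "y \<in> tclass n z" for y z
    proof -
      obtain r where "\<forall>e\<in>pairs n. y e = z e + ereal r" using y by (rule tclass_shiftE)
      note r = bspec[OF this]
      have "?F y = ?F z * (exp r * exp r)" by (rule shift[OF r]) (use z in \<open>auto simp: topspace_coords\<close>)
      then show ?thesis by (simp add: mult_less_0_iff)
    qed
    have pre: "{z \<in> topspace (coords n). tclass n z \<in> ?O} = {z \<in> topspace (coords n). ?F z \<in> {..<0}}"
    proof (intro Collect_cong conj_cong refl)
      fix z assume z: "z \<in> topspace (coords n)"
      then have "tclass n z \<in> topspace (TP n)" "z \<in> tclass n z"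
        by (auto simp: TP_coords topspace_coords intro: tclass_self)
      then show "tclass n z \<in> ?O \<longleftrightarrow> ?F z \<in> {..<0}" using iff[OF z] by blast
    qed
    have "continuous_map (coords n) euclideanreal ?F"
      by (intro continuous_map_diff continuous_map_real_mult continuous_coords_eexp p)
    then have "openin (coords n) {z \<in> topspace (coords n). ?F z \<in> {..<0}}"
      by (rule openin_continuous_map_preimage) simp
    moreover have "?O \<subseteq> tclass n ` topspace (coords n)" by (auto simp: TP_coords)
    ultimately have op: "openin (TP n) ?O" using pre by (simp only: TP_coords openin_quotient_topology)
    have t: "t \<in> topspace (TP n)" using cl by (simp add: in_closure_of)
    have "\<not> ?F x < 0"
    proof
      assume "?F x < 0"
      then have "t \<in> ?O" using t x by blast
      then have "\<exists>s. s \<in> tree_cone n T \<and> s \<in> ?O"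
        using conjunct2[OF cl[unfolded in_closure_of], THEN spec, THEN mp, of ?O] op by (simp only: simp_thms)
      then obtain s where s: "s \<in> tree_cone n T" "s \<in> ?O" by (elim exE conjE)
      obtain y where y: "y \<in> s" "?F y < 0" using s(2) by blast
      obtain z \<omega> where z: "s = tclass n (\<lambda>e. ereal (z e))" "\<forall>e\<in>inner_edges T. 0 \<le> \<omega> e"
        "\<forall>k\<in>{1..n}. \<forall>l\<in>{1..n}. k \<noteq> l \<longrightarrow> z {k, l} = (\<Sum>e\<in>path_edges (tpath T k l). \<omega> e)"
        using s(1) unfolding tree_cone_def by blast
      have d: "z {k, l} = ph.tdist \<omega> k l" if "k \<in> {1..n}" "l \<in> {1..n}" "k \<noteq> l" for k l
        using z(3) that by (simp add: ph.tdist_def)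
      have "ph.tdist \<omega> a c + ph.tdist \<omega> b d \<le> ph.tdist \<omega> a b + ph.tdist \<omega> c d"
        by (rule ph.four_point) (use z(2) abcd ns ph.lV in auto)
      then have le: "z {a, c} + z {b, d} \<le> z {a, b} + z {c, d}" using abcd by (simp add: d)
      obtain r where "\<forall>e\<in>pairs n. y e = ereal (z e) + ereal r" using y(1) unfolding z(1) by (rule tclass_shiftE)
      note r = bspec[OF this]
      have "?F y = (exp (z {a, b} + z {c, d}) - exp (z {a, c} + z {b, d})) * (exp r * exp r)"
        using shift[OF r] by (simp add: exp_add)
      moreover have "0 \<le> (exp (z {a, b} + z {c, d}) - exp (z {a, c} + z {b, d})) * (exp r * exp r)"
        using le by (intro mult_nonneg_nonneg) auto
      ultimately show False using y(2) by linarith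
    qed
    then have "eexp (x {a, c}) * eexp (x {b, d}) \<le> eexp (x {a, b}) * eexp (x {c, d})" by simp
    then have "eexp (x {a, c}) * eexp (x {b, d}) / (eexp (x {i, j}) * eexp (x {i, j}))
        \<le> eexp (x {a, b}) * eexp (x {c, d}) / (eexp (x {i, j}) * eexp (x {i, j}))"
      by (rule divide_right_mono) simp
    then show ?thesis using p abcd(2) by (simp add: wd_def cw_def)
  qed
  then show ?thesis unfolding C.tree_bounded_def by blast
qed

lemma Jset_cw:
  assumes ij: "(i, j) \<in> charts n" and nz: "x {i, j} \<noteq> -\<infinity>"
  shows "{e \<in> pairs n. cw n i j x e = 0} = Jset n x"
  using nz eexp_simps(3)[of "x {i, j}"] by (auto simp: cw_def Jset_def eexp_def split: if_splits)

text \<open>Expansions in the sense of sigma are precisely the admissible Laurent polynomials over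
  I, and their norm is the Gauss norm. Uniqueness of the expansion then makes the definite
  description meaningful.\<close>

lemma choice_seminorm:
  assumes t: "t \<in> topspace (TGr n v)" and ch: "sigma_choice n t x i j T r I"
  shows "sigma_seminorm n v i j I x = chart.smax v n i j (cw n i j x)"
proof -
  have x: "x \<in> t" and ij: "(i, j) \<in> charts n" and nJ: "{i, j} \<notin> Jset n x" and T: "tree_on n T"
    and cl: "t \<in> TP n closure_of tree_cone n T" and r: "cherry_property n T i j r"
    and comp: "compatible n T i j r (Jset n x \<inter> Iset n i j) I" using ch by (auto simp: sigma_choice_def)
  interpret C: chart v n i j by (rule chartI[OF ij])
  let ?w = "cw n i j x" and ?J = "Jset n x"
  have nz: "x {i, j} \<noteq> -\<infinity>" using nJ chart_pair[OF ij] by (simp add: Jset_def)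
  have I: "I \<subseteq> pairs n" using comp by (simp add: compatible_def)
  have xinf: "x e \<noteq> \<infinity>" if "e \<in> pairs n" for e
    using TP_rep(1)[OF TGr_TP[OF t] x] that by (simp add: topspace_coords)
  note w = cw_tplu[OF t x ij nz] and J = Jset_cw[where i = i and j = j and x = x, OF ij nz]
  have "C.tree_bounded T ?w" by (rule tree_bounded_cw[OF cl T x ij])
  then have ad: "adapted n i j ?w {1..n} I" by (rule C.choice_adapted[OF T w _ r]) (simp only: J comp)
  obtain \<Psi> where \<Psi>: "C.presents I ?w \<Psi>" and eq: "C.smax ?w = (\<lambda>f\<in>C.R. C.G ?w (\<Psi> f))"
    using C.adapted_smax[OF w ad] by blast
  let ?N = "invertibles n i j ?w I"
  have N: "?N = I \<inter> Iset n i j - ?J" using I J by (auto simp: invertibles_def)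
  have rm: "rmono (pairs n) g \<alpha> = (\<Prod>e\<in>I. g e powi lookup \<alpha> e)" if "keys \<alpha> \<subseteq> I"
    for g :: "nat set \<Rightarrow> 'b::field" and \<alpha>
  proof -
    have "lookup \<alpha> e = 0" if "e \<notin> I" for e using that \<open>keys \<alpha> \<subseteq> I\<close> by (meson in_keys_iff subsetD)
    then show ?thesis unfolding rmono_def using I by (intro prod.mono_neutral_right) auto
  qed
  have E1: "expansion n i j I ?J f c \<longleftrightarrow> adm I ?N c \<and> C.EV c = to_frac f" for f and c :: "'k laurent"
  proof -
    have "C.EV c = (\<Sum>\<alpha>\<in>keys c. to_frac (Const (lookup c \<alpha>)) * (\<Prod>e\<in>I. to_frac (ucoord i j e) powi lookup \<alpha> e))"
      if "adm I ?N c"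
      unfolding ev_def geval_def using that by (intro sum.cong refl arg_cong2[of _ _ _ _ "(*)"] rm) (simp add: adm_def)
    then show ?thesis unfolding expansion_def adm_def N[symmetric] by (auto simp: adm_def)
  qed
  have E2: "expansion_norm v i j I x c = C.G ?w c" if c: "adm I ?N c" for c
  proof -
    have "eexp (\<Sum>e\<in>I. ereal (real_of_int (lookup \<alpha> e)) * (x e - x {i, j})) = mono_wt (pairs n) ?w \<alpha>"
      if \<alpha>: "\<alpha> \<in> keys c" for \<alpha>
    proof -
      have sub: "keys \<alpha> \<subseteq> I" and neg: "\<And>e. e \<in> I \<Longrightarrow> lookup \<alpha> e < 0 \<Longrightarrow> e \<notin> ?J"
        using c \<alpha> by (auto simp: adm_def N)
      have ew: "ereal (real_of_int (lookup \<alpha> e)) * (x e - x {i, j}) \<noteq> \<infinity>"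
        "eexp (ereal (real_of_int (lookup \<alpha> e)) * (x e - x {i, j})) = ?w e powi lookup \<alpha> e" if e: "e \<in> I" for e
      proof -
        have ep: "e \<in> pairs n" using e I by blast
        \<comment> \<open>A negative multiple of minus infinity would be infinite, where
          \<open>eexp\<close> is not meaningful.\<close>
        have "0 \<le> lookup \<alpha> e" if "x e = -\<infinity>" by (rule leI) (use neg[OF e] that ep in \<open>auto simp: Jset_def\<close>)
        note * = eexp_weight[OF xinf[OF ep] xinf[OF chart_pair[OF ij]] nz this]
        show "ereal (real_of_int (lookup \<alpha> e)) * (x e - x {i, j}) \<noteq> \<infinity>" by (rule *(1))
        show "eexp (ereal (real_of_int (lookup \<alpha> e)) * (x e - x {i, j})) = ?w e powi lookup \<alpha> e"
          using *(2) ep by (simp add: cw_def)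
      qed
      have "eexp (\<Sum>e\<in>I. ereal (real_of_int (lookup \<alpha> e)) * (x e - x {i, j})) = (\<Prod>e\<in>I. ?w e powi lookup \<alpha> e)"
        using ew by (simp add: eexp_sum)
      also have "\<dots> = mono_wt (pairs n) ?w \<alpha>" using rm[OF sub, of ?w] by (simp add: rmono_def mono_wt_def)
      finally show ?thesis .
    qed
    then show ?thesis by (simp add: expansion_norm_def gauss_def cong: image_cong)
  qed
  show ?thesis unfolding sigma_seminorm_def eq
  proof (rule restrict_ext, rule the_equality)
    fix f :: "'k mpoly" assume f: "f \<in> C.R"
    have \<Psi>f: "adm I ?N (\<Psi> f)" "C.EV (\<Psi> f) = to_frac f" using \<Psi> f by (auto simp: C.presents_def)
    then show "\<exists>c. expansion n i j I ?J f c \<and> C.G ?w (\<Psi> f) = expansion_norm v i j I x c"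
      using E1[of f "\<Psi> f"] E2[OF \<Psi>f(1)] by metis
    fix s assume "\<exists>c. expansion n i j I ?J f c \<and> s = expansion_norm v i j I x c"
    then obtain c where c: "expansion n i j I ?J f c" "s = expansion_norm v i j I x c" by blast
    have c1: "adm I ?N c" "C.EV c = to_frac f" using c(1) E1[of f c] by simp_all
    have "c = \<Psi> f" by (rule C.presents_unique[OF \<Psi> f c1])
    then show "s = C.G ?w (\<Psi> f)" using c(2) E2[OF c1(1)] by simp
  qed
qed

text \<open>The delicate part is a tree: t is approached by positive tropical Pluecker vectors, each
  of which is a tree metric, and since finitely many trees suffice, one of them occurs in every
  neighbourhood.\<close>

lemma choice_exists:
  assumes t: "t \<in> topspace (TGr n v)" and n: "2 \<le> n"
  shows "\<exists>x i j T r I. sigma_choice n t x i j T r I"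
proof -
  note tp = TGr_TP[OF t]
  define x where "x = rep t"
  have x: "x \<in> t" unfolding x_def by (rule rep_in[OF tp])
  have xc: "x \<in> topspace (coords n)" "tclass n x = t" using TP_rep[OF tp x] by blast+
  then obtain e0 where e0: "e0 \<in> pairs n" "x e0 \<noteq> -\<infinity>" by (auto simp: topspace_coords)
  obtain i j where "e0 = {i, j}" "i \<in> {1..n}" "j \<in> {1..n}" "i < j" using e0(1) by (rule pairsE)
  then have ij: "(i, j) \<in> charts n" and nz: "x {i, j} \<noteq> -\<infinity>" using e0 by (auto simp: charts_def)
  interpret C: chart v n i j by (rule chartI[OF ij])
  define w where "w = cw n i j x"
  have w: "C.tplu w" unfolding w_def by (rule cw_tplu[OF t x ij nz])
  obtain D where D: "adapted n i j w {1..n} D" using C.adapted_near[OF w w C.near_refl] by blast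
  obtain \<Psi> where \<Psi>: "C.presents D w \<Psi>" using C.adapted_smax[OF w D] by blast
  have \<Psi>u: "adm D (invertibles n i j w D) (\<Psi> (C.u e)) \<and> C.EV (\<Psi> (C.u e)) = to_frac (C.u e) \<and> C.G w (\<Psi> (C.u e)) = w e"
    if "e \<in> pairs n" for e using \<Psi> ucoord_chart_ring[OF ij that] that by (auto simp: C.presents_def)
  \<comment> \<open>Only vanishing weights are perturbed, so the invertible coordinates remain
    invertible. The perturbed vector itself need not satisfy the Pluecker relations;
    \<open>W\<close> is the vector of norms it induces on all coordinates.\<close>
  define y where "y s e = (if w e = 0 then s else w e)" for s :: real and e
  define W where "W s e = C.G (y s) (\<Psi> (C.u e))" for s e
  have y_pos: "0 < y s e" if "0 < s" "e \<in> pairs n" for s e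
    using C.tplu_nonneg[OF w that(2)] that(1) by (auto simp: y_def)
  have W_pos: "0 < W s e" if s: "0 < s" and e: "e \<in> pairs n" for s e
  proof -
    have "\<Psi> (C.u e) \<noteq> 0"
    proof
      assume "\<Psi> (C.u e) = 0"
      then have "to_frac (C.u e) = 0" using \<Psi>u[OF e] by (simp add: ev_def geval_def)
      then show False using C.tu_neq_0[OF e] by simp
    qed
    then obtain \<alpha> where \<alpha>: "lookup (\<Psi> (C.u e)) \<alpha> \<noteq> 0" by (metis lookup_zero poly_mapping_eqI)
    have "0 < v (lookup (\<Psi> (C.u e)) \<alpha>)" using nonneg eq_0_iff \<alpha> by (metis less_eq_real_def)
    moreover have "0 < mono_wt (pairs n) (y s) \<alpha>"
      unfolding mono_wt_def using y_pos[OF s] by (intro prod_pos) (auto intro: zero_less_power_int)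
    ultimately have "0 < v (lookup (\<Psi> (C.u e)) \<alpha>) * mono_wt (pairs n) (y s) \<alpha>" by simp
    also have "\<dots> \<le> W s e" unfolding W_def by (rule gauss_ge)
    finally show ?thesis .
  qed
  have W_tplu: "C.tplu (W s)" if s: "0 < s" for s
  proof -
    have "(\<lambda>f\<in>C.R. C.G (y s) (\<Psi> f)) \<in> mult_seminorms v C.R"
    proof (rule C.gauss_mult_seminorm[OF \<Psi>])
      show "0 \<le> y s e" if "e \<in> pairs n" for e using y_pos[OF s that] by simp
      show "y s e \<noteq> 0" if "e \<in> invertibles n i j w D" for e using s by (simp add: y_def)
    qed
    then have "(\<lambda>f\<in>C.R. C.G (y s) (\<Psi> f)) \<in> C.fiber (W s)"
      unfolding C.fiber_def W_def using ucoord_chart_ring[OF ij, where 'k = 'k] by simp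
    then show ?thesis by (rule C.fiber_tplu)
  qed
  have W_lim: "((\<lambda>s. W s e) \<longlongrightarrow> w e) (at_right 0)" if e: "e \<in> pairs n" for e
  proof -
    have "((\<lambda>s. C.G (y s) (\<Psi> (C.u e))) \<longlongrightarrow> C.G w (\<Psi> (C.u e))) (at_right 0)"
    proof (rule tendsto_gauss)
      show "((\<lambda>s. y s e') \<longlongrightarrow> w e') (at_right 0)" for e'
        by (cases "w e' = 0") (simp_all add: y_def tendsto_ident_at)
      show "okexp (pairs n) w \<alpha>" if "\<alpha> \<in> keys (\<Psi> (C.u e))" for \<alpha>
        using adm_okexp[OF conjunct1[OF \<Psi>u[OF e]], of "pairs n" w \<alpha>] that \<Psi>
        by (auto simp: C.presents_def invertibles_def)
    qed
    then show ?thesis using \<Psi>u[OF e] by (simp add: W_def)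
  qed
  define x' where "x' = (\<lambda>e\<in>pairs n. elog (w e))"
  define Y where "Y s = (\<lambda>e\<in>pairs n. elog (W s e))" for s
  have xij: "x {i, j} \<noteq> \<infinity>" using xc chart_pair[OF ij] by (simp add: topspace_coords)
  then have pos: "0 < 1 / eexp (x {i, j})" using nz by (cases "x {i, j}") simp_all
  have "tclass n x' = tclass n (\<lambda>e. x e + ereal (ln (1 / eexp (x {i, j}))))"
  proof (rule tclass_cong)
    fix e assume e: "e \<in> pairs n"
    have "w e = (1 / eexp (x {i, j})) * eexp (x e)" using e by (simp add: w_def cw_def)
    then have "elog (w e) = elog (eexp (x e)) + ereal (ln (1 / eexp (x {i, j})))"
      by (simp only: elog_mult[OF pos eexp_simps(4)])
    also have "elog (eexp (x e)) = x e" using xc e by (intro elog_eexp) (simp add: topspace_coords)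
    finally show "x' e = x e + ereal (ln (1 / eexp (x {i, j})))" using e by (simp add: x'_def)
  qed
  then have tx': "t = tclass n x'" using xc(2) by (simp only: tclass_shift)
  have in_coords: "(\<lambda>e\<in>pairs n. elog (g e)) \<in> topspace (coords n)" if "g {i, j} \<noteq> 0" for g
    using that chart_pair[OF ij] elog_neq by (auto simp: topspace_coords)
  have "tclass n x' \<in> TP n closure_of (\<Union>T\<in>std_trees n. tree_cone n T)"
  proof (rule limit_in_closure)
    show "((\<lambda>s. Y s e) \<longlongrightarrow> x' e) (at_right 0)" if e: "e \<in> pairs n" for e
    proof -
      have "eventually (\<lambda>s. 0 \<le> W s e) (at_right 0)"
        by (rule always_eventually) (simp add: W_def gauss_nonneg)
      then have "((\<lambda>s. elog (W s e)) \<longlongrightarrow> elog (w e)) (at_right 0)"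
        by (rule tendsto_elog[OF W_lim[OF e] C.tplu_nonneg[OF w e]])
      then show ?thesis using e by (simp add: Y_def x'_def)
    qed
    show "at_right (0::real) \<noteq> bot" by simp
    show "x' \<in> topspace (coords n)" unfolding x'_def using C.tplu_ij[OF w] by (intro in_coords) simp
    show "\<forall>\<^sub>F s in at_right 0. Y s \<in> topspace (coords n) \<and> tclass n (Y s) \<in> (\<Union>T\<in>std_trees n. tree_cone n T)"
      using eventually_at_right_less[of "0::real"]
    proof (rule eventually_mono)
      fix s :: real assume s: "0 < s"
      have "W s {i, j} \<noteq> 0" using W_pos[OF s chart_pair[OF ij]] by simp
      then have "Y s \<in> topspace (coords n)" unfolding Y_def by (rule in_coords)
      moreover have "tclass n (Y s) \<in> (\<Union>T\<in>std_trees n. tree_cone n T)"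
      proof -
        have "ln (W s {a, b}) + ln (W s {c, d}) \<le> max (ln (W s {a, c}) + ln (W s {b, d})) (ln (W s {a, d}) + ln (W s {b, c}))"
          if abcd: "{a, b, c, d} \<subseteq> {1..n}" "distinct [a, b, c, d]" for a b c d
        proof -
          have p: "{a, b} \<in> pairs n" "{c, d} \<in> pairs n" "{a, c} \<in> pairs n" "{b, d} \<in> pairs n" "{a, d} \<in> pairs n" "{b, c} \<in> pairs n"
            using abcd by (simp_all add: pairs_iff)
          have "W s {a, b} * W s {c, d} \<le> max (W s {a, c} * W s {b, d}) (W s {a, d} * W s {b, c})"
            using C.plu[OF W_tplu[OF s], of a b c d] abcd by (simp add: wd_def)
          then show ?thesis by (rule ln_max_le) (intro W_pos[OF s] p)+
        qed
        then obtain T \<omega> where T: "T \<in> std_trees n" and \<omega>: "\<And>e. e \<in> inner_edges T \<Longrightarrow> 0 \<le> \<omega> e"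
          "\<And>k l. k \<in> {1..n} \<Longrightarrow> l \<in> {1..n} \<Longrightarrow> k \<noteq> l \<Longrightarrow> ln (W s {k, l}) = (\<Sum>e\<in>path_edges (tpath T k l). \<omega> e)"
          using tree_of_metric[OF n, of "\<lambda>e. ln (W s e)"] by blast
        have "elog (W s e) = ereal (ln (W s e))" if "e \<in> pairs n" for e
          using W_pos[OF s that] by (simp add: elog_def)
        then have "tclass n (Y s) = tclass n (\<lambda>e. ereal (ln (W s e)))" by (intro tclass_cong) (simp add: Y_def)
        moreover have "tclass n (\<lambda>e. ereal (ln (W s e))) \<in> tree_cone n T"
          unfolding tree_cone_def
          by (rule CollectI, rule exI[of _ "\<lambda>e. ln (W s e)"], rule conjI[OF refl], rule exI[of _ \<omega>]) (use \<omega> in auto)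
        ultimately show ?thesis using T by auto
      qed
      ultimately show "Y s \<in> topspace (coords n) \<and> tclass n (Y s) \<in> (\<Union>T\<in>std_trees n. tree_cone n T)" ..
    qed
  qed
  \<comment> \<open>Closure commutes with the finite union over standard trees.\<close>
  then have "t \<in> (\<Union>T\<in>std_trees n. TP n closure_of tree_cone n T)"
    unfolding tx' closure_of_Union[OF finite_imageI[OF finite_std_trees]] by simp
  then obtain T where T: "T \<in> std_trees n" "t \<in> TP n closure_of tree_cone n T" by blast
  then have Ton: "tree_on n T" by (simp add: std_trees_def)
  obtain r where r: "cherry_property n T i j r"
    using phylo.cherry_order_exists[OF tree_on_phylo[OF Ton] C.ij(1,2,4)] by blast
  have "C.tree_bounded T w" unfolding w_def by (rule tree_bounded_cw[OF T(2) Ton x ij])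
  then obtain I where "compatible n T i j r ({e \<in> pairs n. w e = 0} \<inter> Iset n i j) I"
    using C.compatible_exists[OF Ton w _ r] by blast
  then have "compatible n T i j r (Jset n x \<inter> Iset n i j) I" unfolding w_def Jset_cw[where i = i and j = j and x = x, OF ij nz] .
  moreover have "{i, j} \<notin> Jset n x" using nz by (simp add: Jset_def)
  ultimately have "sigma_choice n t x i j T r I" using x ij Ton T(2) r by (simp add: sigma_choice_def)
  then show ?thesis by blast
qed

text \<open>Every admissible choice gives the maximal seminorm in its own chart, and these seminorms
  agree after gluing.\<close>

lemma sigma_map_chart:
  assumes t: "t \<in> topspace (TGr n v)" and n: "2 \<le> n" and x: "x \<in> t" and ij: "(i, j) \<in> charts n" and nz: "x {i, j} \<noteq> -\<infinity>"
  shows "sigma_map n v t = glue n v ((i, j), chart.smax v n i j (cw n i j x))"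
proof -
  have *: "glue n v ((k, l), sigma_seminorm n v k l I y) = glue n v ((i, j), chart.smax v n i j (cw n i j x))"
    if ch: "sigma_choice n t y k l T r I" for y k l T r I
  proof -
    have y: "y \<in> t" and kl: "(k, l) \<in> charts n" and "{k, l} \<notin> Jset n y" using ch by (auto simp: sigma_choice_def)
    then have nzy: "y {k, l} \<noteq> -\<infinity>" using chart_pair[OF kl] by (simp add: Jset_def)
    show ?thesis unfolding choice_seminorm[OF t ch] by (rule smax_chart_independent[OF t y x kl ij nzy nz])
  qed
  obtain y k l T r I where ch: "sigma_choice n t y k l T r I" using choice_exists[OF t n] by (elim exE)
  show ?thesis
    unfolding sigma_map_def
  proof (rule the_equality)
    show "\<exists>y k l T r I. sigma_choice n t y k l T r I \<and>
        glue n v ((i, j), chart.smax v n i j (cw n i j x)) = glue n v ((k, l), sigma_seminorm n v k l I y)"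
      by (intro exI conjI) (rule ch, rule *[OF ch, symmetric])
    fix z assume "\<exists>y k l T r I. sigma_choice n t y k l T r I \<and> z = glue n v ((k, l), sigma_seminorm n v k l I y)"
    then show "z = glue n v ((i, j), chart.smax v n i j (cw n i j x))" by (elim exE conjE) (simp only: *)
  qed
qed

lemma continuous_smax_chart:
  assumes ij: "(i, j) \<in> charts n"
  shows "continuous_map (subtopology (TGr n v) (topspace (TGr n v) \<inter> TV n i j)) (U_an n v (i, j))
    (\<lambda>t. chart.smax v n i j (cw n i j (rep t)))"
proof -
  interpret C: chart v n i j by (rule chartI[OF ij])
  let ?Z = "subtopology (TGr n v) (topspace (TGr n v) \<inter> TV n i j)" and ?w = "\<lambda>t. cw n i j (rep t)"
  have Z: "t \<in> topspace (TGr n v) \<and> C.tplu (?w t)" if "t \<in> topspace ?Z" for t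
  proof -
    have t: "t \<in> topspace (TGr n v)" "t \<in> TV n i j" using that by auto
    note r = rep_in[OF TGr_TP[OF t(1)]]
    have "rep t {i, j} \<noteq> -\<infinity>" using t(2) TV_iff[OF TGr_TP[OF t(1)] r ij] by simp
    then show ?thesis using cw_tplu[OF t(1) r ij] t(1) by simp
  qed
  have cont: "continuous_map ?Z euclideanreal (\<lambda>t. ?w t e)" if "e \<in> pairs n" for e
    using continuous_cw[OF ij that] unfolding TGr_def subtopology_subtopology
    by (rule continuous_map_from_subtopology_mono) blast
  have "continuous_map ?Z euclideanreal (\<lambda>t. C.smax (?w t) f)" if f: "f \<in> C.R" for f
    unfolding continuous_map_atin limitin_canonical_iff
  proof
    fix t assume t: "t \<in> topspace ?Z"
    show "((\<lambda>s. C.smax (?w s) f) \<longlongrightarrow> C.smax (?w t) f) (atin ?Z t)"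
    proof (rule C.tendsto_smax[OF _ _ _ f])
      show "((\<lambda>s. ?w s e) \<longlongrightarrow> ?w t e) (atin ?Z t)" if "e \<in> pairs n" for e
        using cont[OF that] t unfolding continuous_map_atin limitin_canonical_iff by blast
      show "C.tplu (?w t)" using Z[OF t] by simp
      show "eventually (\<lambda>s. C.tplu (?w s)) (atin ?Z t)"
        unfolding eventually_atin using t Z openin_topspace[of ?Z] by blast
    qed
  qed
  moreover have "C.smax (?w t) \<in> mult_seminorms v C.R" if "t \<in> topspace ?Z" for t
    using smax_point[OF ij conjunct2[OF Z[OF that]]] unfolding topspace_U_sum by blast
  ultimately show ?thesis
    unfolding U_an_def prod.case continuous_map_in_subtopology continuous_map_componentwise
    by (auto simp: mult_seminorms_def simp del: topspace_subtopology)
qed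

end

theorem theorem4p19:
  fixes v :: "'k::field \<Rightarrow> real" and n :: nat
  assumes "complete_nonarch_field v" and "n \<ge> 2"
  shows "continuous_map (TGr n v) (Gr_an n v) (sigma_map n v)"
\<comment> \<open>Continuity is checked on the open sets where a coordinate x_ij is finite; there
  the map factors through the chart of ij.\<close>
proof (rule pasting_lemma)
  interpret complete_nonarch_field v by fact
  let ?T = "\<lambda>(i, j). topspace (TGr n v) \<inter> TV n i j"
  show "openin (TGr n v) (?T c)" if "c \<in> charts n" for c
  proof -
    obtain i j where c: "c = (i, j)" by (cases c)
    have "openin (TP n) (TV n i j)" using that unfolding c by (rule openin_TV)
    then show ?thesis
      unfolding c prod.case by (auto simp: TGr_def openin_subtopology)
  qed
  show "continuous_map (subtopology (TGr n v) (?T c)) (Gr_an n v) (sigma_map n v)" if cc: "c \<in> charts n" for c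
  proof -
    obtain i j where c: "c = (i, j)" by (cases c)
    have ij: "(i, j) \<in> charts n" using cc c by simp
    let ?Z = "subtopology (TGr n v) (topspace (TGr n v) \<inter> TV n i j)"
    have "continuous_map (U_an n v (i, j)) (U_sum n v) (\<lambda>\<gamma>. ((i, j), \<gamma>))"
      unfolding U_sum_def by (rule continuous_map_component_injection[OF ij])
    then have "continuous_map (U_an n v (i, j)) (Gr_an n v) (glue n v \<circ> (\<lambda>\<gamma>. ((i, j), \<gamma>)))"
      unfolding Gr_an_def by (rule continuous_map_compose[OF _ quotient_imp_continuous_map[OF quotient_map_quotient_topology]])
    then have "continuous_map ?Z (Gr_an n v)
        ((glue n v \<circ> (\<lambda>\<gamma>. ((i, j), \<gamma>))) \<circ> (\<lambda>t. chart.smax v n i j (cw n i j (rep t))))"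
      by (rule continuous_map_compose[OF continuous_smax_chart[OF ij]])
    then have "continuous_map ?Z (Gr_an n v) (sigma_map n v)"
    proof (rule continuous_map_eq)
      fix t assume "t \<in> topspace ?Z"
      then have t: "t \<in> topspace (TGr n v)" "t \<in> TV n i j" by auto
      note r = rep_in[OF TGr_TP[OF t(1)]]
      have "rep t {i, j} \<noteq> -\<infinity>" using t(2) TV_iff[OF TGr_TP[OF t(1)] r ij] by simp
      then show "((glue n v \<circ> (\<lambda>\<gamma>. ((i, j), \<gamma>))) \<circ> (\<lambda>t. chart.smax v n i j (cw n i j (rep t)))) t = sigma_map n v t"
        using sigma_map_chart[OF t(1) assms(2) r ij] by simp
    qed
    then show ?thesis unfolding c prod.case .
  qed
  show "\<exists>c. c \<in> charts n \<and> t \<in> ?T c \<and> sigma_map n v t = sigma_map n v t" if t: "t \<in> topspace (TGr n v)" for t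
  proof -
    note tp = TGr_TP[OF t]
    obtain e where e: "e \<in> pairs n" "rep t e \<noteq> -\<infinity>"
      using TP_rep(1)[OF tp rep_in[OF tp]] by (auto simp: topspace_coords)
    obtain i j where "e = {i, j}" "i \<in> {1..n}" "j \<in> {1..n}" "i < j" using e(1) by (rule pairsE)
    then have ij: "(i, j) \<in> charts n" and "rep t {i, j} \<noteq> -\<infinity>" using e by (auto simp: charts_def)
    then have "t \<in> TV n i j" using TV_iff[OF tp rep_in[OF tp] ij] by simp
    then show ?thesis using ij t by (intro exI[of _ "(i, j)"]) simp
  qed
qed simp

end
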